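(* Let $m\ge1$, let $f_0,\dots,f_m\in\mathbb{R}[x_1,\dots,x_n]/I$, let $a_0=0$ and let $a_1,\dots,a_m$ be positive numbers. Put $F:=\prod_{0\le j\le m}\widetilde P(f_j)$ and $\varphi:=\log\big(\sum_{1\le j\le m}|\widetilde P(f_j)|^{\frac1{a_j}}\big)$, regarded as functions on $X$ near $o$. If $\sigma(\log|F|,\varphi)=\sum_{1\le j\le m}a_j$, then there exists a valuation $\nu$ on $\mathbb{R}[x_1,\dots,x_n]/I$ such that $\nu(f_j)=a_j$ for all $0\le j\le m$. Conversely, if there exists a valuation $\nu$ on $\mathbb{R}[x_1,\dots,x_n]/I$ satisfying $\nu(f_j)=a_j$ for all $0\le j\le m$ and $\nu(x_l)>0$ for every $1\le l\le n$, then $\sigma(\log|F|,\varphi)=\sum_{1\le j\le m}a_j$.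
   Context: $I$ is an ideal in $\mathbb{R}[x_1,\dots,x_n]$. $P:\mathbb{R}[x_1,\dots,x_n]\to\mathbb{C}[z_1,\dots,z_n]$ is the natural inclusion $P(\sum_\alpha a_\alpha x^\alpha)=\sum_\alpha a_\alpha z^\alpha$, $(P(I))$ is the ideal of $\mathbb{C}[z_1,\dots,z_n]$ generated by $P(I)$, assumed to be prime (which implies $I$ is prime), and $\widetilde P:\mathbb{R}[x_1,\dots,x_n]/I\to\mathbb{C}[z_1,\dots,z_n]/(P(I))$ is the induced homomorphism $\widetilde P([f])=[P(f)]$. $X\subset\mathbb{C}^n$ is the affine variety defined by $(P(I))$; it is assumed that the origin $o$ lies in $X$ and that $(X,o)$ is irreducible as a germ of an analytic set. $x_l$ also denotes its class modulo $I$. A valuation on $R=\mathbb{R}[x_1,\dots,x_n]/I$ is a nonconstant map $\nu:R\setminus\{0\}\to\mathbb{R}_{\ge0}$ with $\nu(fg)=\nu(f)+\nu(g)$, $\nu(f+g)\ge\min\{\nu(f),\nu(g)\}$ (when $f+g\ne0$), and $\nu(c)=0$ for every nonzero constant $c$; by convention $\nu(0)=+\infty$. Relative type at $o$: for functions $\psi,\varphi$ on $X$ near $o$, $\sigma(\psi,\varphi)=\sup\{c\ge0:\psi\le c\varphi+O(1)\text{ on }U\setminus X_{\mathrm{sing}}\text{ for some open neighborhood }U\text{ of }o\text{ in }X\}\in[0,+\infty]$ (with $\log0=-\infty$). *)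

theory Defs
  imports
    "HOL-Analysis.Analysis"
    "HOL-Library.Poly_Mapping"
    "HOL-Algebra.Algebraic_Closure_Type"
begin

section \<open>Polynomials in finitely many variables\<close>

text \<open>
  A monomial is an exponent vector, i.e. a map from the finite index type \<open>'n\<close> of the variables
  to \<open>nat\<close>; the product on polynomials is the convolution product of \<open>Poly_Mapping\<close>.
\<close>

type_synonym ('n, 'a) mpoly = "('n \<Rightarrow>\<^sub>0 nat) \<Rightarrow>\<^sub>0 'a"

abbreviation mpoly_ring :: "('n::finite, 'a::comm_ring_1) mpoly ring" where
  "mpoly_ring \<equiv> ring_of_type_algebra"

definition mpoly_const :: "'a::comm_ring_1 \<Rightarrow> ('n::finite, 'a) mpoly" where
  "mpoly_const c = Poly_Mapping.single 0 c"

definition mpoly_var :: "'n::finite \<Rightarrow> ('n, 'a::comm_ring_1) mpoly" where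
  "mpoly_var l = Poly_Mapping.single (Poly_Mapping.single l 1) 1"

definition mpoly_eval :: "('n::finite, 'a::comm_ring_1) mpoly \<Rightarrow> 'a ^ 'n \<Rightarrow> 'a" where
  "mpoly_eval p z =
     (\<Sum>\<alpha>\<in>Poly_Mapping.keys p. Poly_Mapping.lookup p \<alpha> *
        (\<Prod>i\<in>UNIV. (z $ i) ^ Poly_Mapping.lookup \<alpha> i))"


section \<open>Complexification of a real ideal\<close>

definition complexify :: "('n::finite, real) mpoly \<Rightarrow> ('n, complex) mpoly" where
  "complexify = Poly_Mapping.map complex_of_real"

definition complexified_ideal ::
    "('n::finite, real) mpoly set \<Rightarrow> ('n, complex) mpoly set" where
  "complexified_ideal I = Idl\<^bsub>mpoly_ring\<^esub> (complexify ` I)"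

abbreviation real_quotient ::
    "('n::finite, real) mpoly set \<Rightarrow> ('n, real) mpoly set ring" where
  "real_quotient I \<equiv> mpoly_ring Quot I"

abbreviation complex_quotient ::
    "('n::finite, real) mpoly set \<Rightarrow> ('n, complex) mpoly set ring" where
  "complex_quotient I \<equiv> mpoly_ring Quot (complexified_ideal I)"

text \<open>
  The induced map \<open>[f] \<mapsto> [P f]\<close>. The image below is a singleton, as \<open>[P f]\<close> does not depend on the
  representative \<open>f\<close> of the coset \<open>K\<close>.
\<close>

definition quotient_complexify ::
    "('n::finite, real) mpoly set \<Rightarrow> ('n, real) mpoly set \<Rightarrow> ('n, complex) mpoly set" where
  "quotient_complexify I K =
     the_elem ((\<lambda>f. complexified_ideal I +>\<^bsub>mpoly_ring\<^esub> complexify f) ` K)"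

definition zero_locus :: "('n::finite, complex) mpoly set \<Rightarrow> (complex ^ 'n) set" where
  "zero_locus J = {z. \<forall>p\<in>J. mpoly_eval p z = 0}"

text \<open>
  The function on \<open>zero_locus J\<close> defined by a residue class \<open>K\<close> modulo \<open>J\<close>: at a point of
  \<open>zero_locus J\<close>, all representatives of \<open>K\<close> take the same value.
\<close>

definition residue_eval :: "('n::finite, complex) mpoly set \<Rightarrow> complex ^ 'n \<Rightarrow> complex" where
  "residue_eval K z = (THE v. \<forall>p\<in>K. mpoly_eval p z = v)"


section \<open>Analytic germs and regular points\<close>

text \<open>Holomorphy in several variables, for functions on open sets: complex Frechet
  differentiability.\<close>

definition cholomorphic_on ::
    "(complex ^ 'n::finite \<Rightarrow> complex) \<Rightarrow> (complex ^ 'n) set \<Rightarrow> bool" where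
  "cholomorphic_on f U \<longleftrightarrow>
     (\<forall>z\<in>U. \<exists>D. (f has_derivative D) (at z) \<and> (\<forall>c v. D (c *s v) = c * D v))"

text \<open>\<open>A\<close> is, near the point \<open>q\<close>, an analytic set.\<close>

definition analytic_at_point :: "(complex ^ 'n::finite) set \<Rightarrow> complex ^ 'n \<Rightarrow> bool" where
  "analytic_at_point A q \<longleftrightarrow>
     (\<exists>U G. open U \<and> q \<in> U \<and> finite G \<and> (\<forall>g\<in>G. cholomorphic_on g U) \<and>
        A \<inter> U = {z\<in>U. \<forall>g\<in>G. g z = 0})"

definition germ_eq :: "'a::topological_space \<Rightarrow> 'a set \<Rightarrow> 'a set \<Rightarrow> bool" where
  "germ_eq q A B \<longleftrightarrow> (\<exists>U. open U \<and> q \<in> U \<and> A \<inter> U = B \<inter> U)"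

definition irreducible_germ :: "(complex ^ 'n::finite) set \<Rightarrow> complex ^ 'n \<Rightarrow> bool" where
  "irreducible_germ Z q \<longleftrightarrow>
     analytic_at_point Z q \<and> q \<in> Z \<and>
     (\<forall>A B. analytic_at_point A q \<and> analytic_at_point B q \<and> germ_eq q Z (A \<union> B) \<longrightarrow>
        germ_eq q Z A \<or> germ_eq q Z B)"

text \<open>
  A point of \<open>Z\<close> is regular if, near it, \<open>Z\<close> is a complex submanifold: some biholomorphic map
  \<open>\<Phi>\<close> between open sets takes \<open>Z\<close> to a coordinate subspace.
\<close>

definition regular_point :: "(complex ^ 'n::finite) set \<Rightarrow> complex ^ 'n \<Rightarrow> bool" where
  "regular_point Z q \<longleftrightarrow> q \<in> Z \<and>
     (\<exists>U V. \<exists>\<Phi> :: complex ^ 'n \<Rightarrow> complex ^ 'n. \<exists>\<Psi> S. open U \<and> q \<in> U \<and> open V \<and> homeomorphism U V \<Phi> \<Psi> \<and>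
        (\<forall>i. cholomorphic_on (\<lambda>z. \<Phi> z $ i) U) \<and>
        (\<forall>i. cholomorphic_on (\<lambda>w. \<Psi> w $ i) V) \<and>
        \<Phi> ` (Z \<inter> U) = {w\<in>V. \<forall>i\<in>S. w $ i = 0})"

definition sing_locus :: "(complex ^ 'n::finite) set \<Rightarrow> (complex ^ 'n) set" where
  "sing_locus Z = {q\<in>Z. \<not> regular_point Z q}"


section \<open>Relative type\<close>

text \<open>The logarithm of a nonnegative real, with \<open>log 0 = -\<infinity>\<close>.\<close>

definition elog :: "real \<Rightarrow> ereal" where
  "elog t = (if t = 0 then -\<infinity> else ereal (ln t))"

text \<open>
  In \<open>ereal\<close>, \<open>0 * (-\<infinity>) = 0\<close>. This only affects \<open>c = 0\<close>, and the supremum is taken in \<open>ennreal\<close>,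
  where the empty set has supremum \<open>0\<close>; so the convention is irrelevant.
\<close>

definition relative_type ::
    "(complex ^ 'n::finite) set \<Rightarrow> complex ^ 'n \<Rightarrow>
     (complex ^ 'n \<Rightarrow> ereal) \<Rightarrow> (complex ^ 'n \<Rightarrow> ereal) \<Rightarrow> ennreal" where
  "relative_type Z q \<psi> \<phi> =
     Sup (ennreal ` {c. 0 \<le> c \<and>
       (\<exists>U C. openin (top_of_set Z) U \<and> q \<in> U \<and>
          (\<forall>z \<in> U - sing_locus Z. \<psi> z \<le> ereal c * \<phi> z + ereal C))})"


section \<open>Valuations\<close>

text \<open>Real-valued on nonzero elements; the value \<open>\<infinity>\<close> occurs at \<open>0\<close> only.\<close>

definition is_valuation ::
    "('n::finite, real) mpoly set \<Rightarrow> (('n, real) mpoly set \<Rightarrow> ereal) \<Rightarrow> bool" where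
  "is_valuation I \<nu> \<longleftrightarrow>
     (let R = real_quotient I; R' = carrier R - {\<zero>\<^bsub>R\<^esub>} in
        \<nu> \<zero>\<^bsub>R\<^esub> = \<infinity> \<and>
        (\<forall>f\<in>R'. \<exists>r\<ge>0. \<nu> f = ereal r) \<and>
        (\<exists>f\<in>R'. \<exists>g\<in>R'. \<nu> f \<noteq> \<nu> g) \<and>
        (\<forall>f\<in>R'. \<forall>g\<in>R'. \<nu> (f \<otimes>\<^bsub>R\<^esub> g) = \<nu> f + \<nu> g) \<and>
        (\<forall>f\<in>R'. \<forall>g\<in>R'. f \<oplus>\<^bsub>R\<^esub> g \<noteq> \<zero>\<^bsub>R\<^esub> \<longrightarrow> \<nu> (f \<oplus>\<^bsub>R\<^esub> g) \<ge> min (\<nu> f) (\<nu> g)) \<and>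
        (\<forall>c. c \<noteq> 0 \<longrightarrow> \<nu> (I +>\<^bsub>mpoly_ring\<^esub> mpoly_const c) = 0))"

end

theory Submission
  imports Defs
begin

text \<open>
  Both implications turn an analytic statement near the origin into a statement about valuation rings
  of one large field, and come back through a transport theorem (\<open>approx_UNIV\<close>).

  The prime ideal has a generic point (\<open>generic_point\<close>): a homomorphism with kernel exactly the ideal into
  the algebraically closed field \<open>host\<close>. A valuation on the quotient ring is a partial description of a
  valuation ring of \<open>host\<close> (\<open>valuation_extends\<close>), and Chevalley's theorem produces valuation rings from
  subrings with a proper ideal (\<open>chevalley\<close>). The transport theorem says the following. Let a valuation ring
  \<open>V\<close> of a field be given, let \<open>V'\<close> be a nontrivial valuation ring of an algebraically closed field, and
  let a homomorphism on a small subfield respect \<open>V\<close> and \<open>V'\<close>. Then any finite set \<open>S\<close> of elements lies in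
  the domain of a partial homomorphism to the target that still decides membership in the valuation rings
  correctly on \<open>S\<close> and kills no nonzero element of \<open>S\<close>. It is proved by adjoining one element of least
  degree at a time: over such an element every rational expression is a product of linear factors, so
  only the values of finitely many differences have to be controlled.

  From a valuation to the relative type: the target is an ultrapower of the complex numbers with the ring
  of its finite elements. A homomorphism into it is a sequence of complex points, elements of the maximal
  ideal become arbitrarily small, and so \<open>\<nu>(s) > \<nu>(t)\<close> yields points of \<open>X\<close> arbitrarily close to the
  origin where \<open>\<bar>s\<bar> \<le> \<epsilon> \<bar>t\<bar>\<close>. Comparing suitable powers of \<open>f\<^sub>1\<close>, of the other \<open>f\<^sub>j\<close> and
  of \<open>F\<close> contradicts every bound \<open>\<bar>F\<bar> \<le> C e\<^sup>c\<^sup>\<phi>\<close> with \<open>c > \<Sum> a\<^sub>j\<close>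
  (\<open>valuation_violates_bound\<close>). Such points can be taken regular, since one polynomial outside the ideal
  and finitely many inside it certify regularity (\<open>generic_regular_points\<close>). The bound with
  \<open>c = \<Sum> a\<^sub>j\<close> is elementary, as \<open>\<bar>f\<^sub>j\<bar> \<le> e\<^sup>a\<^sup>\<phi>\<close> with \<open>a = a\<^sub>j\<close>.

  From the relative type to a valuation: the elements \<open>x\<close> for which some \<open>x F\<^sup>M\<close> is a polynomial of order
  at least \<open>M \<Sum> a\<^sub>j + \<delta>\<close> in \<open>e\<^sup>\<phi>\<close> form a ring for \<open>\<delta> = 0\<close>, and those with some
  \<open>\<delta> > 0\<close> an ideal in it. The relative type says that this ideal is proper. A valuation ring given by
  Chevalley's theorem orders the monomials in the \<open>f\<^sub>j\<close> by their weights, but it need not have rank one.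
  Transporting it, over the field generated by those \<open>f\<^sub>j\<close> whose \<open>a\<^sub>j\<close> form a maximal independent
  family, to a target with a real monomial valuation keeps these weights and gives the required real
  valuation (\<open>ex_real_valuation\<close>).
\<close>

(* The names coeff, degree, lead_coeff, monom and smult are to mean univariate polynomials over a type class. *)
hide_const (open) up_ring.coeff up_ring.monom module.smult Polynomials.lead_coeff Polynomials.degree Poly_Mapping.degree

section \<open>Subrings and polynomials over them\<close>

definition is_subring :: "'a::comm_ring_1 set => bool" where
 "is_subring A \<longleftrightarrow> 1 \<in> A \<and> (\<forall>x\<in>A. \<forall>y\<in>A. x + y \<in> A \<and> x * y \<in> A) \<and> (\<forall>x\<in>A. - x \<in> A)"

lemma is_subringI:
 assumes "1 \<in> A" "\<And>x y. x \<in> A ==> y \<in> A ==> x + y \<in> A"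
  "\<And>x y. x \<in> A ==> y \<in> A ==> x * y \<in> A" "\<And>x. x \<in> A ==> - x \<in> A"
 shows "is_subring A"
 using assms unfolding is_subring_def by blast

lemma subring_one: "is_subring A ==> 1 \<in> A"
 and subring_add: "is_subring A ==> x \<in> A ==> y \<in> A ==> x + y \<in> A"
 and subring_mult: "is_subring A ==> x \<in> A ==> y \<in> A ==> x * y \<in> A"
 and subring_uminus: "is_subring A ==> x \<in> A ==> - x \<in> A"
 unfolding is_subring_def by blast+

lemma subring_zero: "is_subring A ==> 0 \<in> A"
 using subring_add[of A 1 "-1"] subring_one subring_uminus by fastforce

lemma subring_diff: "is_subring A ==> x \<in> A ==> y \<in> A ==> x - y \<in> A"
 using subring_add[of A x "-y"] subring_uminus by fastforce

lemma subring_power: "is_subring A ==> x \<in> A ==> x ^ n \<in> A"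
 by (induction n) (auto intro: subring_one subring_mult)

lemma subring_sum: "is_subring A ==> (\<And>i. i \<in> K ==> f i \<in> A) ==> sum f K \<in> A"
 by (induction K rule: infinite_finite_induct) (auto intro: subring_zero subring_add)

lemma subring_prod: "is_subring A ==> (\<And>i. i \<in> K ==> f i \<in> A) ==> prod f K \<in> A"
 by (induction K rule: infinite_finite_induct) (auto intro: subring_one subring_mult)

lemmas subring_intros = subring_zero subring_one subring_add subring_mult subring_uminus
 subring_diff subring_power subring_sum subring_prod

definition polys_over :: "'a::comm_ring_1 set => 'a poly set" where
 "polys_over A = {p. \<forall>i. coeff p i \<in> A}"

lemma polys_over_mono: "A \<subseteq> B ==> polys_over A \<subseteq> polys_over B"
 by (auto simp: polys_over_def)

lemma is_subring_polys_over: "is_subring A ==> is_subring (polys_over A)"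
 unfolding polys_over_def
 by (rule is_subringI) (auto simp: coeff_mult coeff_1 intro!: subring_intros)

lemma polys_over_pCons: "a \<in> A ==> p \<in> polys_over A ==> pCons a p \<in> polys_over A"
 by (auto simp: polys_over_def coeff_pCons split: nat.splits)

lemma polys_over_pCons_iff: "pCons a p \<in> polys_over A \<longleftrightarrow> a \<in> A \<and> p \<in> polys_over A"
 by (auto simp: polys_over_def coeff_pCons split: nat.splits)

lemma polys_over_smult: "is_subring A ==> a \<in> A ==> p \<in> polys_over A ==> smult a p \<in> polys_over A"
 by (auto simp: polys_over_def intro: subring_intros)

lemma polys_over_monom: "is_subring A ==> a \<in> A ==> monom a n \<in> polys_over A"
 by (auto simp: polys_over_def intro: subring_intros)

lemma polys_over_0: "is_subring A ==> 0 \<in> polys_over A"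
 by (auto simp: polys_over_def intro: subring_intros)

lemma polys_over_poly_in:
 assumes "is_subring A" "p \<in> polys_over A" "x \<in> A" shows "poly p x \<in> A"
 using assms by (auto simp: poly_altdef polys_over_def intro!: subring_intros)

lemmas polys_over_intros = polys_over_pCons polys_over_smult polys_over_monom polys_over_0
 subring_intros[OF is_subring_polys_over]

text \<open>Division with remainder by a monic polynomial stays inside the coefficient ring.\<close>

lemma polys_over_monic_division:
 fixes p :: "'a::comm_ring_1 poly"
 assumes A: "is_subring A" and p: "p \<in> polys_over A" "lead_coeff p = 1"
  and q: "q \<in> polys_over A"
 shows "\<exists>h r. h \<in> polys_over A \<and> r \<in> polys_over A \<and> q = p * h + r \<and> (r = 0 \<or> degree r < degree p)"
 using q
proof (induction "degree q" arbitrary: q rule: less_induct)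
 case less
 show ?case
 proof (cases "q = 0 \<or> degree q < degree p")
  case True
  then show ?thesis
   using less.prems by (intro exI[of _ 0] exI[of _ q]) (auto intro: polys_over_0[OF A])
 next
  case False
  then have q0: "q ~= 0" and dq: "degree p \<le> degree q" by auto
  define t where "t = monom (lead_coeff q) (degree q - degree p)"
  have t: "t \<in> polys_over A"
   unfolding t_def using less.prems by (intro polys_over_monom A) (auto simp: polys_over_def)
  define q' where "q' = q - p * t"
  have q': "q' \<in> polys_over A"
   unfolding q'_def using p t less.prems by (intro polys_over_intros A)
  have p0: "p ~= 0" using p by auto
  have lt: "lead_coeff q ~= 0" using q0 by simp
  have cpt: "coeff (p * t) n = (if n < degree q - degree p then 0 else coeff p (n - (degree q - degree p)) * lead_coeff q)" for n
  proof -
   have "p * t = t * p" by (rule mult.commute)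
   then show ?thesis unfolding t_def by (simp only: coeff_monom_mult) (simp add: mult.commute)
  qed
  have small: "coeff q' n = 0" if "n \<ge> degree q" for n
  proof (cases "n = degree q")
   case True
   have "degree q - (degree q - degree p) = degree p" using dq by auto
   then show ?thesis using True p dq by (simp add: q'_def cpt)
  next
   case False
   then have "n > degree q" using that by auto
   moreover have "n - (degree q - degree p) > degree p" using \<open>n > degree q\<close> dq by auto
   ultimately show ?thesis by (simp add: q'_def cpt coeff_eq_0)
  qed
  show ?thesis
  proof (cases "q' = 0")
   case True
   then show ?thesis using t polys_over_0[OF A]
    by (intro exI[of _ t] exI[of _ 0]) (auto simp: q'_def)
  next
   case False
   have "degree q' < degree q"
    using small[of "degree q'"] False by (metis leading_coeff_0_iff not_less)
   from less.hyps[OF this q'] obtain h r where hr: "h \<in> polys_over A" "r \<in> polys_over A"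
    "q' = p * h + r" "r = 0 \<or> degree r < degree p" by blast
   have "q = p * (h + t) + r" using hr(3) by (simp add: q'_def algebra_simps)
   moreover have "h + t \<in> polys_over A" using hr t by (intro polys_over_intros A)
   ultimately show ?thesis using hr by blast
  qed
 qed
qed

section \<open>Valuation rings and Chevalley's extension theorem\<close>

definition is_vring :: "'a::field set => bool" where
 "is_vring V \<longleftrightarrow> is_subring V \<and> (\<forall>x. x \<in> V \<or> inverse x \<in> V)"

text \<open>Pairs of a subring and a proper ideal, ordered by inclusion in both components in Chevalley's theorem.\<close>

definition proper_pair :: "'a::field set => 'a set => bool" where
 "proper_pair B Q \<longleftrightarrow> is_subring B \<and> Q \<subseteq> B \<and> 0 \<in> Q \<and> (\<forall>x\<in>Q. \<forall>y\<in>Q. x + y \<in> Q) \<and>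
  (\<forall>b\<in>B. \<forall>x\<in>Q. b * x \<in> Q) \<and> 1 \<notin> Q"

lemma proper_pair_sum:
 assumes "proper_pair B Q" "\<And>i. i \<in> K ==> f i \<in> Q" shows "sum f K \<in> Q"
 using assms(2)
 by (induction K rule: infinite_finite_induct) (use assms(1) in \<open>auto simp: proper_pair_def\<close>)

lemma proper_pair_uminus: "proper_pair B Q ==> x \<in> Q ==> - x \<in> Q"
 unfolding proper_pair_def by (metis mult_minus1 subring_one subring_uminus)

text \<open>Adjoining \<open>x\<close> together with the multiples of \<open>Q\<close> would give a larger pair. By maximality its ideal is
  improper, and an expression of \<open>1\<close> in it is a polynomial relation for \<open>x\<close>.\<close>

lemma proper_pair_adjoin:
 assumes pp: "proper_pair B Q"
  and max: "\<And>B' Q'. proper_pair B' Q' ==> B \<subseteq> B' ==> Q \<subseteq> Q' ==> B' = B"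
  and x: "x \<notin> B"
 shows "\<exists>p\<in>polys_over Q. poly p x = 1"
proof (rule ccontr)
 assume no: "\<not> ?thesis"
 define B' where "B' = (\<lambda>p. poly p x) ` polys_over B"
 define Q' where "Q' = (\<lambda>p. poly p x) ` polys_over Q"
 have B: "is_subring B" and QB: "Q \<subseteq> B" and Q0: "0 \<in> Q"
  and Qadd: "\<And>x y. x \<in> Q ==> y \<in> Q ==> x + y \<in> Q"
  and Qm: "\<And>b x. b \<in> B ==> x \<in> Q ==> b * x \<in> Q"
  using pp by (auto simp: proper_pair_def)
 note PB = is_subring_polys_over[OF B]
 have subB': "is_subring B'"
 proof (rule is_subringI)
  show "1 \<in> B'" unfolding B'_def using subring_one[OF PB] by (intro image_eqI[of _ _ 1]) auto
 next
  fix u v assume "u \<in> B'" "v \<in> B'"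
  then obtain p q where "p \<in> polys_over B" "q \<in> polys_over B" "u = poly p x" "v = poly q x"
   unfolding B'_def by blast
  then have "u + v = poly (p + q) x" "u * v = poly (p * q) x" "p + q \<in> polys_over B" "p * q \<in> polys_over B"
   using subring_add[OF PB, of p q] subring_mult[OF PB, of p q] by auto
  then show "u + v \<in> B'" "u * v \<in> B'" unfolding B'_def by blast+
 next
  fix u assume "u \<in> B'"
  then obtain p where "p \<in> polys_over B" "u = poly p x" unfolding B'_def by blast
  then show "- u \<in> B'" unfolding B'_def
   using subring_uminus[OF PB, of p] by (auto intro!: image_eqI[of _ _ "- p"])
 qed
 have "proper_pair B' Q'"
  unfolding proper_pair_def
 proof (intro conjI ballI)
  show "Q' \<subseteq> B'" unfolding Q'_def B'_def using polys_over_mono[OF QB] by blast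
  show "0 \<in> Q'" unfolding Q'_def using Q0 by (intro image_eqI[of _ _ 0]) (auto simp: polys_over_def)
  show "1 \<notin> Q'" unfolding Q'_def using no by force
 next
  fix u v assume "u \<in> Q'" "v \<in> Q'"
  then obtain p q where "p \<in> polys_over Q" "q \<in> polys_over Q" "u = poly p x" "v = poly q x"
   unfolding Q'_def by blast
  then show "u + v \<in> Q'" unfolding Q'_def
   by (auto intro!: image_eqI[of _ _ "p + q"] simp: polys_over_def Qadd)
 next
  fix u v assume "u \<in> B'" "v \<in> Q'"
  then obtain p q where pq: "p \<in> polys_over B" "q \<in> polys_over Q" "u = poly p x" "v = poly q x"
   unfolding B'_def Q'_def by blast
  have "p * q \<in> polys_over Q"
   using pq(1,2) unfolding polys_over_def
   by (auto simp: coeff_mult intro!: proper_pair_sum[OF pp] Qm)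
  then show "u * v \<in> Q'" unfolding Q'_def using pq by (auto intro!: image_eqI[of _ _ "p * q"])
 qed (rule subB')
 moreover have "B \<subseteq> B'"
 proof
  fix b assume "b \<in> B" then show "b \<in> B'" unfolding B'_def
   by (intro image_eqI[of _ _ "[:b:]"]) (auto intro!: polys_over_intros B)
 qed
 moreover have "Q \<subseteq> Q'"
 proof
  fix b assume "b \<in> Q" then show "b \<in> Q'" unfolding Q'_def
   by (intro image_eqI[of _ _ "[:b:]"]) (auto simp: polys_over_def Q0 coeff_pCons split: nat.split)
 qed
 ultimately have "B' = B" using max by blast
 moreover have "x \<in> B'" unfolding B'_def
  using B by (intro image_eqI[of _ _ "[:0, 1:]"]) (auto intro!: polys_over_intros intro: subring_intros)
 ultimately show False using x by simp
qed

text \<open>Inverting all elements congruent to \<open>1\<close> keeps the ideal proper, so a maximal pair already contains their inverses.\<close>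

lemma proper_pair_localize:
 assumes pp: "proper_pair B Q"
  and max: "\<And>B' Q'. proper_pair B' Q' ==> B \<subseteq> B' ==> Q \<subseteq> Q' ==> B' = B"
  and q: "q \<in> Q"
 shows "inverse (1 - q) \<in> B"
proof -
 have B: "is_subring B" and QB: "Q \<subseteq> B" and Q0: "0 \<in> Q" and Q1: "1 \<notin> Q"
  and Qadd: "\<And>x y. x \<in> Q ==> y \<in> Q ==> x + y \<in> Q"
  and Qm: "\<And>b x. b \<in> B ==> x \<in> Q ==> b * x \<in> Q"
  using pp by (auto simp: proper_pair_def)
 note Qneg = proper_pair_uminus[OF pp]
 have ne: "1 - u ~= 0" if "u \<in> Q" for u using that Q1 by auto
 have clos: "\<exists>w\<in>Q. (1 - u) * (1 - v) = 1 - w" if "u \<in> Q" "v \<in> Q" for u v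
 proof (intro bexI)
  show "(1 - u) * (1 - v) = 1 - (u + (v + (- u) * v))" by (simp add: algebra_simps)
  show "u + (v + (- u) * v) \<in> Q" using that QB by (intro Qadd Qm) (auto intro: Qneg)
 qed
 define B' where "B' = {b / (1 - u) | b u. b \<in> B \<and> u \<in> Q}"
 define Q' where "Q' = {b / (1 - u) | b u. b \<in> Q \<and> u \<in> Q}"
 have oneB: "1 - u \<in> B" if "u \<in> Q" for u using that QB B by (auto intro: subring_intros)
 have "is_subring B'"
 proof (rule is_subringI)
  show "1 \<in> B'" unfolding B'_def using Q0 subring_one[OF B] by (intro CollectI exI[of _ 1] exI[of _ 0]) auto
 next
  fix s t assume "s \<in> B'" "t \<in> B'"
  then obtain b u c v where st: "b \<in> B" "u \<in> Q" "s = b / (1 - u)" "c \<in> B" "v \<in> Q" "t = c / (1 - v)"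
   unfolding B'_def by blast
  obtain w where w: "w \<in> Q" "(1 - u) * (1 - v) = 1 - w" using clos st by blast
  have "s + t = (b * (1 - v) + c * (1 - u)) / (1 - w)" "s * t = (b * c) / (1 - w)"
   using st ne[of u] ne[of v] by (simp_all add: w(2)[symmetric] add_frac_eq)
  moreover have "b * (1 - v) + c * (1 - u) \<in> B" "b * c \<in> B"
   using st oneB B by (auto intro: subring_intros)
  ultimately show "s + t \<in> B'" "s * t \<in> B'" unfolding B'_def using w by blast+
 next
  fix s assume "s \<in> B'"
  then obtain b u where st: "b \<in> B" "u \<in> Q" "s = b / (1 - u)" unfolding B'_def by blast
  have "- s = (- b) / (1 - u)" by (simp add: st)
  then show "- s \<in> B'" unfolding B'_def using st subring_uminus[OF B] by blast
 qed
 moreover have "Q' \<subseteq> B'" unfolding Q'_def B'_def using QB by blast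
 moreover have "0 \<in> Q'" unfolding Q'_def using Q0 by force
 moreover have "s + t \<in> Q'" if st': "s \<in> Q'" "t \<in> Q'" for s t
 proof -
  from st' obtain b u c v where st: "b \<in> Q" "u \<in> Q" "s = b / (1 - u)" "c \<in> Q" "v \<in> Q" "t = c / (1 - v)"
   unfolding Q'_def by blast
  obtain w where w: "w \<in> Q" "(1 - u) * (1 - v) = 1 - w" using clos st by blast
  have "s + t = ((1 - v) * b + (1 - u) * c) / (1 - w)"
   using st ne[of u] ne[of v] by (simp add: w(2)[symmetric] add_frac_eq mult.commute)
  moreover have "(1 - v) * b + (1 - u) * c \<in> Q" using st oneB by (intro Qadd Qm) auto
  ultimately show ?thesis unfolding Q'_def using w by blast
 qed
 moreover have "s * t \<in> Q'" if st': "s \<in> B'" "t \<in> Q'" for s t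
 proof -
  from st' obtain b u c v where st: "b \<in> B" "u \<in> Q" "s = b / (1 - u)" "c \<in> Q" "v \<in> Q" "t = c / (1 - v)"
   unfolding Q'_def B'_def by blast
  obtain w where w: "w \<in> Q" "(1 - u) * (1 - v) = 1 - w" using clos st by blast
  have "s * t = (b * c) / (1 - w)" using st by (simp add: w(2)[symmetric])
  moreover have "b * c \<in> Q" using st by (intro Qm) auto
  ultimately show ?thesis unfolding Q'_def using w by blast
 qed
 moreover have "1 \<notin> Q'"
 proof
  assume "1 \<in> Q'"
  then obtain b u where bu: "b \<in> Q" "u \<in> Q" "1 = b / (1 - u)" unfolding Q'_def by blast
  then have "1 = b + u" using ne[of u] by (simp add: field_simps)
  then show False using Qadd[of b u] bu Q1 by simp
 qed
 ultimately have "proper_pair B' Q'" unfolding proper_pair_def by blast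
 moreover have "B \<subseteq> B'" unfolding B'_def using Q0 by force
 moreover have "Q \<subseteq> Q'" unfolding Q'_def using Q0 by force
 ultimately have "B' = B" using max by blast
 moreover have "inverse (1 - q) \<in> B'" unfolding B'_def using q subring_one[OF B]
  by (intro CollectI exI[of _ 1] exI[of _ q]) (auto simp: field_simps)
 ultimately show ?thesis by simp
qed

text \<open>The relation for the inverse, multiplied by a power of \<open>x\<close>, expresses the leading term of the relation for
  \<open>x\<close> through lower ones. Two such relations can therefore be shortened in turn, without end.\<close>

lemma proper_pair_reduce:
 assumes pp: "proper_pair B Q" and loc: "\<And>q. q \<in> Q ==> inverse (1 - q) \<in> B"
  and x: "x ~= 0"
  and P: "P \<in> polys_over Q" "poly P x = 1" and R: "R \<in> polys_over Q" "poly R (inverse x) = 1"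
  and deg: "degree R \<le> degree P"
 shows "\<exists>P'\<in>polys_over Q. poly P' x = 1 \<and> degree P' < degree P"
proof -
 have B: "is_subring B" and QB: "Q \<subseteq> B" and Q0: "0 \<in> Q" and Q1: "1 \<notin> Q"
  and Qadd: "\<And>x y. x \<in> Q ==> y \<in> Q ==> x + y \<in> Q"
  and Qm: "\<And>b x. b \<in> B ==> x \<in> Q ==> b * x \<in> Q"
  using pp by (auto simp: proper_pair_def)
 note Qneg = proper_pair_uminus[OF pp]
 let ?n = "degree P" and ?m = "degree R"
 have Pc: "coeff P i \<in> Q" and Rc: "coeff R i \<in> Q" for i using P R by (auto simp: polys_over_def)
 have n0: "?n > 0"
 proof (rule ccontr)
  assume "\<not> ?n > 0"
  then obtain a where "P = [:a:]" using degree_eq_zeroE[of P] by auto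
  then have "coeff P 0 = 1" using P by simp
  then show False using Pc[of 0] Q1 by simp
 qed
 define r where "r = inverse (1 - coeff R 0)"
 have rB: "r \<in> B" unfolding r_def using loc Rc by blast
 have ne: "1 - coeff R 0 ~= 0" using Rc[of 0] Q1 by auto
 have "1 = (\<Sum>j\<le>?m. coeff R j * inverse x ^ j)" using R by (simp add: poly_altdef)
 also have "\<dots> = coeff R 0 + (\<Sum>j\<in>{1..?m}. coeff R j * inverse x ^ j)"
  by (subst atMost_atLeast0, subst sum.atLeast_Suc_atMost) auto
 finally have "1 - coeff R 0 = (\<Sum>j\<in>{1..?m}. coeff R j * inverse x ^ j)" by (simp add: diff_eq_eq add.commute)
 then have "1 = r * (\<Sum>j\<in>{1..?m}. coeff R j * inverse x ^ j)"
  unfolding r_def using ne by (metis left_inverse)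
 then have "x ^ ?n = r * (\<Sum>j\<in>{1..?m}. coeff R j * inverse x ^ j) * x ^ ?n" by simp
 also have "\<dots> = (\<Sum>j\<in>{1..?m}. r * coeff R j * x ^ (?n - j))"
 proof -
  have "inverse x ^ j * x ^ ?n = x ^ (?n - j)" if "j \<in> {1..?m}" for j
  proof -
   have "x ^ ?n = x ^ j * x ^ (?n - j)" using that deg by (simp flip: power_add)
   then show ?thesis using x by (simp add: power_inverse)
  qed
  then show ?thesis by (simp add: sum_distrib_left sum_distrib_right mult.assoc)
 qed
 finally have xn: "x ^ ?n = (\<Sum>j\<in>{1..?m}. r * coeff R j * x ^ (?n - j))" .
 define P' where "P' = (\<Sum>i<?n. monom (coeff P i) i) + (\<Sum>j\<in>{1..?m}. monom (lead_coeff P * (r * coeff R j)) (?n - j))"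
 have "poly P' x = (\<Sum>i<?n. coeff P i * x ^ i) + lead_coeff P * (\<Sum>j\<in>{1..?m}. r * coeff R j * x ^ (?n - j))"
  unfolding P'_def by (simp add: poly_sum poly_monom sum_distrib_left mult.assoc)
 also have "\<dots> = (\<Sum>i\<le>?n. coeff P i * x ^ i)"
  unfolding xn[symmetric] by (simp add: lessThan_Suc_atMost[symmetric])
 also have "\<dots> = 1" using P by (simp add: poly_altdef)
 finally have "poly P' x = 1" .
 moreover have "degree P' < ?n"
 proof -
  have "degree (\<Sum>i<?n. monom (coeff P i) i) < ?n"
   using n0 by (intro degree_sum_less) (auto intro: le_less_trans[OF degree_monom_le])
  moreover have "degree (\<Sum>j\<in>{1..?m}. monom (lead_coeff P * (r * coeff R j)) (?n - j)) < ?n"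
   using n0 by (intro degree_sum_less) (auto intro: le_less_trans[OF degree_monom_le])
  ultimately show ?thesis unfolding P'_def by (rule degree_add_less)
 qed
 moreover have "P' \<in> polys_over Q"
  unfolding P'_def polys_over_def
  using Pc Rc rB Q0 subsetD[OF QB Pc] by (auto simp: coeff_sum intro!: Qadd proper_pair_sum[OF pp] Qm)
 ultimately show ?thesis by blast
qed

text \<open>Zorn's lemma yields a maximal pair. If it contained neither \<open>x\<close> nor its inverse, both would satisfy
  relations with coefficients in the ideal, and the longer one could always be shortened.\<close>

theorem chevalley:
 fixes A J :: "'a::field set"
 assumes "proper_pair A J"
 obtains V where "is_vring V" "A \<subseteq> V" "\<And>x. x \<in> J ==> x ~= 0 ==> inverse x \<notin> V"
proof -
 define ring where "ring = (\<lambda>S::('a \<times> bool) set. {x. (x, True) \<in> S})"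
 define idl where "idl = (\<lambda>S::('a \<times> bool) set. {x. (x, False) \<in> S})"
 define \<A> where "\<A> = {S. proper_pair (ring S) (idl S) \<and> A \<subseteq> ring S \<and> J \<subseteq> idl S}"
 have "A \<times> {True} \<union> J \<times> {False} \<in> \<A>"
 proof -
  have "ring (A \<times> {True} \<union> J \<times> {False}) = A" "idl (A \<times> {True} \<union> J \<times> {False}) = J"
   by (auto simp: ring_def idl_def)
  then show ?thesis using assms by (simp add: \<A>_def)
 qed
 then have ne: "\<A> ~= {}" by blast
 have "\<exists>S\<in>\<A>. \<forall>T\<in>\<A>. S \<subseteq> T --> T = S"
 proof (rule subset_Zorn_nonempty[OF ne])
  fix \<C> assume C: "\<C> ~= {}" "subset.chain \<A> \<C>"
  have CA: "\<And>S. S \<in> \<C> ==> S \<in> \<A>" and lin: "\<And>S T. S \<in> \<C> ==> T \<in> \<C> ==> S \<subseteq> T \<or> T \<subseteq> S"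
   using C(2) by (auto simp: subset_chain_def)
  have two: "\<exists>S\<in>\<C>. s \<in> S \<and> t \<in> S" if st: "s \<in> \<Union>\<C>" "t \<in> \<Union>\<C>" for s t
   using st lin by (meson UnionE subsetD)
  have memR: "x \<in> ring S \<longleftrightarrow> (x, True) \<in> S" and memI: "x \<in> idl S \<longleftrightarrow> (x, False) \<in> S" for x S
   by (auto simp: ring_def idl_def)
  have pp: "proper_pair (ring S) (idl S)" "A \<subseteq> ring S" "J \<subseteq> idl S" if "S \<in> \<C>" for S
   using CA[OF that] by (auto simp: \<A>_def)
  obtain S0 where S0: "S0 \<in> \<C>" using C by blast
  have "proper_pair (ring (\<Union>\<C>)) (idl (\<Union>\<C>))"
   unfolding proper_pair_def
  proof (intro conjI ballI)
   show "is_subring (ring (\<Union>\<C>))"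
   proof (rule is_subringI)
    show "1 \<in> ring (\<Union>\<C>)" using pp(1)[OF S0] S0 subring_one
     by (fastforce simp: memR proper_pair_def)
   next
    fix x y assume "x \<in> ring (\<Union>\<C>)" "y \<in> ring (\<Union>\<C>)"
    then obtain S where S: "S \<in> \<C>" "x \<in> ring S" "y \<in> ring S" using two unfolding memR by blast
    then have "x + y \<in> ring S" "x * y \<in> ring S"
     using pp(1)[OF S(1)] by (auto simp: proper_pair_def intro: subring_intros)
    then show "x + y \<in> ring (\<Union>\<C>)" "x * y \<in> ring (\<Union>\<C>)" using S by (auto simp: memR)
   next
    fix x assume "x \<in> ring (\<Union>\<C>)"
    then obtain S where S: "S \<in> \<C>" "x \<in> ring S" unfolding memR by blast
    then have "- x \<in> ring S"
     using pp(1)[OF S(1)] by (auto simp: proper_pair_def intro: subring_intros)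
    then show "- x \<in> ring (\<Union>\<C>)" using S by (auto simp: memR)
   qed
   show "idl (\<Union>\<C>) \<subseteq> ring (\<Union>\<C>)"
   proof
    fix x assume "x \<in> idl (\<Union>\<C>)"
    then obtain S where S: "S \<in> \<C>" "x \<in> idl S" unfolding memI by blast
    then show "x \<in> ring (\<Union>\<C>)" using pp(1)[OF S(1)] unfolding proper_pair_def memR by (metis UnionI memR subsetD)
   qed
   show "0 \<in> idl (\<Union>\<C>)" using pp(1)[OF S0] S0 by (auto simp: memI proper_pair_def)
   show "1 \<notin> idl (\<Union>\<C>)"
   proof
    assume "1 \<in> idl (\<Union>\<C>)"
    then obtain S where "S \<in> \<C>" "1 \<in> idl S" unfolding memI by blast
    then show False using pp(1) by (auto simp: proper_pair_def)
   qed
  next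
   fix x y assume "x \<in> idl (\<Union>\<C>)" "y \<in> idl (\<Union>\<C>)"
   then obtain S where S: "S \<in> \<C>" "x \<in> idl S" "y \<in> idl S" using two unfolding memI by blast
   then have "x + y \<in> idl S" using pp(1)[OF S(1)] by (auto simp: proper_pair_def)
   then show "x + y \<in> idl (\<Union>\<C>)" using S by (auto simp: memI)
  next
   fix x y assume "x \<in> ring (\<Union>\<C>)" "y \<in> idl (\<Union>\<C>)"
   then obtain S where S: "S \<in> \<C>" "x \<in> ring S" "y \<in> idl S" using two unfolding memI memR by blast
   then have "x * y \<in> idl S" using pp(1)[OF S(1)] by (auto simp: proper_pair_def)
   then show "x * y \<in> idl (\<Union>\<C>)" using S by (auto simp: memI)
  qed
  moreover have "A \<subseteq> ring (\<Union>\<C>)" "J \<subseteq> idl (\<Union>\<C>)"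
   using pp(2,3)[OF S0] S0 by (auto simp: ring_def idl_def)
  ultimately show "\<Union>\<C> \<in> \<A>" by (simp add: \<A>_def)
 qed
 then obtain M where M: "M \<in> \<A>" and Mmax: "\<And>T. T \<in> \<A> ==> M \<subseteq> T ==> T = M" by blast
 define V where "V = ring M"
 define Q where "Q = idl M"
 have pp: "proper_pair V Q" and AV: "A \<subseteq> V" and JQ: "J \<subseteq> Q"
  using M by (auto simp: \<A>_def V_def Q_def)
 have max: "B' = V" if B': "proper_pair B' Q'" "V \<subseteq> B'" "Q \<subseteq> Q'" for B' Q'
 proof -
  have r: "ring (B' \<times> {True} \<union> Q' \<times> {False}) = B'" "idl (B' \<times> {True} \<union> Q' \<times> {False}) = Q'"
   by (auto simp: ring_def idl_def)
  have "B' \<times> {True} \<union> Q' \<times> {False} \<in> \<A>" using B' AV JQ by (auto simp: \<A>_def r)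
  moreover have "M \<subseteq> B' \<times> {True} \<union> Q' \<times> {False}"
  proof
   fix s assume s: "s \<in> M"
   obtain x b where xb: "s = (x, b)" by (cases s)
   show "s \<in> B' \<times> {True} \<union> Q' \<times> {False}"
    using s xb B' by (cases b) (auto simp: V_def Q_def ring_def idl_def)
  qed
  ultimately have "B' \<times> {True} \<union> Q' \<times> {False} = M" using Mmax by blast
  then show ?thesis using r by (simp add: V_def)
 qed
 have loc: "inverse (1 - q) \<in> V" if "q \<in> Q" for q
  by (rule proper_pair_localize[OF pp _ that]) (rule max)
 have "x \<in> V \<or> inverse x \<in> V" for x
 proof (rule ccontr)
  assume no: "\<not> (x \<in> V \<or> inverse x \<in> V)"
  have V: "is_subring V" using pp by (simp add: proper_pair_def)
  have x0: "x ~= 0" using no subring_zero[OF V] by auto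
  define D where "D = (\<lambda>u n. \<exists>p\<in>polys_over Q. poly p u = 1 \<and> degree p = n)"
  have ex: "\<exists>n. D u n" if "u \<notin> V" for u
  proof -
   have "\<exists>p\<in>polys_over Q. poly p u = 1" by (rule proper_pair_adjoin[OF pp _ that]) (rule max)
   then show ?thesis unfolding D_def by blast
  qed
  define n where "n = (LEAST n. D x n)"
  define m where "m = (LEAST n. D (inverse x) n)"
  have n: "D x n" and nl: "\<And>k. D x k ==> n \<le> k"
   unfolding n_def using ex[of x] no by (auto intro: LeastI_ex Least_le)
  have m: "D (inverse x) m" and ml: "\<And>k. D (inverse x) k ==> m \<le> k"
   unfolding m_def using ex[of "inverse x"] no by (auto intro: LeastI_ex Least_le)
  obtain P where P: "P \<in> polys_over Q" "poly P x = 1" "degree P = n" using n unfolding D_def by blast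
  obtain R where R: "R \<in> polys_over Q" "poly R (inverse x) = 1" "degree R = m" using m unfolding D_def by blast
  show False
  proof (cases "m \<le> n")
   case True
   then obtain P' where "P' \<in> polys_over Q" "poly P' x = 1" "degree P' < n"
    using proper_pair_reduce[OF pp loc x0 P(1,2) R(1,2)] P R by auto
   then show False using nl[of "degree P'"] unfolding D_def by fastforce
  next
   case False
   then obtain P' where "P' \<in> polys_over Q" "poly P' (inverse x) = 1" "degree P' < m"
    using proper_pair_reduce[OF pp loc, of "inverse x" R P] P R x0 by auto
   then show False using ml[of "degree P'"] unfolding D_def by fastforce
  qed
 qed
 then have "is_vring V" using pp by (simp add: is_vring_def proper_pair_def)
 moreover have "inverse x \<notin> V" if "x \<in> J" "x ~= 0" for x
 proof
  assume "inverse x \<in> V"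
  then have "inverse x * x \<in> Q" using pp that JQ unfolding proper_pair_def by blast
  then show False using that pp by (simp add: proper_pair_def)
 qed
 ultimately show thesis using that AV by blast
qed

section \<open>Homomorphisms on subrings\<close>

text \<open>A homomorphism on a subring only, given by a total function with unspecified values elsewhere.\<close>

definition phom :: "'a::comm_ring_1 set => ('a => 'b::comm_ring_1) => bool" where
 "phom D hm \<longleftrightarrow> is_subring D \<and> hm 1 = 1 \<and> (\<forall>x\<in>D. \<forall>y\<in>D. hm (x + y) = hm x + hm y \<and> hm (x * y) = hm x * hm y)"

lemma phom_subring: "phom D hm ==> is_subring D"
 and phom_one: "phom D hm ==> hm 1 = 1"
 and phom_add: "phom D hm ==> x \<in> D ==> y \<in> D ==> hm (x + y) = hm x + hm y"
 and phom_mult: "phom D hm ==> x \<in> D ==> y \<in> D ==> hm (x * y) = hm x * hm y"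
 unfolding phom_def by blast+

lemma phom_zero: "phom D hm ==> hm 0 = 0"
 using phom_add[of D hm 0 0] subring_zero[OF phom_subring] by fastforce

lemma phom_uminus: "phom D hm ==> x \<in> D ==> hm (- x) = - hm x"
 using phom_add[of D hm x "- x"] subring_uminus[OF phom_subring] phom_zero[of D hm]
 by (metis add.right_inverse add_eq_0_iff)

lemma phom_diff: "phom D hm ==> x \<in> D ==> y \<in> D ==> hm (x - y) = hm x - hm y"
 using phom_add[of D hm x "- y"] phom_uminus[of D hm y] subring_uminus[OF phom_subring, of D hm y] by simp

lemma phom_power: "phom D hm ==> x \<in> D ==> hm (x ^ n) = hm x ^ n"
 by (induction n) (auto simp: phom_one phom_mult subring_power phom_subring)

lemma phom_sum:
 assumes "phom D hm" "\<And>i. i \<in> K ==> f i \<in> D"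
 shows "hm (sum f K) = (\<Sum>i\<in>K. hm (f i))"
 using assms(2)
proof (induction K rule: infinite_finite_induct)
 case (insert x F)
 then show ?case using assms(1) by (simp add: phom_add phom_subring subring_sum)
qed (use assms(1) in \<open>auto simp: phom_zero\<close>)

lemma phom_prod:
 assumes "phom D hm" "\<And>i. i \<in> K ==> f i \<in> D"
 shows "hm (prod f K) = (\<Prod>i\<in>K. hm (f i))"
 using assms(2)
proof (induction K rule: infinite_finite_induct)
 case (insert x F)
 then show ?case using assms(1) by (simp add: phom_mult phom_subring subring_prod)
qed (use assms(1) in \<open>auto simp: phom_one\<close>)

lemma phom_inverse:
 fixes hm :: "'a::field => 'b::field"
 assumes "phom D hm" "x \<in> D" "inverse x \<in> D" shows "hm (inverse x) = inverse (hm x)"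
proof (cases "x = 0")
 case False
 then have "hm x * hm (inverse x) = 1" using assms phom_mult[OF assms(1), of x "inverse x"] phom_one by fastforce
 then show ?thesis by (metis inverse_unique)
qed (simp add: phom_zero[OF assms(1)])

text \<open>The value at \<open>w\<close> of the polynomial obtained by applying \<open>hm\<close> to the coefficients.\<close>

definition ev :: "('a::comm_ring_1 => 'b::comm_ring_1) => 'b => 'a poly => 'b" where
 "ev hm w p = poly (map_poly hm p) w"

lemma map_poly_phom:
 assumes "phom D hm" "p \<in> polys_over D" "q \<in> polys_over D"
 shows "map_poly hm (p + q) = map_poly hm p + map_poly hm q"
  and "map_poly hm (p * q) = map_poly hm p * map_poly hm q"
proof -
 have D: "coeff p i \<in> D" "coeff q i \<in> D" for i using assms by (auto simp: polys_over_def)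
 show "map_poly hm (p + q) = map_poly hm p + map_poly hm q"
  by (rule poly_eqI) (use assms(1) D in \<open>simp add: coeff_map_poly phom_zero phom_add\<close>)
 show "map_poly hm (p * q) = map_poly hm p * map_poly hm q"
 proof (rule poly_eqI)
  fix n
  have "hm (\<Sum>i\<le>n. coeff p i * coeff q (n - i)) = (\<Sum>i\<le>n. hm (coeff p i * coeff q (n - i)))"
   using D assms(1) by (intro phom_sum) (auto intro: subring_mult phom_subring)
  then show "coeff (map_poly hm (p * q)) n = coeff (map_poly hm p * map_poly hm q) n"
   using assms(1) D by (simp add: coeff_map_poly phom_zero coeff_mult phom_mult)
 qed
qed

lemma ev_add: "phom D hm ==> p \<in> polys_over D ==> q \<in> polys_over D ==> ev hm w (p + q) = ev hm w p + ev hm w q"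
 and ev_mult: "phom D hm ==> p \<in> polys_over D ==> q \<in> polys_over D ==> ev hm w (p * q) = ev hm w p * ev hm w q"
 unfolding ev_def by (simp_all add: map_poly_phom)

lemma ev_pCons: "phom D hm ==> ev hm w (pCons a p) = hm a + w * ev hm w p"
 unfolding ev_def using phom_zero by (cases "p = 0 \<and> a = 0") (auto simp: map_poly_pCons)

lemma ev_0 [simp]: "ev hm w 0 = 0"
 unfolding ev_def by simp

lemma ev_const: "phom D hm ==> ev hm w [:a:] = hm a"
 by (simp add: ev_pCons)

lemma ev_uminus: "phom D hm ==> p \<in> polys_over D ==> ev hm w (- p) = - ev hm w p"
 using ev_add[of D hm p "- p" w] subring_uminus[OF is_subring_polys_over[OF phom_subring]]
 by (metis add.right_inverse add_eq_0_iff ev_0)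

lemma ev_altdef: "phom D hm ==> ev hm w p = (\<Sum>i\<le>degree p. hm (coeff p i) * w ^ i)"
proof -
 assume h: "phom D hm"
 have "poly (map_poly hm p) w = (\<Sum>i\<le>degree p. coeff (map_poly hm p) i * w ^ i)"
  unfolding poly_altdef
 proof (rule sum.mono_neutral_left)
  have "degree (map_poly hm p) \<le> degree p"
   by (rule degree_le) (auto simp: coeff_map_poly phom_zero[OF h] coeff_eq_0)
  then show "{..degree (map_poly hm p)} \<subseteq> {..degree p}" by auto
 qed (auto simp: coeff_eq_0)
 then show ?thesis using h by (simp add: ev_def coeff_map_poly phom_zero)
qed

definition adjoin :: "'a::comm_ring_1 set => 'a => 'a set" where
 "adjoin D y = (\<lambda>Q. poly Q y) ` polys_over D"

lemma is_subring_adjoin: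
 assumes D: "is_subring D" shows "is_subring (adjoin D y)"
proof (rule is_subringI)
 note PD = is_subring_polys_over[OF D]
 show "1 \<in> adjoin D y" unfolding adjoin_def using subring_one[OF PD] by (intro image_eqI[of _ _ 1]) auto
 fix u assume "u \<in> adjoin D y"
 then obtain p where p: "p \<in> polys_over D" "u = poly p y" unfolding adjoin_def by blast
 show "- u \<in> adjoin D y" unfolding adjoin_def
  using subring_uminus[OF PD, of p] p by (intro image_eqI[of _ _ "- p"]) auto
 fix v assume "v \<in> adjoin D y"
 then obtain q where q: "q \<in> polys_over D" "v = poly q y" unfolding adjoin_def by blast
 show "u + v \<in> adjoin D y" unfolding adjoin_def
  using subring_add[OF PD, of p q] p q by (intro image_eqI[of _ _ "p + q"]) auto
 show "u * v \<in> adjoin D y" unfolding adjoin_def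
  using subring_mult[OF PD, of p q] p q by (intro image_eqI[of _ _ "p * q"]) auto
qed

lemma adjoin_superset: "is_subring D ==> D \<subseteq> adjoin D y"
proof
 fix d assume "is_subring D" "d \<in> D"
 then show "d \<in> adjoin D y" unfolding adjoin_def
  by (intro image_eqI[of _ _ "[:d:]"]) (auto intro!: polys_over_intros)
qed

lemma adjoin_mem: "is_subring D ==> y \<in> adjoin D y"
 unfolding adjoin_def by (intro image_eqI[of _ _ "[:0, 1:]"]) (auto intro!: polys_over_intros intro: subring_intros)

text \<open>The condition on \<open>w\<close> makes the value independent of the polynomial representing an element.\<close>

lemma phom_adjoin:
 assumes h: "phom D hm" and cond: "\<And>Q. Q \<in> polys_over D ==> poly Q y = 0 ==> ev hm w Q = 0"
 shows "\<exists>hm'. phom (adjoin D y) hm' \<and> (\<forall>Q\<in>polys_over D. hm' (poly Q y) = ev hm w Q)"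
proof -
 note D = phom_subring[OF h] and PD = is_subring_polys_over[OF phom_subring[OF h]]
 define hm' where "hm' = (\<lambda>x. ev hm w (SOME Q. Q \<in> polys_over D \<and> poly Q y = x))"
 have eq: "hm' (poly Q y) = ev hm w Q" if Q: "Q \<in> polys_over D" for Q
 proof -
  define Q' where "Q' = (SOME Q'. Q' \<in> polys_over D \<and> poly Q' y = poly Q y)"
  have Q': "Q' \<in> polys_over D" "poly Q' y = poly Q y"
   unfolding Q'_def using someI_ex[of "\<lambda>Q'. Q' \<in> polys_over D \<and> poly Q' y = poly Q y"] Q by blast+
  have "ev hm w (Q' + (- Q)) = 0"
   using Q Q' by (intro cond subring_add[OF PD] subring_uminus[OF PD]) auto
  then have "ev hm w Q' = ev hm w Q"
   using ev_add[OF h Q'(1) subring_uminus[OF PD Q]] ev_uminus[OF h Q] by (simp add: eq_neg_iff_add_eq_0)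
  then show ?thesis unfolding hm'_def Q'_def .
 qed
 have "phom (adjoin D y) hm'"
  unfolding phom_def
 proof (intro conjI ballI)
  show "is_subring (adjoin D y)" by (rule is_subring_adjoin[OF D])
  show "hm' 1 = 1" using eq[of "[:1:]"] subring_one[OF PD] ev_const[OF h] phom_one[OF h] by (simp add: one_pCons)
 next
  fix u v assume "u \<in> adjoin D y" "v \<in> adjoin D y"
  then obtain p q where pq: "p \<in> polys_over D" "u = poly p y" "q \<in> polys_over D" "v = poly q y"
   unfolding adjoin_def by blast
  show "hm' (u + v) = hm' u + hm' v"
   using eq[of "p + q"] eq[of p] eq[of q] pq subring_add[OF PD, of p q] ev_add[OF h] by simp
  show "hm' (u * v) = hm' u * hm' v"
   using eq[of "p * q"] eq[of p] eq[of q] pq subring_mult[OF PD, of p q] ev_mult[OF h] by simp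
 qed
 then show ?thesis using eq by blast
qed

text \<open>The domain contains the inverse of everything that is not killed; it is the local ring at the kernel.\<close>

definition local_hom :: "'a::field set => ('a => 'b::field) => bool" where
 "local_hom D hm \<longleftrightarrow> phom D hm \<and> (\<forall>x\<in>D. hm x ~= 0 --> inverse x \<in> D)"

lemma phom_localize:
 fixes hm :: "'a::field => 'b::field"
 assumes h: "phom D hm"
 shows "\<exists>D' hm'. local_hom D' hm' \<and> D' = {a / b | a b. a \<in> D \<and> b \<in> D \<and> hm b ~= 0} \<and>
  (\<forall>a\<in>D. \<forall>b\<in>D. hm b ~= 0 --> hm' (a / b) = hm a / hm b)"
proof -
 note D = phom_subring[OF h]
 have nz: "b ~= 0" if "hm b ~= 0" for b using that phom_zero[OF h] by auto
 define D' where "D' = {a / b | a b. a \<in> D \<and> b \<in> D \<and> hm b ~= 0}"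
 define P where "P = (\<lambda>x (a, b). a \<in> D \<and> b \<in> D \<and> hm b ~= 0 \<and> x = a / b)"
 define hm' where "hm' = (\<lambda>x. case (SOME ab. P x ab) of (a, b) => hm a / hm b)"
 have eq: "hm' (a / b) = hm a / hm b" if ab: "a \<in> D" "b \<in> D" "hm b ~= 0" for a b
 proof -
  have "P (a / b) (a, b)" using ab by (simp add: P_def)
  then have "P (a / b) (SOME ab. P (a / b) ab)" by (rule someI)
  moreover obtain c d where cd: "(SOME ab. P (a / b) ab) = (c, d)" by (meson surj_pair)
  ultimately have P: "c \<in> D" "d \<in> D" "hm d ~= 0" "a / b = c / d" by (auto simp: P_def)
  then have "a * d = c * b" using nz[of b] nz[of d] ab by (simp add: frac_eq_eq)
  then have "hm a * hm d = hm c * hm b" using ab P phom_mult[OF h] by metis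
  then show ?thesis using cd P(3) ab(3) by (simp add: hm'_def frac_eq_eq)
 qed
 have one: "hm 1 ~= 0" using phom_one[OF h] by simp
 have "is_subring D'"
 proof (rule is_subringI)
  show "1 \<in> D'" unfolding D'_def using subring_one[OF D] one by (intro CollectI exI[of _ 1]) auto
 next
  fix s t assume "s \<in> D'" "t \<in> D'"
  then obtain a b c d where st: "a \<in> D" "b \<in> D" "hm b ~= 0" "s = a / b" "c \<in> D" "d \<in> D" "hm d ~= 0" "t = c / d"
   unfolding D'_def by blast
  have "s + t = (a * d + c * b) / (b * d)" "s * t = (a * c) / (b * d)"
   using st nz[of b] nz[of d] by (simp_all add: add_frac_eq)
  moreover have "a * d + c * b \<in> D" "a * c \<in> D" "b * d \<in> D" using st D by (auto intro: subring_intros)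
  moreover have "hm (b * d) ~= 0" using st phom_mult[OF h] by simp
  ultimately show "s + t \<in> D'" "s * t \<in> D'" unfolding D'_def by blast+
 next
  fix s assume "s \<in> D'"
  then obtain a b where st: "a \<in> D" "b \<in> D" "hm b ~= 0" "s = a / b" unfolding D'_def by blast
  then have "- s = (- a) / b" by simp
  then show "- s \<in> D'" unfolding D'_def using st subring_uminus[OF D] by blast
 qed
 moreover have "hm' 1 = 1" using eq[of 1 1] subring_one[OF D] one by simp
 moreover have "hm' (s + t) = hm' s + hm' t \<and> hm' (s * t) = hm' s * hm' t" if st': "s \<in> D'" "t \<in> D'" for s t
 proof -
  obtain a b c d where st: "a \<in> D" "b \<in> D" "hm b ~= 0" "s = a / b" "c \<in> D" "d \<in> D" "hm d ~= 0" "t = c / d"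
   using st' unfolding D'_def by blast
  have e: "s + t = (a * d + c * b) / (b * d)" "s * t = (a * c) / (b * d)"
   using st nz[of b] nz[of d] by (simp_all add: add_frac_eq)
  have m: "a * d + c * b \<in> D" "a * c \<in> D" "b * d \<in> D" "a * d \<in> D" "c * b \<in> D" using st D by (auto intro: subring_intros)
  have n: "hm (b * d) ~= 0" using st phom_mult[OF h] by simp
  show ?thesis
   unfolding e using eq[OF m(1,3) n] eq[OF m(2,3) n] eq[of a b] eq[of c d] st m
   by (simp add: phom_add[OF h] phom_mult[OF h] add_frac_eq)
 qed
 ultimately have ph: "phom D' hm'" unfolding phom_def by blast
 have "inverse x \<in> D'" if x: "x \<in> D'" "hm' x ~= 0" for x
 proof -
  obtain a b where st: "a \<in> D" "b \<in> D" "hm b ~= 0" "x = a / b" using x unfolding D'_def by blast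
  have "hm a ~= 0" using x(2) eq[of a b] st by auto
  then show ?thesis unfolding D'_def using st by (intro CollectI exI[of _ b] exI[of _ a]) auto
 qed
 then have "local_hom D' hm'" using ph by (simp add: local_hom_def)
 then show ?thesis using eq D'_def by blast
qed

lemma local_hom_adjoin:
 fixes hm :: "'a::field => 'b::field"
 assumes h: "phom D hm" and cond: "\<And>Q. Q \<in> polys_over D ==> poly Q y = 0 ==> ev hm w Q = 0"
 obtains D' hm' where "local_hom D' hm'" "D \<subseteq> D'" "\<And>d. d \<in> D ==> hm' d = hm d" "y \<in> D'" "hm' y = w"
  "\<And>x. x \<in> D' ==> \<exists>P\<in>polys_over D. \<exists>Q\<in>polys_over D. x = poly P y / poly Q y \<and> poly Q y ~= 0 \<and>
    ev hm w Q ~= 0 \<and> hm' x = ev hm w P / ev hm w Q"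
proof -
 note D = phom_subring[OF h]
 obtain hm1 where c1: "phom (adjoin D y) hm1" "\<And>Q. Q \<in> polys_over D ==> hm1 (poly Q y) = ev hm w Q"
  using phom_adjoin[OF h cond] by blast
 obtain D' hm' where c2: "local_hom D' hm'"
  "D' = {a / b | a b. a \<in> adjoin D y \<and> b \<in> adjoin D y \<and> hm1 b ~= 0}"
  "\<And>a b. a \<in> adjoin D y ==> b \<in> adjoin D y ==> hm1 b ~= 0 ==> hm' (a / b) = hm1 a / hm1 b"
  using phom_localize[OF c1(1)] by blast
 have one: "1 \<in> adjoin D y" "hm1 1 = 1" using c1(1) phom_one phom_subring subring_one by blast+
 have in': "a \<in> D' \<and> hm' a = hm1 a" if "a \<in> adjoin D y" for a
 proof
  have "a / 1 \<in> D'" unfolding c2(2) using that one by (intro CollectI exI[of _ a] exI[of _ 1]) auto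
  then show "a \<in> D'" by simp
  show "hm' a = hm1 a" using c2(3)[of a 1] that one by simp
 qed
 have d1: "hm1 d = hm d" if "d \<in> D" for d
  using c1(2)[of "[:d:]"] that D ev_const[OF h] by (auto intro!: polys_over_intros)
 have y1: "hm1 y = w"
 proof -
  have "[:0, 1:] \<in> polys_over D" using D by (auto intro!: polys_over_intros intro: subring_intros)
  from c1(2)[OF this] show ?thesis by (simp add: ev_pCons[OF h] phom_zero[OF h] phom_one[OF h])
 qed
 show thesis
 proof (rule that[OF c2(1)])
  show "D \<subseteq> D'" using in' adjoin_superset[OF D] by blast
  show "hm' d = hm d" if "d \<in> D" for d using in' adjoin_superset[OF D] d1 that by fastforce
  show "y \<in> D'" "hm' y = w" using in'[OF adjoin_mem[OF D]] y1 by auto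
 next
  fix x assume "x \<in> D'"
  then obtain P Q where PQ: "P \<in> polys_over D" "Q \<in> polys_over D" "x = poly P y / poly Q y" "hm1 (poly Q y) ~= 0"
   unfolding c2(2) adjoin_def by blast
  have "poly Q y ~= 0" using PQ(4) phom_zero[OF c1(1)] by auto
  moreover have "hm' x = ev hm w P / ev hm w Q"
   using c2(3)[of "poly P y" "poly Q y"] PQ c1(2) by (simp add: adjoin_def)
  moreover have "ev hm w Q ~= 0" using PQ c1(2) by simp
  ultimately show "\<exists>P\<in>polys_over D. \<exists>Q\<in>polys_over D. x = poly P y / poly Q y \<and> poly Q y ~= 0 \<and>
    ev hm w Q ~= 0 \<and> hm' x = ev hm w P / ev hm w Q" using PQ by blast
 qed
qed

section \<open>Units and the maximal ideal of a valuation ring\<close>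

definition units_of_vring :: "'a::field set => 'a set" where
 "units_of_vring V = {x \<in> V. x ~= 0 \<and> inverse x \<in> V}"

definition maximal_ideal :: "'a::field set => 'a set" where
 "maximal_ideal V = {x \<in> V. x = 0 \<or> inverse x \<notin> V}"

lemma vring_subring: "is_vring V ==> is_subring V"
 by (simp add: is_vring_def)

lemma vring_total: "is_vring V ==> x \<in> V \<or> inverse x \<in> V"
 by (simp add: is_vring_def)

lemma vring_cases: "x \<in> V ==> x \<in> units_of_vring V \<or> x \<in> maximal_ideal V"
 by (auto simp: units_of_vring_def maximal_ideal_def)

lemma units_not_maximal: "x \<in> units_of_vring V ==> x \<notin> maximal_ideal V"
 by (auto simp: units_of_vring_def maximal_ideal_def)

lemma maximal_sub: "x \<in> maximal_ideal V ==> x \<in> V"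
 and units_sub: "x \<in> units_of_vring V ==> x \<in> V"
 and units_nonzero: "x \<in> units_of_vring V ==> x ~= 0"
 by (auto simp: units_of_vring_def maximal_ideal_def)

lemma units_one: "is_vring V ==> 1 \<in> units_of_vring V"
 by (auto simp: units_of_vring_def dest: vring_subring intro: subring_one)

lemma units_mult: "is_vring V ==> x \<in> units_of_vring V ==> y \<in> units_of_vring V ==> x * y \<in> units_of_vring V"
 by (auto simp: units_of_vring_def dest: vring_subring intro: subring_intros)

lemma units_inverse: "x \<in> units_of_vring V ==> inverse x \<in> units_of_vring V"
 by (auto simp: units_of_vring_def)

lemma units_divide: "is_vring V ==> x \<in> units_of_vring V ==> y \<in> units_of_vring V ==> x / y \<in> units_of_vring V"
 by (simp add: divide_inverse units_mult units_inverse)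

lemma units_power: "is_vring V ==> x \<in> units_of_vring V ==> x ^ n \<in> units_of_vring V"
 by (induction n) (auto simp: units_one units_mult)

lemma units_power_int: "is_vring V ==> x \<in> units_of_vring V ==> x powi n \<in> units_of_vring V"
 by (auto simp: power_int_def intro: units_power units_inverse)

lemma mult_unit_in_vring_iff:
 assumes "is_vring V" "u \<in> units_of_vring V" shows "x * u \<in> V \<longleftrightarrow> x \<in> V"
proof
 assume "x * u \<in> V"
 then have "x * u * inverse u \<in> V" using assms by (auto simp: units_of_vring_def dest: vring_subring intro: subring_intros)
 then show "x \<in> V" using units_nonzero[OF assms(2)] by (simp add: mult.assoc)
qed (use assms in \<open>auto simp: units_of_vring_def dest: vring_subring intro: subring_intros\<close>)

lemma not_in_vring:
 assumes "is_vring V" "x \<notin> V" shows "inverse x \<in> maximal_ideal V" "x ~= 0"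
 using assms vring_total[OF assms(1), of x] subring_zero[OF vring_subring[OF assms(1)]]
 by (auto simp: maximal_ideal_def)

lemma maximal_mult:
 assumes V: "is_vring V" and x: "x \<in> maximal_ideal V" and v: "v \<in> V"
 shows "v * x \<in> maximal_ideal V"
proof -
 have "inverse (v * x) \<notin> V" if "v * x ~= 0"
 proof
  assume "inverse (v * x) \<in> V"
  then have "v * inverse (v * x) \<in> V" using V v by (auto dest: vring_subring intro: subring_intros)
  moreover have "v * inverse (v * x) = inverse x" using that by (simp add: inverse_mult_distrib mult.assoc[symmetric])
  ultimately have "inverse x \<in> V" by (simp only:)
  then show False using x that by (simp add: maximal_ideal_def)
 qed
 then show ?thesis using V x v by (auto simp: maximal_ideal_def dest: vring_subring intro: subring_intros)
qed

lemma maximal_mult_right: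
 assumes V: "is_vring V" and x: "x \<in> maximal_ideal V" and v: "v \<in> V"
 shows "x * v \<in> maximal_ideal V"
 using maximal_mult[OF assms] by (simp add: mult.commute)

lemma maximal_add:
 assumes V: "is_vring V" and x: "x \<in> maximal_ideal V" and y: "y \<in> maximal_ideal V"
 shows "x + y \<in> maximal_ideal V"
proof -
 have key: "a + b \<in> maximal_ideal V"
  if a: "a \<in> maximal_ideal V" and b: "b \<in> maximal_ideal V" "b ~= 0" and ab: "a / b \<in> V" for a b
 proof -
  have "1 + a / b \<in> V" using ab V by (auto dest: vring_subring intro: subring_intros)
  then have "(1 + a / b) * b \<in> maximal_ideal V" using maximal_mult[OF V b(1)] by blast
  moreover have "(1 + a / b) * b = a + b" using b by (simp add: distrib_right)
  ultimately show ?thesis by simp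
 qed
 show ?thesis
 proof (cases "x = 0 \<or> y = 0")
  case False
  have "x / y \<in> V \<or> y / x \<in> V" using vring_total[OF V, of "x / y"] by simp
  then show ?thesis using key[OF x y] key[OF y x] False by (auto simp: add.commute)
 qed (use x y in auto)
qed

lemma maximal_zero: "is_vring V ==> 0 \<in> maximal_ideal V"
 by (auto simp: maximal_ideal_def dest: vring_subring intro: subring_intros)

lemma maximal_uminus: "is_vring V ==> x \<in> maximal_ideal V ==> - x \<in> maximal_ideal V"
 using maximal_mult[of V x "-1"] by (auto dest: vring_subring intro: subring_intros)

lemma maximal_diff: "is_vring V ==> x \<in> maximal_ideal V ==> y \<in> maximal_ideal V ==> x - y \<in> maximal_ideal V"
 using maximal_add[of V x "- y"] maximal_uminus[of V y] by simp

lemma maximal_sum: "is_vring V ==> (\<And>i. i \<in> K ==> f i \<in> maximal_ideal V) ==> sum f K \<in> maximal_ideal V"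
 by (induction K rule: infinite_finite_induct) (auto simp: maximal_zero maximal_add)

lemma one_not_maximal: "is_vring V ==> 1 \<notin> maximal_ideal V"
 by (auto simp: maximal_ideal_def dest: vring_subring intro: subring_intros)

lemma units_add_maximal:
 assumes V: "is_vring V" and u: "u \<in> units_of_vring V" and x: "x \<in> maximal_ideal V"
 shows "u + x \<in> units_of_vring V"
proof -
 have "u + x \<in> V" using u x V by (auto simp: units_of_vring_def maximal_ideal_def dest: vring_subring intro: subring_intros)
 moreover have "u + x \<notin> maximal_ideal V"
 proof
  assume "u + x \<in> maximal_ideal V"
  from maximal_diff[OF V this x] show False using units_not_maximal[OF u] by simp
 qed
 ultimately show ?thesis using vring_cases by blast
qed

lemma units_mult_maximal_iff:
 assumes V: "is_vring V" and "u \<in> units_of_vring V" shows "x * u \<in> maximal_ideal V \<longleftrightarrow> x \<in> maximal_ideal V"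
proof
 assume "x * u \<in> maximal_ideal V"
 from maximal_mult_right[OF V this units_sub[OF units_inverse[OF assms(2)]]]
 show "x \<in> maximal_ideal V" using units_nonzero[OF assms(2)] by (simp add: mult.assoc)
qed (use maximal_mult_right[OF V] units_sub[OF assms(2)] in auto)

lemma power_in_vring_iff:
 assumes V: "is_vring V" and n: "n > 0" shows "x ^ n \<in> V \<longleftrightarrow> x \<in> V"
proof
 assume x: "x ^ n \<in> V"
 show "x \<in> V"
 proof (rule ccontr)
  assume "x \<notin> V"
  then have i: "inverse x \<in> maximal_ideal V" and x0: "x ~= 0" using not_in_vring[OF V] by auto
  obtain m where m: "n = Suc m" using n by (cases n) auto
  have "inverse x ^ m \<in> V" using i V by (auto simp: maximal_ideal_def dest: vring_subring intro: subring_power)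
  then have "inverse x ^ m * inverse x * x ^ n \<in> maximal_ideal V"
   using maximal_mult[OF V i] maximal_mult_right[OF V _ x] by blast
  moreover have "inverse x ^ m * inverse x * x ^ n = 1"
   using x0 by (simp add: m power_inverse field_simps)
  ultimately show False using one_not_maximal[OF V] by simp
 qed
qed (use V in \<open>auto dest: vring_subring intro: subring_power\<close>)

lemma units_iff: "is_vring V ==> x \<in> units_of_vring V \<longleftrightarrow> x ~= 0 \<and> x \<in> V \<and> inverse x \<in> V"
 by (auto simp: units_of_vring_def)

lemma power_in_units_iff:
 assumes V: "is_vring V" and n: "n > 0" shows "x ^ n \<in> units_of_vring V \<longleftrightarrow> x \<in> units_of_vring V"
 using power_in_vring_iff[OF V n, of x] power_in_vring_iff[OF V n, of "inverse x"] n
 by (auto simp: units_of_vring_def power_inverse)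

lemma power_in_maximal_iff:
 assumes V: "is_vring V" and n: "n > 0" shows "x ^ n \<in> maximal_ideal V \<longleftrightarrow> x \<in> maximal_ideal V"
 using power_in_vring_iff[OF V n, of x] power_in_vring_iff[OF V n, of "inverse x"] n
 by (auto simp: maximal_ideal_def power_inverse)

section \<open>Transporting finitely many valuation conditions to another valued field\<close>

definition is_subfield :: "'a::field set => bool" where
 "is_subfield W \<longleftrightarrow> is_subring W \<and> (\<forall>x\<in>W. inverse x \<in> W)"

lemma subfield_subring: "is_subfield W ==> is_subring W"
 and subfield_inverse: "is_subfield W ==> x \<in> W ==> inverse x \<in> W"
 by (auto simp: is_subfield_def)

lemma subfield_divide: "is_subfield W ==> x \<in> W ==> y \<in> W ==> x / y \<in> W"
 by (simp add: divide_inverse subring_mult subfield_subring subfield_inverse)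

lemma subfield_power_int: "is_subfield W ==> x \<in> W ==> x powi n \<in> W"
 by (auto simp: power_int_def intro: subring_power subfield_subring subfield_inverse)

lemmas subfield_intros = subring_intros[OF subfield_subring] subfield_inverse subfield_divide subfield_power_int

definition rel_closed :: "'a::field set => bool" where
 "rel_closed W \<longleftrightarrow> (\<forall>p\<in>polys_over W. p ~= 0 --> (\<forall>x. poly p x = 0 --> x \<in> W))"

definition field_adjoin :: "'a::field set => 'a => 'a set" where
 "field_adjoin W y = {poly P y / poly Q y | P Q. P \<in> polys_over W \<and> Q \<in> polys_over W}"

lemma phom_injI:
 assumes "phom D hm" "\<And>x. x \<in> D ==> hm x = 0 ==> x = 0" shows "inj_on hm D"
proof (rule inj_onI)
 fix x y assume xy: "x \<in> D" "y \<in> D" "hm x = hm y"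
 then have "hm (x - y) = 0" using assms(1) by (simp add: phom_diff)
 moreover have "x - y \<in> D" by (rule subring_diff[OF phom_subring[OF assms(1)] xy(1,2)])
 ultimately have "x - y = 0" using assms(2) by blast
 then show "x = y" by simp
qed

text \<open>The data of a transport: \<open>V\<close> and \<open>V'\<close> are the valuation rings on both sides, and every partial
  homomorphism has to agree with \<open>\<iota>\<close> on the set \<open>base\<close>. If the flag \<open>J\<close> is set, the homomorphisms are also
  kept injective. For this their images are confined to members of a chain \<open>EE\<close> of relatively closed
  subfields, and there is always a larger member with a fresh element of \<open>V'\<close>.\<close>

locale valued_target =
 fixes V :: "'a::alg_closed_field set" and V' :: "'b::alg_closed_field set"
  and base :: "'a set" and \<iota> :: "'a => 'b" and J :: bool and EE :: "'b set set"
 assumes V: "is_vring V" and V': "is_vring V'"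
  and nat_unit: "\<And>n. n > 0 ==> of_nat n \<in> units_of_vring V'"
  and nontriv: "\<exists>p. p ~= 0 \<and> p \<in> maximal_ideal V' \<and> (J --> (\<forall>E\<in>EE. p \<in> E))"
  and EE_field: "\<And>E. J ==> E \<in> EE ==> is_subfield E \<and> rel_closed E"
  and EE_fresh: "\<And>E. J ==> E \<in> EE ==> \<exists>E'\<in>EE. \<exists>t\<in>E'. E \<subseteq> E' \<and> t \<in> V' \<and> t \<notin> E"
begin

definition target_hom :: "'a set => ('a => 'b) => 'b set => bool" where
 "target_hom D hm E \<longleftrightarrow> local_hom D hm \<and> base \<subseteq> D \<and> (\<forall>b\<in>base. hm b = \<iota> b) \<and>
  (J --> inj_on hm D \<and> E \<in> EE \<and> hm ` D \<subseteq> E)"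

definition agree :: "'a set => ('a => 'b) => bool" where
 "agree S hm \<longleftrightarrow> (\<forall>s\<in>S. s ~= 0 --> hm s ~= 0 \<and> (s \<in> V \<longleftrightarrow> hm s \<in> V'))"

text \<open>Only finitely many elements are transported at a time: this makes the property inductive and allows the
  target to be any nontrivially valued algebraically closed field.\<close>

definition approx :: "'a set => bool" where
 "approx W \<longleftrightarrow> (\<forall>S. finite S --> S \<subseteq> W -->
  (\<exists>D hm E. target_hom D hm E \<and> D \<subseteq> W \<and> S \<subseteq> D \<and> agree S hm))"

lemma target_hom_phom: "target_hom D hm E ==> phom D hm"
 by (simp add: target_hom_def local_hom_def)

lemma target_hom_J: "target_hom D hm E ==> J ==> inj_on hm D \<and> E \<in> EE \<and> hm ` D \<subseteq> E"
 unfolding target_hom_def by blast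

lemma target_hom_inverse:
 assumes "target_hom D hm E" "s \<in> D" "hm s ~= 0" shows "inverse s \<in> D" "hm (inverse s) = inverse (hm s)"
proof -
 show "inverse s \<in> D" using assms by (simp add: target_hom_def local_hom_def)
 then show "hm (inverse s) = inverse (hm s)" using phom_inverse[OF target_hom_phom[OF assms(1)] assms(2)] by blast
qed

lemma target_hom_divide:
 assumes "target_hom D hm E" "s \<in> D" "t \<in> D" "hm s ~= 0" shows "t / s \<in> D" "hm (t / s) = hm t / hm s"
 using target_hom_inverse[OF assms(1,2,4)] assms(3) target_hom_phom[OF assms(1)]
 by (auto simp: divide_inverse phom_mult intro: subring_mult phom_subring)

definition agree_units :: "'a set => ('a => 'b) => bool" where
 "agree_units S hm \<longleftrightarrow> (\<forall>s\<in>S. (s ~= 0 --> hm s ~= 0) \<and> (s \<in> V \<longleftrightarrow> hm s \<in> V') \<and>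
  (s \<in> maximal_ideal V \<longleftrightarrow> hm s \<in> maximal_ideal V') \<and>
  (s \<in> units_of_vring V \<longleftrightarrow> hm s \<in> units_of_vring V'))"

lemma agree_unitsD: "agree_units S hm ==> s \<in> S ==> s ~= 0 ==> hm s ~= 0"
 "agree_units S hm ==> s \<in> S ==> s \<in> V \<longleftrightarrow> hm s \<in> V'"
 "agree_units S hm ==> s \<in> S ==> s \<in> maximal_ideal V \<longleftrightarrow> hm s \<in> maximal_ideal V'"
 "agree_units S hm ==> s \<in> S ==> s \<in> units_of_vring V \<longleftrightarrow> hm s \<in> units_of_vring V'"
 by (simp_all add: agree_units_def)

lemma agree_units_subset: "agree_units S hm ==> S' \<subseteq> S ==> (\<And>s. s \<in> S' ==> hm' s = hm s) ==> agree_units S' hm'"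
 unfolding agree_units_def by fastforce

text \<open>Agreement on a set closed under inverses also transports units and the maximal ideal.\<close>

lemma approxE:
 assumes W: "is_subfield W" and ap: "approx W" and S: "finite S" "S \<subseteq> W"
 obtains D hm E where "target_hom D hm E" "D \<subseteq> W" "S \<subseteq> D" "agree_units S hm"
proof -
 have "finite (S \<union> inverse ` S)" "S \<union> inverse ` S \<subseteq> W" using S W by (auto intro: subfield_intros)
 then have "\<exists>D hm E. target_hom D hm E \<and> D \<subseteq> W \<and> S \<union> inverse ` S \<subseteq> D \<and> agree (S \<union> inverse ` S) hm"
  by (rule ap[unfolded approx_def, rule_format])
 then obtain D hm E where D: "target_hom D hm E" "D \<subseteq> W" "S \<union> inverse ` S \<subseteq> D" "agree (S \<union> inverse ` S) hm"
  by blast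
 note ph = target_hom_phom[OF D(1)]
 have nz: "hm s ~= 0" if "s \<in> S" "s ~= 0" for s using D(4) that by (auto simp: agree_def)
 have z: "s = 0 \<longleftrightarrow> hm s = 0" if "s \<in> S" for s using nz that phom_zero[OF ph] by auto
 have inV: "s \<in> V \<longleftrightarrow> hm s \<in> V'" if "s \<in> S" for s
  using D(4) that phom_zero[OF ph] subring_zero[OF vring_subring[OF V]] subring_zero[OF vring_subring[OF V']]
  by (cases "s = 0") (auto simp: agree_def)
 have inV2: "inverse s \<in> V \<longleftrightarrow> inverse (hm s) \<in> V'" if "s \<in> S" "s ~= 0" for s
 proof -
  have "hm (inverse s) = inverse (hm s)" using target_hom_inverse(2)[OF D(1)] nz that D(3) by blast
  then show ?thesis using D(4) that by (auto simp: agree_def)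
 qed
 have "s \<in> maximal_ideal V \<longleftrightarrow> hm s \<in> maximal_ideal V'" "s \<in> units_of_vring V \<longleftrightarrow> hm s \<in> units_of_vring V'" if "s \<in> S" for s
  using inV[OF that] inV2[OF that] z[OF that] by (auto simp: maximal_ideal_def units_of_vring_def)
 then have "agree_units S hm" using inV nz by (simp add: agree_units_def)
 then show thesis using that[OF D(1,2)] D(3) by blast
qed

text \<open>A transcendental element may be sent anywhere. Injectivity only survives if its image is transcendental over
  the field containing the previous image, which holds as that field is relatively closed.\<close>

lemma extend_transcendental:
 assumes h: "target_hom D hm E" and DW: "D \<subseteq> W"
  and tr: "\<And>p. p \<in> polys_over W ==> p ~= 0 ==> poly p y ~= 0"
  and w: "J ==> E' \<in> EE \<and> E \<subseteq> E' \<and> w \<in> E' \<and> w \<notin> E"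
 obtains D' hm' where "target_hom D' hm' E'" "D \<subseteq> D'" "D' \<subseteq> field_adjoin W y"
  "\<And>d. d \<in> D ==> hm' d = hm d" "y \<in> D'" "hm' y = w"
proof -
 note ph = target_hom_phom[OF h]
 have PW: "p \<in> polys_over W" if "p \<in> polys_over D" for p using polys_over_mono[OF DW] that by blast
 have cond: "ev hm w Q = 0" if "Q \<in> polys_over D" "poly Q y = 0" for Q
  using tr[OF PW[OF that(1)]] that(2) by (cases "Q = 0") auto
 obtain D' hm' where D': "local_hom D' hm'" "D \<subseteq> D'" "\<And>d. d \<in> D ==> hm' d = hm d" "y \<in> D'" "hm' y = w"
  and rep: "\<And>x. x \<in> D' ==> \<exists>P\<in>polys_over D. \<exists>Q\<in>polys_over D. x = poly P y / poly Q y \<and> poly Q y ~= 0 \<and>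
    ev hm w Q ~= 0 \<and> hm' x = ev hm w P / ev hm w Q"
  using local_hom_adjoin[OF ph cond] by blast
 have "inj_on hm' D' \<and> E' \<in> EE \<and> hm' ` D' \<subseteq> E'" if J
 proof (intro conjI)
  have E: "inj_on hm D" "E \<in> EE" "hm ` D \<subseteq> E" using target_hom_J[OF h that] by blast+
  have rc: "rel_closed E" using EE_field[OF that E(2)] by blast
  show E'E: "E' \<in> EE" using w that by blast
  have sf: "is_subfield E'" using EE_field[OF that E'E] by blast
  show "inj_on hm' D'"
  proof (rule phom_injI)
   show "phom D' hm'" using D'(1) by (simp add: local_hom_def)
   fix x assume x: "x \<in> D'" "hm' x = 0"
   obtain P Q where PQ: "P \<in> polys_over D" "x = poly P y / poly Q y" "ev hm w Q ~= 0" "hm' x = ev hm w P / ev hm w Q"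
    using rep[OF x(1)] by blast
   have "poly (map_poly hm P) w = 0" using x(2) PQ by (auto simp: ev_def)
   moreover have "map_poly hm P \<in> polys_over E"
    using PQ(1) E(3) by (auto simp: polys_over_def coeff_map_poly phom_zero[OF ph])
   ultimately have "map_poly hm P = 0" using rc w that unfolding rel_closed_def by blast
   then have "hm (coeff P i) = hm 0" for i
    by (metis coeff_0 coeff_map_poly phom_zero[OF ph])
   moreover have "coeff P i \<in> D" "0 \<in> D" for i
    using PQ(1) by (auto simp: polys_over_def intro: subring_zero phom_subring[OF ph])
   ultimately have "coeff P i = 0" for i using E(1) unfolding inj_on_def by blast
   then have "P = 0" by (simp add: poly_eq_iff)
   then show "x = 0" using PQ by simp
  qed
  have evE: "ev hm w P \<in> E'" if P: "P \<in> polys_over D" for P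
  proof -
   have "hm (coeff P i) \<in> E'" for i using P E(3) w \<open>J\<close> by (auto simp: polys_over_def)
   then show ?thesis unfolding ev_altdef[OF ph] using w \<open>J\<close> sf by (auto intro!: subfield_intros)
  qed
  show "hm' ` D' \<subseteq> E'"
  proof
   fix v assume "v \<in> hm' ` D'"
   then obtain x where x: "x \<in> D'" "v = hm' x" by blast
   obtain P Q where PQ: "P \<in> polys_over D" "Q \<in> polys_over D" "hm' x = ev hm w P / ev hm w Q"
    using rep[OF x(1)] by blast
   then show "v \<in> E'" using evE x by (simp add: subfield_divide[OF sf])
  qed
 qed
 moreover have "base \<subseteq> D'" "\<forall>b\<in>base. hm' b = \<iota> b"
  using h D'(2,3) unfolding target_hom_def by (blast, metis subsetD)
 ultimately have "target_hom D' hm' E'"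
  using D'(1) unfolding target_hom_def by blast
 moreover have "D' \<subseteq> field_adjoin W y"
 proof
  fix x assume "x \<in> D'"
  then show "x \<in> field_adjoin W y" using rep[of x] PW unfolding field_adjoin_def by blast
 qed
 ultimately show thesis using that D' by blast
qed

text \<open>An element may be sent to any root of its transported minimal polynomial. Injectivity is kept because a
  relation of lower degree for the image would divide the transported polynomial, and so come from a
  factorisation of the minimal polynomial.\<close>

lemma extend_algebraic:
 assumes h: "target_hom D hm E" and DW: "D \<subseteq> W"
  and p0: "p0 \<in> polys_over D" "lead_coeff p0 = 1" "poly p0 y = 0"
  and mini: "\<And>p. p \<in> polys_over W ==> p ~= 0 ==> degree p < degree p0 ==> poly p y ~= 0"
  and w: "ev hm w p0 = 0"
 obtains D' hm' where "target_hom D' hm' E" "D \<subseteq> D'" "D' \<subseteq> field_adjoin W y"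
  "\<And>d. d \<in> D ==> hm' d = hm d" "y \<in> D'" "hm' y = w"
proof -
 note ph = target_hom_phom[OF h]
 note D = phom_subring[OF ph]
 note PD = is_subring_polys_over[OF D]
 have PW: "p \<in> polys_over W" if "p \<in> polys_over D" for p using polys_over_mono[OF DW] that by blast
 have cond: "ev hm w Q = 0" if Q: "Q \<in> polys_over D" "poly Q y = 0" for Q
 proof -
  obtain H r where Hr: "H \<in> polys_over D" "r \<in> polys_over D" "Q = p0 * H + r" "r = 0 \<or> degree r < degree p0"
   using polys_over_monic_division[OF D p0(1,2) Q(1)] by blast
  have "poly r y = 0" using Q Hr(3) p0 by simp
  then have "r = 0" using mini[OF PW[OF Hr(2)]] Hr(4) by blast
  then show ?thesis using Hr p0 w ev_mult[OF ph p0(1) Hr(1)] by simp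
 qed
 obtain D' hm' where D': "local_hom D' hm'" "D \<subseteq> D'" "\<And>d. d \<in> D ==> hm' d = hm d" "y \<in> D'" "hm' y = w"
  and rep: "\<And>x. x \<in> D' ==> \<exists>P\<in>polys_over D. \<exists>Q\<in>polys_over D. x = poly P y / poly Q y \<and> poly Q y ~= 0 \<and>
    ev hm w Q ~= 0 \<and> hm' x = ev hm w P / ev hm w Q"
  using local_hom_adjoin[OF ph cond] by blast
 have "inj_on hm' D' \<and> E \<in> EE \<and> hm' ` D' \<subseteq> E" if J
 proof (intro conjI)
  have E: "inj_on hm D" "hm ` D \<subseteq> E" and EE: "E \<in> EE" using target_hom_J[OF h that] by blast+
  show "E \<in> EE" by (rule EE)
  have rc: "rel_closed E" and sf: "is_subfield E" using EE_field[OF that EE] by blast+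
  have inv: "inverse d \<in> D" if "d \<in> D" for d
  proof (cases "hm d = 0")
   case True
   then have "d = 0" using E(1) that phom_zero[OF ph] subring_zero[OF D] unfolding inj_on_def by metis
   then show ?thesis using subring_zero[OF D] by simp
  next
   case False
   then show ?thesis using target_hom_inverse[OF h that] by blast
  qed
  define Z where "Z = {R \<in> polys_over D. R ~= 0 \<and> ev hm w R = 0}"
  have "p0 \<in> Z" using p0 w by (auto simp: Z_def)
  then obtain R where R: "R \<in> Z" and Rmin: "\<And>S. S \<in> Z ==> degree R \<le> degree S"
   using ex_has_least_nat[of "\<lambda>R. R \<in> Z" p0 degree] by blast
  define R1 where "R1 = smult (inverse (lead_coeff R)) R"
  have R0: "R ~= 0" and RP: "R \<in> polys_over D" "ev hm w R = 0" using R by (auto simp: Z_def)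
  have lcD: "inverse (lead_coeff R) \<in> D" using RP by (intro inv) (auto simp: polys_over_def)
  have R1P: "R1 \<in> polys_over D" unfolding R1_def using lcD RP D by (intro polys_over_smult)
  have R1l: "lead_coeff R1 = 1" "degree R1 = degree R" using R0 by (auto simp: R1_def)
  have "R1 = [:inverse (lead_coeff R):] * R" by (simp add: R1_def)
  then have evR1: "ev hm w R1 = 0"
   using ev_mult[OF ph, of "[:inverse (lead_coeff R):]" R w] RP lcD D by (auto intro!: polys_over_intros)
  have dvd: "\<exists>h\<in>polys_over D. S = R1 * h" if S: "S \<in> polys_over D" "ev hm w S = 0" for S
  proof -
   obtain H r where Hr: "H \<in> polys_over D" "r \<in> polys_over D" "S = R1 * H + r" "r = 0 \<or> degree r < degree R1"
    using polys_over_monic_division[OF D R1P R1l(1) S(1)] by blast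
   have "ev hm w S = ev hm w R1 * ev hm w H + ev hm w r"
    unfolding Hr(3) using Hr R1P ev_add[OF ph subring_mult[OF PD R1P Hr(1)] Hr(2)] ev_mult[OF ph R1P Hr(1)] by simp
   then have "ev hm w r = 0" using evR1 S by simp
   then have "r = 0" using Rmin[of r] Hr(2,4) R1l by (cases "r = 0") (auto simp: Z_def)
   then show ?thesis using Hr by auto
  qed
  have R1y: "poly R1 y = 0"
  proof (rule ccontr)
   assume ne: "poly R1 y ~= 0"
   obtain H where H: "H \<in> polys_over D" "p0 = R1 * H" using dvd[OF p0(1) w] by blast
   have Hy: "poly H y = 0" using H p0 ne by simp
   have H0: "H ~= 0" "R1 ~= 0" using H p0(2) by auto
   have "degree R1 > 0"
   proof (rule ccontr)
    assume "\<not> degree R1 > 0"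
    then have d0: "degree R1 = 0" by simp
    obtain a where a: "R1 = [:a:]" using degree_eq_zeroE[OF d0] by blast
    then have "a = 1" using R1l(1) by simp
    then have "R1 = [:1:]" using a by simp
    then show False using evR1 ev_const[OF ph] phom_one[OF ph] by simp
   qed
   then have "degree H < degree p0" using H H0 by (simp add: degree_mult_eq)
   then show False using mini[OF PW[OF H(1)] H0(1)] Hy by blast
  qed
  show "inj_on hm' D'"
  proof (rule phom_injI)
   show "phom D' hm'" using D'(1) by (simp add: local_hom_def)
   fix x assume x: "x \<in> D'" "hm' x = 0"
   obtain P Q where PQ: "P \<in> polys_over D" "x = poly P y / poly Q y" "ev hm w Q ~= 0" "hm' x = ev hm w P / ev hm w Q"
    using rep[OF x(1)] by blast
   then have "ev hm w P = 0" using x by auto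
   then obtain h where "P = R1 * h" using dvd[OF PQ(1)] by blast
   then show "x = 0" using R1y PQ(2) by simp
  qed
  have "w \<in> E"
  proof -
   have "map_poly hm p0 \<in> polys_over E"
    using p0(1) E(2) by (auto simp: polys_over_def coeff_map_poly phom_zero[OF ph])
   moreover have "coeff (map_poly hm p0) (degree p0) = 1"
    using p0 phom_one[OF ph] by (simp add: coeff_map_poly phom_zero[OF ph])
   then have "map_poly hm p0 ~= 0" by auto
   ultimately show ?thesis using rc w unfolding rel_closed_def ev_def by blast
  qed
  then have evE: "ev hm w P \<in> E" if P: "P \<in> polys_over D" for P
  proof -
   have "hm (coeff P i) \<in> E" for i using P E(2) by (auto simp: polys_over_def)
   then show ?thesis unfolding ev_altdef[OF ph] using \<open>w \<in> E\<close> sf by (auto intro!: subfield_intros)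
  qed
  show "hm' ` D' \<subseteq> E"
  proof
   fix v assume "v \<in> hm' ` D'"
   then obtain x where x: "x \<in> D'" "v = hm' x" by blast
   obtain P Q where PQ: "P \<in> polys_over D" "Q \<in> polys_over D" "hm' x = ev hm w P / ev hm w Q"
    using rep[OF x(1)] by blast
   then show "v \<in> E" using evE x by (simp add: subfield_divide[OF sf])
  qed
 qed
 moreover have "base \<subseteq> D'" "\<forall>b\<in>base. hm' b = \<iota> b"
  using h D'(2,3) unfolding target_hom_def by (blast, metis subsetD)
 ultimately have "target_hom D' hm' E"
  using D'(1) unfolding target_hom_def by blast
 moreover have "D' \<subseteq> field_adjoin W y"
 proof
  fix x assume "x \<in> D'"
  then show "x \<in> field_adjoin W y" using rep[of x] PW unfolding field_adjoin_def by blast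
 qed
 ultimately show thesis using that D' by blast
qed

end

section \<open>Generators of least degree\<close>

lemma subring_of_nat: "is_subring A ==> of_nat n \<in> A"
 by (induction n) (auto intro: subring_intros)

lemma vring_finite_min:
 assumes V: "is_vring V" and A: "finite A" "A ~= {}" "0 \<notin> A"
 shows "\<exists>a\<in>A. \<forall>b\<in>A. b / a \<in> V"
 using A
proof (induction A rule: finite_ne_induct)
 case (singleton x)
 then show ?case using subring_one[OF vring_subring[OF V]] by auto
next
 case (insert x A)
 then obtain a where a: "a \<in> A" "\<forall>b\<in>A. b / a \<in> V" by auto
 have one: "1 \<in> V" using subring_one[OF vring_subring[OF V]] .
 have a0: "a ~= 0" "x ~= 0" using a insert by auto
 show ?case
 proof (cases "x / a \<in> V")
  case True
  then show ?thesis using a by (intro bexI[of _ a]) auto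
 next
  case False
  then have ax: "a / x \<in> V" using vring_total[OF V, of "x / a"] by simp
  have "b / x \<in> V" if "b \<in> A" for b
  proof -
   have "(b / a) * (a / x) \<in> V" using a ax that by (intro subring_mult vring_subring V) auto
   then show ?thesis using a0 by simp
  qed
  then show ?thesis using a0 one by (intro bexI[of _ x]) auto
 qed
qed

lemma is_subfield_field_adjoin:
 assumes W: "is_subfield W"
 shows "is_subfield (field_adjoin W y)" "W \<subseteq> field_adjoin W y" "y \<in> field_adjoin W y"
proof -
 note Wr = subfield_subring[OF W]
 note PW = is_subring_polys_over[OF Wr]
 have rep: "\<exists>P Q. P \<in> polys_over W \<and> Q \<in> polys_over W \<and> poly Q y ~= 0 \<and> x = poly P y / poly Q y"
  if x: "x \<in> field_adjoin W y" for x
 proof -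
  obtain P Q where PQ: "P \<in> polys_over W" "Q \<in> polys_over W" "x = poly P y / poly Q y"
   using x unfolding field_adjoin_def by blast
  show ?thesis
  proof (cases "poly Q y = 0")
   case True
   then show ?thesis using PQ subring_zero[OF PW] subring_one[OF PW] by (intro exI[of _ 0] exI[of _ 1]) auto
  qed (use PQ in blast)
 qed
 have inn: "poly P y / poly Q y \<in> field_adjoin W y" if "P \<in> polys_over W" "Q \<in> polys_over W" for P Q
  using that unfolding field_adjoin_def by blast
 have "is_subring (field_adjoin W y)"
 proof (rule is_subringI)
  show "1 \<in> field_adjoin W y" using inn[of 1 1] subring_one[OF PW] by simp
  fix u assume "u \<in> field_adjoin W y"
  then obtain P Q where PQ: "P \<in> polys_over W" "Q \<in> polys_over W" "poly Q y ~= 0" "u = poly P y / poly Q y"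
   using rep by blast
  show "- u \<in> field_adjoin W y" using inn[of "- P" Q] PQ subring_uminus[OF PW] by simp
  fix v assume "v \<in> field_adjoin W y"
  then obtain R S where RS: "R \<in> polys_over W" "S \<in> polys_over W" "poly S y ~= 0" "v = poly R y / poly S y"
   using rep by blast
  have "u + v = poly (P * S + R * Q) y / poly (Q * S) y" using PQ RS by (simp add: add_frac_eq)
  then show "u + v \<in> field_adjoin W y" using PQ RS PW inn[of "P * S + R * Q" "Q * S"]
   by (simp add: subring_add subring_mult)
  have "u * v = poly (P * R) y / poly (Q * S) y" using PQ RS by simp
  then show "u * v \<in> field_adjoin W y" using PQ RS PW inn[of "P * R" "Q * S"]
   by (simp add: subring_add subring_mult)
 qed
 moreover have "inverse u \<in> field_adjoin W y" if u: "u \<in> field_adjoin W y" for u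
 proof -
  obtain P Q where PQ: "P \<in> polys_over W" "Q \<in> polys_over W" "poly Q y ~= 0" "u = poly P y / poly Q y"
   using rep[OF u] by blast
  then show ?thesis using inn[of Q P] by simp
 qed
 ultimately show "is_subfield (field_adjoin W y)" by (simp add: is_subfield_def)
 show "W \<subseteq> field_adjoin W y"
 proof
  fix w assume "w \<in> W"
  then show "w \<in> field_adjoin W y" using inn[of "[:w:]" 1] Wr subring_one[OF PW] by (auto intro!: polys_over_intros)
 qed
 show "y \<in> field_adjoin W y"
  using inn[of "[:0, 1:]" 1] Wr subring_one[OF PW] by (auto intro!: polys_over_intros intro: subring_intros)
qed

text \<open>Either the field is relatively closed (encoded by the zero polynomial), or the generator has the
  least degree among all algebraic elements outside the field.\<close>

definition minimal_gen :: "'a::field set => 'a => 'a poly => bool" where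
 "minimal_gen W z p0 \<longleftrightarrow> z \<notin> W \<and> (if p0 = 0 then rel_closed W else
  p0 \<in> polys_over W \<and> lead_coeff p0 = 1 \<and> poly p0 z = 0 \<and>
  (\<forall>p\<in>polys_over W. p ~= 0 --> degree p < degree p0 --> (\<forall>x. poly p x = 0 --> x \<in> W)))"

lemma minimal_gen_root:
 assumes "minimal_gen W z p0" "p \<in> polys_over W" "p ~= 0" "p0 = 0 \<or> degree p < degree p0" "poly p x = 0"
 shows "x \<in> W"
 using assms unfolding minimal_gen_def rel_closed_def by (auto split: if_splits)

lemma minimal_gen_nz:
 assumes "minimal_gen W z p0" "p \<in> polys_over W" "p ~= 0" "p0 = 0 \<or> degree p < degree p0"
 shows "poly p z ~= 0"
 using minimal_gen_root[OF assms, of z] assms(1) by (auto simp: minimal_gen_def)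

lemma polys_over_pcompose:
 assumes "is_subring W" "p \<in> polys_over W" "q \<in> polys_over W" shows "pcompose p q \<in> polys_over W"
 using assms(2)
proof (induction p)
 case (pCons a p)
 then show ?case using assms(1,3)
  by (auto simp: pcompose_pCons polys_over_pCons_iff intro!: polys_over_intros)
qed (use assms in \<open>auto intro: polys_over_intros\<close>)

text \<open>The least degree depends on the generated field only, so the generator may be moved to a more
  convenient position.\<close>

lemma minimal_gen_affine:
 assumes W: "is_subfield W" and mg: "minimal_gen W y p0" and rw: "r \<in> W" "w \<in> W" "w ~= 0"
 shows "\<exists>p1. minimal_gen W ((y - r) / w) p1"
proof -
 note Wr = subfield_subring[OF W]
 define z where "z = (y - r) / w"
 have y: "y = r + w * z" using rw by (simp add: z_def)
 have zW: "z \<notin> W"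
 proof
  assume "z \<in> W"
  then have "y \<in> W" unfolding y using rw Wr by (auto intro: subring_intros)
  then show False using mg by (simp add: minimal_gen_def)
 qed
 show ?thesis
 proof (cases "p0 = 0")
  case True
  then show ?thesis using mg zW by (intro exI[of _ 0]) (auto simp: minimal_gen_def z_def)
 next
  case False
  let ?q = "[:r, w:]"
  have p0: "p0 \<in> polys_over W" "lead_coeff p0 = 1" "poly p0 y = 0" using mg False by (auto simp: minimal_gen_def)
  have q: "?q \<in> polys_over W" using rw Wr by (auto intro!: polys_over_intros)
  define c where "c = inverse (w ^ degree p0)"
  define p1 where "p1 = smult c (pcompose p0 ?q)"
  have c: "c \<in> W" "c ~= 0" using rw W by (auto simp: c_def intro!: subfield_intros)
  have dq: "degree ?q = 1" using rw by simp
  have "degree p1 = degree p0" using c dq by (simp add: p1_def degree_pcompose)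
  moreover have "lead_coeff p1 = 1"
   using c dq p0 rw lead_coeff_comp[of ?q p0] by (simp add: p1_def c_def lead_coeff_smult)
  moreover have "p1 \<in> polys_over W" unfolding p1_def using c p0 q Wr
   by (intro polys_over_smult polys_over_pcompose)
  moreover have "poly p1 z = 0" using p0 by (simp add: p1_def poly_pcompose y mult.commute)
  moreover have "p1 ~= 0" using calculation(2) by auto
  ultimately have "minimal_gen W z p1" using mg False zW by (auto simp: minimal_gen_def)
  then show ?thesis unfolding z_def by blast
 qed
qed

context valued_target begin

text \<open>Evaluating at a suitable translate of a fresh element by an integer avoids finitely many residues.\<close>

lemma generic_unit:
 assumes B: "finite B" "B \<subseteq> V'" and E: "J ==> E \<in> EE"
 obtains w E' where "w \<in> units_of_vring V'" "\<And>b. b \<in> B ==> w + b \<in> units_of_vring V'"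
  "J ==> E' \<in> EE \<and> E \<subseteq> E' \<and> w \<in> E' \<and> w \<notin> E"
proof -
 have "\<exists>t E'. t \<in> V' \<and> (J --> E' \<in> EE \<and> E \<subseteq> E' \<and> t \<in> E' \<and> t \<notin> E)"
 proof (cases J)
  case True
  then show ?thesis using EE_fresh[OF True E] by blast
 next
  case False
  then show ?thesis using subring_zero[OF vring_subring[OF V']] by blast
 qed
 then obtain t E' where t: "t \<in> V'" "J ==> E' \<in> EE \<and> E \<subseteq> E' \<and> t \<in> E' \<and> t \<notin> E" by blast
 define bad where "bad = (\<lambda>b. {j::nat. t + of_nat j + b \<in> maximal_ideal V'})"
 have "finite (bad b)" for b
 proof (cases "bad b = {}")
  case False
  then obtain i where i: "i \<in> bad b" by blast
  have "bad b \<subseteq> {i}"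
  proof
   fix j assume j: "j \<in> bad b"
   have ab: "of_nat (k - l) \<notin> maximal_ideal V'" if "l < k" for k l :: nat
    using nat_unit[of "k - l"] that by (auto simp: units_of_vring_def maximal_ideal_def)
   have "(t + of_nat j + b) - (t + of_nat i + b) \<in> maximal_ideal V'" "(t + of_nat i + b) - (t + of_nat j + b) \<in> maximal_ideal V'"
    using i j maximal_diff[OF V'] unfolding bad_def by blast+
   then have "of_nat j - of_nat i \<in> maximal_ideal V'" "of_nat i - of_nat j \<in> maximal_ideal V'" by simp_all
   then have "i = j" using ab[of i j] ab[of j i] by (cases i j rule: linorder_cases) (simp_all add: of_nat_diff)
   then show "j \<in> {i}" by simp
  qed
  then show ?thesis using finite_subset by blast
 qed simp
 then have "finite (\<Union>b\<in>insert 0 B. bad b)" using B by auto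
 then obtain j where j: "j \<notin> (\<Union>b\<in>insert 0 B. bad b)" using ex_new_if_finite[OF infinite_UNIV_nat] by blast
 define w where "w = t + of_nat j"
 have wV: "w \<in> V'" unfolding w_def using t V' by (auto intro!: subring_add subring_of_nat vring_subring)
 have un: "w + b \<in> units_of_vring V'" if "b \<in> insert 0 B" for b
 proof -
  have "b \<in> V'" using that B subring_zero[OF vring_subring[OF V']] by auto
  then have "w + b \<in> V'" using wV V' by (auto intro: subring_add vring_subring)
  moreover have "w + b \<notin> maximal_ideal V'" using j that by (auto simp: bad_def w_def)
  ultimately show ?thesis using vring_cases by blast
 qed
 show thesis
 proof (rule that)
  show "w \<in> units_of_vring V'" using un[of 0] by simp
  show "w + b \<in> units_of_vring V'" if "b \<in> B" for b using un that by blast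
  assume J
  then have sf: "is_subfield E" "is_subfield E'"
   using EE_field E t(2) by blast+
  have k: "of_nat j \<in> E" "of_nat j \<in> E'" using sf by (auto intro: subring_of_nat subfield_subring)
  have "w \<in> E'" unfolding w_def using t(2)[OF \<open>J\<close>] k sf by (auto intro: subfield_intros)
  moreover have "w \<notin> E"
  proof
   assume "w \<in> E"
   then have "w - of_nat j \<in> E" using k sf by (intro subring_diff subfield_subring)
   then show False using t(2)[OF \<open>J\<close>] by (simp add: w_def)
  qed
  ultimately show "E' \<in> EE \<and> E \<subseteq> E' \<and> w \<in> E' \<and> w \<notin> E" using t(2)[OF \<open>J\<close>] by blast
 qed
qed

text \<open>Roots outside \<open>V'\<close> contribute, up to the maximal ideal, only to the scalar \<open>\<gamma>\<close>; each root in \<open>V'\<close> is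
  congruent to some \<open>- b\<close>.\<close>

lemma bad_roots_product:
 assumes bad: "\<And>\<rho>. \<rho> \<in># A ==> \<rho> \<notin> V' \<or> (\<exists>b\<in>Bs. b \<in> V' \<and> \<rho> + b \<in> maximal_ideal V')"
 shows "\<exists>\<gamma> xs H. set xs \<subseteq> Bs \<inter> V' \<and> length xs \<le> size A \<and> H \<in> polys_over (maximal_ideal V') \<and>
  (\<Prod>\<rho>\<in>#A. [:- \<rho>, 1:]) = smult \<gamma> ((\<Prod>x\<leftarrow>xs. [:x, 1:]) + H)"
 using bad
proof (induction A)
 case empty
 show ?case using maximal_zero[OF V'] by (intro exI[of _ 1] exI[of _ "[]"] exI[of _ 0]) (auto simp: polys_over_def)
next
 case (add \<rho> A)
 note Vr = vring_subring[OF V']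
 have mul: "P * H \<in> polys_over (maximal_ideal V')" if "P \<in> polys_over V'" "H \<in> polys_over (maximal_ideal V')" for P H
  using that by (auto simp: polys_over_def coeff_mult intro!: maximal_sum[OF V'] maximal_mult[OF V'])
 have add': "P + H \<in> polys_over (maximal_ideal V')" if "P \<in> polys_over (maximal_ideal V')" "H \<in> polys_over (maximal_ideal V')" for P H
  using that by (auto simp: polys_over_def intro!: maximal_add[OF V'])
 have cst: "[:a:] \<in> polys_over (maximal_ideal V')" "[:0, a:] \<in> polys_over (maximal_ideal V')" if "a \<in> maximal_ideal V'" for a
  using that maximal_zero[OF V'] by (auto simp: polys_over_def coeff_pCons split: nat.split)
 have sub: "H \<in> polys_over V'" if "H \<in> polys_over (maximal_ideal V')" for H
  using that maximal_sub by (auto simp: polys_over_def)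
 from add obtain \<gamma> xs H where IH: "set xs \<subseteq> Bs \<inter> V'" "length xs \<le> size A" "H \<in> polys_over (maximal_ideal V')"
  "(\<Prod>\<rho>\<in>#A. [:- \<rho>, 1:]) = smult \<gamma> ((\<Prod>x\<leftarrow>xs. [:x, 1:]) + H)" by auto
 have prodV: "(\<Prod>x\<leftarrow>xs. [:x, 1:]) \<in> polys_over V'"
  using IH(1)
 proof (induction xs)
  case Nil
  then show ?case using subring_one[OF is_subring_polys_over[OF Vr]] by simp
 next
  case (Cons x xs)
  then have "[:x, 1:] \<in> polys_over V'" "(\<Prod>x\<leftarrow>xs. [:x, 1:]) \<in> polys_over V'"
   using Vr by (auto intro!: polys_over_intros intro: subring_intros)
  then show ?case unfolding list.map prod_list.Cons by (rule subring_mult[OF is_subring_polys_over[OF Vr]])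
 qed
 show ?case
 proof (cases "\<rho> \<in> V'")
  case True
  then obtain b where b: "b \<in> Bs" "b \<in> V'" "\<rho> + b \<in> maximal_ideal V'" using add.prems[of \<rho>] by auto
  define \<mu> where "\<mu> = - (\<rho> + b)"
  have mu: "\<mu> \<in> maximal_ideal V'" unfolding \<mu>_def using b maximal_uminus[OF V'] by blast
  have e: "[:- \<rho>, 1:] = [:b, 1:] + [:\<mu>:]" by (simp add: \<mu>_def)
  define H' where "H' = [:b, 1:] * H + ((\<Prod>x\<leftarrow>xs. [:x, 1:]) * [:\<mu>:] + H * [:\<mu>:])"
  have bV: "[:b, 1:] \<in> polys_over V'" using b Vr by (auto intro!: polys_over_intros intro: subring_intros)
  have "H' \<in> polys_over (maximal_ideal V')"
   unfolding H'_def by (intro add' mul bV IH(3) prodV sub[OF IH(3)] cst(1)[OF mu])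
  moreover have "(\<Prod>\<rho>\<in>#add_mset \<rho> A. [:- \<rho>, 1:]) = smult \<gamma> ((\<Prod>x\<leftarrow>b # xs. [:x, 1:]) + H')"
  proof -
   have "(\<Prod>\<rho>\<in>#add_mset \<rho> A. [:- \<rho>, 1:]) = ([:b, 1:] + [:\<mu>:]) * smult \<gamma> ((\<Prod>x\<leftarrow>xs. [:x, 1:]) + H)"
    using IH(4) e by simp
   also have "\<dots> = smult \<gamma> (([:b, 1:] + [:\<mu>:]) * ((\<Prod>x\<leftarrow>xs. [:x, 1:]) + H))"
    by (rule mult_smult_right)
   also have "([:b, 1:] + [:\<mu>:]) * ((\<Prod>x\<leftarrow>xs. [:x, 1:]) + H) = (\<Prod>x\<leftarrow>b # xs. [:x, 1:]) + H'"
    unfolding H'_def by (simp only: list.map prod_list.Cons) (simp only: distrib_left distrib_right ac_simps)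
   finally show ?thesis .
  qed
  ultimately show ?thesis using IH b
   by (intro exI[of _ \<gamma>] exI[of _ "b # xs"] exI[of _ H']) auto
 next
  case False
  then have i: "inverse \<rho> \<in> maximal_ideal V'" "\<rho> ~= 0" using not_in_vring[OF V'] by auto
  have e: "[:- \<rho>, 1:] = smult (- \<rho>) (1 + [:0, - inverse \<rho>:])" using i(2) by (simp add: one_pCons)
  define H' where "H' = H + [:0, - inverse \<rho>:] * ((\<Prod>x\<leftarrow>xs. [:x, 1:]) + H)"
  have mi: "- inverse \<rho> \<in> maximal_ideal V'" using i maximal_uminus[OF V'] by blast
  have "(\<Prod>x\<leftarrow>xs. [:x, 1:]) + H \<in> polys_over V'"
   using prodV sub[OF IH(3)] subring_add[OF is_subring_polys_over[OF Vr]] by blast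
  then have "H' \<in> polys_over (maximal_ideal V')"
   unfolding H'_def by (intro add' IH(3)) (subst mult.commute, intro mul cst mi)
  moreover have "(\<Prod>\<rho>\<in>#add_mset \<rho> A. [:- \<rho>, 1:]) = smult (- \<rho> * \<gamma>) ((\<Prod>x\<leftarrow>xs. [:x, 1:]) + H')"
  proof -
   have "(\<Prod>\<rho>\<in>#add_mset \<rho> A. [:- \<rho>, 1:]) = smult (- \<rho>) (1 + [:0, - inverse \<rho>:]) * smult \<gamma> ((\<Prod>x\<leftarrow>xs. [:x, 1:]) + H)"
    using IH(4) e by simp
   also have "\<dots> = smult (- \<rho> * \<gamma>) ((1 + [:0, - inverse \<rho>:]) * ((\<Prod>x\<leftarrow>xs. [:x, 1:]) + H))"
    by (simp only: mult_smult_left mult_smult_right smult_smult mult.commute[of \<gamma>])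
   also have "(1 + [:0, - inverse \<rho>:]) * ((\<Prod>x\<leftarrow>xs. [:x, 1:]) + H) = (\<Prod>x\<leftarrow>xs. [:x, 1:]) + H'"
    unfolding H'_def by (simp only: distrib_right mult_1_left add.assoc)
   finally show ?thesis .
  qed
  ultimately show ?thesis using IH
   by (intro exI[of _ "- \<rho> * \<gamma>"] exI[of _ xs] exI[of _ H']) auto
 qed
qed

end

section \<open>Adjoining a unit\<close>

context valued_target begin

text \<open>The image of \<open>z\<close> has to be a root of the transported minimal polynomial at which none of the finitely
  many \<open>z + b\<close> loses its invertibility. If all roots were bad, the transported polynomial would be, modulo
  the maximal ideal, a multiple of a product of factors \<open>X + b\<close>. Finitely many coefficients are transported
  faithfully, so the same congruence would hold before transport, and a product of the units \<open>z + b\<close> would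
  lie in the maximal ideal. In the transcendental case any generic unit serves.\<close>

lemma extend_unit:
 assumes W: "is_subfield W" and ap: "approx W" and mg: "minimal_gen W z p0"
  and z: "z \<in> units_of_vring V" and Bs: "finite Bs" "Bs \<subseteq> W"
  and zb: "\<And>b. b \<in> Bs ==> b \<in> V \<and> z + b \<in> units_of_vring V"
  and S: "finite S" "S \<subseteq> W"
 obtains D hm E where "target_hom D hm E" "D \<subseteq> field_adjoin W z" "S \<union> Bs \<subseteq> D" "agree_units S hm" "z \<in> D" "hm z \<in> V'"
  "\<And>b. b \<in> Bs ==> hm z + hm b \<in> units_of_vring V'"
proof (cases "p0 = 0")
 case True
 obtain D hm E where D: "target_hom D hm E" "D \<subseteq> W" "S \<union> Bs \<subseteq> D" "agree_units (S \<union> Bs) hm"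
  using approxE[OF W ap, of "S \<union> Bs"] S Bs by auto
 have "hm ` Bs \<subseteq> V'" using agree_unitsD(2)[OF D(4)] zb by auto
 moreover have "J ==> E \<in> EE" using target_hom_J[OF D(1)] by blast
 ultimately obtain w E' where w: "w \<in> units_of_vring V'" "\<And>b. b \<in> hm ` Bs ==> w + b \<in> units_of_vring V'"
  "J ==> E' \<in> EE \<and> E \<subseteq> E' \<and> w \<in> E' \<and> w \<notin> E"
  using generic_unit[of "hm ` Bs" E] Bs by blast
 have tr: "poly p z ~= 0" if "p \<in> polys_over W" "p ~= 0" for p
  using minimal_gen_nz[OF mg that] True by blast
 obtain D' hm' where D': "target_hom D' hm' E'" "D \<subseteq> D'" "D' \<subseteq> field_adjoin W z"
  "\<And>d. d \<in> D ==> hm' d = hm d" "z \<in> D'" "hm' z = w"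
  using extend_transcendental[OF D(1,2) tr w(3)] by blast
 have e: "hm' s = hm s" if "s \<in> S \<union> Bs" for s using that D(3) D'(4) by blast
 show thesis
 proof (rule that[OF D'(1,3)])
  show "S \<union> Bs \<subseteq> D'" using D D' by blast
  show "agree_units S hm'" by (rule agree_units_subset[OF D(4)]) (auto simp: e)
  show "z \<in> D'" "hm' z \<in> V'" using D' w units_sub by auto
  show "hm' z + hm' b \<in> units_of_vring V'" if "b \<in> Bs" for b using that D' w e by simp
 qed
next
 case False
 note Wr = subfield_subring[OF W] and Vr = vring_subring[OF V] and Vr' = vring_subring[OF V']
 have p0: "p0 \<in> polys_over W" "lead_coeff p0 = 1" "poly p0 z = 0" using mg False by (auto simp: minimal_gen_def)
 let ?N = "degree p0"
 have N0: "?N > 0"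
 proof (rule ccontr)
  assume "\<not> ?N > 0"
  then have d0: "degree p0 = 0" by simp
  obtain a where a: "p0 = [:a:]" using degree_eq_zeroE[OF d0] by blast
  then show False using p0 by simp
 qed
 define Cs where "Cs = {coeff p0 i | i. i \<le> ?N \<and> coeff p0 i ~= 0}"
 have "1 \<in> Cs" unfolding Cs_def using p0(2) by (intro CollectI exI[of _ ?N]) auto
 then have Cs: "finite Cs" "Cs ~= {}" "0 \<notin> Cs" by (auto simp: Cs_def)
 obtain a where a: "a \<in> Cs" "\<forall>b\<in>Cs. b / a \<in> V"
  using vring_finite_min[OF V Cs] by (elim bexE)
 then obtain j0 where j0: "a = coeff p0 j0" "j0 \<le> ?N" "coeff p0 j0 ~= 0" by (auto simp: Cs_def)
 have aV: "coeff p0 i / a \<in> V" for i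
 proof (cases "coeff p0 i = 0")
  case True
  then show ?thesis using subring_zero[OF Vr] by simp
 next
  case False
  then have "i \<le> ?N" by (simp add: le_degree)
  then have "coeff p0 i \<in> Cs" using False by (auto simp: Cs_def)
  then show ?thesis using a(2) by simp
 qed
 have aW: "coeff p0 i \<in> W" for i using p0 by (auto simp: polys_over_def)
 define c where "c = (\<lambda>i. coeff p0 i / a)"
 have cW: "c i \<in> W" for i unfolding c_def using aW j0 W by (auto intro: subfield_intros)
 define Es where "Es = (\<lambda>xs::'a list. (\<Prod>x\<leftarrow>xs. [:x, 1:]))"
 define Ls where "Ls = {xs. set xs \<subseteq> Bs \<and> length xs \<le> ?N}"
 have finL: "finite Ls" unfolding Ls_def by (rule finite_lists_length_le[OF Bs(1)])
 have EsA: "Es xs \<in> polys_over A" if "is_subring A" "set xs \<subseteq> A" for xs A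
  using that(2)
 proof (induction xs)
  case Nil
  then show ?case using subring_one[OF is_subring_polys_over[OF that(1)]] by (simp add: Es_def)
 next
  case (Cons x xs)
  then have "[:x, 1:] \<in> polys_over A" "Es xs \<in> polys_over A"
   using that(1) by (auto intro!: polys_over_intros intro: subring_intros)
  then show ?case unfolding Es_def list.map prod_list.Cons by (rule subring_mult[OF is_subring_polys_over[OF that(1)]])
 qed
 have Esl: "lead_coeff (Es xs) = 1 \<and> degree (Es xs) = length xs" for xs
 proof (induction xs)
  case (Cons x xs)
  have E0: "Es xs ~= 0" using Cons by auto
  have "Es (x # xs) = [:x, 1:] * Es xs" unfolding Es_def by (simp only: list.map prod_list.Cons)
  moreover have "degree ([:x, 1:] * Es xs) = 1 + degree (Es xs)" using E0 by (subst degree_mult_eq) auto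
  moreover have "lead_coeff ([:x, 1:] * Es xs) = lead_coeff (Es xs)" unfolding lead_coeff_mult by simp
  ultimately show ?case using Cons by (metis length_Cons plus_1_eq_Suc)
 qed (simp add: Es_def)
 have Esp: "poly (Es xs) z = (\<Prod>x\<leftarrow>xs. z + x)" for xs
  unfolding Es_def by (induction xs) (auto simp: algebra_simps)
 \<comment> \<open>the coefficients of the normalised \<open>p0\<close> minus those of each candidate product: their values decide the congruence\<close>
 define d where "d = (\<lambda>xs i. c i - c (length xs) * coeff (Es xs) i)"
 have dW: "d xs i \<in> W" if "xs \<in> Ls" for xs i
 proof -
  have "Es xs \<in> polys_over W" using that Bs Wr by (intro EsA) (auto simp: Ls_def)
  then show ?thesis unfolding d_def using cW Wr by (auto simp: polys_over_def intro!: subring_intros)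
 qed
 define S1 where "S1 = S \<union> Bs \<union> (coeff p0 ` {..?N} \<union> c ` {..?N}) \<union> (\<lambda>(xs, i). d xs i) ` (Ls \<times> {..?N})"
 have "finite S1" "S1 \<subseteq> W" unfolding S1_def using S Bs finL cW aW dW by auto
 then obtain D hm E where D: "target_hom D hm E" "D \<subseteq> W" "S1 \<subseteq> D" "agree_units S1 hm"
  using approxE[OF W ap, of S1] by blast
 note ph = target_hom_phom[OF D(1)]
 note Dr = phom_subring[OF ph]
 have coD: "coeff p0 i \<in> D" for i
 proof (cases "i \<le> ?N")
  case True then show ?thesis using D(3) by (auto simp: S1_def)
 next
  case False then show ?thesis using subring_zero[OF Dr] by (simp add: coeff_eq_0)
 qed
 then have p0D: "p0 \<in> polys_over D" by (simp add: polys_over_def)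
 define q where "q = map_poly hm p0"
 have qc: "coeff q i = hm (coeff p0 i)" for i by (simp add: q_def coeff_map_poly phom_zero[OF ph])
 have qN: "coeff q ?N = 1" using p0 phom_one[OF ph] by (simp add: qc)
 have dq: "degree q = ?N"
 proof (rule antisym)
  show "degree q \<le> ?N" by (rule degree_le) (auto simp: qc coeff_eq_0 phom_zero[OF ph])
  show "?N \<le> degree q" using qN by (intro le_degree) auto
 qed
 have q0: "q ~= 0" using qN by auto
 obtain A where A: "size A = degree q" "q = smult (lead_coeff q) (\<Prod>x\<in>#A. [:-x, 1:])"
  using alg_closed_imp_factorization[OF q0] by blast
 have qA: "q = (\<Prod>x\<in>#A. [:-x, 1:])" using A(2) qN dq by simp
 have BsV': "hm b \<in> V'" if "b \<in> Bs" for b using agree_unitsD(2)[OF D(4), of b] zb that by (auto simp: S1_def)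
 have "\<exists>\<rho>. \<rho> \<in># A \<and> \<rho> \<in> V' \<and> (\<forall>b\<in>Bs. \<rho> + hm b \<notin> maximal_ideal V')"
 proof (rule ccontr)
  assume "\<not> ?thesis"
  then have bad: "\<rho> \<notin> V' \<or> (\<exists>b\<in>hm ` Bs. b \<in> V' \<and> \<rho> + b \<in> maximal_ideal V')" if "\<rho> \<in># A" for \<rho>
   using that BsV' by blast
  obtain \<gamma> ys H where g: "set ys \<subseteq> hm ` Bs \<inter> V'" "length ys \<le> size A" "H \<in> polys_over (maximal_ideal V')"
   "q = smult \<gamma> ((\<Prod>x\<leftarrow>ys. [:x, 1:]) + H)"
   using bad_roots_product[of A "hm ` Bs", OF bad] qA by auto
  have "\<exists>xs. set xs \<subseteq> Bs \<and> ys = map hm xs" using g(1)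
  proof (induction ys)
   case (Cons y ys)
   then obtain xs b where "set xs \<subseteq> Bs" "ys = map hm xs" "b \<in> Bs" "y = hm b" by auto
   then show ?case by (intro exI[of _ "b # xs"]) auto
  qed simp
  then obtain xs where xs: "set xs \<subseteq> Bs" "ys = map hm xs" by blast
  have xL: "xs \<in> Ls" using xs g(2) A(1) dq by (auto simp: Ls_def)
  let ?k = "length xs"
  have kN: "?k \<le> ?N" using xL by (auto simp: Ls_def)
  have EsD: "Es xs \<in> polys_over D" if "set xs \<subseteq> Bs" for xs
   using that D(3) by (intro EsA Dr) (auto simp: S1_def)
  have mapE: "map_poly hm (Es xs) = (\<Prod>x\<leftarrow>map hm xs. [:x, 1:])" if "set xs \<subseteq> Bs" for xs
   using that
  proof (induction xs)
   case Nil
   show ?case using phom_one[OF ph] phom_zero[OF ph] by (simp add: Es_def)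
  next
   case (Cons x xs)
   have "[:x, 1:] \<in> polys_over D" using Cons.prems D(3) Dr by (auto simp: S1_def intro!: polys_over_intros intro: subring_intros)
   moreover have "Es xs \<in> polys_over D" using Cons.prems by (intro EsD) auto
   ultimately have "map_poly hm ([:x, 1:] * Es xs) = map_poly hm [:x, 1:] * map_poly hm (Es xs)"
    by (rule map_poly_phom(2)[OF ph])
   moreover have "map_poly hm [:x, 1:] = [:hm x, 1:]"
    using phom_one[OF ph] phom_zero[OF ph] by (simp add: map_poly_pCons)
   moreover have "Es (x # xs) = [:x, 1:] * Es xs" unfolding Es_def by (simp only: list.map prod_list.Cons)
   moreover have "map_poly hm (Es xs) = (\<Prod>x\<leftarrow>map hm xs. [:x, 1:])" using Cons by auto
   ultimately show ?case by (simp only: list.map prod_list.Cons)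
  qed
  have Hc: "coeff H i \<in> maximal_ideal V'" for i using g(3) by (auto simp: polys_over_def)
  have ec: "hm (coeff (Es xs) i) \<in> V'" for i
  proof -
   have "Es xs \<in> polys_over (D \<inter> hm -` V')"
   proof (rule EsA)
    show "is_subring (D \<inter> hm -` V')"
     by (rule is_subringI)
      (auto simp: phom_one[OF ph] phom_add[OF ph] phom_mult[OF ph] phom_uminus[OF ph] intro: subring_intros[OF Dr] subring_intros[OF Vr'])
    show "set xs \<subseteq> D \<inter> hm -` V'" using xs(1) D(3) BsV' by (auto simp: S1_def)
   qed
   then show ?thesis by (auto simp: polys_over_def)
  qed
  have qe: "hm (coeff p0 i) = \<gamma> * (hm (coeff (Es xs) i) + coeff H i)" for i
  proof -
   have "coeff q i = \<gamma> * (coeff (map_poly hm (Es xs)) i + coeff H i)"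
    using g(4) mapE[OF xs(1)] xs(2) by simp
   then show ?thesis by (simp add: qc coeff_map_poly phom_zero[OF ph])
  qed
  have ha: "hm a ~= 0"
   using agree_unitsD(1)[OF D(4), of a] j0 by (auto simp: S1_def)
  define \<gamma>' where "\<gamma>' = \<gamma> / hm a"
  have hc: "hm (c i) = \<gamma>' * (hm (coeff (Es xs) i) + coeff H i)" for i
   using target_hom_divide(2)[OF D(1), of a "coeff p0 i"] coD ha j0 qe[of i] by (simp add: c_def \<gamma>'_def)
  have cV': "hm (c i) \<in> V'" if "i \<le> ?N" for i
   using agree_unitsD(2)[OF D(4), of "c i"] that aV by (auto simp: S1_def c_def)
  have lead: "coeff (Es xs) ?k = 1" using Esl[of xs] by auto
  have u: "1 + coeff H ?k \<in> units_of_vring V'" by (intro units_add_maximal V' units_one Hc)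
  have hk: "hm (c ?k) = \<gamma>' * (1 + coeff H ?k)" using hc[of ?k] lead phom_one[OF ph] by simp
  have gV: "\<gamma>' \<in> V'" using cV'[OF kN] mult_unit_in_vring_iff[OF V' u, of \<gamma>'] hk by simp
  have cD: "c i \<in> D" for i
   using target_hom_divide(1)[OF D(1), of a "coeff p0 i"] coD ha j0 by (simp add: c_def)
  have dm: "d xs i \<in> maximal_ideal V" if i: "i \<le> ?N" for i
  proof -
   have eD: "coeff (Es xs) i \<in> D" using EsD[OF xs(1)] by (auto simp: polys_over_def)
   have "hm (d xs i) = hm (c i) - hm (c ?k) * hm (coeff (Es xs) i)"
    unfolding d_def using cD eD by (simp add: phom_diff[OF ph] phom_mult[OF ph] subring_mult[OF Dr])
   also have "\<dots> = \<gamma>' * (coeff H i - hm (coeff (Es xs) i) * coeff H ?k)"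
    unfolding hk hc[of i] by (simp add: algebra_simps)
   finally have "hm (d xs i) \<in> maximal_ideal V'"
    using gV Hc ec by (auto intro!: maximal_mult[OF V'] maximal_diff[OF V'])
   moreover have "d xs i \<in> S1" unfolding S1_def using xL i by auto
   ultimately show ?thesis using agree_unitsD(3)[OF D(4)] by blast
  qed
  have zV: "z \<in> V" using z units_sub by blast
  have cz: "c i * z ^ i = d xs i * z ^ i + c ?k * (coeff (Es xs) i * z ^ i)" for i
   by (simp add: d_def algebra_simps)
  have a0: "a ~= 0" using j0 by simp
  have "(\<Sum>i\<le>?N. c i * z ^ i) = poly p0 z / a"
   by (simp add: c_def poly_altdef sum_divide_distrib)
  then have "0 = (\<Sum>i\<le>?N. d xs i * z ^ i) + c ?k * (\<Sum>i\<le>?N. coeff (Es xs) i * z ^ i)"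
   using p0 unfolding cz by (simp add: sum.distrib sum_distrib_left)
  moreover have "(\<Sum>i\<le>?N. coeff (Es xs) i * z ^ i) = poly (Es xs) z"
   unfolding poly_altdef using Esl[of xs] kN by (intro sum.mono_neutral_right) (auto simp: coeff_eq_0)
  ultimately have "c ?k * poly (Es xs) z = - (\<Sum>i\<le>?N. d xs i * z ^ i)"
   by (simp add: eq_neg_iff_add_eq_0 add.commute)
  moreover have "(\<Sum>i\<le>?N. d xs i * z ^ i) \<in> maximal_ideal V"
   using dm zV by (intro maximal_sum[OF V] maximal_mult_right[OF V]) (auto intro: subring_power Vr)
  ultimately have "c ?k * poly (Es xs) z \<in> maximal_ideal V" using maximal_uminus[OF V] by simp
  moreover have "poly (Es xs) z \<in> units_of_vring V"
   unfolding Esp using xs(1) by (induction xs) (auto simp: units_one[OF V] zb intro!: units_mult[OF V])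
  ultimately have ck: "c ?k \<in> maximal_ideal V" using units_mult_maximal_iff[OF V] by blast
  have "coeff (Es xs) j0 \<in> V" using EsA[OF Vr, of xs] xs(1) zb by (auto simp: polys_over_def)
  then have "d xs j0 + c ?k * coeff (Es xs) j0 \<in> maximal_ideal V"
   using dm[OF j0(2)] ck by (intro maximal_add[OF V] maximal_mult_right[OF V])
  moreover have "d xs j0 + c ?k * coeff (Es xs) j0 = 1" using a0 j0 by (simp add: d_def c_def)
  ultimately show False using one_not_maximal[OF V] by simp
 qed
 then obtain \<rho> where \<rho>: "\<rho> \<in># A" "\<rho> \<in> V'" "\<And>b. b \<in> Bs ==> \<rho> + hm b \<notin> maximal_ideal V'" by blast
 have "poly q \<rho> = 0" using \<rho>(1) unfolding qA by (auto simp: poly_prod_mset image_iff)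
 then have ev0: "ev hm \<rho> p0 = 0" by (simp add: ev_def q_def)
 have mini: "poly p z ~= 0" if "p \<in> polys_over W" "p ~= 0" "degree p < degree p0" for p
  using minimal_gen_nz[OF mg that(1,2)] that(3) by blast
 obtain D' hm' where D': "target_hom D' hm' E" "D \<subseteq> D'" "D' \<subseteq> field_adjoin W z"
  "\<And>d. d \<in> D ==> hm' d = hm d" "z \<in> D'" "hm' z = \<rho>"
  using extend_algebraic[OF D(1,2) p0D p0(2,3) mini ev0] by blast
 have e: "hm' s = hm s" if "s \<in> S \<union> Bs" for s using that D(3) D'(4) by (auto simp: S1_def)
 show thesis
 proof (rule that[OF D'(1,3)])
  show "S \<union> Bs \<subseteq> D'" using D D' by (auto simp: S1_def)
  show "agree_units S hm'" by (rule agree_units_subset[OF D(4)]) (auto simp: e S1_def)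
  show "z \<in> D'" "hm' z \<in> V'" using D' \<rho> by auto
  show "hm' z + hm' b \<in> units_of_vring V'" if b: "b \<in> Bs" for b
  proof -
   have "\<rho> + hm b \<in> V'" using \<rho>(2) BsV'[OF b] by (rule subring_add[OF Vr'])
   then show ?thesis using \<rho>(3)[OF b] vring_cases D' e b by auto
  qed
 qed
qed

end

section \<open>Adjoining an element with a new value\<close>

text \<open>In a vanishing sum no term can strictly dominate all others.\<close>

lemma sum_zero_two_minimal:
 assumes V: "is_vring V" and K: "finite K" and s: "(\<Sum>i\<in>K. t i) = 0" and m: "m \<in> K" "t m ~= 0"
  and all: "\<And>i. i \<in> K ==> i ~= m ==> t i / t m \<in> maximal_ideal V"
 shows False
proof -
 have "(\<Sum>i\<in>K. t i) = t m + (\<Sum>i\<in>K - {m}. t i)" using K m by (simp add: sum.remove)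
 then have "(\<Sum>i\<in>K - {m}. t i) / t m = - 1" using s m by (simp add: field_simps eq_neg_iff_add_eq_0)
 then have "(\<Sum>i\<in>K - {m}. t i / t m) = - 1" by (simp add: sum_divide_distrib)
 moreover have "(\<Sum>i\<in>K - {m}. t i / t m) \<in> maximal_ideal V" using all by (intro maximal_sum[OF V]) auto
 ultimately have "- (- 1) \<in> maximal_ideal V" using maximal_uminus[OF V] by metis
 then show False using one_not_maximal[OF V] by simp
qed

context valued_target begin

text \<open>The value of \<open>z\<close> differs from all values of \<open>W\<close>; its finitely many comparisons with the elements of
  \<open>G\<close> place it in a gap. The target is algebraically closed, so its values are divisible and there is room in
  the corresponding gap.\<close>

lemma extend_ramified_transcendental:
 assumes W: "is_subfield W" and ap: "approx W" and mg: "minimal_gen W z 0"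
  and now: "\<And>w. w \<in> W ==> w ~= 0 ==> z / w \<notin> units_of_vring V"
  and S: "finite S" "S \<subseteq> W" and G: "finite G" "G \<subseteq> W" "0 \<notin> G"
 obtains D hm E where "target_hom D hm E" "D \<subseteq> field_adjoin W z" "S \<union> G \<subseteq> D" "agree_units S hm" "z \<in> D" "hm z ~= 0"
  "\<And>g k. g \<in> G ==> \<bar>k\<bar> \<le> int n0 ==> g * z powi k \<in> V \<longleftrightarrow> hm g * hm z powi k \<in> V'"
proof -
 note Wr = subfield_subring[OF W] and Vr = vring_subring[OF V] and Vr' = vring_subring[OF V']
 have rc: "rel_closed W" and zW: "z \<notin> W" using mg by (auto simp: minimal_gen_def)
 have z0: "z ~= 0" using zW subring_zero[OF Wr] by auto
 have "\<exists>h. h \<in> W \<and> h ~= 0 \<and> h powi k = inverse g" if g: "g \<in> G" and k: "k ~= 0" for g k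
 proof -
  define n where "n = nat \<bar>k\<bar>"
  define v where "v = (if k > 0 then inverse g else g)"
  have n: "n > 0" using k by (simp add: n_def)
  have v: "v \<in> W" "v ~= 0" using g G W by (auto simp: v_def intro: subfield_intros)
  obtain h where h: "h ^ n = v" using nth_root_exists[OF n] by blast
  have "monom 1 n - [:v:] \<in> polys_over W" using v Wr by (intro polys_over_intros) (auto simp: polys_over_def intro: subring_intros)
  moreover have "coeff (monom 1 n - [:v:]) n = 1" using n by (simp add: coeff_pCons split: nat.split)
  then have "monom 1 n - [:v:] ~= 0" by (metis coeff_0 zero_neq_one)
  moreover have "poly (monom 1 n - [:v:]) h = 0" using h by (simp add: poly_monom)
  ultimately have "h \<in> W" using rc unfolding rel_closed_def by blast
  moreover have "h ~= 0" using h v n by auto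
  moreover have "h powi k = inverse g"
   using h k unfolding n_def v_def by (cases "k > 0") (auto simp: power_int_def power_inverse)
  ultimately show ?thesis by blast
 qed
 then obtain h where h: "\<And>g k. g \<in> G ==> k ~= 0 ==> h g k \<in> W \<and> h g k ~= 0 \<and> h g k powi k = inverse g" by metis
 define H where "H = (\<lambda>(g, k). h g k) ` (G \<times> ({- int n0..int n0} - {0}))"
 have H: "finite H" "H \<subseteq> W" "0 \<notin> H" unfolding H_def using G h by (auto, fastforce)
 have side: "z / x \<in> V \<longleftrightarrow> x / z \<notin> V" if "x \<in> H" for x
 proof -
  have "z / x \<in> V \<or> x / z \<in> V" using vring_total[OF V, of "z / x"] by simp
  moreover have "\<not> (z / x \<in> V \<and> x / z \<in> V)"
   using now[of x] that H z0 by (auto simp: units_iff[OF V])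
  ultimately show ?thesis by blast
 qed
 define L where "L = {x \<in> H. x / z \<in> V}"
 define U where "U = {x \<in> H. z / x \<in> V}"
 have Lm: "l / z \<in> maximal_ideal V" if "l \<in> L" for l using that side[of l] by (auto simp: L_def maximal_ideal_def)
 have LU: "l / u \<in> maximal_ideal V" if "l \<in> L" "u \<in> U" for l u
 proof -
  have "(l / z) * (z / u) \<in> maximal_ideal V" using that Lm by (intro maximal_mult_right[OF V]) (auto simp: U_def)
  then show ?thesis using z0 by simp
 qed
 define S1 where "S1 = S \<union> G \<union> H \<union> (\<lambda>(x, y). x / y) ` (H \<times> H)"
 have S1: "finite S1" "S1 \<subseteq> W" unfolding S1_def using S G H W by (auto intro: subfield_intros)
 obtain D hm E where D: "target_hom D hm E" "D \<subseteq> W" "S1 \<subseteq> D" "agree_units S1 hm"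
  using approxE[OF W ap S1] by blast
 note ph = target_hom_phom[OF D(1)]
 have hn: "hm x ~= 0" if "x \<in> H" for x using agree_unitsD(1)[OF D(4), of x] that H by (auto simp: S1_def)
 have hdiv: "hm (x / y) = hm x / hm y" "x / y \<in> S1" if "x \<in> H" "y \<in> H" for x y
  using target_hom_divide(2)[OF D(1), of y x] that hn[of y] D(3) by (auto simp: S1_def)
 have hLU: "hm l / hm u \<in> maximal_ideal V'" if "l \<in> L" "u \<in> U" for l u
  using LU[OF that] that agree_unitsD(3)[OF D(4), of "l / u"] hdiv[of l u] by (auto simp: L_def U_def)
 have EJ: "E \<in> EE" "hm ` D \<subseteq> E" "is_subfield E" "rel_closed E" if J
  using target_hom_J[OF D(1) that] EE_field that by blast+
 obtain \<pi> where pi: "\<pi> ~= 0" "\<pi> \<in> maximal_ideal V'" "J --> (\<forall>E\<in>EE. \<pi> \<in> E)" using nontriv by blast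
 have "\<exists>w0. w0 ~= 0 \<and> (J --> w0 \<in> E) \<and> (\<forall>l\<in>L. hm l / w0 \<in> maximal_ideal V') \<and> (\<forall>u\<in>U. w0 / hm u \<in> maximal_ideal V')"
 proof -
  have fL: "finite L" "0 \<notin> L" and fU: "finite (inverse ` U)" "0 \<notin> inverse ` U"
   using H by (auto simp: L_def U_def)
  have HE: "hm x \<in> E" if "x \<in> H" J for x
  proof -
   have "x \<in> D" using that D(3) by (auto simp: S1_def)
   then show ?thesis using EJ(2)[OF that(2)] by blast
  qed
  have l0: "\<exists>l0\<in>L. \<forall>l\<in>L. hm l / hm l0 \<in> V'" if Ln: "L ~= {}"
  proof -
   obtain l0 where l0: "l0 \<in> L" "\<forall>b\<in>L. b / l0 \<in> V" using vring_finite_min[OF V fL(1) Ln fL(2)] by (elim bexE)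
   have "hm l / hm l0 \<in> V'" if "l \<in> L" for l
    using l0 that agree_unitsD(2)[OF D(4), of "l / l0"] hdiv[of l l0] by (auto simp: L_def)
   then show ?thesis using l0 by blast
  qed
  have u0: "\<exists>u0\<in>U. \<forall>u\<in>U. hm u0 / hm u \<in> V'" if Un: "U ~= {}"
  proof -
   obtain v where v: "v \<in> inverse ` U" "\<forall>b\<in>inverse ` U. b / v \<in> V"
    using vring_finite_min[OF V fU(1) _ fU(2)] Un by blast
   then obtain u0 where u0: "u0 \<in> U" "v = inverse u0" by blast
   have "hm u0 / hm u \<in> V'" if "u \<in> U" for u
   proof -
    have "inverse u \<in> inverse ` U" using that by (rule imageI)
    from bspec[OF v(2) this] have "inverse u / inverse u0 \<in> V" unfolding u0(2) .
    then have "u0 / u \<in> V" by (simp add: divide_inverse mult.commute)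
    then show ?thesis using u0 that agree_unitsD(2)[OF D(4), of "u0 / u"] hdiv[of u0 u] by (auto simp: U_def)
   qed
   then show ?thesis using u0 by blast
  qed
  have nzL: "hm x ~= 0" if "x \<in> L \<union> U" for x using hn that by (auto simp: L_def U_def)
  consider "L = {}" "U = {}" | "L = {}" "U ~= {}" | "L ~= {}" "U = {}" | "L ~= {}" "U ~= {}" by blast
  then show ?thesis
  proof cases
   case 1
   then show ?thesis using EJ(3) by (intro exI[of _ 1]) (auto intro: subfield_intros)
  next
   case 2
   obtain u0 where u0: "u0 \<in> U" "\<forall>u\<in>U. hm u0 / hm u \<in> V'" using u0[OF 2(2)] by blast
   have "hm u0 * \<pi> / hm u \<in> maximal_ideal V'" if "u \<in> U" for u
    using maximal_mult[OF V' pi(2), of "hm u0 / hm u"] u0 that by simp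
   moreover have "hm u0 * \<pi> \<in> E" if J
    using HE[of u0] pi(3) EJ that u0 by (auto simp: U_def intro!: subfield_intros)
   ultimately show ?thesis using 2 nzL u0 pi by (intro exI[of _ "hm u0 * \<pi>"]) auto
  next
   case 3
   obtain l0 where l0: "l0 \<in> L" "\<forall>l\<in>L. hm l / hm l0 \<in> V'" using l0[OF 3(1)] by blast
   have "hm l / (hm l0 / \<pi>) \<in> maximal_ideal V'" if "l \<in> L" for l
    using maximal_mult[OF V' pi(2), of "hm l / hm l0"] l0 that by simp
   moreover have "hm l0 / \<pi> \<in> E" if J
    using HE[of l0] pi(3) EJ that l0 by (auto simp: L_def intro!: subfield_intros)
   ultimately show ?thesis using 3 nzL l0 pi by (intro exI[of _ "hm l0 / \<pi>"]) auto
  next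
   case 4
   obtain l0 where l0: "l0 \<in> L" "\<forall>l\<in>L. hm l / hm l0 \<in> V'" using l0[OF 4(1)] by blast
   obtain u0 where u0: "u0 \<in> U" "\<forall>u\<in>U. hm u0 / hm u \<in> V'" using u0[OF 4(2)] by blast
   have nz: "hm l0 ~= 0" "hm u0 ~= 0" using nzL l0 u0 by auto
   obtain w0 where w0: "w0 ^ 2 = hm l0 * hm u0" using nth_root_exists[of 2] by auto
   have w00: "w0 ~= 0" using w0 nz by auto
   have m: "hm l0 / hm u0 \<in> maximal_ideal V'" using hLU l0 u0 by blast
   have "(hm l0 / w0) ^ 2 = hm l0 / hm u0" unfolding power_divide w0 using nz by (simp add: power2_eq_square)
   with m have "(hm l0 / w0) ^ 2 \<in> maximal_ideal V'" by (simp only:)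
   then have m1: "hm l0 / w0 \<in> maximal_ideal V'" using power_in_maximal_iff[OF V', of 2] pos2 by blast
   have "(w0 / hm u0) ^ 2 = hm l0 / hm u0" unfolding power_divide w0 using nz by (simp add: power2_eq_square)
   with m have "(w0 / hm u0) ^ 2 \<in> maximal_ideal V'" by (simp only:)
   then have m2: "w0 / hm u0 \<in> maximal_ideal V'" using power_in_maximal_iff[OF V', of 2] pos2 by blast
   have "hm l / w0 \<in> maximal_ideal V'" if "l \<in> L" for l
    using maximal_mult[OF V' m1, of "hm l / hm l0"] l0 that nz by simp
   moreover have "w0 / hm u \<in> maximal_ideal V'" if "u \<in> U" for u
    using maximal_mult[OF V' m2, of "hm u0 / hm u"] u0 that nz by simp
   moreover have "w0 \<in> E" if J
   proof -
    have v: "hm l0 * hm u0 \<in> E" using HE[of l0] HE[of u0] EJ that l0 u0 by (auto simp: L_def U_def intro!: subfield_intros)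
    have "monom 1 2 - [:hm l0 * hm u0:] \<in> polys_over E"
     using v EJ(3)[OF that] by (intro polys_over_intros subfield_subring) (auto simp: polys_over_def intro: subfield_intros)
    moreover have "coeff (monom 1 2 - [:hm l0 * hm u0:]) 2 = 1" by (simp add: coeff_pCons split: nat.split)
    then have "monom 1 2 - [:hm l0 * hm u0:] ~= 0" by (metis coeff_0 zero_neq_one)
    moreover have "poly (monom 1 2 - [:hm l0 * hm u0:]) w0 = 0" using w0 by (simp add: poly_monom)
    ultimately show ?thesis using EJ(4)[OF that] unfolding rel_closed_def by blast
   qed
   ultimately show ?thesis using w00 by (intro exI[of _ w0]) auto
  qed
 qed
 then obtain w0 where w0: "w0 ~= 0" "J ==> w0 \<in> E" "\<And>l. l \<in> L ==> hm l / w0 \<in> maximal_ideal V'"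
  "\<And>u. u \<in> U ==> w0 / hm u \<in> maximal_ideal V'" by blast
 obtain v E' where v: "v \<in> units_of_vring V'" "J ==> E' \<in> EE \<and> E \<subseteq> E' \<and> v \<in> E' \<and> v \<notin> E"
 proof -
  have "J ==> E \<in> EE" by (rule EJ(1))
  then show thesis using that by (rule generic_unit[of "{}" E, OF finite.emptyI empty_subsetI])
 qed
 define w where "w = w0 * v"
 have w_nz: "w ~= 0" using w0 units_nonzero[OF v(1)] by (simp add: w_def)
 have wJ: "E' \<in> EE \<and> E \<subseteq> E' \<and> w \<in> E' \<and> w \<notin> E" if J
 proof -
  have sf': "is_subfield E'" using EE_field v(2) that by blast
  have "w \<in> E'" unfolding w_def using v(2)[OF that] w0(2)[OF that] sf' by (auto intro: subfield_intros)
  moreover have "w \<notin> E"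
  proof
   assume "w \<in> E"
   then have "w / w0 \<in> E" using w0(2)[OF that] EJ(3)[OF that] by (intro subfield_divide)
   then show False using v(2)[OF that] w0(1) by (simp add: w_def)
  qed
  ultimately show ?thesis using v(2)[OF that] by blast
 qed
 have tr: "poly p z ~= 0" if "p \<in> polys_over W" "p ~= 0" for p
  using minimal_gen_nz[OF mg that] by blast
 obtain D' hm' where D': "target_hom D' hm' E'" "D \<subseteq> D'" "D' \<subseteq> field_adjoin W z"
  "\<And>d. d \<in> D ==> hm' d = hm d" "z \<in> D'" "hm' z = w"
  using extend_transcendental[OF D(1,2) tr wJ] by blast
 have e: "hm' s = hm s" if "s \<in> S1" for s using that D(3) D'(4) by blast
 have wl: "hm l / w \<in> maximal_ideal V'" if "l \<in> L" for l
  using maximal_mult_right[OF V' w0(3)[OF that] units_sub[OF units_inverse[OF v(1)]]] by (simp add: w_def divide_inverse inverse_mult_distrib mult.assoc)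
 have wu: "w / hm u \<in> maximal_ideal V'" if "u \<in> U" for u
  using maximal_mult_right[OF V' w0(4)[OF that] units_sub[OF v(1)]] by (simp add: w_def)
 have zx: "z / x \<in> V \<longleftrightarrow> w / hm x \<in> V'" "x / z \<in> V \<longleftrightarrow> hm x / w \<in> V'" if x: "x \<in> H" for x
 proof -
  have nu: "\<not> (w / hm x \<in> maximal_ideal V' \<and> hm x / w \<in> V')" "\<not> (hm x / w \<in> maximal_ideal V' \<and> w / hm x \<in> V')"
   using w_nz hn[OF x] by (auto simp: maximal_ideal_def)
  show "z / x \<in> V \<longleftrightarrow> w / hm x \<in> V'" "x / z \<in> V \<longleftrightarrow> hm x / w \<in> V'"
   using side[OF x] x wl[of x] wu[of x] nu maximal_sub unfolding L_def U_def by blast+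
 qed
 show thesis
 proof (rule that[OF D'(1,3)])
  show "S \<union> G \<subseteq> D'" using D D' by (auto simp: S1_def)
  show "agree_units S hm'" by (rule agree_units_subset[OF D(4)]) (auto simp: e S1_def)
  show "z \<in> D'" "hm' z ~= 0" using D' w_nz by auto
  fix g k assume g: "g \<in> G" and k: "\<bar>k\<bar> \<le> int n0"
  have hg: "hm' g = hm g" using e g by (simp add: S1_def)
  have gV: "g \<in> V \<longleftrightarrow> hm g \<in> V'" using agree_unitsD(2)[OF D(4), of g] g by (simp add: S1_def)
  show "g * z powi k \<in> V \<longleftrightarrow> hm' g * hm' z powi k \<in> V'"
  proof (cases "k = 0")
   case True
   then show ?thesis using gV hg by simp
  next
   case False
   let ?h = "h g k"
   have hH: "?h \<in> H" unfolding H_def using g k False by (intro image_eqI[of _ _ "(g, k)"]) auto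
   have hh: "?h ~= 0" "?h powi k = inverse g" "?h \<in> W" using h[OF g False] by auto
   have g1: "g = inverse (?h powi k)" using hh by simp
   have hD: "?h \<in> D" "inverse ?h \<in> D" "hm (inverse ?h) = inverse (hm ?h)"
    using hH D(3) target_hom_inverse[OF D(1), of ?h] hn by (auto simp: S1_def)
   have "hm (?h powi k) = hm ?h powi k"
    using hD phom_power[OF ph] by (auto simp: power_int_def)
   moreover have "?h powi k \<in> D" using hD subring_power[OF phom_subring[OF ph]] by (auto simp: power_int_def)
   moreover have "hm (?h powi k) ~= 0" using hn[OF hH] calculation by simp
   ultimately have g2: "hm g = inverse (hm ?h powi k)"
    using target_hom_inverse(2)[OF D(1), of "?h powi k"] g1 by metis
   have a: "g * z powi k = (z / ?h) powi k" by (subst g1) (simp add: divide_inverse power_int_mult_distrib power_int_inverse mult.commute)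
   have b: "hm g * w powi k = (w / hm ?h) powi k" by (subst g2) (simp add: divide_inverse power_int_mult_distrib power_int_inverse mult.commute)
   show ?thesis
   proof (cases "k > 0")
    case True
    then obtain n where n: "k = int n" "n > 0" using zero_less_imp_eq_int by blast
    show ?thesis unfolding hg D'(6) a b using power_in_vring_iff[OF V n(2)] power_in_vring_iff[OF V' n(2)] zx(1)[OF hH] n(1)
     by simp
   next
    case F: False
    then obtain n where n: "k = - int n" "n > 0" using False by (metis int_cases2 neq0_conv of_nat_0 of_nat_0_less_iff minus_zero)
    have "(z / ?h) powi k = (?h / z) ^ n" "(w / hm ?h) powi k = (hm ?h / w) ^ n"
     using n(1) by (simp_all add: power_int_minus power_inverse[symmetric])
    then show ?thesis unfolding hg D'(6) a b using power_in_vring_iff[OF V n(2)] power_in_vring_iff[OF V' n(2)] zx(2)[OF hH]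
     by simp
   qed
  qed
 qed
qed

end

context valued_target begin

text \<open>Two terms of the minimal polynomial at \<open>z\<close> must have the same value, and minimality of the degree
  together with \<open>now\<close> leaves only the extreme ones. So a power of \<open>z\<close> has a value in \<open>W\<close>, which
  every root of the transported polynomial inherits, and this determines all comparisons.\<close>

lemma extend_ramified_algebraic:
 assumes W: "is_subfield W" and ap: "approx W" and mg: "minimal_gen W z p0" and p00: "p0 ~= 0"
  and now: "\<And>w. w \<in> W ==> w ~= 0 ==> z / w \<notin> units_of_vring V"
  and S: "finite S" "S \<subseteq> W" and G: "finite G" "G \<subseteq> W" "0 \<notin> G"
 obtains D hm E where "target_hom D hm E" "D \<subseteq> field_adjoin W z" "S \<union> G \<subseteq> D" "agree_units S hm" "z \<in> D" "hm z ~= 0"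
  "\<And>g k. g \<in> G ==> \<bar>k\<bar> \<le> int n0 ==> g * z powi k \<in> V \<longleftrightarrow> hm g * hm z powi k \<in> V'"
proof -
 note Wr = subfield_subring[OF W] and Vr = vring_subring[OF V] and Vr' = vring_subring[OF V']
 have p0: "p0 \<in> polys_over W" "lead_coeff p0 = 1" "poly p0 z = 0" and zW: "z \<notin> W"
  using mg p00 by (auto simp: minimal_gen_def)
 have z0: "z ~= 0" using zW subring_zero[OF Wr] by auto
 define N where "N = degree p0"
 define c where "c = coeff p0"
 have cN: "c N = 1" using p0 by (simp add: c_def N_def)
 have cW: "c i \<in> W" for i using p0 by (auto simp: polys_over_def c_def)
 have N0: "N > 0"
 proof (rule ccontr)
  assume "\<not> N > 0"
  then have d0: "degree p0 = 0" by (simp add: N_def)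
  obtain a where a: "p0 = [:a:]" using degree_eq_zeroE[OF d0] by blast
  then show False using p0 by simp
 qed
 have sum0: "(\<Sum>i\<le>N. c i * z ^ i) = 0" using p0 by (simp add: poly_altdef c_def N_def)
 have c0: "c 0 ~= 0"
 proof
  assume h: "c 0 = 0"
  obtain a q where q: "p0 = pCons a q" by (cases p0)
  have a0: "a = 0" using h q by (simp add: c_def)
  have qW: "q \<in> polys_over W" using p0(1) q polys_over_pCons_iff by auto
  have q0: "q ~= 0" using p00 q a0 by auto
  have "degree q < degree p0" using q q0 by simp
  then have "poly q z ~= 0" using minimal_gen_nz[OF mg qW q0] by blast
  then show False using p0(3) q a0 z0 by simp
 qed
 define t where "t = (\<lambda>i. c i * z ^ i)"
 have nounit: "t j / t i \<notin> units_of_vring V" if ij: "i < j" "j \<le> N" "c i ~= 0" "c j ~= 0" "\<not> (i = 0 \<and> j = N)" for i j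
 proof
  assume u: "t j / t i \<in> units_of_vring V"
  define d where "d = j - i"
  have d: "d > 0" "d < N" using ij by (auto simp: d_def)
  define a where "a = c i / c j"
  have a: "a \<in> W" "a ~= 0" using cW ij W by (auto simp: a_def intro: subfield_intros)
  obtain h where h: "h ^ d = a" using nth_root_exists[OF d(1)] by blast
  have P: "monom 1 d - [:a:] \<in> polys_over W" using a Wr
   by (intro polys_over_intros) (auto simp: polys_over_def intro: subring_intros)
  have cd: "coeff (monom 1 d - [:a:]) d = 1" using d by (simp add: coeff_pCons split: nat.split)
  then have P0: "monom 1 d - [:a:] ~= 0" by (metis coeff_0 zero_neq_one)
  have dg: "degree (monom 1 d - [:a:]) < degree p0"
   using d(2) unfolding N_def[symmetric] by (intro degree_diff_less) (auto intro: le_less_trans[OF degree_monom_le])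
  have "poly (monom 1 d - [:a:]) h = 0" using h by (simp add: poly_monom)
  then have hW: "h \<in> W" using minimal_gen_root[OF mg P P0] dg by blast
  have h0: "h ~= 0" using h a d by auto
  have "z ^ j = z ^ i * z ^ d" using ij by (simp add: d_def flip: power_add)
  then have "t j / t i = (z / h) ^ d" using h z0 ij by (simp add: t_def a_def power_divide)
  then have "z / h \<in> units_of_vring V" using u power_in_units_iff[OF V d(1)] by simp
  then show False using now[OF hW h0] by blast
 qed
 define T where "T = {i. i \<le> N \<and> c i ~= 0}"
 have T: "finite T" "0 \<in> T" "N \<in> T" using c0 cN by (auto simp: T_def)
 have tn: "t i ~= 0" if "i \<in> T" for i using that z0 by (simp add: T_def t_def)
 have tT3: "0 \<notin> t ` T"
 proof
  assume "0 \<in> t ` T"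
  then obtain i where "i \<in> T" "0 = t i" by (elim imageE)
  then show False using tn[of i] by simp
 qed
 have tT: "finite (t ` T)" "t ` T ~= {}" using T by auto
 obtain x where x: "x \<in> t ` T" "\<forall>b\<in>t ` T. b / x \<in> V"
  using vring_finite_min[OF V tT tT3] by (elim bexE)
 then obtain m where m: "m \<in> T" "\<And>i. i \<in> T ==> t i / t m \<in> V" by auto
 have sumT: "(\<Sum>i\<in>T. t i) = 0"
 proof -
  have "(\<Sum>i\<in>T. t i) = (\<Sum>i\<le>N. t i)" by (rule sum.mono_neutral_left) (auto simp: T_def t_def)
  then show ?thesis using sum0 by (simp add: t_def)
 qed
 have "\<exists>i\<in>T. i ~= m \<and> t i / t m \<notin> maximal_ideal V"
  using sum_zero_two_minimal[OF V T(1) sumT m(1) tn[OF m(1)]] by blast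
 then obtain i where i: "i \<in> T" "i ~= m" "t i / t m \<in> units_of_vring V" using m(2) vring_cases by blast
 have im: "{i, m} = {0, N}"
 proof (cases "i < m")
  case True
  have "t m / t i \<in> units_of_vring V" using units_inverse[OF i(3)] by simp
  then have "i = 0 \<and> m = N" using nounit[of i m] True i(1) m(1) unfolding T_def mem_Collect_eq by blast
  then show ?thesis by auto
 next
  case False
  then have "m < i" using i(2) by simp
  then have "m = 0 \<and> i = N" using nounit[of m i] i m(1) unfolding T_def mem_Collect_eq by blast
  then show ?thesis by auto
 qed
 have uN: "t N / t 0 \<in> units_of_vring V"
  using im i(3) units_inverse[OF i(3)] N0 by (auto simp: doubleton_eq_iff)
 then have zN: "z ^ N / c 0 \<in> units_of_vring V" using cN by (simp add: t_def)
 have mid: "t j / t 0 \<in> maximal_ideal V" if j: "j \<in> T" "0 < j" "j < N" for j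
 proof -
  have "t j / t m \<in> V" using m(2) j by blast
  moreover have "t m / t 0 \<in> units_of_vring V"
   using im uN units_one[OF V] tn[OF T(2)] by (auto simp: doubleton_eq_iff)
  ultimately have "t j / t m * (t m / t 0) \<in> V" using mult_unit_in_vring_iff[OF V] by blast
  then have "t j / t 0 \<in> V" using tn[OF m(1)] by simp
  moreover have "t j / t 0 \<notin> units_of_vring V" using nounit[of 0 j] j c0 by (auto simp: T_def)
  ultimately show ?thesis using vring_cases by blast
 qed
 have midc: "c j ^ N / c 0 ^ (N - j) \<in> maximal_ideal V" if j: "0 < j" "j < N" for j
 proof (cases "c j = 0")
  case True
  then show ?thesis using maximal_zero[OF V] N0 by (simp add: zero_power)
 next
  case False
  then have "t j / t 0 \<in> maximal_ideal V" using mid[of j] j by (auto simp: T_def)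
  then have tjN: "(t j / t 0) ^ N \<in> maximal_ideal V" using power_in_maximal_iff[OF V N0] by blast
  have "(z ^ j) ^ N = (z ^ N) ^ j" by (simp add: mult.commute flip: power_mult)
  moreover have "c 0 ^ N = c 0 ^ (N - j) * c 0 ^ j" using j by (simp flip: power_add)
  ultimately have "(t j / t 0) ^ N = c j ^ N / c 0 ^ (N - j) * (z ^ N / c 0) ^ j"
   by (simp add: t_def power_divide power_mult_distrib)
  then show ?thesis using tjN units_mult_maximal_iff[OF V units_power[OF V zN]] by metis
 qed
 define S1 where "S1 = S \<union> G \<union> c ` {..N} \<union> (\<lambda>j. c j ^ N / c 0 ^ (N - j)) ` {..N} \<union>
  (\<lambda>(g, k). g ^ N * c 0 powi k) ` (G \<times> {- int n0..int n0})"
 have S1: "finite S1" "S1 \<subseteq> W" unfolding S1_def using S G cW W by (auto intro!: subfield_intros)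
 obtain D hm E where D: "target_hom D hm E" "D \<subseteq> W" "S1 \<subseteq> D" "agree_units S1 hm"
  using approxE[OF W ap S1] by blast
 note ph = target_hom_phom[OF D(1)]
 note Dr = phom_subring[OF ph]
 have cD: "c i \<in> D" for i
 proof (cases "i \<le> N")
  case True then show ?thesis using D(3) by (auto simp: S1_def)
 next
  case False then show ?thesis using subring_zero[OF Dr] by (simp add: coeff_eq_0 c_def N_def)
 qed
 then have p0D: "p0 \<in> polys_over D" by (simp add: polys_over_def c_def)
 have hc0: "hm (c 0) ~= 0" using agree_unitsD(1)[OF D(4), of "c 0"] c0 by (auto simp: S1_def)
 define q where "q = map_poly hm p0"
 have qc: "coeff q i = hm (c i)" for i by (simp add: q_def c_def coeff_map_poly phom_zero[OF ph])
 have "degree q \<ge> N" using cN phom_one[OF ph] by (intro le_degree) (simp add: qc)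
 then obtain \<rho> where "poly q \<rho> = 0" using alg_closed_imp_poly_has_root[of q] N0 by auto
 then have ev0: "ev hm \<rho> p0 = 0" by (simp add: ev_def q_def)
 define \<tau> where "\<tau> = (\<lambda>i. hm (c i) * \<rho> ^ i)"
 have tau0: "(\<Sum>i\<le>N. \<tau> i) = 0" using ev0 ev_altdef[OF ph, of \<rho> p0] by (simp add: \<tau>_def c_def N_def)
 have midh: "hm (c j) ^ N / hm (c 0) ^ (N - j) \<in> maximal_ideal V'" if j: "0 < j" "j < N" for j
 proof -
  have "c 0 ^ (N - j) \<in> D" "c j ^ N \<in> D" using subring_power[OF Dr cD] by auto
  moreover have "hm (c 0 ^ (N - j)) ~= 0" using hc0 phom_power[OF ph cD] by simp
  ultimately have "hm (c j ^ N / c 0 ^ (N - j)) = hm (c j) ^ N / hm (c 0) ^ (N - j)"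
   using target_hom_divide(2)[OF D(1)] phom_power[OF ph cD] by simp
  moreover have "c j ^ N / c 0 ^ (N - j) \<in> S1" using j by (auto simp: S1_def)
  ultimately show ?thesis using agree_unitsD(3)[OF D(4)] midc[OF j] by metis
 qed
 define r where "r = \<rho> ^ N / hm (c 0)"
 have r: "r \<in> units_of_vring V'"
 proof (rule ccontr)
  assume nr: "r \<notin> units_of_vring V'"
  have "r \<in> maximal_ideal V' \<or> inverse r \<in> maximal_ideal V' \<and> r ~= 0"
   using nr vring_cases not_in_vring[OF V'] by metis
  then show False
  proof
   assume rm: "r \<in> maximal_ideal V'"
   show False
   proof (rule sum_zero_two_minimal[OF V' _ tau0])
    show "finite {..N}" "0 \<in> {..N}" "\<tau> 0 ~= 0" using hc0 by (auto simp: \<tau>_def)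
    fix j assume j: "j \<in> {..N}" "j ~= 0"
    show "\<tau> j / \<tau> 0 \<in> maximal_ideal V'"
    proof (cases "j = N")
     case True
     then show ?thesis using rm cN phom_one[OF ph] by (simp add: \<tau>_def r_def)
    next
     case False
     then have j': "0 < j" "j < N" using j by auto
     have "(\<rho> ^ j) ^ N = (\<rho> ^ N) ^ j" by (simp add: mult.commute flip: power_mult)
     moreover have "hm (c 0) ^ N = hm (c 0) ^ (N - j) * hm (c 0) ^ j" using j' by (simp flip: power_add)
     ultimately have "(\<tau> j / \<tau> 0) ^ N = hm (c j) ^ N / hm (c 0) ^ (N - j) * r ^ j"
      by (simp add: \<tau>_def r_def power_divide power_mult_distrib)
     moreover have "hm (c j) ^ N / hm (c 0) ^ (N - j) * r ^ j \<in> maximal_ideal V'"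
      using midh[OF j'] maximal_sub[OF rm] by (intro maximal_mult_right[OF V'] subring_power[OF Vr'])
     ultimately show ?thesis using power_in_maximal_iff[OF V' N0] by metis
    qed
   qed
  next
   assume rm: "inverse r \<in> maximal_ideal V' \<and> r ~= 0"
   then have rho0: "\<rho> ~= 0" using N0 by (auto simp: r_def)
   have tN: "\<tau> N = \<rho> ^ N" using cN phom_one[OF ph] by (simp add: \<tau>_def)
   show False
   proof (rule sum_zero_two_minimal[OF V' _ tau0])
    show "finite {..N}" "N \<in> {..N}" "\<tau> N ~= 0" using tN rho0 by auto
    fix j assume j: "j \<in> {..N}" "j ~= N"
    show "\<tau> j / \<tau> N \<in> maximal_ideal V'"
    proof (cases "j = 0")
     case True
     have "\<tau> j / \<tau> N = inverse r" unfolding tN using True by (simp add: \<tau>_def r_def)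
     then show ?thesis using rm by simp
    next
     case False
     then have j': "0 < j" "j < N" using j by auto
     have "(\<rho> ^ N) ^ N = (\<rho> ^ N) ^ (N - j) * (\<rho> ^ N) ^ j" using j' by (simp flip: power_add)
     moreover have "(\<rho> ^ j) ^ N = (\<rho> ^ N) ^ j" by (simp add: mult.commute flip: power_mult)
     ultimately have "(\<tau> j / \<tau> N) ^ N = hm (c j) ^ N / hm (c 0) ^ (N - j) * inverse r ^ (N - j)"
      using rho0 hc0 unfolding tN by (simp add: \<tau>_def r_def power_divide power_mult_distrib)
     moreover have "hm (c j) ^ N / hm (c 0) ^ (N - j) * inverse r ^ (N - j) \<in> maximal_ideal V'"
      using midh[OF j'] rm maximal_sub by (intro maximal_mult_right[OF V'] subring_power[OF Vr']) auto
     ultimately show ?thesis using power_in_maximal_iff[OF V' N0] by metis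
    qed
   qed
  qed
 qed
 have rho0: "\<rho> ~= 0" using units_nonzero[OF r] N0 by (auto simp: r_def)
 have mini: "poly p z ~= 0" if "p \<in> polys_over W" "p ~= 0" "degree p < degree p0" for p
  using minimal_gen_nz[OF mg that(1,2)] that(3) by blast
 obtain D' hm' where D': "target_hom D' hm' E" "D \<subseteq> D'" "D' \<subseteq> field_adjoin W z"
  "\<And>d. d \<in> D ==> hm' d = hm d" "z \<in> D'" "hm' z = \<rho>"
  using extend_algebraic[OF D(1,2) p0D p0(2,3) mini ev0] by blast
 have e: "hm' s = hm s" if "s \<in> S1" for s using that D(3) D'(4) by blast
 show thesis
 proof (rule that[OF D'(1,3)])
  show "S \<union> G \<subseteq> D'" using D D' by (auto simp: S1_def)
  show "agree_units S hm'" by (rule agree_units_subset[OF D(4)]) (auto simp: e S1_def)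
  show "z \<in> D'" "hm' z ~= 0" using D' rho0 by auto
  fix g k assume g: "g \<in> G" and k: "\<bar>k\<bar> \<le> int n0"
  have gS: "g \<in> S1" and gkS: "g ^ N * c 0 powi k \<in> S1"
   unfolding S1_def using g k by (blast, intro UnI2 image_eqI[of _ _ "(g, k)"]) auto
  have hg: "hm' g = hm g" using e gS by simp
  have gD: "g \<in> D" using gS D(3) by blast
  have pw: "(x powi k) ^ N = (x ^ N) powi k" for x :: "'x::field"
   by (metis power_int_mult power_int_of_nat mult.commute)
  have "(g * z powi k) ^ N = g ^ N * c 0 powi k * (z ^ N / c 0) powi k"
   using c0 by (simp add: power_mult_distrib pw power_int_divide_distrib)
  then have a: "g * z powi k \<in> V \<longleftrightarrow> g ^ N * c 0 powi k \<in> V"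
   using power_in_vring_iff[OF V N0, of "g * z powi k"] mult_unit_in_vring_iff[OF V units_power_int[OF V zN]] by metis
  have "(hm g * \<rho> powi k) ^ N = hm g ^ N * hm (c 0) powi k * r powi k"
   using hc0 by (simp add: power_mult_distrib pw power_int_divide_distrib r_def)
  then have b: "hm g * \<rho> powi k \<in> V' \<longleftrightarrow> hm g ^ N * hm (c 0) powi k \<in> V'"
   using power_in_vring_iff[OF V' N0, of "hm g * \<rho> powi k"] mult_unit_in_vring_iff[OF V' units_power_int[OF V' r]] by metis
  have ci: "inverse (c 0) \<in> D" "hm (inverse (c 0)) = inverse (hm (c 0))" using target_hom_inverse[OF D(1) cD hc0] by auto
  have "c 0 powi k \<in> D" "hm (c 0 powi k) = hm (c 0) powi k"
   using ci cD phom_power[OF ph] subring_power[OF Dr] by (auto simp: power_int_def)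
  then have "hm (g ^ N * c 0 powi k) = hm g ^ N * hm (c 0) powi k"
   using gD phom_mult[OF ph] phom_power[OF ph] subring_power[OF Dr] by simp
  then have cc: "g ^ N * c 0 powi k \<in> V \<longleftrightarrow> hm g ^ N * hm (c 0) powi k \<in> V'"
   using agree_unitsD(2)[OF D(4) gkS] by simp
  show "g * z powi k \<in> V \<longleftrightarrow> hm' g * hm' z powi k \<in> V'" unfolding hg D'(6) a b cc ..
 qed
qed

end

section \<open>The transport theorem\<close>

lemma poly_linear_factors:
 fixes p :: "'a::alg_closed_field poly"
 assumes mg: "minimal_gen W y p0" and p: "p \<in> polys_over W" "p ~= 0" "p0 = 0 \<or> degree p < degree p0"
 shows "\<exists>c A. c \<in> W \<and> c ~= 0 \<and> set_mset A \<subseteq> W \<and> poly p y = c * (\<Prod>x\<in>#A. y - x)"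
proof -
 obtain A where A: "p = smult (lead_coeff p) (\<Prod>x\<in>#A. [:-x, 1:])"
  using alg_closed_imp_factorization[OF p(2)] by blast
 have "x \<in> W" if x: "x \<in># A" for x
 proof -
  have "poly p x = 0" by (subst A) (use x in \<open>auto simp: poly_prod_mset image_iff\<close>)
  then show ?thesis by (rule minimal_gen_root[OF mg p])
 qed
 moreover have "poly p y = lead_coeff p * (\<Prod>x\<in>#A. y - x)"
  by (subst A) (simp add: poly_prod_mset)
 moreover have "lead_coeff p \<in> W" "lead_coeff p ~= 0" using p by (auto simp: polys_over_def)
 ultimately show ?thesis by blast
qed

text \<open>Polynomials of degree less than the least degree have all their roots in \<open>W\<close>.\<close>

lemma field_adjoin_linear_factors:
 fixes y :: "'a::alg_closed_field"
 assumes W: "is_subfield W" and mg: "minimal_gen W y p0" and s: "s \<in> field_adjoin W y" "s ~= 0"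
 shows "\<exists>c A B. c \<in> W \<and> c ~= 0 \<and> set_mset A \<subseteq> W \<and> set_mset B \<subseteq> W \<and>
  s = c * (\<Prod>x\<in>#A. y - x) / (\<Prod>x\<in>#B. y - x)"
proof -
 have fac: "\<exists>c A. c \<in> W \<and> c ~= 0 \<and> set_mset A \<subseteq> W \<and> poly p y = c * (\<Prod>x\<in>#A. y - x)"
  if p: "p \<in> polys_over W" "poly p y ~= 0" for p
 proof (cases "p0 = 0")
  case True
  have "p ~= 0" using p(2) by auto
  then show ?thesis using poly_linear_factors[OF mg p(1)] True by blast
 next
  case False
  then have p0: "p0 \<in> polys_over W" "lead_coeff p0 = 1" "poly p0 y = 0" using mg by (auto simp: minimal_gen_def)
  obtain h r where hr: "r \<in> polys_over W" "p = p0 * h + r" "r = 0 \<or> degree r < degree p0"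
   using polys_over_monic_division[OF subfield_subring[OF W] p0(1,2) p(1)] by blast
  have e: "poly p y = poly r y" using hr p0 by simp
  then have r0: "r ~= 0" using p by auto
  then have dr: "degree r < degree p0" using hr by blast
  show ?thesis using poly_linear_factors[OF mg hr(1) r0] dr e by simp
 qed
 obtain P Q where PQ: "P \<in> polys_over W" "Q \<in> polys_over W" "s = poly P y / poly Q y"
  using s(1) unfolding field_adjoin_def by blast
 then have nz: "poly P y ~= 0" "poly Q y ~= 0" using s(2) by auto
 obtain c A where c: "c \<in> W" "c ~= 0" "set_mset A \<subseteq> W" "poly P y = c * (\<Prod>x\<in>#A. y - x)" using fac[OF PQ(1) nz(1)] by blast
 obtain d B where d: "d \<in> W" "d ~= 0" "set_mset B \<subseteq> W" "poly Q y = d * (\<Prod>x\<in>#B. y - x)" using fac[OF PQ(2) nz(2)] by blast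
 have "s = (c / d) * (\<Prod>x\<in>#A. y - x) / (\<Prod>x\<in>#B. y - x)" using PQ c d by simp
 moreover have "c / d \<in> W" "c / d ~= 0" using c d W by (auto intro: subfield_divide)
 ultimately show ?thesis using c d by blast
qed

context valued_target begin

text \<open>Each difference \<open>y - x\<close> has been written as an element of the small field times a power of one
  element times a unit, on both sides; the same then holds for products.\<close>

lemma transport_products:
 assumes h: "target_hom D hm E" and z: "z \<in> D" "hm z ~= 0" "z ~= 0" and y: "y \<in> D"
  and e: "\<And>x. x \<in> R ==> x \<in> D \<and> e x \<in> D \<and> e x ~= 0 \<and> hm (e x) ~= 0"
  and u: "\<And>x. x \<in> R ==> (\<exists>u\<in>units_of_vring V. y - x = e x * z powi k x * u)"
  and u': "\<And>x. x \<in> R ==> (\<exists>u\<in>units_of_vring V'. hm y - hm x = hm (e x) * hm z powi k x * u)"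
  and A: "set_mset A \<subseteq> R"
 shows "(\<Prod>x\<in>#A. y - x) \<in> D" (is ?a) and "(\<Prod>x\<in>#A. e x) \<in> D" (is ?b)
  and "\<exists>u\<in>units_of_vring V. (\<Prod>x\<in>#A. y - x) = (\<Prod>x\<in>#A. e x) * z powi (\<Sum>x\<in>#A. k x) * u" (is ?c)
  and "\<exists>u\<in>units_of_vring V'. hm (\<Prod>x\<in>#A. y - x) = hm (\<Prod>x\<in>#A. e x) * hm z powi (\<Sum>x\<in>#A. k x) * u" (is ?d)
  and "hm (\<Prod>x\<in>#A. e x) ~= 0" (is ?e) and "(\<Prod>x\<in>#A. e x) ~= 0" (is ?f)
proof -
 note ph = target_hom_phom[OF h]
 note Dr = phom_subring[OF ph]
 have "?a \<and> ?b \<and> ?c \<and> ?d \<and> ?e \<and> ?f" using A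
 proof (induction A)
  case empty
  then show ?case using units_one[OF V] units_one[OF V'] subring_one[OF Dr] phom_one[OF ph] by auto
 next
  case (add x A)
  then have xR: "x \<in> R" and IH: "(\<Prod>x\<in>#A. y - x) \<in> D" "(\<Prod>x\<in>#A. e x) \<in> D"
   "\<exists>u\<in>units_of_vring V. (\<Prod>x\<in>#A. y - x) = (\<Prod>x\<in>#A. e x) * z powi (\<Sum>x\<in>#A. k x) * u"
   "\<exists>u\<in>units_of_vring V'. hm (\<Prod>x\<in>#A. y - x) = hm (\<Prod>x\<in>#A. e x) * hm z powi (\<Sum>x\<in>#A. k x) * u"
   "hm (\<Prod>x\<in>#A. e x) ~= 0" "(\<Prod>x\<in>#A. e x) ~= 0" by auto
  have yx: "y - x \<in> D" "hm (y - x) = hm y - hm x" using e[OF xR] y Dr phom_diff[OF ph] by (auto intro: subring_diff)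
  obtain u1 u2 where u12: "u1 \<in> units_of_vring V" "y - x = e x * z powi k x * u1"
   "u2 \<in> units_of_vring V" "(\<Prod>x\<in>#A. y - x) = (\<Prod>x\<in>#A. e x) * z powi (\<Sum>x\<in>#A. k x) * u2" using u[OF xR] IH(3) by blast
  obtain v1 v2 where v12: "v1 \<in> units_of_vring V'" "hm y - hm x = hm (e x) * hm z powi k x * v1"
   "v2 \<in> units_of_vring V'" "hm (\<Prod>x\<in>#A. y - x) = hm (\<Prod>x\<in>#A. e x) * hm z powi (\<Sum>x\<in>#A. k x) * v2" using u'[OF xR] IH(4) by blast
  have m1: "hm ((y - x) * (\<Prod>x\<in>#A. y - x)) = hm (y - x) * hm (\<Prod>x\<in>#A. y - x)"
   using phom_mult[OF ph yx(1) IH(1)] .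
  have m2: "hm (e x * (\<Prod>x\<in>#A. e x)) = hm (e x) * hm (\<Prod>x\<in>#A. e x)"
   using phom_mult[OF ph _ IH(2)] e[OF xR] by blast
  have "(y - x) * (\<Prod>x\<in>#A. y - x) = (e x * (\<Prod>x\<in>#A. e x)) * z powi (k x + (\<Sum>x\<in>#A. k x)) * (u1 * u2)"
   unfolding u12(2) u12(4) using z by (simp add: power_int_add)
  then have c: "\<exists>u\<in>units_of_vring V. (y - x) * (\<Prod>x\<in>#A. y - x) = (e x * (\<Prod>x\<in>#A. e x)) * z powi (k x + (\<Sum>x\<in>#A. k x)) * u"
   using units_mult[OF V u12(1,3)] by blast
  have "hm ((y - x) * (\<Prod>x\<in>#A. y - x)) = hm (e x * (\<Prod>x\<in>#A. e x)) * hm z powi (k x + (\<Sum>x\<in>#A. k x)) * (v1 * v2)"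
   unfolding m1 m2 yx(2) v12(2) v12(4) using z by (simp add: power_int_add)
  then have d: "\<exists>u\<in>units_of_vring V'. hm ((y - x) * (\<Prod>x\<in>#A. y - x)) = hm (e x * (\<Prod>x\<in>#A. e x)) * hm z powi (k x + (\<Sum>x\<in>#A. k x)) * u"
   using units_mult[OF V' v12(1,3)] by blast
  show ?case using c d IH yx e[OF xR] m2 subring_mult[OF Dr] by simp
 qed
 then show ?a ?b ?c ?d ?e ?f by blast+
qed

lemma agree_products:
 assumes h: "target_hom D hm E" and z: "z \<in> D" "hm z ~= 0" "z ~= 0" and y: "y \<in> D"
  and e: "\<And>x. x \<in> R ==> x \<in> D \<and> e x \<in> D \<and> e x ~= 0 \<and> hm (e x) ~= 0"
  and u: "\<And>x. x \<in> R ==> (\<exists>u\<in>units_of_vring V. y - x = e x * z powi k x * u)"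
  and u': "\<And>x. x \<in> R ==> (\<exists>u\<in>units_of_vring V'. hm y - hm x = hm (e x) * hm z powi k x * u)"
  and A: "set_mset A \<subseteq> R" and B: "set_mset B \<subseteq> R" and c: "c \<in> D" "c ~= 0" "hm c ~= 0"
  and s: "s = c * (\<Prod>x\<in>#A. y - x) / (\<Prod>x\<in>#B. y - x)"
  and g: "g = c * (\<Prod>x\<in>#A. e x) / (\<Prod>x\<in>#B. e x)" and l: "l = (\<Sum>x\<in>#A. k x) - (\<Sum>x\<in>#B. k x)"
  and gl: "g * z powi l \<in> V \<longleftrightarrow> hm g * hm z powi l \<in> V'"
 shows "s \<in> D" "hm s ~= 0" "s \<in> V \<longleftrightarrow> hm s \<in> V'"
proof -
 note ph = target_hom_phom[OF h]
 note Dr = phom_subring[OF ph]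
 note TA = transport_products[OF h z y e u u' A]
 note TB = transport_products[OF h z y e u u' B]
 obtain u1 u2 where u12: "u1 \<in> units_of_vring V" "(\<Prod>x\<in>#A. y - x) = (\<Prod>x\<in>#A. e x) * z powi (\<Sum>x\<in>#A. k x) * u1"
   "u2 \<in> units_of_vring V" "(\<Prod>x\<in>#B. y - x) = (\<Prod>x\<in>#B. e x) * z powi (\<Sum>x\<in>#B. k x) * u2" using TA(3) TB(3) by blast
 obtain v1 v2 where v12: "v1 \<in> units_of_vring V'" "hm (\<Prod>x\<in>#A. y - x) = hm (\<Prod>x\<in>#A. e x) * hm z powi (\<Sum>x\<in>#A. k x) * v1"
   "v2 \<in> units_of_vring V'" "hm (\<Prod>x\<in>#B. y - x) = hm (\<Prod>x\<in>#B. e x) * hm z powi (\<Sum>x\<in>#B. k x) * v2" using TA(4) TB(4) by blast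
 have nB: "hm (\<Prod>x\<in>#B. y - x) ~= 0" unfolding v12(4) using TB(5) z units_nonzero[OF v12(3)] by simp
 have nA: "hm (\<Prod>x\<in>#A. y - x) ~= 0" unfolding v12(2) using TA(5) z units_nonzero[OF v12(1)] by simp
 have cA: "c * (\<Prod>x\<in>#A. y - x) \<in> D" "c * (\<Prod>x\<in>#A. e x) \<in> D" using c TA(1,2) Dr by (auto intro: subring_mult)
 show sD: "s \<in> D" unfolding s using target_hom_divide(1)[OF h TB(1) cA(1) nB] .
 have hs: "hm s = hm c * hm (\<Prod>x\<in>#A. y - x) / hm (\<Prod>x\<in>#B. y - x)"
  unfolding s using target_hom_divide(2)[OF h TB(1) cA(1) nB] phom_mult[OF ph c(1) TA(1)] by simp
 have hg: "hm g = hm c * hm (\<Prod>x\<in>#A. e x) / hm (\<Prod>x\<in>#B. e x)"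
  unfolding g using target_hom_divide(2)[OF h TB(2) cA(2) TB(5)] phom_mult[OF ph c(1) TA(2)] by simp
 show "hm s ~= 0" unfolding hs using c nA nB by simp
 have "s = g * z powi l * (u1 / u2)"
  unfolding s g l u12(2) u12(4) using z by (simp add: power_int_diff field_simps)
 then have a: "s \<in> V \<longleftrightarrow> g * z powi l \<in> V"
  using mult_unit_in_vring_iff[OF V units_divide[OF V u12(1,3)]] by simp
 have "hm s = hm g * hm z powi l * (v1 / v2)"
  unfolding hs hg l v12(2) v12(4) using z by (simp add: power_int_diff field_simps)
 then have b: "hm s \<in> V' \<longleftrightarrow> hm g * hm z powi l \<in> V'"
  using mult_unit_in_vring_iff[OF V' units_divide[OF V' v12(1,3)]] by simp
 show "s \<in> V \<longleftrightarrow> hm s \<in> V'" using a b gl by simp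
qed

lemma extend_ramified:
 assumes W: "is_subfield W" and ap: "approx W" and mg: "minimal_gen W z p0"
  and now: "\<And>w. w \<in> W ==> w ~= 0 ==> z / w \<notin> units_of_vring V"
  and S: "finite S" "S \<subseteq> W" and G: "finite G" "G \<subseteq> W" "0 \<notin> G"
 shows "\<exists>D hm E. target_hom D hm E \<and> D \<subseteq> field_adjoin W z \<and> S \<union> G \<subseteq> D \<and> agree_units S hm \<and> z \<in> D \<and> hm z ~= 0 \<and>
  (\<forall>g k. g \<in> G --> \<bar>k\<bar> \<le> int n0 --> (g * z powi k \<in> V \<longleftrightarrow> hm g * hm z powi k \<in> V'))"
proof (cases "p0 = 0")
 case True
 then have mg': "minimal_gen W z 0" using mg by simp
 show ?thesis by (rule extend_ramified_transcendental[OF W ap mg' now S G, of n0]) blast+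
next
 case False
 show ?thesis by (rule extend_ramified_algebraic[OF W ap mg False now S G, of n0]) blast+
qed

text \<open>The finitely many given elements are products of factors \<open>y - r\<close> with \<open>r\<close> in a finite set \<open>R\<close>. Let
  \<open>r0\<close> be the point of \<open>R\<close> nearest to \<open>y\<close>. If \<open>y - r0 = w z\<close> with \<open>w\<close> in \<open>W\<close> and a unit \<open>z\<close>, then
  every factor is an element of \<open>W\<close> times a unit \<open>z + b\<close> or \<open>1 + z / b\<close>. Otherwise \<open>z = y - r0\<close> has a new
  value, and each factor \<open>z + (r0 - r)\<close> is dominated by one of its two terms. Either way the value of each
  factor is read off from \<open>W\<close> and powers of \<open>z\<close>, which the preceding sections control.\<close>

lemma approx_field_adjoin:
 assumes W: "is_subfield W" and ap: "approx W" and mg: "minimal_gen W y p0"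
 shows "approx (field_adjoin W y)"
 unfolding approx_def
proof (intro allI impI)
 fix S assume S: "finite S" "S \<subseteq> field_adjoin W y"
 note Wr = subfield_subring[OF W] and Vr = vring_subring[OF V] and Vr' = vring_subring[OF V']
 have yW: "y \<notin> W" using mg by (simp add: minimal_gen_def)
 have "\<exists>c A B. c \<in> W \<and> c ~= 0 \<and> set_mset A \<subseteq> W \<and> set_mset B \<subseteq> W \<and>
  s = c * (\<Prod>x\<in>#A. y - x) / (\<Prod>x\<in>#B. y - x)" if "s \<in> S - {0}" for s
  using field_adjoin_linear_factors[OF W mg, of s] that S by blast
 then obtain c A B where cAB: "\<And>s. s \<in> S - {0} ==> c s \<in> W \<and> c s ~= 0 \<and> set_mset (A s) \<subseteq> W \<and> set_mset (B s) \<subseteq> W \<and>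
  s = c s * (\<Prod>x\<in>#A s. y - x) / (\<Prod>x\<in>#B s. y - x)" by metis
 define R where "R = insert 0 (\<Union>s\<in>S - {0}. set_mset (A s) \<union> set_mset (B s))"
 have R: "finite R" "R \<subseteq> W" "0 \<in> R" unfolding R_def using S cAB subring_zero[OF Wr] by auto
 have yr: "y - r ~= 0" if "r \<in> R" for r using that R yW by auto
 have iR: "finite ((\<lambda>r. inverse (y - r)) ` R)" "(\<lambda>r. inverse (y - r)) ` R ~= {}" "0 \<notin> (\<lambda>r. inverse (y - r)) ` R"
  using R yr by auto
 \<comment> \<open>\<open>r0\<close> is a nearest point: \<open>inverse (y - r0)\<close> has the least value\<close>
 obtain v where v: "v \<in> (\<lambda>r. inverse (y - r)) ` R" "\<forall>b\<in>(\<lambda>r. inverse (y - r)) ` R. b / v \<in> V"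
  using vring_finite_min[OF V iR] by (elim bexE)
 then obtain r0 where r0: "r0 \<in> R" "v = inverse (y - r0)" by blast
 have close: "(y - r0) / (y - r) \<in> V" if "r \<in> R" for r
 proof -
  have "inverse (y - r) / v \<in> V" using v(2) that by blast
  then show ?thesis by (simp add: r0(2) divide_inverse mult.commute)
 qed
 have r0W: "r0 \<in> W" using r0 R by blast
 define d where "d = (\<lambda>r. r0 - r)"
 have dW: "d r \<in> W" if "r \<in> R" for r unfolding d_def using that R r0W Wr by (auto intro: subring_diff)
 show "\<exists>D hm E. target_hom D hm E \<and> D \<subseteq> field_adjoin W y \<and> S \<subseteq> D \<and> agree S hm"
 proof (cases "\<exists>w\<in>W. w ~= 0 \<and> (y - r0) / w \<in> units_of_vring V")
  case True
  then obtain w where w: "w \<in> W" "w ~= 0" "(y - r0) / w \<in> units_of_vring V" by blast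
  define z where "z = (y - r0) / w"
  have zu: "z \<in> units_of_vring V" using w by (simp add: z_def)
  have z0: "z ~= 0" using units_nonzero[OF zu] .
  have ye: "y = r0 + w * z" using w by (simp add: z_def)
  obtain p1 where mgz: "minimal_gen W z p1" using minimal_gen_affine[OF W mg r0W w(1,2)] by (auto simp: z_def)
  define b where "b = (\<lambda>r. d r / w)"
  have bW: "b r \<in> W" if "r \<in> R" for r unfolding b_def using dW[OF that] w W by (auto intro: subfield_divide)
  have yrb: "y - r = w * (z + b r)" for r using w by (simp add: ye b_def d_def field_simps)
  define Bs where "Bs = b ` {r \<in> R. b r \<in> V}"
  have Bs: "finite Bs" "Bs \<subseteq> W" using R bW by (auto simp: Bs_def)
  have zbu: "z + b r \<in> units_of_vring V" if r: "r \<in> R" "b r \<in> V" for r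
  proof -
   have zb: "z + b r \<in> V" using units_sub[OF zu] r(2) Vr by (auto intro: subring_add)
   have ne: "z + b r ~= 0" using yr[OF r(1)] yrb[of r] by auto
   have "(y - r0) / (y - r) = z * inverse (z + b r)"
    using w yrb[of r] yrb[of r0] by (simp add: b_def d_def divide_inverse)
   then have "z * inverse (z + b r) \<in> V" using close[OF r(1)] by simp
   then have "inverse (z + b r) \<in> V" using mult_unit_in_vring_iff[OF V zu, of "inverse (z + b r)"] by (simp add: mult.commute)
   then show ?thesis using zb ne by (simp add: units_of_vring_def)
  qed
  define e where "e = (\<lambda>r. if b r \<in> V then w else d r)"
  define g where "g = (\<lambda>s. c s * (\<Prod>x\<in>#A s. e x) / (\<Prod>x\<in>#B s. e x))"
  have bd: "d r ~= 0" if "b r \<notin> V" for r using that subring_zero[OF Vr] by (auto simp: b_def)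
  have yrd: "y - r = d r * (1 + z * inverse (b r))" if "b r \<notin> V" for r
  proof -
   have "d r * (1 + z * inverse (b r)) = d r + w * z" using bd[OF that] w by (simp add: b_def field_simps)
   then show ?thesis by (simp add: ye d_def)
  qed
  have e0: "e r ~= 0" for r using bd w by (auto simp: e_def)
  have eW: "e r \<in> W" if "r \<in> R" for r using dW[OF that] w by (auto simp: e_def)
  have prodW: "(\<Prod>x\<in>#M. e x) \<in> W" if "set_mset M \<subseteq> R" for M
   using that by (induction M) (auto intro: eW subring_mult[OF Wr] subring_one[OF Wr])
  have AR: "set_mset (A s) \<subseteq> R" "set_mset (B s) \<subseteq> R" if "s \<in> S - {0}" for s using that by (auto simp: R_def)
  have gW: "g s \<in> W" if "s \<in> S - {0}" for s
   unfolding g_def using prodW[OF AR(1)[OF that]] prodW[OF AR(2)[OF that]] cAB[OF that] W by (auto intro!: subfield_intros)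
  define S1 where "S1 = {r0, w} \<union> R \<union> c ` (S - {0}) \<union> g ` (S - {0}) \<union> e ` R \<union> (\<lambda>r. inverse (b r)) ` R"
  have S1: "finite S1" "S1 \<subseteq> W"
   unfolding S1_def using S R r0W w gW cAB eW bW W by (auto intro: subfield_inverse)
  have zb': "x \<in> V \<and> z + x \<in> units_of_vring V" if "x \<in> Bs" for x using that zbu by (auto simp: Bs_def)
  obtain D hm E where D: "target_hom D hm E" "D \<subseteq> field_adjoin W z" "S1 \<union> Bs \<subseteq> D" "agree_units S1 hm" "z \<in> D" "hm z \<in> V'"
   and Db: "\<And>x. x \<in> Bs ==> hm z + hm x \<in> units_of_vring V'"
   using extend_unit[OF W ap mgz zu Bs zb' S1] by blast
  note ph = target_hom_phom[OF D(1)]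
  note Dr = phom_subring[OF ph]
  have inD: "x \<in> D" if "x \<in> S1" for x using that D(3) by blast
  have m: "r0 \<in> S1" "w \<in> S1" and mR: "\<And>r. r \<in> R ==> r \<in> S1 \<and> e r \<in> S1 \<and> inverse (b r) \<in> S1"
   and mS: "\<And>s. s \<in> S - {0} ==> c s \<in> S1 \<and> g s \<in> S1" by (auto simp: S1_def)
  have yD: "y \<in> D" unfolding ye using inD[OF m(1)] inD[OF m(2)] D(5) Dr by (auto intro: subring_intros)
  have r0R: "b r0 \<in> V" "b r0 = 0" using subring_zero[OF Vr] by (simp_all add: b_def d_def)
  have "0 \<in> Bs" using r0 r0R by (force simp: Bs_def)
  then have hz: "hm z \<in> units_of_vring V'" using Db[of 0] phom_zero[OF ph] by simp
  have hy: "hm y = hm r0 + hm w * hm z"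
   unfolding ye using inD[OF m(1)] inD[OF m(2)] D(5) by (simp add: phom_add[OF ph] phom_mult[OF ph] subring_mult[OF Dr])
  have hnz: "hm x ~= 0" if "x \<in> S1" "x ~= 0" for x using agree_unitsD(1)[OF D(4)] that by blast
  have hw: "hm w ~= 0" using hnz m w by blast
  have u: "\<exists>u\<in>units_of_vring V. y - r = e r * z powi 0 * u" if r: "r \<in> R" for r
  proof (cases "b r \<in> V")
   case True
   then show ?thesis using zbu[OF r True] yrb[of r] by (intro bexI[of _ "z + b r"]) (auto simp: e_def)
  next
   case False
   have "inverse (b r) \<in> maximal_ideal V" using not_in_vring[OF V False] by blast
   then have "z * inverse (b r) \<in> maximal_ideal V" using units_sub[OF zu] maximal_mult[OF V] by blast
   then have "1 + z * inverse (b r) \<in> units_of_vring V" using units_add_maximal[OF V units_one[OF V]] by blast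
   moreover have "y - r = d r * (1 + z * inverse (b r))"
    by (rule yrd[OF False])
   ultimately show ?thesis using False by (intro bexI[of _ "1 + z * inverse (b r)"]) (auto simp: e_def)
  qed
  have u': "\<exists>u\<in>units_of_vring V'. hm y - hm r = hm (e r) * hm z powi 0 * u" if r: "r \<in> R" for r
  proof (cases "b r \<in> V")
   case True
   then have bB: "b r \<in> Bs" using r by (auto simp: Bs_def)
   then have bD: "b r \<in> D" using D(3) by blast
   have rD: "r \<in> D" using inD mR r by blast
   have "hm y - hm r = hm (y - r)" using phom_diff[OF ph yD rD] by simp
   also have "\<dots> = hm w * (hm z + hm (b r))"
    unfolding yrb using phom_mult[OF ph inD[OF m(2)] subring_add[OF Dr D(5) bD]] phom_add[OF ph D(5) bD] by simp
   finally show ?thesis using Db[OF bB] True by (intro bexI[of _ "hm z + hm (b r)"]) (auto simp: e_def)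
  next
   case False
   have ib: "inverse (b r) \<in> S1" using mR r by blast
   have "inverse (b r) \<in> maximal_ideal V" using not_in_vring[OF V False] by blast
   then have "hm (inverse (b r)) \<in> maximal_ideal V'" using agree_unitsD(3)[OF D(4) ib] by blast
   then have "hm z * hm (inverse (b r)) \<in> maximal_ideal V'" using D(6) maximal_mult[OF V'] by blast
   then have un: "1 + hm z * hm (inverse (b r)) \<in> units_of_vring V'" using units_add_maximal[OF V' units_one[OF V']] by blast
   have ed: "e r = d r" using False by (simp add: e_def)
   have dD: "d r \<in> D" using mR[OF r] inD ed by metis
   have rD: "r \<in> D" using inD mR r by blast
   have ibD: "inverse (b r) \<in> D" using inD ib by blast
   have yr': "y - r = d r * (1 + z * inverse (b r))"
    by (rule yrd[OF False])
   have "hm y - hm r = hm (y - r)" using phom_diff[OF ph yD rD] by simp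
   also have "\<dots> = hm (d r) * (1 + hm z * hm (inverse (b r)))"
    unfolding yr' using dD D(5) ibD Dr
    by (simp add: phom_mult[OF ph] phom_add[OF ph] phom_one[OF ph] subring_one subring_add subring_mult)
   finally show ?thesis using un ed by (intro bexI[of _ "1 + hm z * hm (inverse (b r))"]) auto
  qed
  have eD: "x \<in> D \<and> e x \<in> D \<and> e x ~= 0 \<and> hm (e x) ~= 0" if "x \<in> R" for x
   using mR[OF that] inD e0 hnz by blast
  have fin: "s \<in> D \<and> hm s ~= 0 \<and> (s \<in> V \<longleftrightarrow> hm s \<in> V')" if s: "s \<in> S - {0}" for s
  proof -
   have cs: "c s \<in> D" "c s ~= 0" "hm (c s) ~= 0" using cAB[OF s] mS[OF s] inD hnz by blast+
   have se: "s = c s * (\<Prod>x\<in>#A s. y - x) / (\<Prod>x\<in>#B s. y - x)" using cAB[OF s] by blast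
   have "g s * z powi 0 \<in> V \<longleftrightarrow> hm (g s) * hm z powi 0 \<in> V'" using agree_unitsD(2)[OF D(4)] mS[OF s] by simp
   then have gl: "g s * z powi ((\<Sum>x\<in>#A s. 0) - (\<Sum>x\<in>#B s. 0)) \<in> V \<longleftrightarrow> hm (g s) * hm z powi ((\<Sum>x\<in>#A s. 0) - (\<Sum>x\<in>#B s. 0)) \<in> V'"
    by simp
   show ?thesis
    using agree_products[OF D(1,5) units_nonzero[OF hz] z0 yD eD u u' AR[OF s] cs se g_def[THEN fun_cong] refl gl] by blast
  qed
  have "S \<subseteq> D" using fin subring_zero[OF Dr] by blast
  moreover have "agree S hm" using fin by (auto simp: agree_def)
  moreover have "D \<subseteq> field_adjoin W y"
  proof
   fix x assume "x \<in> D"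
   then obtain P Q where PQ: "P \<in> polys_over W" "Q \<in> polys_over W" "x = poly P z / poly Q z"
    using D(2) unfolding field_adjoin_def by blast
   note F = is_subfield_field_adjoin[OF W, of y]
   have "z \<in> field_adjoin W y" unfolding z_def using F r0W w by (intro subfield_divide subring_diff subfield_subring) auto
   then have "poly P z \<in> field_adjoin W y" "poly Q z \<in> field_adjoin W y"
    using PQ F by (auto intro!: polys_over_poly_in[OF subfield_subring[OF F(1)]] dest: subsetD[OF polys_over_mono[OF F(2)]])
   then show "x \<in> field_adjoin W y" using PQ F by (auto intro: subfield_divide)
  qed
  ultimately show ?thesis using D(1) by blast
 next
  case False
  define z where "z = y - r0"
  have now: "z / w \<notin> units_of_vring V" if "w \<in> W" "w ~= 0" for w using False that by (auto simp: z_def)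
  have "\<exists>p1. minimal_gen W ((y - r0) / 1) p1" using subring_one[OF Wr] by (intro minimal_gen_affine[OF W mg r0W]) auto
  then obtain p1 where mgz: "minimal_gen W z p1" by (auto simp: z_def)
  have z0: "z ~= 0" using yr r0 by (auto simp: z_def)
  have ye: "y = r0 + z" by (simp add: z_def)
  have yrd: "y - r = z + d r" for r by (simp add: z_def d_def)
  define lo where "lo = (\<lambda>r. d r / z \<in> V)"
  define e where "e = (\<lambda>r. if lo r then 1 else d r)"
  define k where "k = (\<lambda>r. if lo r then 1 else 0::int)"
  define g where "g = (\<lambda>s. c s * (\<Prod>x\<in>#A s. e x) / (\<Prod>x\<in>#B s. e x))"
  define l where "l = (\<lambda>s. (\<Sum>x\<in>#A s. k x) - (\<Sum>x\<in>#B s. k x))"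
  have bd: "d r ~= 0" if "\<not> lo r" for r using that subring_zero[OF Vr] by (auto simp: lo_def)
  have e0: "e r ~= 0" for r using bd by (auto simp: e_def)
  have eW: "e r \<in> W" if "r \<in> R" for r using dW[OF that] subring_one[OF Wr] by (auto simp: e_def)
  have prodW: "(\<Prod>x\<in>#M. e x) \<in> W" if "set_mset M \<subseteq> R" for M
   using that by (induction M) (auto intro: eW subring_mult[OF Wr] subring_one[OF Wr])
  have prod0: "(\<Prod>x\<in>#M. e x) ~= 0" for M by (induction M) (auto simp: e0)
  have AR: "set_mset (A s) \<subseteq> R" "set_mset (B s) \<subseteq> R" if "s \<in> S - {0}" for s using that by (auto simp: R_def)
  have gW: "g s \<in> W" "g s ~= 0" if "s \<in> S - {0}" for s
   unfolding g_def using prodW[OF AR(1)[OF that]] prodW[OF AR(2)[OF that]] cAB[OF that] W prod0 by (auto intro!: subfield_intros)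
  define n0 where "n0 = Max (insert 1 ((\<lambda>s. nat \<bar>l s\<bar>) ` (S - {0})))"
  have n0: "1 \<le> n0" and n0s: "\<bar>l s\<bar> \<le> int n0" if "s \<in> S - {0}" for s
  proof -
   show "1 \<le> n0" unfolding n0_def using S by (intro Max_ge) auto
   have "nat \<bar>l s\<bar> \<le> n0" unfolding n0_def using S that by (intro Max_ge) auto
   then show "\<bar>l s\<bar> \<le> int n0" by linarith
  qed
  have n01: "1 \<le> n0" unfolding n0_def using S by (intro Max_ge) auto
  define S1 where "S1 = {r0} \<union> R \<union> c ` (S - {0}) \<union> e ` R"
  have S1: "finite S1" "S1 \<subseteq> W" unfolding S1_def using S R r0W cAB eW by auto
  define G where "G = g ` (S - {0}) \<union> (d ` R - {0}) \<union> (inverse ` (d ` R) - {0})"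
  have G12: "finite G" "G \<subseteq> W"
   unfolding G_def using S R gW(1) dW W by (auto intro: subfield_inverse)
  have "0 \<notin> g ` (S - {0})" using gW(2) by (metis imageE)
  then have "0 \<notin> G" unfolding G_def by blast
  note G = G12 this
  have "\<exists>D hm E. target_hom D hm E \<and> D \<subseteq> field_adjoin W z \<and> S1 \<union> G \<subseteq> D \<and> agree_units S1 hm \<and> z \<in> D \<and> hm z ~= 0 \<and>
   (\<forall>g k. g \<in> G --> \<bar>k\<bar> \<le> int n0 --> (g * z powi k \<in> V \<longleftrightarrow> hm g * hm z powi k \<in> V'))"
   by (rule extend_ramified[OF W ap mgz _ S1 G]) (rule now)
  then obtain D hm E where D: "target_hom D hm E" "D \<subseteq> field_adjoin W z" "S1 \<union> G \<subseteq> D" "agree_units S1 hm" "z \<in> D" "hm z ~= 0"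
   and Dg0: "\<forall>g k. g \<in> G --> \<bar>k\<bar> \<le> int n0 --> (g * z powi k \<in> V \<longleftrightarrow> hm g * hm z powi k \<in> V')"
   by (elim exE conjE)
  have Dg: "\<And>x k. x \<in> G ==> \<bar>k\<bar> \<le> int n0 ==> x * z powi k \<in> V \<longleftrightarrow> hm x * hm z powi k \<in> V'" using Dg0 by simp
  note ph = target_hom_phom[OF D(1)]
  note Dr = phom_subring[OF ph]
  have inD: "x \<in> D" if "x \<in> S1 \<union> G" for x using that D(3) by blast
  have mR: "\<And>r. r \<in> R ==> r \<in> S1 \<and> e r \<in> S1" and m0: "r0 \<in> S1"
   and mS: "\<And>s. s \<in> S - {0} ==> c s \<in> S1 \<and> g s \<in> G" by (auto simp: S1_def G_def)
  have mG: "d r \<in> G \<and> inverse (d r) \<in> G" if "r \<in> R" "d r ~= 0" for r using that by (auto simp: G_def)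
  have yD: "y \<in> D" unfolding ye using inD m0 D(5) Dr by (auto intro: subring_add)
  have hnz: "hm x ~= 0" if "x \<in> S1" "x ~= 0" for x using agree_unitsD(1)[OF D(4)] that by blast
  have eD: "x \<in> D \<and> e x \<in> D \<and> e x ~= 0 \<and> hm (e x) ~= 0" if "x \<in> R" for x
   using mR[OF that] inD e0 hnz by blast
  have dz: "d r / z \<in> V \<longleftrightarrow> hm (d r) / hm z \<in> V'" "z / d r \<in> V \<longleftrightarrow> hm z / hm (d r) \<in> V'" "hm (d r) ~= 0"
   if r: "r \<in> R" "d r ~= 0" for r
  proof -
   have a: "d r \<in> G" "inverse (d r) \<in> G" using mG[OF r] by auto
   have b: "d r \<in> D" "inverse (d r) \<in> D" using a inD by auto
   have c: "hm (inverse (d r)) = inverse (hm (d r))" by (rule phom_inverse[OF ph b])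
   have "hm (d r) * hm (inverse (d r)) = 1" using phom_mult[OF ph b] r phom_one[OF ph] by simp
   then show "hm (d r) ~= 0" by auto
   show "d r / z \<in> V \<longleftrightarrow> hm (d r) / hm z \<in> V'"
    using Dg[OF a(1), of "-1"] n01 by (simp add: power_int_minus divide_inverse)
   show "z / d r \<in> V \<longleftrightarrow> hm z / hm (d r) \<in> V'"
    using Dg[OF a(2), of 1] n01 c by (simp add: divide_inverse mult.commute)
  qed
  have notboth: "\<not> (d r / z \<in> V \<and> z / d r \<in> V)" "d r / z \<in> V \<or> z / d r \<in> V" if r: "r \<in> R" "d r ~= 0" for r
  proof -
   have "z / d r \<notin> units_of_vring V" using now dW r by blast
   then show "\<not> (d r / z \<in> V \<and> z / d r \<in> V)" using r z0 by (auto simp: units_of_vring_def)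
   show "d r / z \<in> V \<or> z / d r \<in> V" using vring_total[OF V, of "d r / z"] by simp
  qed
  have mlo: "d r / z \<in> maximal_ideal V \<and> hm (d r) / hm z \<in> maximal_ideal V'" if r: "r \<in> R" "lo r" for r
  proof (cases "d r = 0")
   case True
   then show ?thesis using maximal_zero[OF V] maximal_zero[OF V'] phom_zero[OF ph] by simp
  next
   case False
   then show ?thesis using r(2) notboth(1)[OF r(1) False] dz[OF r(1) False] by (auto simp: lo_def maximal_ideal_def)
  qed
  have mhi: "z / d r \<in> maximal_ideal V \<and> hm z / hm (d r) \<in> maximal_ideal V'" if r: "r \<in> R" "\<not> lo r" for r
   using r(2) notboth[OF r(1) bd[OF r(2)]] dz[OF r(1) bd[OF r(2)]] by (auto simp: lo_def maximal_ideal_def)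
  have u: "\<exists>u\<in>units_of_vring V. y - r = e r * z powi k r * u" if r: "r \<in> R" for r
  proof (cases "lo r")
   case True
   have "1 + d r / z \<in> units_of_vring V" using mlo[OF r True] units_add_maximal[OF V units_one[OF V]] by blast
   moreover have "y - r = e r * z powi k r * (1 + d r / z)" using True z0 by (simp add: e_def k_def yrd distrib_left)
   ultimately show ?thesis by blast
  next
   case F: False
   have "1 + z / d r \<in> units_of_vring V" using mhi[OF r F] units_add_maximal[OF V units_one[OF V]] by blast
   moreover have "y - r = e r * z powi k r * (1 + z / d r)" using F bd[OF F] by (simp add: e_def k_def yrd distrib_left)
   ultimately show ?thesis by blast
  qed
  have u': "\<exists>u\<in>units_of_vring V'. hm y - hm r = hm (e r) * hm z powi k r * u" if r: "r \<in> R" for r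
  proof -
   have rD: "r \<in> D" using inD mR r by blast
   have dD: "d r \<in> D" unfolding d_def using rD inD m0 Dr by (auto intro: subring_diff)
   have "hm y - hm r = hm (y - r)" using phom_diff[OF ph yD rD] by simp
   then have yh: "hm y - hm r = hm z + hm (d r)" using phom_add[OF ph D(5) dD] yrd by simp
   show ?thesis
   proof (cases "lo r")
    case True
    have "1 + hm (d r) / hm z \<in> units_of_vring V'" using mlo[OF r True] units_add_maximal[OF V' units_one[OF V']] by blast
    moreover have "hm y - hm r = hm (e r) * hm z powi k r * (1 + hm (d r) / hm z)"
     using True D(6) phom_one[OF ph] by (simp add: e_def k_def yh distrib_left)
    ultimately show ?thesis by blast
   next
    case F: False
    have "1 + hm z / hm (d r) \<in> units_of_vring V'" using mhi[OF r F] units_add_maximal[OF V' units_one[OF V']] by blast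
    moreover have "hm y - hm r = hm (e r) * hm z powi k r * (1 + hm z / hm (d r))"
     using F dz(3)[OF r bd[OF F]] by (simp add: e_def k_def yh distrib_left)
    ultimately show ?thesis by blast
   qed
  qed
  have fin: "s \<in> D \<and> hm s ~= 0 \<and> (s \<in> V \<longleftrightarrow> hm s \<in> V')" if s: "s \<in> S - {0}" for s
  proof -
   have cs: "c s \<in> D" "c s ~= 0" "hm (c s) ~= 0" using cAB[OF s] mS[OF s] inD hnz by blast+
   have se: "s = c s * (\<Prod>x\<in>#A s. y - x) / (\<Prod>x\<in>#B s. y - x)" using cAB[OF s] by blast
   have gl: "g s * z powi l s \<in> V \<longleftrightarrow> hm (g s) * hm z powi l s \<in> V'" using Dg mS[OF s] n0s[OF s] by blast
   show ?thesis
    using agree_products[OF D(1,5,6) z0 yD eD u u' AR[OF s] cs se g_def[THEN fun_cong] l_def[THEN fun_cong] gl] by blast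
  qed
  have "S \<subseteq> D" using fin subring_zero[OF Dr] by blast
  moreover have "agree S hm" using fin by (auto simp: agree_def)
  moreover have "D \<subseteq> field_adjoin W y"
  proof
   fix x assume "x \<in> D"
   then obtain P Q where PQ: "P \<in> polys_over W" "Q \<in> polys_over W" "x = poly P z / poly Q z"
    using D(2) unfolding field_adjoin_def by blast
   note F = is_subfield_field_adjoin[OF W, of y]
   have "z \<in> field_adjoin W y" unfolding z_def using F r0W by (intro subring_diff subfield_subring) auto
   then have "poly P z \<in> field_adjoin W y" "poly Q z \<in> field_adjoin W y"
    using PQ F by (auto intro!: polys_over_poly_in[OF subfield_subring[OF F(1)]] dest: subsetD[OF polys_over_mono[OF F(2)]])
   then show "x \<in> field_adjoin W y" using PQ F by (auto intro: subfield_divide)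
  qed
  ultimately show ?thesis using D(1) by blast
 qed
qed

text \<open>By Zorn's lemma there is a largest field on which the transport is possible. If it is not everything, some
  element outside is of least degree over it, or it is relatively closed and any element outside will do.\<close>

theorem approx_UNIV:
 assumes W0: "is_subfield W0" "approx W0"
 shows "approx UNIV"
proof -
 define \<A> where "\<A> = {W. is_subfield W \<and> approx W}"
 have ne: "\<A> ~= {}" using W0 by (auto simp: \<A>_def)
 have "\<exists>S\<in>\<A>. \<forall>T\<in>\<A>. S \<subseteq> T --> T = S"
 proof (rule subset_Zorn_nonempty[OF ne])
  fix \<C> assume C: "\<C> ~= {}" "subset.chain \<A> \<C>"
  have CA: "\<And>S. S \<in> \<C> ==> is_subfield S \<and> approx S" and lin: "\<And>S T. S \<in> \<C> ==> T \<in> \<C> ==> S \<subseteq> T \<or> T \<subseteq> S"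
   using C(2) by (auto simp: subset_chain_def \<A>_def)
  have two: "\<exists>S\<in>\<C>. s \<in> S \<and> t \<in> S" if st: "s \<in> \<Union>\<C>" "t \<in> \<Union>\<C>" for s t
   using st lin by (meson UnionE subsetD)
  obtain S0 where S0: "S0 \<in> \<C>" using C by blast
  have "is_subring (\<Union>\<C>)"
  proof (rule is_subringI)
   show "1 \<in> \<Union>\<C>" using S0 CA subring_one[OF subfield_subring] by blast
   fix x assume x: "x \<in> \<Union>\<C>"
   then show "- x \<in> \<Union>\<C>" using CA subring_uminus[OF subfield_subring] by blast
   fix y assume "y \<in> \<Union>\<C>"
   then obtain S where "S \<in> \<C>" "x \<in> S" "y \<in> S" using two x by blast
   then show "x + y \<in> \<Union>\<C>" "x * y \<in> \<Union>\<C>"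
    using CA subring_add[OF subfield_subring] subring_mult[OF subfield_subring] by blast+
  qed
  moreover have "inverse x \<in> \<Union>\<C>" if "x \<in> \<Union>\<C>" for x using that CA subfield_inverse by blast
  ultimately have sf: "is_subfield (\<Union>\<C>)" by (simp add: is_subfield_def)
  have "approx (\<Union>\<C>)"
   unfolding approx_def
  proof (intro allI impI)
   fix S assume S: "finite S" "S \<subseteq> \<Union>\<C>"
   have "\<exists>W\<in>\<C>. S \<subseteq> W" using S
   proof (induction S rule: finite_induct)
    case empty
    then show ?case using S0 by blast
   next
    case (insert s S)
    then obtain W W' where "W \<in> \<C>" "S \<subseteq> W" "W' \<in> \<C>" "s \<in> W'" by auto
    then show ?case using lin[of W W'] by (meson insert_subset subset_trans subsetD)
   qed
   then obtain W where W: "W \<in> \<C>" "S \<subseteq> W" by blast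
   then have "\<exists>D hm E. target_hom D hm E \<and> D \<subseteq> W \<and> S \<subseteq> D \<and> agree S hm"
    using CA[OF W(1)] S(1) by (simp add: approx_def)
   then obtain D hm E where "target_hom D hm E" "D \<subseteq> W" "S \<subseteq> D" "agree S hm" by blast
   moreover have "W \<subseteq> \<Union>\<C>" using W by blast
   ultimately show "\<exists>D hm E. target_hom D hm E \<and> D \<subseteq> \<Union>\<C> \<and> S \<subseteq> D \<and> agree S hm"
    by (meson subset_trans)
  qed
  with sf show "\<Union>\<C> \<in> \<A>" by (simp add: \<A>_def)
 qed
 then obtain W where W: "is_subfield W" "approx W" and mx: "\<And>T. is_subfield T ==> approx T ==> W \<subseteq> T ==> T = W"
  by (auto simp: \<A>_def)
 have "W = UNIV"
 proof (rule ccontr)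
  assume nU: "W ~= UNIV"
  have "\<exists>y p0. minimal_gen W y p0"
  proof (cases "rel_closed W")
   case True
   obtain y where "y \<notin> W" using nU by blast
   then show ?thesis using True by (intro exI[of _ y] exI[of _ 0]) (simp add: minimal_gen_def)
  next
   case False
   define P where "P = {p \<in> polys_over W. p ~= 0 \<and> (\<exists>x. poly p x = 0 \<and> x \<notin> W)}"
   have "\<exists>p. p \<in> P" using False by (auto simp: rel_closed_def P_def)
   then obtain p where p: "p \<in> P" and pmin: "\<And>q. q \<in> P ==> degree p \<le> degree q"
    using ex_has_least_nat[of "\<lambda>p. p \<in> P" _ degree] by blast
   obtain y where y: "poly p y = 0" "y \<notin> W" using p by (auto simp: P_def)
   have pW: "p \<in> polys_over W" "p ~= 0" using p by (auto simp: P_def)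
   define p0 where "p0 = smult (inverse (lead_coeff p)) p"
   have lW: "inverse (lead_coeff p) \<in> W" using pW W by (auto simp: polys_over_def intro: subfield_inverse)
   have "p0 \<in> polys_over W" unfolding p0_def using lW pW W by (intro polys_over_smult subfield_subring)
   moreover have "lead_coeff p0 = 1" "degree p0 = degree p" "p0 ~= 0" using pW by (auto simp: p0_def)
   moreover have "poly p0 y = 0" using y by (simp add: p0_def)
   moreover have "x \<in> W" if "q \<in> polys_over W" "q ~= 0" "degree q < degree p" "poly q x = 0" for q x
    using that pmin[of q] by (auto simp: P_def)
   ultimately have "minimal_gen W y p0" using y by (auto simp: minimal_gen_def)
   then show ?thesis by blast
  qed
  then obtain y p0 where mg: "minimal_gen W y p0" by blast
  have "field_adjoin W y = W"
   using mx is_subfield_field_adjoin[OF W(1)] approx_field_adjoin[OF W mg] by blast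
  then show False using is_subfield_field_adjoin(3)[OF W(1), of y] mg by (simp add: minimal_gen_def)
 qed
 then show ?thesis using W by simp
qed

end

section \<open>From valuations on a ring to valuation rings, and back\<close>

text \<open>The fractions of nonnegative value form a ring, those of positive value a proper ideal. Chevalley's theorem
  gives a ring containing the former, and the latter being nonunits there excludes all other fractions.\<close>

theorem valuation_extends:
 fixes e :: "'r::comm_ring_1 => 'a::field" and v :: "'r => real"
 assumes e: "phom UNIV e"
  and v_eq: "\<And>a b. e a = e b ==> v a = v b"
  and v_mult: "\<And>a b. e a ~= 0 ==> e b ~= 0 ==> v (a * b) = v a + v b"
  and v_add: "\<And>a b. e a ~= 0 ==> e b ~= 0 ==> e (a + b) ~= 0 ==> v (a + b) \<ge> min (v a) (v b)"
 obtains V where "is_vring V" "\<And>a b. e a ~= 0 ==> e b ~= 0 ==> e a / e b \<in> V \<longleftrightarrow> v a \<ge> v b"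
proof -
 note eh = phom_add[OF e UNIV_I UNIV_I] phom_mult[OF e UNIV_I UNIV_I] phom_one[OF e] phom_zero[OF e] phom_uminus[OF e UNIV_I]
 define A where "A = {e a / e b | a b. e b ~= 0 \<and> (e a ~= 0 --> v a \<ge> v b)}"
 define K where "K = {e a / e b | a b. e b ~= 0 \<and> (e a ~= 0 --> v a > v b)}"
 have v1: "v 1 = 0" using v_mult[of 1 1] eh by simp
 have vm1: "v (- 1) = 0" using v_mult[of "- 1" "- 1"] eh v1 by simp
 have vneg: "v (- a) = v a" if "e a ~= 0" for a using v_mult[of "- 1" a] that eh vm1 by simp
 have add: "e (a * d + c * b) ~= 0 --> v (a * d + c * b) - v (b * d) \<ge> t"
  if "e b ~= 0" "e d ~= 0" "e a ~= 0 --> v a - v b \<ge> t" "e c ~= 0 --> v c - v d \<ge> t" for a b c d t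
 proof
  assume ne: "e (a * d + c * b) ~= 0"
  consider "e a = 0" "e c ~= 0" | "e a ~= 0" "e c = 0" | "e a ~= 0" "e c ~= 0" using ne eh by fastforce
  then show "v (a * d + c * b) - v (b * d) \<ge> t"
  proof cases
   case 1
   then have "e (a * d + c * b) = e (c * b)" using eh by simp
   then have "v (a * d + c * b) = v c + v b" using v_eq v_mult[of c b] 1 that by metis
   then show ?thesis using that 1 v_mult[of b d] by simp
  next
   case 2
   then have "e (a * d + c * b) = e (a * d)" using eh by simp
   then have "v (a * d + c * b) = v a + v d" using v_eq v_mult[of a d] 2 that by metis
   then show ?thesis using that 2 v_mult[of b d] by simp
  next
   case 3
   then have "e (a * d) ~= 0" "e (c * b) ~= 0" using eh that by auto
   then have "v (a * d + c * b) \<ge> min (v a + v d) (v c + v b)"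
    using v_add[of "a * d" "c * b"] ne v_mult[of a d] v_mult[of c b] 3 that by simp
   then show ?thesis using that 3 v_mult[of b d] by linarith
  qed
 qed
 have "proper_pair A K"
  unfolding proper_pair_def
 proof (intro conjI ballI)
  show "is_subring A"
  proof (rule is_subringI)
   show "1 \<in> A" unfolding A_def using eh by (intro CollectI exI[of _ 1]) auto
  next
   fix x y assume "x \<in> A" "y \<in> A"
   then obtain a b c d where x: "x = e a / e b" "e b ~= 0" "e a ~= 0 --> v a \<ge> v b"
    and y: "y = e c / e d" "e d ~= 0" "e c ~= 0 --> v c \<ge> v d" unfolding A_def by blast
   have "x + y = e (a * d + c * b) / e (b * d)" using x y eh by (simp add: add_frac_eq)
   moreover have "e (a * d + c * b) ~= 0 --> v (a * d + c * b) \<ge> v (b * d)"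
    using add[of b d a 0 c] x y by simp
   moreover have "e (b * d) ~= 0" using x y eh by simp
   ultimately show "x + y \<in> A" unfolding A_def by blast
   have "x * y = e (a * c) / e (b * d)" using x y eh by simp
   moreover have "e (a * c) ~= 0 --> v (a * c) \<ge> v (b * d)"
    using x y v_mult[of a c] v_mult[of b d] eh by auto
   ultimately show "x * y \<in> A" unfolding A_def using \<open>e (b * d) ~= 0\<close> by blast
  next
   fix x assume "x \<in> A"
   then obtain a b where x: "x = e a / e b" "e b ~= 0" "e a ~= 0 --> v a \<ge> v b" unfolding A_def by blast
   then have "- x = e (- a) / e b" "e (- a) ~= 0 --> v (- a) \<ge> v b" using eh vneg by auto
   then show "- x \<in> A" unfolding A_def using x by blast
  qed
  show "K \<subseteq> A" unfolding K_def A_def by force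
  show "0 \<in> K" unfolding K_def using eh by (intro CollectI exI[of _ 0] exI[of _ 1]) auto
  show "1 \<notin> K"
  proof
   assume "1 \<in> K"
   then obtain a b where "1 = e a / e b" "e b ~= 0" "e a ~= 0 --> v a > v b" unfolding K_def by blast
   then show False using v_eq[of a b] by auto
  qed
 next
  fix x y assume "x \<in> K" "y \<in> K"
  then obtain a b c d where x: "x = e a / e b" "e b ~= 0" "e a ~= 0 --> v a > v b"
   and y: "y = e c / e d" "e d ~= 0" "e c ~= 0 --> v c > v d" unfolding K_def by blast
  define t where "t = min (if e a ~= 0 then v a - v b else 1) (if e c ~= 0 then v c - v d else 1)"
  have t: "t > 0" using x y by (auto simp: t_def)
  have "x + y = e (a * d + c * b) / e (b * d)" using x y eh by (simp add: add_frac_eq)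
  moreover have "e (a * d + c * b) ~= 0 --> v (a * d + c * b) > v (b * d)"
   using add[of b d a t c] x y t by (auto simp: t_def)
  moreover have "e (b * d) ~= 0" using x y eh by simp
  ultimately show "x + y \<in> K" unfolding K_def by blast
 next
  fix x y assume "x \<in> A" "y \<in> K"
  then obtain a b c d where x: "x = e a / e b" "e b ~= 0" "e a ~= 0 --> v a \<ge> v b"
   and y: "y = e c / e d" "e d ~= 0" "e c ~= 0 --> v c > v d" unfolding A_def K_def by blast
  have "x * y = e (a * c) / e (b * d)" using x y eh by simp
  moreover have "e (a * c) ~= 0 --> v (a * c) > v (b * d)"
   using x y v_mult[of a c] v_mult[of b d] eh by auto
  moreover have "e (b * d) ~= 0" using x y eh by simp
  ultimately show "x * y \<in> K" unfolding K_def by blast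
 qed
 then obtain V where V: "is_vring V" "A \<subseteq> V" "\<And>x. x \<in> K ==> x ~= 0 ==> inverse x \<notin> V" using chevalley by metis
 have "e a / e b \<in> V \<longleftrightarrow> v a \<ge> v b" if ab: "e a ~= 0" "e b ~= 0" for a b
 proof
  assume "v a \<ge> v b"
  then have "e a / e b \<in> A" unfolding A_def using ab by blast
  then show "e a / e b \<in> V" using V by blast
 next
  assume h: "e a / e b \<in> V"
  show "v a \<ge> v b"
  proof (rule ccontr)
   assume "\<not> v a \<ge> v b"
   then have "e b / e a \<in> K" unfolding K_def using ab by fastforce
   then have "inverse (e b / e a) \<notin> V" using V(3)[of "e b / e a"] ab by (metis divide_eq_0_iff)
   then show False using h by simp
  qed
 qed
 then show thesis using that V(1) by blast
qed

subsection \<open>Relative algebraic closure\<close>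

text \<open>The intersection of all valuation rings above a subfield is its relative algebraic closure. Taking
  this as the definition makes the closure properties immediate.\<close>

definition acl :: "'a::field set => 'a set" where
 "acl F = {x. \<forall>V. is_vring V --> F \<subseteq> V --> x \<in> V}"

lemma acl_mono: "F \<subseteq> G ==> acl F \<subseteq> acl G"
 by (auto simp: acl_def)

lemma acl_superset: "F \<subseteq> acl F"
 by (auto simp: acl_def)

lemma acl_subring: "is_subring (acl F)"
 unfolding acl_def by (rule is_subringI) (auto intro!: subring_intros dest: vring_subring)

text \<open>If \<open>x\<close> were not in \<open>V\<close>, the leading term would dominate the equation.\<close>

lemma root_in_vring:
 assumes V: "is_vring V" and p: "p \<in> polys_over V" "p ~= 0" "inverse (lead_coeff p) \<in> V" "poly p x = 0"
 shows "x \<in> V"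
proof (rule ccontr)
 assume "x \<notin> V"
 then have i: "inverse x \<in> maximal_ideal V" "x ~= 0" using not_in_vring[OF V] by auto
 let ?n = "degree p"
 have n: "?n > 0"
 proof (rule ccontr)
  assume "\<not> ?n > 0"
  then have d0: "degree p = 0" by simp
  obtain a where a: "p = [:a:]" using degree_eq_zeroE[OF d0] by blast
  then show False using p by simp
 qed
 have lp: "lead_coeff p ~= 0" using p by simp
 show False
 proof (rule sum_zero_two_minimal[OF V, of "{..?n}" "\<lambda>i. coeff p i * x ^ i" ?n])
  show "(\<Sum>i\<le>?n. coeff p i * x ^ i) = 0" using p by (simp add: poly_altdef)
  show "coeff p ?n * x ^ ?n ~= 0" using lp i by simp
  fix j assume j: "j \<in> {..?n}" "j ~= ?n"
  define m where "m = ?n - j - 1"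
  have "x ^ ?n = x ^ j * (x * x ^ m)" using j by (simp add: m_def flip: power_Suc power_add)
  then have e: "coeff p j * x ^ j / (coeff p ?n * x ^ ?n) = (coeff p j * inverse (lead_coeff p) * inverse x ^ m) * inverse x"
   using i lp by (simp add: field_simps power_inverse)
  have "inverse x ^ m \<in> V" using i by (auto intro: subring_power[OF vring_subring[OF V]] maximal_sub)
  then have "coeff p j * inverse (lead_coeff p) * inverse x ^ m \<in> V"
   using p(1,3) by (intro subring_mult[OF vring_subring[OF V]]) (auto simp: polys_over_def)
  then show "coeff p j * x ^ j / (coeff p ?n * x ^ ?n) \<in> maximal_ideal V"
   unfolding e using maximal_mult[OF V i(1)] by blast
 qed auto
qed

text \<open>If \<open>x\<close> is transcendental, then \<open>1 / x\<close> generates a proper ideal in the polynomial ring generated by it, and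
  Chevalley's theorem gives a valuation ring without \<open>x\<close>.\<close>

lemma acl_algebraic:
 assumes F: "is_subfield F" and x: "x \<in> acl F"
 shows "\<exists>p\<in>polys_over F. p ~= 0 \<and> poly p x = 0"
proof (rule ccontr)
 assume no: "\<not> ?thesis"
 note Fr = subfield_subring[OF F]
 note PF = is_subring_polys_over[OF Fr]
 have x0: "x ~= 0"
 proof
  assume "x = 0"
  moreover have "[:0, 1:] \<in> polys_over F" using Fr by (auto intro!: polys_over_intros intro: subring_intros)
  ultimately show False using no by force
 qed
 define A where "A = adjoin F (inverse x)"
 define K where "K = (\<lambda>p. poly p (inverse x)) ` {p \<in> polys_over F. coeff p 0 = 0}"
 have "proper_pair A K"
  unfolding proper_pair_def
 proof (intro conjI ballI)
  show "is_subring A" unfolding A_def by (rule is_subring_adjoin[OF Fr])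
  show "K \<subseteq> A" unfolding A_def K_def adjoin_def by blast
  show "0 \<in> K" unfolding K_def using subring_zero[OF PF] by (intro image_eqI[of _ _ 0]) auto
  show "1 \<notin> K"
  proof
   assume "1 \<in> K"
   then obtain p where p: "p \<in> polys_over F" "coeff p 0 = 0" "poly p (inverse x) = 1" unfolding K_def by auto
   define q where "q = 1 - p"
   have q: "q \<in> polys_over F" unfolding q_def using p subring_one[OF PF] by (intro subring_diff[OF PF])
   have "coeff q 0 = 1" using p by (simp add: q_def)
   then have q0: "q ~= 0" by auto
   have "poly (reflect_poly q) x = x ^ degree q * poly q (inverse x)"
    using x0 by (rule poly_reflect_poly_nz)
   then have "poly (reflect_poly q) x = 0" using p by (simp add: q_def)
   moreover have "reflect_poly q \<in> polys_over F"
    using q subring_zero[OF Fr] by (auto simp: polys_over_def coeff_reflect_poly)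
   moreover have "reflect_poly q ~= 0" using q0 by simp
   ultimately show False using no by blast
  qed
 next
  fix a b assume "a \<in> K" "b \<in> K"
  then obtain p q where "p \<in> polys_over F" "coeff p 0 = 0" "a = poly p (inverse x)"
   "q \<in> polys_over F" "coeff q 0 = 0" "b = poly q (inverse x)" unfolding K_def by blast
  then show "a + b \<in> K" unfolding K_def using subring_add[OF PF, of p q]
   by (intro image_eqI[of _ _ "p + q"]) auto
 next
  fix a b assume "a \<in> A" "b \<in> K"
  then obtain p q where "p \<in> polys_over F" "a = poly p (inverse x)"
   "q \<in> polys_over F" "coeff q 0 = 0" "b = poly q (inverse x)" unfolding K_def A_def adjoin_def by blast
  then show "a * b \<in> K" unfolding K_def using subring_mult[OF PF, of p q]
   by (intro image_eqI[of _ _ "p * q"]) (auto simp: coeff_mult)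
 qed
 then obtain V where V: "is_vring V" "A \<subseteq> V" "\<And>x. x \<in> K ==> x ~= 0 ==> inverse x \<notin> V" using chevalley by metis
 have "inverse x \<in> K" unfolding K_def using Fr
  by (intro image_eqI[of _ _ "[:0, 1:]"]) (auto intro!: polys_over_intros intro: subring_intros)
 then have "x \<notin> V" using V(3)[of "inverse x"] x0 by simp
 moreover have "F \<subseteq> V" using V(2) adjoin_superset[OF Fr] unfolding A_def by blast
 ultimately show False using x V(1) by (auto simp: acl_def)
qed

lemma acl_subfield:
 assumes F: "is_subfield F" shows "is_subfield (acl F)"
proof -
 have "inverse x \<in> acl F" if x: "x \<in> acl F" for x
 proof (cases "x = 0")
  case False
  define P where "P = {p \<in> polys_over F. p ~= 0 \<and> poly p x = 0}"
  obtain p1 where "p1 \<in> P" using acl_algebraic[OF F x] by (auto simp: P_def)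
  then obtain p where p: "p \<in> P" and pmin: "\<And>q. q \<in> P ==> degree p \<le> degree q"
   using ex_has_least_nat[of "\<lambda>p. p \<in> P" _ degree] by blast
  have c0: "coeff p 0 ~= 0"
  proof
   assume h: "coeff p 0 = 0"
   obtain a q where q: "p = pCons a q" by (cases p)
   then have "q \<in> P" using p h False polys_over_pCons_iff[of a q F] by (auto simp: P_def)
   then show False using pmin[of q] q by (auto simp: P_def split: if_splits)
  qed
  have "poly (reflect_poly p) (inverse x) = inverse x ^ degree p * poly p (inverse (inverse x))"
   using False by (intro poly_reflect_poly_nz) simp
  then have r: "poly (reflect_poly p) (inverse x) = 0" using p by (simp add: P_def)
  show ?thesis
   unfolding acl_def
  proof (intro CollectI allI impI)
   fix V assume V: "is_vring V" "F \<subseteq> V"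
   have cF: "coeff p i \<in> F" for i using p by (auto simp: P_def polys_over_def)
   show "inverse x \<in> V"
   proof (rule root_in_vring[OF V(1) _ _ _ r])
    show "reflect_poly p \<in> polys_over V"
     using cF V subring_zero[OF vring_subring[OF V(1)]] by (auto simp: polys_over_def coeff_reflect_poly)
    show "reflect_poly p ~= 0" using p by (simp add: P_def)
    have "lead_coeff (reflect_poly p) = coeff p 0" using c0 by (simp add: coeff_reflect_poly)
    then show "inverse (lead_coeff (reflect_poly p)) \<in> V"
     using cF[of 0] subfield_inverse[OF F] V(2) by auto
   qed
  qed
 qed (use x in simp)
 then show ?thesis using acl_subring by (simp add: is_subfield_def)
qed

lemma acl_rel_closed:
 assumes F: "is_subfield F" shows "rel_closed (acl F)"
 unfolding rel_closed_def
proof (intro ballI impI allI)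
 fix p x assume p: "p \<in> polys_over (acl F)" "p ~= 0" "poly p x = 0"
 show "x \<in> acl F"
  unfolding acl_def
 proof (intro CollectI allI impI)
  fix V assume V: "is_vring V" "F \<subseteq> V"
  have sub: "acl F \<subseteq> V" using V by (auto simp: acl_def)
  have "inverse (lead_coeff p) \<in> acl F" using p by (intro subfield_inverse acl_subfield F) (auto simp: polys_over_def)
  then show "x \<in> V" using root_in_vring[OF V(1) _ p(2) _ p(3)] polys_over_mono[OF sub] p(1) sub by blast
 qed
qed

section \<open>A large algebraically closed field with prescribed real valuations\<close>

type_synonym gring = "(nat \<Rightarrow>\<^sub>0 nat) \<Rightarrow>\<^sub>0 real"
text \<open>The rational functions in countably many variables provide fresh transcendentals at every stage. Their algebraic
  closure serves for generic points and as the target of a transport.\<close>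

type_synonym host = "((nat \<Rightarrow>\<^sub>0 nat) \<Rightarrow>\<^sub>0 real) fract alg_closure"

definition emb :: "gring => host" where
 "emb p = to_ac (to_fract p)"

lemma phom_emb: "phom UNIV emb"
 unfolding phom_def emb_def by (auto simp: is_subring_def)

lemmas emb_simps = phom_add[OF phom_emb UNIV_I UNIV_I] phom_mult[OF phom_emb UNIV_I UNIV_I]
 phom_one[OF phom_emb] phom_zero[OF phom_emb] phom_uminus[OF phom_emb UNIV_I]
 phom_diff[OF phom_emb UNIV_I UNIV_I] phom_power[OF phom_emb UNIV_I]

lemma emb_eq_iff [simp]: "emb p = emb q \<longleftrightarrow> p = q"
 by (simp add: emb_def)

lemma emb_eq_0_iff [simp]: "emb p = 0 \<longleftrightarrow> p = 0"
 using emb_eq_iff[of p 0] by (simp add: emb_simps del: emb_eq_iff)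

definition gconst :: "real => host" where
 "gconst c = emb (Poly_Mapping.single 0 c)"

definition gvar :: "nat => gring" where
 "gvar i = Poly_Mapping.single (Poly_Mapping.single i 1) 1"

lemma phom_gconst: "phom UNIV gconst"
proof -
 have "Poly_Mapping.single (0 :: nat \<Rightarrow>\<^sub>0 nat) (x * y :: real) = Poly_Mapping.single 0 x * Poly_Mapping.single 0 y" for x y
  by (simp add: mult_single)
 then show ?thesis unfolding phom_def gconst_def by (simp add: is_subring_def single_add emb_simps)
qed

lemma to_fract_cases: "\<exists>a b. b ~= 0 \<and> x = to_fract a / to_fract b"
 by (cases x) (auto simp: to_fract_def)

subsection \<open>Monomial valuations\<close>

definition mweight :: "(nat => real) => (nat \<Rightarrow>\<^sub>0 nat) => real" where
 "mweight \<gamma> \<alpha> = (\<Sum>j\<in>Poly_Mapping.keys \<alpha>. real (Poly_Mapping.lookup \<alpha> j) * \<gamma> j)"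

definition mval :: "(nat => real) => gring => real" where
 "mval \<gamma> p = Min (mweight \<gamma> ` Poly_Mapping.keys p)"

lemma mweight_superset:
 assumes "finite K" "Poly_Mapping.keys \<alpha> \<subseteq> K"
 shows "mweight \<gamma> \<alpha> = (\<Sum>j\<in>K. real (Poly_Mapping.lookup \<alpha> j) * \<gamma> j)"
 unfolding mweight_def using assms by (intro sum.mono_neutral_left) (auto simp: in_keys_iff)

lemma mweight_add: "mweight \<gamma> (\<alpha> + \<beta>) = mweight \<gamma> \<alpha> + mweight \<gamma> \<beta>"
proof -
 let ?K = "Poly_Mapping.keys \<alpha> \<union> Poly_Mapping.keys \<beta>"
 have "mweight \<gamma> (\<alpha> + \<beta>) = (\<Sum>j\<in>?K. real (Poly_Mapping.lookup (\<alpha> + \<beta>) j) * \<gamma> j)"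
  by (rule mweight_superset) (use Poly_Mapping.keys_add[of \<alpha> \<beta>] in auto)
 also have "\<dots> = (\<Sum>j\<in>?K. real (Poly_Mapping.lookup \<alpha> j) * \<gamma> j) + (\<Sum>j\<in>?K. real (Poly_Mapping.lookup \<beta> j) * \<gamma> j)"
  by (simp add: lookup_add distrib_right sum.distrib)
 finally show ?thesis using mweight_superset[of ?K \<alpha> \<gamma>] mweight_superset[of ?K \<beta> \<gamma>] by simp
qed

lemma mval_le: "\<alpha> \<in> Poly_Mapping.keys p ==> mval \<gamma> p \<le> mweight \<gamma> \<alpha>"
 unfolding mval_def by (intro Min_le) auto

lemma mval_attained: "p ~= 0 ==> \<exists>\<alpha>\<in>Poly_Mapping.keys p. mweight \<gamma> \<alpha> = mval \<gamma> p"
proof -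
 assume "p ~= 0"
 then have "mval \<gamma> p \<in> mweight \<gamma> ` Poly_Mapping.keys p"
  unfolding mval_def by (intro Min_in) auto
 then show ?thesis by auto
qed

lemma mval_eqI: "\<alpha> \<in> Poly_Mapping.keys p ==> mweight \<gamma> \<alpha> = c ==> (\<And>\<beta>. \<beta> \<in> Poly_Mapping.keys p ==> c \<le> mweight \<gamma> \<beta>) ==> mval \<gamma> p = c"
 unfolding mval_def by (intro Min_eqI) auto

lemma mval_add:
 assumes "p ~= 0" "q ~= 0" "p + q ~= 0" shows "mval \<gamma> (p + q) \<ge> min (mval \<gamma> p) (mval \<gamma> q)"
proof -
 obtain \<alpha> where a: "\<alpha> \<in> Poly_Mapping.keys (p + q)" "mweight \<gamma> \<alpha> = mval \<gamma> (p + q)" using mval_attained[OF assms(3)] by blast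
 have "\<alpha> \<in> Poly_Mapping.keys p \<union> Poly_Mapping.keys q" by (rule subsetD[OF Poly_Mapping.keys_add a(1)])
 then show ?thesis
 proof
  assume "\<alpha> \<in> Poly_Mapping.keys p"
  then show ?thesis using mval_le[of \<alpha> p \<gamma>] a(2) by linarith
 next
  assume "\<alpha> \<in> Poly_Mapping.keys q"
  then show ?thesis using mval_le[of \<alpha> q \<gamma>] a(2) by linarith
 qed
qed

text \<open>The product of the two initial forms is nonzero and homogeneous, and every other product of
  monomials has larger weight.\<close>

lemma mval_mult:
 assumes p: "p ~= 0" and q: "q ~= 0" shows "mval \<gamma> (p * q) = mval \<gamma> p + mval \<gamma> q"
proof -
 define ini where "ini = (\<lambda>r::gring. \<Sum>\<alpha>\<in>{\<alpha> \<in> Poly_Mapping.keys r. mweight \<gamma> \<alpha> = mval \<gamma> r}. Poly_Mapping.single \<alpha> (Poly_Mapping.lookup r \<alpha>))"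
 have lk: "Poly_Mapping.lookup (ini r) k = (if mweight \<gamma> k = mval \<gamma> r then Poly_Mapping.lookup r k else 0)" for r k
 proof -
  have "Poly_Mapping.lookup (ini r) k = (\<Sum>\<alpha>\<in>{\<alpha> \<in> Poly_Mapping.keys r. mweight \<gamma> \<alpha> = mval \<gamma> r}. if \<alpha> = k then Poly_Mapping.lookup r \<alpha> else 0)"
   unfolding ini_def lookup_sum by (intro sum.cong) (auto simp: lookup_single when_def)
  also have "\<dots> = (if k \<in> {\<alpha> \<in> Poly_Mapping.keys r. mweight \<gamma> \<alpha> = mval \<gamma> r} then Poly_Mapping.lookup r k else 0)"
   by (rule sum.delta) simp
  finally show ?thesis by (auto simp: in_keys_iff)
 qed
 have ki: "mweight \<gamma> k = mval \<gamma> r" if "k \<in> Poly_Mapping.keys (ini r)" for r k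
  using that lk[of r k] by (auto simp: in_keys_iff split: if_splits)
 have kr: "mweight \<gamma> k > mval \<gamma> r" if "k \<in> Poly_Mapping.keys (r - ini r)" for r k
 proof -
  have "Poly_Mapping.lookup r k ~= 0 \<and> mweight \<gamma> k ~= mval \<gamma> r"
   using that by (auto simp: in_keys_iff lookup_minus lk split: if_splits)
  then show ?thesis using mval_le[of k r \<gamma>] by (auto simp: in_keys_iff)
 qed
 have ini0: "ini r ~= 0" if r: "r ~= 0" for r
 proof
  assume "ini r = 0"
  moreover obtain \<alpha> where "\<alpha> \<in> Poly_Mapping.keys r" "mweight \<gamma> \<alpha> = mval \<gamma> r" using mval_attained[OF r] by blast
  ultimately show False using lk[of r \<alpha>] by (auto simp: in_keys_iff)
 qed
 define rest where "rest = ini p * (q - ini q) + (p - ini p) * q"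
 have dec: "p * q = ini p * ini q + rest" by (simp add: rest_def algebra_simps)
 have wq: "mweight \<gamma> k \<ge> mval \<gamma> q" if "k \<in> Poly_Mapping.keys q" for k using mval_le that by blast
 have restw: "mweight \<gamma> k > mval \<gamma> p + mval \<gamma> q" if "k \<in> Poly_Mapping.keys rest" for k
 proof -
  have "k \<in> Poly_Mapping.keys (ini p * (q - ini q)) \<union> Poly_Mapping.keys ((p - ini p) * q)"
   by (rule subsetD[OF Poly_Mapping.keys_add that[unfolded rest_def]])
  then consider a b where "k = a + b" "a \<in> Poly_Mapping.keys (ini p)" "b \<in> Poly_Mapping.keys (q - ini q)"
   | a b where "k = a + b" "a \<in> Poly_Mapping.keys (p - ini p)" "b \<in> Poly_Mapping.keys q"
   using Poly_Mapping.keys_mult[of "ini p" "q - ini q"] Poly_Mapping.keys_mult[of "p - ini p" q] by blast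
  then show ?thesis by cases (use ki kr wq in \<open>force simp: mweight_add\<close>)+
 qed
 have "ini p * ini q ~= 0" using ini0 p q by simp
 then obtain k where k: "k \<in> Poly_Mapping.keys (ini p * ini q)" using keys_eq_empty by blast
 have wk: "mweight \<gamma> k = mval \<gamma> p + mval \<gamma> q" if k: "k \<in> Poly_Mapping.keys (ini p * ini q)" for k
 proof -
  obtain a b where "k = a + b" "a \<in> Poly_Mapping.keys (ini p)" "b \<in> Poly_Mapping.keys (ini q)"
   using k Poly_Mapping.keys_mult[of "ini p" "ini q"] by blast
  then show ?thesis using ki by (simp add: mweight_add)
 qed
 have "k \<notin> Poly_Mapping.keys rest" using restw[of k] wk[OF k] by auto
 then have kpq: "k \<in> Poly_Mapping.keys (p * q)" using k by (auto simp: dec in_keys_iff lookup_add)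
 show ?thesis
 proof (rule mval_eqI[OF kpq wk[OF k]])
  fix \<beta> assume "\<beta> \<in> Poly_Mapping.keys (p * q)"
  then have "\<beta> \<in> Poly_Mapping.keys (ini p * ini q) \<union> Poly_Mapping.keys rest"
   unfolding dec by (rule subsetD[OF Poly_Mapping.keys_add])
  then show "mval \<gamma> p + mval \<gamma> q \<le> mweight \<gamma> \<beta>" using wk restw by fastforce
 qed
qed

lemma mval_single: "c ~= 0 ==> mval \<gamma> (Poly_Mapping.single \<alpha> c) = mweight \<gamma> \<alpha>"
 by (rule mval_eqI[of \<alpha>]) auto

lemma mval_one: "mval \<gamma> 1 = 0"
 using mval_single[of 1 \<gamma> 0] by (simp add: mweight_def)

lemma mval_gvar: "mval \<gamma> (gvar i) = \<gamma> i"
 unfolding gvar_def by (simp add: mval_single mweight_def)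

lemma gvar_nz: "gvar i ~= 0"
 by (metis gvar_def lookup_single_eq lookup_zero zero_neq_one)

lemma mweight_0 [simp]: "mweight \<gamma> 0 = 0"
 by (simp add: mweight_def)

lemma monomial_vring:
 obtains V where "is_vring V" "\<And>a b. a ~= 0 ==> b ~= 0 ==> emb a / emb b \<in> V \<longleftrightarrow> mval \<gamma> a \<ge> mval \<gamma> b"
proof (rule valuation_extends[OF phom_emb, of "mval \<gamma>"])
 fix V :: "host set"
 assume "is_vring V" "\<And>a b. emb a ~= 0 ==> emb b ~= 0 ==> emb a / emb b \<in> V \<longleftrightarrow> mval \<gamma> a \<ge> mval \<gamma> b"
 then show thesis using that by simp
qed (auto simp: mval_mult mval_add)

text \<open>The host field is algebraic over the rational functions. Two terms in an equation for \<open>x\<close> must have the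
  same value, so a power of \<open>x\<close> agrees up to a unit with a rational function.\<close>

lemma host_algebraic_value:
 assumes V: "is_vring (V :: host set)" and x: "x ~= 0"
 shows "\<exists>n a b. n > 0 \<and> a ~= 0 \<and> b ~= 0 \<and> x ^ n / (emb a / emb b) \<in> units_of_vring V"
proof -
 obtain p :: "gring fract poly" where p: "p ~= 0" "poly (map_poly to_ac p) x = 0" by (rule alg_closure_algebraic)
 define c where "c = (\<lambda>i. to_ac (coeff p i))"
 define T where "T = {i. i \<le> degree p \<and> coeff p i ~= 0}"
 define t where "t = (\<lambda>i. c i * x ^ i)"
 have tn: "t i ~= 0" if "i \<in> T" for i using that x by (simp add: T_def t_def c_def)
 have T: "finite T" "T ~= {}" using p(1) by (auto simp: T_def intro!: exI[of _ "degree p"])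
 have "0 = (\<Sum>i\<le>degree (map_poly to_ac p). coeff (map_poly to_ac p) i * x ^ i)" using p(2) by (simp add: poly_altdef)
 also have "\<dots> = (\<Sum>i\<le>degree p. t i)"
  by (rule sum.mono_neutral_cong_left) (auto simp: t_def c_def coeff_map_poly coeff_eq_0 degree_map_poly)
 also have "\<dots> = (\<Sum>i\<in>T. t i)" by (rule sum.mono_neutral_right) (auto simp: T_def t_def c_def)
 finally have s: "(\<Sum>i\<in>T. t i) = 0" by simp
 have tT: "finite (t ` T)" "t ` T ~= {}" using T by auto
 have tT3: "0 \<notin> t ` T" using tn by (metis imageE)
 obtain y where y: "y \<in> t ` T" "\<forall>b\<in>t ` T. b / y \<in> V" using vring_finite_min[OF V tT tT3] by (elim bexE)
 then obtain m where m: "m \<in> T" "\<And>i. i \<in> T ==> t i / t m \<in> V" by auto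
 have "\<exists>i\<in>T. i ~= m \<and> t i / t m \<notin> maximal_ideal V"
  using sum_zero_two_minimal[OF V T(1) s m(1) tn[OF m(1)]] by blast
 then obtain i where i: "i \<in> T" "i ~= m" "t i / t m \<in> units_of_vring V" using m(2) vring_cases by blast
 have key: "\<exists>n a b. n > 0 \<and> a ~= 0 \<and> b ~= 0 \<and> x ^ n / (emb a / emb b) \<in> units_of_vring V"
  if jk: "j \<in> T" "k \<in> T" "j < k" "t k / t j \<in> units_of_vring V" for j k
 proof -
  obtain a b where ab: "b ~= 0" "coeff p j / coeff p k = to_fract a / to_fract b" using to_fract_cases by blast
  have nz: "coeff p j ~= 0" "coeff p k ~= 0" using jk by (auto simp: T_def)
  have a0: "a ~= 0" using ab nz by auto
  have e: "emb a / emb b = c j / c k" unfolding emb_def c_def using ab by (metis to_ac_divide)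
  have "x ^ k = x ^ j * x ^ (k - j)" using jk by (simp flip: power_add)
  then have "t k / t j = x ^ (k - j) / (emb a / emb b)" unfolding e using x by (simp add: t_def)
  then show ?thesis using jk a0 ab by (intro exI[of _ "k - j"] exI[of _ a] exI[of _ b]) auto
 qed
 show ?thesis
 proof (cases "m < i")
  case True
  then show ?thesis using key[OF m(1) i(1)] i(3) by blast
 next
  case False
  then have "i < m" using i(2) by simp
  moreover have "t m / t i \<in> units_of_vring V" using units_inverse[OF i(3)] by simp
  ultimately show ?thesis using key[OF i(1) m(1)] by blast
 qed
qed

text \<open>The value of \<open>x\<close> is the value of the rational function agreeing with \<open>x ^ n\<close> up to a unit, divided by \<open>n\<close>.\<close>

theorem monomial_real_valuation:
 obtains V and N :: "host => real" where "is_vring V"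
  "\<And>x y. x ~= 0 ==> y ~= 0 ==> N (x * y) = N x + N y"
  "\<And>x y. x ~= 0 ==> y ~= 0 ==> x + y ~= 0 ==> N (x + y) \<ge> min (N x) (N y)"
  "\<And>x. x ~= 0 ==> x \<in> V \<longleftrightarrow> N x \<ge> 0"
  "\<And>p. p ~= 0 ==> N (emb p) = mval \<gamma> p"
proof -
 obtain V :: "host set" where V: "is_vring V"
  and Viff: "\<And>a b. a ~= 0 ==> b ~= 0 ==> emb a / emb b \<in> V \<longleftrightarrow> mval \<gamma> a \<ge> mval \<gamma> b"
  using monomial_vring by metis
 note Vr = vring_subring[OF V]
 define Q where "Q = (\<lambda>x (n, a, b). n > 0 \<and> a ~= 0 \<and> b ~= 0 \<and> x ^ n / (emb a / emb b) \<in> units_of_vring V)"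
 define N where "N = (\<lambda>x. case (SOME s. Q x s) of (n, a, b) => (mval \<gamma> a - mval \<gamma> b) / real n)"
 have inV: "x \<in> V \<longleftrightarrow> (mval \<gamma> a - mval \<gamma> b) / real n \<ge> 0" if Q: "Q x (n, a, b)" for x n a b
 proof -
  have n: "n > 0" and ab: "a ~= 0" "b ~= 0" and u: "x ^ n / (emb a / emb b) \<in> units_of_vring V" using Q by (auto simp: Q_def)
  have "x ^ n = (emb a / emb b) * (x ^ n / (emb a / emb b))" using ab by simp
  then have "x \<in> V \<longleftrightarrow> emb a / emb b \<in> V"
   using power_in_vring_iff[OF V n, of x] mult_unit_in_vring_iff[OF V u, of "emb a / emb b"] by simp
  then show ?thesis using Viff[OF ab] n by (simp add: zero_le_divide_iff)
 qed
 have mono: "Q x (n, a, b) ==> Q y (m, c, d) ==> Q (x * y) (n * m, a ^ m * c ^ n, b ^ m * d ^ n) \<and>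
  (mval \<gamma> (a ^ m * c ^ n) - mval \<gamma> (b ^ m * d ^ n)) / real (n * m) = (mval \<gamma> a - mval \<gamma> b) / real n + (mval \<gamma> c - mval \<gamma> d) / real m" for x y n m a b c d
 proof -
  assume Q: "Q x (n, a, b)" "Q y (m, c, d)"
  have nm: "n > 0" "m > 0" and nz: "a ~= 0" "b ~= 0" "c ~= 0" "d ~= 0" using Q by (auto simp: Q_def)
  have mp: "mval \<gamma> (p ^ k) = real k * mval \<gamma> p" if "p ~= 0" for p k
  proof (induction k)
   case 0
   then show ?case by (simp add: mval_one)
  qed (use that in \<open>simp add: mval_mult distrib_right\<close>)
  have "(x * y) ^ (n * m) / (emb (a ^ m * c ^ n) / emb (b ^ m * d ^ n)) =
   (x ^ n / (emb a / emb b)) ^ m * (y ^ m / (emb c / emb d)) ^ n"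
   by (simp add: emb_simps power_mult_distrib power_divide mult.commute flip: power_mult)
  moreover have "(x ^ n / (emb a / emb b)) ^ m * (y ^ m / (emb c / emb d)) ^ n \<in> units_of_vring V"
   using Q by (intro units_mult[OF V] units_power[OF V]) (auto simp: Q_def)
  ultimately have "Q (x * y) (n * m, a ^ m * c ^ n, b ^ m * d ^ n)" using nm nz by (simp add: Q_def)
  moreover have "(mval \<gamma> (a ^ m * c ^ n) - mval \<gamma> (b ^ m * d ^ n)) / real (n * m) = (mval \<gamma> a - mval \<gamma> b) / real n + (mval \<gamma> c - mval \<gamma> d) / real m"
   using nm nz by (simp add: mval_mult mp field_simps)
  ultimately show ?thesis by blast
 qed
 have Qinv: "Q (inverse x) (n, b, a)" if "Q x (n, a, b)" for x n a b
 proof -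
  have "inverse x ^ n / (emb b / emb a) = inverse (x ^ n / (emb a / emb b))"
   by (simp add: power_inverse divide_inverse inverse_mult_distrib mult.assoc mult.left_commute mult.commute)
  then show ?thesis using that units_inverse[of "x ^ n / (emb a / emb b)" V] by (auto simp: Q_def)
 qed
 have uniq: "(mval \<gamma> a - mval \<gamma> b) / real n = (mval \<gamma> c - mval \<gamma> d) / real m" if Q: "Q x (n, a, b)" "Q x (m, c, d)" "x ~= 0" for x n a b m c d
 proof -
  have le: "(mval \<gamma> a - mval \<gamma> b) / real n \<ge> (mval \<gamma> c - mval \<gamma> d) / real m" if Q: "Q x (n, a, b)" "Q x (m, c, d)" for n a b m c d
  proof -
   have one: "1 \<in> V" using subring_one[OF Vr] .
   have "x * inverse x \<in> V" using \<open>x ~= 0\<close> one by simp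
   then have "0 \<le> (mval \<gamma> a - mval \<gamma> b) / real n + (mval \<gamma> d - mval \<gamma> c) / real m"
    using inV mono[OF Q(1) Qinv[OF Q(2)]] by metis
   then show ?thesis by (simp add: diff_divide_distrib)
  qed
  show ?thesis using le[OF Q(1,2)] le[OF Q(2,1)] by linarith
 qed
 have Nval: "N x = (mval \<gamma> a - mval \<gamma> b) / real n" if Q: "Q x (n, a, b)" "x ~= 0" for x n a b
 proof -
  have "Q x (SOME s. Q x s)" using Q(1) by (rule someI)
  moreover obtain m c d where s: "(SOME s. Q x s) = (m, c, d)" by (metis prod_cases3)
  ultimately have "Q x (m, c, d)" by simp
  then show ?thesis using uniq[OF _ Q(1,2)] s by (simp add: N_def)
 qed
 have ex: "\<exists>n a b. Q x (n, a, b)" if "x ~= 0" for x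
  using host_algebraic_value[OF V that] by (simp add: Q_def)
 have Nmult: "N (x * y) = N x + N y" if xy: "x ~= 0" "y ~= 0" for x y
 proof -
  obtain n a b m c d where Q: "Q x (n, a, b)" "Q y (m, c, d)" using ex[OF xy(1)] ex[OF xy(2)] by blast
  have "x * y ~= 0" using xy by simp
  then show ?thesis using mono[OF Q] Nval[of "x * y"] Nval[OF Q(1) xy(1)] Nval[OF Q(2) xy(2)] by metis
 qed
 have NV: "x \<in> V \<longleftrightarrow> N x \<ge> 0" if x: "x ~= 0" for x
 proof -
  obtain n a b where Q: "Q x (n, a, b)" using ex[OF x] by blast
  then show ?thesis using inV[OF Q] Nval[OF Q x] by simp
 qed
 have N1: "N 1 = 0" using Nmult[of 1 1] by simp
 have half: "N (x + y) \<ge> N y" if h: "x ~= 0" "y ~= 0" "x + y ~= 0" "N x \<ge> N y" for x y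
 proof -
  have "N x = N y + N (x / y)" using Nmult[of y "x / y"] h by simp
  then have "x / y \<in> V" using NV[of "x / y"] h by simp
  then have "1 + x / y \<in> V" using subring_add[OF Vr subring_one[OF Vr]] by blast
  moreover have e: "x + y = y * (1 + x / y)" using h by (simp add: distrib_left add.commute)
  moreover have "1 + x / y ~= 0" using e h by auto
  ultimately show ?thesis using Nmult[of y "1 + x / y"] NV[of "1 + x / y"] h by simp
 qed
 have Nadd: "N (x + y) \<ge> min (N x) (N y)" if "x ~= 0" "y ~= 0" "x + y ~= 0" for x y
  using half[of x y] half[of y x] that by (cases "N x \<ge> N y") (auto simp: add.commute)
 have "N (emb p) = mval \<gamma> p" if "p ~= 0" for p
 proof -
  have "Q (emb p) (1, p, 1)" using that units_one[OF V] by (simp add: Q_def emb_simps)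
  then show ?thesis using Nval[of "emb p"] that by (simp add: mval_one)
 qed
 then show thesis using that[OF V Nmult Nadd NV] by blast
qed

subsection \<open>A chain of relatively closed subfields\<close>

definition polys_in :: "nat set => gring set" where
 "polys_in S = {p. \<forall>\<alpha>\<in>Poly_Mapping.keys p. Poly_Mapping.keys \<alpha> \<subseteq> S}"

definition gfield :: "nat set => host set" where
 "gfield S = {emb p / emb q | p q. p \<in> polys_in S \<and> q \<in> polys_in S}"

lemma polys_in_subring: "is_subring (polys_in S)"
proof (rule is_subringI)
 show "1 \<in> polys_in S" by (auto simp: polys_in_def)
 fix p q assume p: "p \<in> polys_in S"
 then show "- p \<in> polys_in S" by (auto simp: polys_in_def in_keys_iff)
 assume q: "q \<in> polys_in S"
 show "p + q \<in> polys_in S" using p q Poly_Mapping.keys_add[of p q] unfolding polys_in_def by blast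
 show "p * q \<in> polys_in S"
  unfolding polys_in_def
 proof (intro CollectI ballI)
  fix \<alpha> assume "\<alpha> \<in> Poly_Mapping.keys (p * q)"
  then obtain a b where ab: "\<alpha> = a + b" "a \<in> Poly_Mapping.keys p" "b \<in> Poly_Mapping.keys q"
   using Poly_Mapping.keys_mult[of p q] by blast
  then show "Poly_Mapping.keys \<alpha> \<subseteq> S" using p q Poly_Mapping.keys_add[of a b] unfolding polys_in_def by blast
 qed
qed

lemma gfield_subfield: "is_subfield (gfield S)"
proof -
 note P = polys_in_subring[of S]
 have rep: "\<exists>p q. p \<in> polys_in S \<and> q \<in> polys_in S \<and> q ~= 0 \<and> x = emb p / emb q" if x: "x \<in> gfield S" for x
 proof -
  obtain p q where pq: "p \<in> polys_in S" "q \<in> polys_in S" "x = emb p / emb q" using x unfolding gfield_def by blast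
  show ?thesis
  proof (cases "q = 0")
   case True
   then show ?thesis using pq subring_zero[OF P] subring_one[OF P] by (intro exI[of _ 0] exI[of _ 1]) (auto simp: emb_simps)
  qed (use pq in blast)
 qed
 have inn: "emb p / emb q \<in> gfield S" if "p \<in> polys_in S" "q \<in> polys_in S" for p q
  using that unfolding gfield_def by blast
 have "is_subring (gfield S)"
 proof (rule is_subringI)
  show "1 \<in> gfield S" using inn[of 1 1] subring_one[OF P] by (simp add: emb_simps)
  fix x assume "x \<in> gfield S"
  then obtain p q where x: "p \<in> polys_in S" "q \<in> polys_in S" "q ~= 0" "x = emb p / emb q" using rep by blast
  show "- x \<in> gfield S" using inn[of "- p" q] x subring_uminus[OF P] by (simp add: emb_simps)
  fix y assume "y \<in> gfield S"
  then obtain r s where y: "r \<in> polys_in S" "s \<in> polys_in S" "s ~= 0" "y = emb r / emb s" using rep by blast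
  have "x + y = emb (p * s + r * q) / emb (q * s)" using x y by (simp add: emb_simps add_frac_eq)
  then show "x + y \<in> gfield S" using inn x y P by (simp add: subring_add subring_mult)
  have "x * y = emb (p * r) / emb (q * s)" using x y by (simp add: emb_simps)
  then show "x * y \<in> gfield S" using inn x y P by (simp add: subring_mult)
 qed
 moreover have "inverse x \<in> gfield S" if x: "x \<in> gfield S" for x
 proof -
  obtain p q where "p \<in> polys_in S" "q \<in> polys_in S" "x = emb p / emb q" using rep[OF x] by blast
  then show ?thesis using inn[of q p] by simp
 qed
 ultimately show ?thesis by (simp add: is_subfield_def)
qed

text \<open>The relative algebraic closure of the field generated by the first \<open>i\<close> variables.\<close>

definition gclosed :: "nat => host set" where
 "gclosed i = acl (gfield {..<i})"

lemma gconst_gfield: "gconst c \<in> gfield S"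
proof -
 have "Poly_Mapping.single 0 c \<in> polys_in S" by (auto simp: polys_in_def split: if_splits)
 then have "emb (Poly_Mapping.single 0 c) / emb 1 \<in> gfield S"
  unfolding gfield_def using subring_one[OF polys_in_subring] by blast
 then show ?thesis by (simp add: gconst_def emb_simps)
qed

lemma gclosed_field: "is_subfield (gclosed i) \<and> rel_closed (gclosed i) \<and> range gconst \<subseteq> gclosed i"
 unfolding gclosed_def using acl_subfield[OF gfield_subfield] acl_rel_closed[OF gfield_subfield]
  gconst_gfield acl_superset by blast

lemma gclosed_mono: "i \<le> j ==> gclosed i \<subseteq> gclosed j"
proof -
 assume "i \<le> j"
 then have "polys_in {..<i} \<subseteq> polys_in {..<j}" unfolding polys_in_def by fastforce
 then have "gfield {..<i} \<subseteq> gfield {..<j}" unfolding gfield_def by blast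
 then show ?thesis unfolding gclosed_def by (rule acl_mono)
qed

lemma gvar_gclosed: "i < j ==> emb (gvar i) \<in> gclosed j"
proof -
 assume "i < j"
 then have "gvar i \<in> polys_in {..<j}" by (auto simp: gvar_def polys_in_def split: if_splits)
 then have "emb (gvar i) / emb 1 \<in> gfield {..<j}"
  unfolding gfield_def using subring_one[OF polys_in_subring] by blast
 then show ?thesis using acl_superset unfolding gclosed_def by (auto simp: emb_simps)
qed

text \<open>The monomial valuation giving only the variable \<open>i\<close> a negative value has a valuation ring that contains the
  smaller field but not this variable.\<close>

lemma gvar_fresh: "emb (gvar i) \<notin> gclosed i"
proof
 assume h: "emb (gvar i) \<in> gclosed i"
 define \<gamma> where "\<gamma> = (\<lambda>j. if j = i then - 1 else 0 :: real)"
 obtain V :: "host set" where V: "is_vring V"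
  and Viff: "\<And>a b. a ~= 0 ==> b ~= 0 ==> emb a / emb b \<in> V \<longleftrightarrow> mval \<gamma> a \<ge> mval \<gamma> b"
  using monomial_vring by metis
 have z: "mval \<gamma> p = 0" if p: "p \<in> polys_in {..<i}" "p ~= 0" for p
 proof -
  have w: "mweight \<gamma> \<alpha> = 0" if "\<alpha> \<in> Poly_Mapping.keys p" for \<alpha>
  proof -
   have "Poly_Mapping.keys \<alpha> \<subseteq> {..<i}" using p(1) that by (auto simp: polys_in_def)
   then show ?thesis unfolding mweight_def by (intro sum.neutral) (auto simp: \<gamma>_def)
  qed
  obtain \<alpha> where "\<alpha> \<in> Poly_Mapping.keys p" "mweight \<gamma> \<alpha> = mval \<gamma> p" using mval_attained[OF p(2)] by blast
  then show ?thesis using w by simp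
 qed
 have "gfield {..<i} \<subseteq> V"
 proof
  fix x assume "x \<in> gfield {..<i}"
  then obtain p q where pq: "p \<in> polys_in {..<i}" "q \<in> polys_in {..<i}" "x = emb p / emb q" unfolding gfield_def by blast
  show "x \<in> V"
  proof (cases "p = 0 \<or> q = 0")
   case True
   then show ?thesis using pq subring_zero[OF vring_subring[OF V]] by (auto simp: emb_simps)
  next
   case False
   then show ?thesis using Viff[of p q] z pq by simp
  qed
 qed
 then have "emb (gvar i) / emb 1 \<in> V" using h V by (auto simp: gclosed_def acl_def emb_simps)
 then show False using Viff[of "gvar i" 1] gvar_nz[of i] mval_one[of \<gamma>] by (simp add: mval_gvar \<gamma>_def)
qed

section \<open>An ultrapower of the complex numbers\<close>

definition free_family :: "nat set set => bool" where
 "free_family M \<longleftrightarrow> (\<forall>G\<subseteq>M. finite G --> infinite (\<Inter>G))"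

text \<open>A maximal family all of whose finite intersections are infinite is a nonprincipal ultrafilter.\<close>

lemma ex_maximal_free_family: "\<exists>M. free_family M \<and> (\<forall>A. A \<in> M \<or> - A \<in> M)"
proof -
 have "{} \<in> {M. free_family M}" by (auto simp: free_family_def)
 then have ne: "{M. free_family M} ~= {}" by blast
 have "\<exists>S\<in>{M. free_family M}. \<forall>T\<in>{M. free_family M}. S \<subseteq> T --> T = S"
 proof (rule subset_Zorn_nonempty[OF ne])
  fix \<C> assume C: "\<C> ~= {}" "subset.chain {M. free_family M} \<C>"
  have CA: "\<And>S. S \<in> \<C> ==> free_family S" and lin: "\<And>S T. S \<in> \<C> ==> T \<in> \<C> ==> S \<subseteq> T \<or> T \<subseteq> S"
   using C(2) by (auto simp: subset_chain_def)
  have "infinite (\<Inter>G)" if G: "G \<subseteq> \<Union>\<C>" "finite G" for G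
  proof -
   have "\<exists>W\<in>\<C>. G \<subseteq> W" using G(2,1)
   proof (induction G rule: finite_induct)
    case empty
    then show ?case using C(1) by blast
   next
    case (insert s S)
    then obtain W W' where "W \<in> \<C>" "S \<subseteq> W" "W' \<in> \<C>" "s \<in> W'" by auto
    then show ?case using lin[of W W'] by (meson insert_subset subset_trans subsetD)
   qed
   then show ?thesis using CA G(2) unfolding free_family_def by blast
  qed
  then show "\<Union>\<C> \<in> {M. free_family M}" by (simp add: free_family_def)
 qed
 then obtain M where M: "free_family M" and mx: "\<And>T. free_family T ==> M \<subseteq> T ==> T = M" by auto
 have small: "\<exists>G\<subseteq>M. finite G \<and> finite (\<Inter>G \<inter> A)" if "A \<notin> M" for A
 proof -
  have "\<not> free_family (insert A M)" using mx[of "insert A M"] that by blast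
  then obtain G where G: "G \<subseteq> insert A M" "finite G" "finite (\<Inter>G)" by (auto simp: free_family_def)
  have "\<Inter>(G - {A}) \<inter> A \<subseteq> \<Inter>G" by blast
  then have "finite (\<Inter>(G - {A}) \<inter> A)" using G(3) finite_subset by blast
  then show ?thesis using G by (intro exI[of _ "G - {A}"]) auto
 qed
 have "A \<in> M \<or> - A \<in> M" for A
 proof (rule ccontr)
  assume h: "\<not> (A \<in> M \<or> - A \<in> M)"
  obtain G1 where G1: "G1 \<subseteq> M" "finite G1" "finite (\<Inter>G1 \<inter> A)" using small[of A] h by blast
  obtain G2 where G2: "G2 \<subseteq> M" "finite G2" "finite (\<Inter>G2 \<inter> - A)" using small[of "- A"] h by blast
  have "\<Inter>(G1 \<union> G2) \<subseteq> (\<Inter>G1 \<inter> A) \<union> (\<Inter>G2 \<inter> - A)" by blast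
  then have "finite (\<Inter>(G1 \<union> G2))" using G1(3) G2(3) by (meson finite_UnI finite_subset)
  moreover have "G1 \<union> G2 \<subseteq> M" "finite (G1 \<union> G2)" using G1 G2 by auto
  ultimately show False using M unfolding free_family_def by blast
 qed
 then show ?thesis using M by blast
qed

definition ultra :: "nat set set" where
 "ultra = (SOME M. free_family M \<and> (\<forall>A. A \<in> M \<or> - A \<in> M))"

lemma ultra: "free_family ultra" "A \<in> ultra \<or> - A \<in> ultra"
 using someI_ex[OF ex_maximal_free_family] unfolding ultra_def by blast+

text \<open>Truth almost everywhere with respect to the ultrafilter.\<close>

definition uev :: "(nat => bool) => bool" where
 "uev P \<longleftrightarrow> {n. P n} \<in> ultra"

lemma uev_infinite: "uev P ==> infinite {n. P n}"
proof -
 assume h: "uev P"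
 have "infinite (\<Inter>{{n. P n}})"
 proof (rule ultra(1)[unfolded free_family_def, rule_format])
  show "{{n. P n}} \<subseteq> ultra" using h by (simp add: uev_def)
 qed simp
 then show ?thesis by simp
qed

lemma uev_witness: "uev P ==> \<exists>n\<ge>N. P n"
 using uev_infinite[of P] by (auto simp: infinite_nat_iff_unbounded_le)

lemma uev_three:
 assumes "uev P" "uev Q" "uev R" shows "\<exists>n. P n \<and> Q n \<and> R n"
proof -
 have "infinite (\<Inter>{{n. P n}, {n. Q n}, {n. R n}})"
 proof (rule ultra(1)[unfolded free_family_def, rule_format])
  show "{{n. P n}, {n. Q n}, {n. R n}} \<subseteq> ultra" using assms by (simp add: uev_def)
 qed simp
 then have "\<Inter>{{n. P n}, {n. Q n}, {n. R n}} ~= {}" using finite.emptyI by metis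
 then show ?thesis by blast
qed

lemma uev_not: "uev (\<lambda>n. \<not> P n) \<longleftrightarrow> \<not> uev P"
proof
 assume "uev (\<lambda>n. \<not> P n)"
 then show "\<not> uev P" using uev_three[of P P "\<lambda>n. \<not> P n"] by blast
next
 assume "\<not> uev P"
 then have "- {n. P n} \<in> ultra" using ultra(2) unfolding uev_def by blast
 then show "uev (\<lambda>n. \<not> P n)" unfolding uev_def by (simp add: Collect_neg_eq)
qed

lemma uev_conj: "uev (\<lambda>n. P n \<and> Q n) \<longleftrightarrow> uev P \<and> uev Q"
proof
 assume h: "uev (\<lambda>n. P n \<and> Q n)"
 show "uev P \<and> uev Q" using uev_three[OF h h, of "\<lambda>n. \<not> P n"] uev_three[OF h h, of "\<lambda>n. \<not> Q n"] uev_not by blast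
next
 assume h: "uev P \<and> uev Q"
 show "uev (\<lambda>n. P n \<and> Q n)"
  using uev_three[of P Q "\<lambda>n. \<not> (P n \<and> Q n)"] h uev_not[of "\<lambda>n. P n \<and> Q n"] by blast
qed

lemma uev_mono: "uev P ==> (\<And>n. P n ==> Q n) ==> uev Q"
 using uev_conj[of P Q] by (metis (mono_tags, lifting) uev_not uev_three)

lemma uev_True: "uev (\<lambda>n. True)"
 using uev_not[of "\<lambda>n. True"] uev_witness[of "\<lambda>n. False"] by auto

lemma uev_always: "(\<And>n. P n) ==> uev P"
 using uev_mono[OF uev_True] by blast

lemma uev_finite_conj: "finite S ==> (\<And>s. s \<in> S ==> uev (P s)) ==> uev (\<lambda>n. \<forall>s\<in>S. P s n)"
proof (induction S rule: finite_induct)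
 case (insert s S)
 then have "uev (\<lambda>n. P s n \<and> (\<forall>s\<in>S. P s n))" by (simp add: uev_conj)
 then show ?case by (rule uev_mono) auto
qed (simp add: uev_True)

quotient_type hcomplex = "nat => complex" / "\<lambda>x y. uev (\<lambda>n. x n = y n)"
proof (rule equivpI)
 show "reflp (\<lambda>x y. uev (\<lambda>n. x n = y n))" by (auto simp: reflp_def uev_True)
 show "symp (\<lambda>x y. uev (\<lambda>n. x n = y n))" by (auto simp: symp_def eq_commute)
 show "transp (\<lambda>x y. uev (\<lambda>n. x n = (y n :: complex)))"
 proof (rule transpI)
  fix x y z :: "nat => complex" assume "uev (\<lambda>n. x n = y n)" "uev (\<lambda>n. y n = z n)"
  then have "uev (\<lambda>n. x n = y n \<and> y n = z n)" by (simp add: uev_conj)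
  then show "uev (\<lambda>n. x n = z n)" by (rule uev_mono) auto
 qed
qed

instantiation hcomplex :: field
begin

lift_definition zero_hcomplex :: hcomplex is "\<lambda>n. 0" .
lift_definition one_hcomplex :: hcomplex is "\<lambda>n. 1" .
lift_definition plus_hcomplex :: "hcomplex => hcomplex => hcomplex" is "\<lambda>x y n. x n + y n"
proof -
 fix a b c d :: "nat => complex" assume "uev (\<lambda>n. a n = b n)" "uev (\<lambda>n. c n = d n)"
 then have "uev (\<lambda>n. a n = b n \<and> c n = d n)" by (simp add: uev_conj)
 then show "uev (\<lambda>n. a n + c n = b n + d n)" by (rule uev_mono) auto
qed
lift_definition minus_hcomplex :: "hcomplex => hcomplex => hcomplex" is "\<lambda>x y n. x n - y n"
proof -
 fix a b c d :: "nat => complex" assume "uev (\<lambda>n. a n = b n)" "uev (\<lambda>n. c n = d n)"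
 then have "uev (\<lambda>n. a n = b n \<and> c n = d n)" by (simp add: uev_conj)
 then show "uev (\<lambda>n. a n - c n = b n - d n)" by (rule uev_mono) auto
qed
lift_definition times_hcomplex :: "hcomplex => hcomplex => hcomplex" is "\<lambda>x y n. x n * y n"
proof -
 fix a b c d :: "nat => complex" assume "uev (\<lambda>n. a n = b n)" "uev (\<lambda>n. c n = d n)"
 then have "uev (\<lambda>n. a n = b n \<and> c n = d n)" by (simp add: uev_conj)
 then show "uev (\<lambda>n. a n * c n = b n * d n)" by (rule uev_mono) auto
qed
lift_definition divide_hcomplex :: "hcomplex => hcomplex => hcomplex" is "\<lambda>x y n. x n / y n"
proof -
 fix a b c d :: "nat => complex" assume "uev (\<lambda>n. a n = b n)" "uev (\<lambda>n. c n = d n)"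
 then have "uev (\<lambda>n. a n = b n \<and> c n = d n)" by (simp add: uev_conj)
 then show "uev (\<lambda>n. a n / c n = b n / d n)" by (rule uev_mono) auto
qed
lift_definition uminus_hcomplex :: "hcomplex => hcomplex" is "\<lambda>x n. - x n"
 by simp
lift_definition inverse_hcomplex :: "hcomplex => hcomplex" is "\<lambda>x n. inverse (x n)"
 by simp

instance
proof
 fix a b c :: hcomplex
 show "a + b + c = a + (b + c)" by transfer (simp add: add.assoc uev_True)
 show "a + b = b + a" by transfer (simp add: add.commute uev_True)
 show "0 + a = a" by transfer (simp add: uev_True)
 show "- a + a = 0" by transfer (simp add: uev_True)
 show "a - b = a + - b" by transfer (simp add: uev_True)
 show "a * b * c = a * (b * c)" by transfer (simp add: mult.assoc uev_True)
 show "a * b = b * a" by transfer (simp add: mult.commute uev_True)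
 show "1 * a = a" by transfer (simp add: uev_True)
 show "(a + b) * c = a * c + b * c" by transfer (simp add: distrib_right uev_True)
 show "a div b = a * inverse b" by transfer (simp add: divide_inverse uev_True)
 show "(0 :: hcomplex) ~= 1" by transfer (use uev_witness[of "\<lambda>n. False"] in auto)
 show "inverse (0 :: hcomplex) = 0" by transfer (simp add: uev_True)
 show "inverse a * a = 1" if "a ~= 0" using that
 proof transfer
  fix a :: "nat => complex" assume "\<not> uev (\<lambda>n. a n = 0)"
  then have "uev (\<lambda>n. a n ~= 0)" by (simp add: uev_not)
  then show "uev (\<lambda>n. inverse (a n) * a n = 1)" by (rule uev_mono) auto
 qed
qed

end

lemma abs_hcomplex_simps:
 "abs_hcomplex (\<lambda>n. x n + y n) = abs_hcomplex x + abs_hcomplex y"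
 "abs_hcomplex (\<lambda>n. x n * y n) = abs_hcomplex x * abs_hcomplex y"
 "abs_hcomplex (\<lambda>n. 0) = 0" "abs_hcomplex (\<lambda>n. 1) = 1"
 by (simp_all add: plus_hcomplex.abs_eq times_hcomplex.abs_eq zero_hcomplex_def one_hcomplex_def)

lemma abs_hcomplex_eq_iff: "abs_hcomplex x = abs_hcomplex y \<longleftrightarrow> uev (\<lambda>n. x n = y n)"
 by (simp add: hcomplex.abs_eq_iff)

lemma abs_hcomplex_surj: "\<exists>x. z = abs_hcomplex x"
 by (metis Quotient3_abs_rep Quotient3_hcomplex)

lemma abs_hcomplex_power: "abs_hcomplex (\<lambda>n. x n ^ k) = abs_hcomplex x ^ k"
 by (induction k) (simp_all add: abs_hcomplex_simps)

lemma abs_hcomplex_sum: "finite K ==> abs_hcomplex (\<lambda>n. \<Sum>i\<in>K. x i n) = (\<Sum>i\<in>K. abs_hcomplex (x i))"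
 by (induction K rule: finite_induct) (simp_all add: abs_hcomplex_simps)

instance hcomplex :: alg_closed_field
proof intro_classes
 fix n :: nat and f :: "nat => hcomplex"
 assume n: "n > 0" "f n ~= 0"
 have "\<forall>k. \<exists>x. f k = abs_hcomplex x" using abs_hcomplex_surj by blast
 then obtain F where F: "\<And>k. f k = abs_hcomplex (F k)" by metis
 have "\<exists>x. F n m ~= 0 --> (\<Sum>k\<le>n. F k m * x ^ k) = 0" for m
  using alg_closed[of n "\<lambda>k. F k m"] n(1) by blast
 then obtain x where x: "\<And>m. F n m ~= 0 ==> (\<Sum>k\<le>n. F k m * x m ^ k) = 0" by metis
 have "\<not> uev (\<lambda>m. F n m = 0)" using n(2) unfolding F abs_hcomplex_simps(3)[symmetric] abs_hcomplex_eq_iff .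
 then have "uev (\<lambda>m. F n m ~= 0)" by (simp add: uev_not)
 then have "uev (\<lambda>m. (\<Sum>k\<le>n. F k m * x m ^ k) = 0)" by (rule uev_mono) (use x in auto)
 then have "abs_hcomplex (\<lambda>m. \<Sum>k\<le>n. F k m * x m ^ k) = abs_hcomplex (\<lambda>m. 0)"
  by (simp add: abs_hcomplex_eq_iff)
 then have "(\<Sum>k\<le>n. f k * abs_hcomplex x ^ k) = 0"
  by (simp add: abs_hcomplex_sum abs_hcomplex_simps abs_hcomplex_power F)
 then show "\<exists>x. (\<Sum>k\<le>n. f k * x ^ k) = 0" by blast
qed

subsection \<open>The valuation ring of finite elements\<close>

definition hfinite :: "hcomplex set" where
 "hfinite = {abs_hcomplex z | z. \<exists>C. uev (\<lambda>n. cmod (z n) \<le> C)}"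

lemma hfinite_iff: "abs_hcomplex z \<in> hfinite \<longleftrightarrow> (\<exists>C. uev (\<lambda>n. cmod (z n) \<le> C))"
proof
 assume "abs_hcomplex z \<in> hfinite"
 then obtain w C where w: "abs_hcomplex z = abs_hcomplex w" "uev (\<lambda>n. cmod (w n) \<le> C)" unfolding hfinite_def by blast
 then have "uev (\<lambda>n. z n = w n \<and> cmod (w n) \<le> C)" by (simp add: abs_hcomplex_eq_iff uev_conj)
 then have "uev (\<lambda>n. cmod (z n) \<le> C)" by (rule uev_mono) auto
 then show "\<exists>C. uev (\<lambda>n. cmod (z n) \<le> C)" by blast
qed (auto simp: hfinite_def)

lemma is_vring_hfinite: "is_vring hfinite"
 unfolding is_vring_def
proof (intro conjI allI)
 show "is_subring hfinite"
 proof (rule is_subringI)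
  show "1 \<in> hfinite" unfolding abs_hcomplex_simps(4)[symmetric] hfinite_iff by (intro exI[of _ 1]) (simp add: uev_True)
  fix x assume x: "x \<in> hfinite"
  then obtain z C where z: "x = abs_hcomplex z" "uev (\<lambda>n. cmod (z n) \<le> C)" unfolding hfinite_def by blast
  have m: "- x = abs_hcomplex (\<lambda>n. - z n)" unfolding z(1) by (simp add: uminus_hcomplex.abs_eq)
  show "- x \<in> hfinite" unfolding m hfinite_iff using z(2) by auto
  fix y assume y: "y \<in> hfinite"
  then obtain w B where w: "y = abs_hcomplex w" "uev (\<lambda>n. cmod (w n) \<le> B)" unfolding hfinite_def by blast
  have zw: "uev (\<lambda>n. cmod (z n) \<le> C \<and> cmod (w n) \<le> B)" using z w by (simp add: uev_conj)
  have "uev (\<lambda>n. cmod (z n + w n) \<le> C + B)"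
   using zw by (rule uev_mono) (auto intro: order_trans[OF norm_triangle_ineq])
  then show "x + y \<in> hfinite" unfolding z(1) w(1) abs_hcomplex_simps(1)[symmetric] hfinite_iff by blast
  have "uev (\<lambda>n. cmod (z n * w n) \<le> \<bar>C\<bar> * \<bar>B\<bar>)"
   using zw by (rule uev_mono) (auto simp: norm_mult intro!: mult_mono)
  then show "x * y \<in> hfinite" unfolding z(1) w(1) abs_hcomplex_simps(2)[symmetric] hfinite_iff by blast
 qed
 fix x :: hcomplex
 obtain z where z: "x = abs_hcomplex z" using abs_hcomplex_surj by blast
 have i: "inverse x = abs_hcomplex (\<lambda>n. inverse (z n))" unfolding z by (simp add: inverse_hcomplex.abs_eq)
 show "x \<in> hfinite \<or> inverse x \<in> hfinite"
 proof (cases "uev (\<lambda>n. cmod (z n) \<le> 1)")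
  case True
  then show ?thesis unfolding z hfinite_iff by blast
 next
  case False
  then have "uev (\<lambda>n. \<not> cmod (z n) \<le> 1)" by (simp add: uev_not)
  then have "uev (\<lambda>n. cmod (inverse (z n)) \<le> 1)"
   by (rule uev_mono) (auto simp: norm_inverse intro!: inverse_le_1_iff[THEN iffD2])
  then show ?thesis unfolding i hfinite_iff by blast
 qed
qed

lemma infinitesimal:
 assumes "abs_hcomplex z \<in> maximal_ideal hfinite" "\<epsilon> > 0"
 shows "uev (\<lambda>n. cmod (z n) < \<epsilon>)"
proof (rule ccontr)
 assume "\<not> ?thesis"
 then have h: "uev (\<lambda>n. \<not> cmod (z n) < \<epsilon>)" by (simp add: uev_not)
 then have "uev (\<lambda>n. cmod (inverse (z n)) \<le> inverse \<epsilon>)"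
  by (rule uev_mono) (use assms(2) in \<open>auto simp: norm_inverse intro!: le_imp_inverse_le\<close>)
 then have "inverse (abs_hcomplex z) \<in> hfinite"
  unfolding inverse_hcomplex.abs_eq using hfinite_iff by blast
 then have "abs_hcomplex z = 0" using assms(1) by (auto simp: maximal_ideal_def)
 then have "uev (\<lambda>n. z n = 0)" unfolding abs_hcomplex_simps(3)[symmetric] abs_hcomplex_eq_iff .
 then have "uev (\<lambda>n. z n = 0 \<and> \<not> cmod (z n) < \<epsilon>)" using h by (simp add: uev_conj)
 then show False using uev_witness[of "\<lambda>n. z n = 0 \<and> \<not> cmod (z n) < \<epsilon>" 0] assms(2) by auto
qed

definition hconst :: "real => hcomplex" where
 "hconst c = abs_hcomplex (\<lambda>n. complex_of_real c)"

lemma phom_hconst: "phom UNIV hconst"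
 unfolding phom_def hconst_def by (auto simp: is_subring_def abs_hcomplex_simps[symmetric])

lemma hconst_finite: "range hconst \<subseteq> hfinite"
proof
 fix x assume "x \<in> range hconst"
 then obtain c where c: "x = hconst c" by blast
 show "x \<in> hfinite" unfolding c hconst_def hfinite_iff by (intro exI[of _ "\<bar>c\<bar>"]) (simp add: uev_True)
qed

lemma ex_infinitesimal: "\<exists>p. p ~= 0 \<and> p \<in> maximal_ideal hfinite"
proof (intro exI conjI)
 let ?z = "\<lambda>n::nat. inverse (of_nat (Suc n)) :: complex"
 show nz: "abs_hcomplex ?z ~= 0"
 proof
  assume "abs_hcomplex ?z = 0"
  then have "uev (\<lambda>n. ?z n = 0)" unfolding abs_hcomplex_simps(3)[symmetric] abs_hcomplex_eq_iff .
  then show False using uev_witness[of "\<lambda>n. ?z n = 0" 0] by (auto simp del: of_nat_Suc)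
 qed
 have a: "cmod (?z n) \<le> 1" for n by (simp add: norm_inverse del: of_nat_Suc) (simp add: inverse_le_1_iff)
 have "abs_hcomplex ?z \<in> hfinite" unfolding hfinite_iff by (intro exI[of _ 1] uev_always a)
 moreover have "inverse (abs_hcomplex ?z) \<notin> hfinite"
 proof
  assume "inverse (abs_hcomplex ?z) \<in> hfinite"
  then obtain C where "uev (\<lambda>n. cmod (inverse (?z n)) \<le> C)" unfolding inverse_hcomplex.abs_eq hfinite_iff by blast
  then obtain n where n: "n \<ge> nat \<lceil>C\<rceil>" "cmod (inverse (?z n)) \<le> C" using uev_witness by blast
  have "cmod (inverse (?z n)) = real (Suc n)" by (simp only: inverse_inverse_eq norm_of_nat)
  then show False using n by linarith
 qed
 ultimately show "abs_hcomplex ?z \<in> maximal_ideal hfinite" by (simp add: maximal_ideal_def)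
qed

section \<open>Evaluation of polynomials in several variables\<close>

definition mon_eval :: "('n => 'b::comm_monoid_mult) => ('n \<Rightarrow>\<^sub>0 nat) => 'b" where
 "mon_eval \<xi> \<alpha> = (\<Prod>i\<in>Poly_Mapping.keys \<alpha>. \<xi> i ^ Poly_Mapping.lookup \<alpha> i)"

lemma mon_eval_superset:
 "finite K ==> Poly_Mapping.keys \<alpha> \<subseteq> K ==> mon_eval \<xi> \<alpha> = (\<Prod>i\<in>K. \<xi> i ^ Poly_Mapping.lookup \<alpha> i)"
 unfolding mon_eval_def by (intro prod.mono_neutral_left) (auto simp: in_keys_iff)

lemma mon_eval_add: "mon_eval \<xi> (\<alpha> + \<beta>) = mon_eval \<xi> \<alpha> * mon_eval \<xi> \<beta>"
proof -
 let ?K = "Poly_Mapping.keys \<alpha> \<union> Poly_Mapping.keys \<beta>"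
 have "mon_eval \<xi> (\<alpha> + \<beta>) = (\<Prod>i\<in>?K. \<xi> i ^ Poly_Mapping.lookup (\<alpha> + \<beta>) i)"
  by (rule mon_eval_superset) (simp_all add: Poly_Mapping.keys_add)
 also have "\<dots> = mon_eval \<xi> \<alpha> * mon_eval \<xi> \<beta>"
  using mon_eval_superset[of ?K \<alpha> \<xi>] mon_eval_superset[of ?K \<beta> \<xi>] by (simp add: lookup_add power_add prod.distrib)
 finally show ?thesis .
qed

lemma mon_eval_single: "mon_eval \<xi> (Poly_Mapping.single i k) = \<xi> i ^ k"
 by (simp add: mon_eval_def)

lemma mon_eval_0 [simp]: "mon_eval \<xi> 0 = 1"
 by (simp add: mon_eval_def)

definition meval :: "('a::comm_ring_1 => 'b::comm_ring_1) => ('n => 'b) => (('n \<Rightarrow>\<^sub>0 nat) \<Rightarrow>\<^sub>0 'a) => 'b" where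
 "meval \<kappa> \<xi> p = (\<Sum>\<alpha>\<in>Poly_Mapping.keys p. \<kappa> (Poly_Mapping.lookup p \<alpha>) * mon_eval \<xi> \<alpha>)"

lemma sum_monomials: "p = (\<Sum>\<alpha>\<in>Poly_Mapping.keys p. Poly_Mapping.single \<alpha> (Poly_Mapping.lookup p \<alpha>))"
proof (rule poly_mapping_eqI)
 fix k
 have "Poly_Mapping.lookup (\<Sum>\<alpha>\<in>Poly_Mapping.keys p. Poly_Mapping.single \<alpha> (Poly_Mapping.lookup p \<alpha>)) k =
   (\<Sum>\<alpha>\<in>Poly_Mapping.keys p. if \<alpha> = k then Poly_Mapping.lookup p \<alpha> else 0)"
  unfolding lookup_sum by (intro sum.cong) (auto simp: lookup_single when_def)
 also have "\<dots> = (if k \<in> Poly_Mapping.keys p then Poly_Mapping.lookup p k else 0)"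
  by (rule sum.delta) simp
 finally show "Poly_Mapping.lookup p k = Poly_Mapping.lookup (\<Sum>\<alpha>\<in>Poly_Mapping.keys p. Poly_Mapping.single \<alpha> (Poly_Mapping.lookup p \<alpha>)) k"
  by (simp add: in_keys_iff)
qed

lemma phom_meval:
 assumes k: "phom UNIV \<kappa>" shows "phom UNIV (meval \<kappa> \<xi>)"
proof -
 note ks = phom_add[OF k UNIV_I UNIV_I] phom_mult[OF k UNIV_I UNIV_I] phom_one[OF k] phom_zero[OF k]
 let ?m = "mon_eval \<xi>"
 have sup: "meval \<kappa> \<xi> p = (\<Sum>\<alpha>\<in>K. \<kappa> (Poly_Mapping.lookup p \<alpha>) * ?m \<alpha>)"
  if "finite K" "Poly_Mapping.keys p \<subseteq> K" for p K
  unfolding meval_def using that by (intro sum.mono_neutral_left) (auto simp: in_keys_iff ks)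
 have add: "meval \<kappa> \<xi> (p + q) = meval \<kappa> \<xi> p + meval \<kappa> \<xi> q" for p q
 proof -
  let ?K = "Poly_Mapping.keys p \<union> Poly_Mapping.keys q"
  have "meval \<kappa> \<xi> (p + q) = (\<Sum>\<alpha>\<in>?K. \<kappa> (Poly_Mapping.lookup (p + q) \<alpha>) * ?m \<alpha>)"
   by (rule sup) (simp_all add: Poly_Mapping.keys_add)
  also have "\<dots> = (\<Sum>\<alpha>\<in>?K. \<kappa> (Poly_Mapping.lookup p \<alpha>) * ?m \<alpha>) + (\<Sum>\<alpha>\<in>?K. \<kappa> (Poly_Mapping.lookup q \<alpha>) * ?m \<alpha>)"
   by (simp add: lookup_add ks distrib_right sum.distrib)
  finally show ?thesis using sup[of ?K p] sup[of ?K q] by simp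
 qed
 have single: "meval \<kappa> \<xi> (Poly_Mapping.single \<alpha> c) = \<kappa> c * ?m \<alpha>" for \<alpha> c
  using sup[of "{\<alpha>}" "Poly_Mapping.single \<alpha> c"] by (simp split: if_splits)
 have zero: "meval \<kappa> \<xi> 0 = 0" by (simp add: meval_def)
 have sum: "meval \<kappa> \<xi> (sum f K) = (\<Sum>i\<in>K. meval \<kappa> \<xi> (f i))" if "finite K" for f :: "_ => (_ \<Rightarrow>\<^sub>0 nat) \<Rightarrow>\<^sub>0 'a" and K
  using that by (induction K rule: finite_induct) (simp_all add: zero add)
 have mult: "meval \<kappa> \<xi> (p * q) = meval \<kappa> \<xi> p * meval \<kappa> \<xi> q" for p q
 proof -
  have "p * q = (\<Sum>\<alpha>\<in>Poly_Mapping.keys p. \<Sum>\<beta>\<in>Poly_Mapping.keys q. Poly_Mapping.single (\<alpha> + \<beta>) (Poly_Mapping.lookup p \<alpha> * Poly_Mapping.lookup q \<beta>))"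
   by (subst (1) sum_monomials[of p], subst (1) sum_monomials[of q]) (simp add: sum_product mult_single)
  then have "meval \<kappa> \<xi> (p * q) = (\<Sum>\<alpha>\<in>Poly_Mapping.keys p. \<Sum>\<beta>\<in>Poly_Mapping.keys q. (\<kappa> (Poly_Mapping.lookup p \<alpha>) * ?m \<alpha>) * (\<kappa> (Poly_Mapping.lookup q \<beta>) * ?m \<beta>))"
   by (simp add: sum single ks mon_eval_add mult.assoc mult.left_commute)
  then show ?thesis by (simp add: meval_def sum_product)
 qed
 have "meval \<kappa> \<xi> 1 = 1" using single[of 0 1] by (simp add: ks)
 then show ?thesis unfolding phom_def using add mult by (simp add: is_subring_def)
qed

lemma meval_single:
 assumes "phom UNIV \<kappa>" shows "meval \<kappa> \<xi> (Poly_Mapping.single \<alpha> c) = \<kappa> c * mon_eval \<xi> \<alpha>"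
 using phom_zero[OF assms] by (simp add: meval_def)

lemma meval_const: "phom UNIV \<kappa> ==> meval \<kappa> \<xi> (mpoly_const c) = \<kappa> c"
 by (simp add: mpoly_const_def meval_single)

lemma meval_var: "phom UNIV \<kappa> ==> meval \<kappa> \<xi> (mpoly_var l) = \<xi> l"
 by (simp add: mpoly_var_def meval_single mon_eval_single phom_one)

lemma mpoly_const_simps:
 "mpoly_const (a + b) = mpoly_const a + mpoly_const b" "mpoly_const (a * b) = mpoly_const a * mpoly_const b"
 "mpoly_const 1 = 1" "mpoly_const 0 = 0" "mpoly_const (- a) = - mpoly_const a"
 by (simp_all add: mpoly_const_def single_add mult_single single_uminus)

lemma mpoly_var_power: "(mpoly_var i :: ('n::finite, 'a::comm_ring_1) mpoly) ^ k = Poly_Mapping.single (Poly_Mapping.single i k) 1"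
proof (induction k)
 case (Suc k)
 have "Poly_Mapping.single i 1 + Poly_Mapping.single i k = Poly_Mapping.single i (Suc k)"
  by (simp flip: single_add)
 moreover have "(mpoly_var i :: ('n, 'a) mpoly) ^ Suc k = mpoly_var i * Poly_Mapping.single (Poly_Mapping.single i k) 1" using Suc by simp
 ultimately show ?case unfolding mpoly_var_def mult_single by simp
qed simp

lemma single_eq_mon_eval:
 "Poly_Mapping.single \<alpha> c = mpoly_const c * mon_eval mpoly_var (\<alpha> :: 'n::finite \<Rightarrow>\<^sub>0 nat)"
proof -
 have pr: "(\<Prod>i\<in>K. mpoly_var i ^ f i) = Poly_Mapping.single (\<Sum>i\<in>K. Poly_Mapping.single i (f i)) (1::'a)"
  if "finite K" for K and f :: "'n => nat"
  using that by (induction K rule: finite_induct) (simp_all add: mpoly_var_power mult_single)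
 have "(\<Sum>i\<in>Poly_Mapping.keys \<alpha>. Poly_Mapping.single i (Poly_Mapping.lookup \<alpha> i)) = \<alpha>"
  by (rule sum_monomials[symmetric])
 then show ?thesis
  using pr[of "Poly_Mapping.keys \<alpha>" "Poly_Mapping.lookup \<alpha>"] by (simp add: mpoly_const_def mon_eval_def mult_single)
qed

lemma mpoly_subring_UNIV:
 fixes A :: "('n::finite, 'a::comm_ring_1) mpoly set"
 assumes A: "is_subring A" and c: "\<And>c. mpoly_const c \<in> A" and v: "\<And>l. mpoly_var l \<in> A"
 shows "A = UNIV"
proof -
 have "Poly_Mapping.single \<alpha> c' \<in> A" for \<alpha> c'
  unfolding single_eq_mon_eval mon_eval_def using A c v by (auto intro!: subring_mult subring_prod subring_power)
 then have "p \<in> A" for p by (subst sum_monomials) (auto intro!: subring_sum[OF A])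
 then show ?thesis by blast
qed

lemma phom_mpoly_unique:
 fixes f g :: "('n::finite, 'a::comm_ring_1) mpoly => 'b::comm_ring_1"
 assumes f: "phom UNIV f" and g: "phom UNIV g" and c: "\<And>c. f (mpoly_const c) = g (mpoly_const c)"
  and v: "\<And>l. f (mpoly_var l) = g (mpoly_var l)"
 shows "f p = g p"
proof -
 have "{p. f p = g p} = UNIV"
 proof (rule mpoly_subring_UNIV)
  show "is_subring {p. f p = g p}"
   by (rule is_subringI) (auto simp: phom_one[OF f] phom_one[OF g] phom_add[OF f] phom_add[OF g]
    phom_mult[OF f] phom_mult[OF g] phom_uminus[OF f] phom_uminus[OF g])
 qed (use c v in auto)
 then show ?thesis by blast
qed

section \<open>Generic points of prime ideals\<close>

definition prime_set :: "'r::comm_ring_1 set => bool" where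
 "prime_set P \<longleftrightarrow> 0 \<in> P \<and> (\<forall>x\<in>P. \<forall>y\<in>P. x + y \<in> P) \<and> (\<forall>r. \<forall>x\<in>P. r * x \<in> P) \<and> 1 \<notin> P \<and>
  (\<forall>x y. x * y \<in> P --> x \<in> P \<or> y \<in> P)"

lemma prime_setD:
 assumes "prime_set P"
 shows "0 \<in> P" "x \<in> P ==> y \<in> P ==> x + y \<in> P" "x \<in> P ==> r * x \<in> P" "x \<in> P ==> x * r \<in> P" "1 \<notin> P"
  "x * y \<in> P ==> x \<notin> P ==> y \<in> P" "x \<in> P ==> - x \<in> P" "x \<in> P ==> y \<in> P ==> x - y \<in> P"
proof -
 show a: "0 \<in> P" "x \<in> P ==> y \<in> P ==> x + y \<in> P" "\<And>r x. x \<in> P ==> r * x \<in> P" "1 \<notin> P"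
  "x * y \<in> P ==> x \<notin> P ==> y \<in> P"
  using assms unfolding prime_set_def by blast+
 show "x \<in> P ==> x * r \<in> P" using a(3)[of x r] by (simp add: mult.commute)
 have m: "- x \<in> P" if "x \<in> P" for x using a(3)[OF that, of "- 1"] by simp
 then show "x \<in> P ==> - x \<in> P" .
 show "x \<in> P ==> y \<in> P ==> x - y \<in> P"
  using m[of y] assms unfolding prime_set_def by (metis add_uminus_conv_diff)
qed

lemma prime_set_power: "prime_set P ==> x \<notin> P ==> x ^ n \<notin> P"
 by (induction n) (use prime_setD(5,6) in auto)

lemma prime_set_sum: "prime_set P ==> (\<And>i. i \<in> K ==> f i \<in> P) ==> sum f K \<in> P"
 by (induction K rule: infinite_finite_induct) (auto intro: prime_setD)

lemma poly_coeffs_prime: "prime_set P ==> (\<And>i. coeff Q i \<in> P) ==> poly Q x \<in> P"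
 unfolding poly_altdef by (intro prime_set_sum prime_setD(4))

lemma polys_over_pseudo_division:
 fixes p q :: "'r::comm_ring_1 poly"
 assumes A: "is_subring A" and p: "p \<in> polys_over A" and q: "q \<in> polys_over A"
 shows "\<exists>k h r. h \<in> polys_over A \<and> r \<in> polys_over A \<and> smult (lead_coeff p ^ k) q = p * h + r \<and>
  (r = 0 \<or> degree r < degree p) \<and> degree h \<le> degree q - degree p"
 using q
proof (induction "degree q" arbitrary: q rule: less_induct)
 case less
 note PA = is_subring_polys_over[OF A]
 show ?case
 proof (cases "q = 0 \<or> degree q < degree p")
  case True
  then show ?thesis
   using less.prems by (intro exI[of _ 0] exI[of _ 0] exI[of _ q]) (auto intro: polys_over_0[OF A])
 next
  case False
  then have q0: "q ~= 0" and dq: "degree p \<le> degree q" by auto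
  let ?d = "degree q - degree p"
  define t where "t = monom (lead_coeff q) ?d"
  have tA: "t \<in> polys_over A"
   unfolding t_def using less.prems by (intro polys_over_monom A) (auto simp: polys_over_def)
  have lA: "lead_coeff p \<in> A" using p by (auto simp: polys_over_def)
  define q' where "q' = smult (lead_coeff p) q - p * t"
  have q': "q' \<in> polys_over A"
   unfolding q'_def using p tA less.prems lA by (intro polys_over_intros A)
  have cpt: "coeff (p * t) n = (if n < ?d then 0 else lead_coeff q * coeff p (n - ?d))" for n
  proof -
   have "p * t = t * p" by (rule mult.commute)
   then show ?thesis unfolding t_def by (simp only: coeff_monom_mult)
  qed
  have small: "coeff q' n = 0" if "n \<ge> degree q" for n
  proof (cases "n = degree q")
   case True
   have "degree q - ?d = degree p" using dq by auto
   then show ?thesis using True dq by (simp add: q'_def cpt mult.commute)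
  next
   case False
   then have "n > degree q" using that by auto
   moreover have "n - ?d > degree p" using \<open>n > degree q\<close> dq by auto
   ultimately show ?thesis by (simp add: q'_def cpt coeff_eq_0)
  qed
  have main: "smult (lead_coeff p) q = p * t + q'" by (simp add: q'_def)
  have dt: "degree t \<le> ?d" unfolding t_def by (rule degree_monom_le)
  show ?thesis
  proof (cases "q' = 0")
   case True
   then show ?thesis using tA polys_over_0[OF A] main dt
    by (intro exI[of _ 1] exI[of _ t] exI[of _ 0]) auto
  next
   case False
   have lt: "degree q' < degree q"
    using small[of "degree q'"] False by (metis leading_coeff_0_iff not_less)
   from less.hyps[OF lt q'] obtain k h r where hr: "h \<in> polys_over A" "r \<in> polys_over A"
    "smult (lead_coeff p ^ k) q' = p * h + r" "r = 0 \<or> degree r < degree p" "degree h \<le> degree q' - degree p" by blast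
   define s where "s = smult (lead_coeff p ^ k) t + h"
   have "smult (lead_coeff p ^ Suc k) q = smult (lead_coeff p ^ k) (smult (lead_coeff p) q)" by (simp add: mult.commute)
   also have "\<dots> = smult (lead_coeff p ^ k) (p * t) + (p * h + r)" unfolding main smult_add_right hr(3) ..
   also have "\<dots> = p * s + r" by (simp add: s_def distrib_left)
   finally have "smult (lead_coeff p ^ Suc k) q = p * s + r" .
   moreover have "s \<in> polys_over A" unfolding s_def using hr tA lA by (intro polys_over_intros A) (auto intro: subring_power[OF A])
   moreover have "degree s \<le> ?d" unfolding s_def
    using hr(5) lt dt by (intro degree_add_le) (auto intro: order_trans[OF degree_smult_le])
   ultimately show ?thesis using hr by blast
  qed
 qed
qed

text \<open>Modulo \<open>P\<close>, the element is transcendental over the subring.\<close>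

definition generic_over :: "'r::comm_ring_1 set => 'r set => 'r => bool" where
 "generic_over P A x \<longleftrightarrow> (\<forall>Q\<in>polys_over A. poly Q x \<in> P --> (\<forall>i. coeff Q i \<in> P))"

definition minimal_relation :: "'r::comm_ring_1 set => 'r set => 'r => 'r poly => bool" where
 "minimal_relation P A x M \<longleftrightarrow> M \<in> polys_over A \<and> poly M x \<in> P \<and> lead_coeff M \<notin> P \<and>
  (\<forall>Q\<in>polys_over A. poly Q x \<in> P --> degree Q < degree M --> (\<forall>i. coeff Q i \<in> P))"

text \<open>A nontrivial relation of least degree has its leading coefficient outside \<open>P\<close>, since otherwise the leading
  term could be dropped.\<close>

lemma generic_or_minimal_relation:
 assumes P: "prime_set P" and A: "is_subring A"
 shows "generic_over P A x \<or> (\<exists>M. minimal_relation P A x M)"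
proof (rule disjCI)
 assume no: "\<not> (\<exists>M. minimal_relation P A x M)"
 note PA = is_subring_polys_over[OF A]
 show "generic_over P A x"
 proof (rule ccontr)
  assume "\<not> generic_over P A x"
  then obtain Q1 where Q1: "Q1 \<in> polys_over A" "poly Q1 x \<in> P" "\<exists>i. coeff Q1 i \<notin> P" by (auto simp: generic_over_def)
  define B where "B = (\<lambda>Q. Q \<in> polys_over A \<and> poly Q x \<in> P \<and> (\<exists>i. coeff Q i \<notin> P))"
  have "B Q1" using Q1 by (simp add: B_def)
  then obtain M where M: "B M" and Mmin: "\<And>Q. B Q ==> degree M \<le> degree Q"
   using ex_has_least_nat[of B Q1 degree] by blast
  have "lead_coeff M \<notin> P"
  proof
   assume l: "lead_coeff M \<in> P"
   define Q where "Q = M - monom (lead_coeff M) (degree M)"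
   have QA: "Q \<in> polys_over A" unfolding Q_def using M by (intro polys_over_intros A) (auto simp: B_def polys_over_def)
   have "poly Q x \<in> P" using prime_setD(8)[OF P _ prime_setD(4)[OF P l]] M by (simp add: Q_def poly_monom B_def)
   moreover obtain i where i: "coeff M i \<notin> P" using M by (auto simp: B_def)
   have "i ~= degree M" using i l by auto
   then have "coeff Q i = coeff M i" by (simp add: Q_def)
   then have "coeff Q i \<notin> P" using i by simp
   ultimately have BQ: "B Q" using QA by (auto simp: B_def)
   have Q0: "Q ~= 0" using \<open>coeff Q i \<notin> P\<close> prime_setD(1)[OF P] by auto
   have "coeff Q n = 0" if "n \<ge> degree M" for n using that by (cases "n = degree M") (auto simp: Q_def coeff_eq_0)
   then have "degree Q < degree M" using Q0 by (metis leading_coeff_0_iff not_less)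
   then show False using Mmin[OF BQ] by simp
  qed
  moreover have "\<forall>i. coeff Q i \<in> P" if "Q \<in> polys_over A" "poly Q x \<in> P" "degree Q < degree M" for Q
   using Mmin[of Q] that by (auto simp: B_def)
  ultimately have "minimal_relation P A x M" using M by (simp add: minimal_relation_def B_def)
  then show False using no by blast
 qed
qed

lemma minimal_relation_degree:
 assumes P: "prime_set P" and M: "minimal_relation P A x M" shows "degree M > 0"
proof (rule ccontr)
 assume "\<not> degree M > 0"
 then have d0: "degree M = 0" by simp
 obtain a where a: "M = [:a:]" using degree_eq_zeroE[OF d0] by blast
 then show False using M by (simp add: minimal_relation_def)
qed

text \<open>Pseudodivision by \<open>M\<close> leaves a remainder of smaller degree which is again a relation.\<close>

lemma minimal_relation_divides:
 assumes P: "prime_set P" and A: "is_subring A" and M: "minimal_relation P A x M"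
  and Q: "Q \<in> polys_over A" "poly Q x \<in> P"
 shows "\<exists>k h r. h \<in> polys_over A \<and> r \<in> polys_over A \<and> smult (lead_coeff M ^ k) Q = M * h + r \<and> (\<forall>i. coeff r i \<in> P)"
proof -
 have M': "M \<in> polys_over A" "poly M x \<in> P"
  and Mm: "\<And>Q. Q \<in> polys_over A ==> poly Q x \<in> P ==> degree Q < degree M ==> (\<forall>i. coeff Q i \<in> P)"
  using M by (auto simp: minimal_relation_def)
 obtain k h r where hr: "h \<in> polys_over A" "r \<in> polys_over A" "smult (lead_coeff M ^ k) Q = M * h + r"
  "r = 0 \<or> degree r < degree M" using polys_over_pseudo_division[OF A M'(1) Q(1)] by blast
 have "poly r x = lead_coeff M ^ k * poly Q x - poly M x * poly h x"
  using arg_cong[OF hr(3), of "\<lambda>p. poly p x"] by simp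
 then have "poly r x \<in> P" using prime_setD(8)[OF P prime_setD(3)[OF P Q(2)] prime_setD(4)[OF P M'(2)]] by simp
 then have "\<forall>i. coeff r i \<in> P" using Mm[OF hr(2)] hr(4) prime_setD(1)[OF P] by auto
 then show ?thesis using hr by blast
qed

text \<open>A root of the transported minimal relation satisfies exactly the relations of \<open>x\<close>.\<close>

lemma generic_step_algebraic:
 fixes e :: "'r::comm_ring_1 => 'a::alg_closed_field"
 assumes P: "prime_set P" and e: "phom A e" and ker: "\<And>a. a \<in> A ==> e a = 0 \<longleftrightarrow> a \<in> P"
  and M: "minimal_relation P A x M" and w: "ev e w M = 0" and Q: "Q \<in> polys_over A"
 shows "ev e w Q = 0 \<longleftrightarrow> poly Q x \<in> P"
proof -
 note A = phom_subring[OF e]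
 note PA = is_subring_polys_over[OF A]
 have M': "M \<in> polys_over A" "poly M x \<in> P" "lead_coeff M \<notin> P"
  and Mm: "\<And>Q. Q \<in> polys_over A ==> poly Q x \<in> P ==> degree Q < degree M ==> (\<forall>i. coeff Q i \<in> P)"
  using M by (auto simp: minimal_relation_def)
 have cA: "coeff Q i \<in> A" if "Q \<in> polys_over A" for Q i using that by (auto simp: polys_over_def)
 have evs: "ev e w (smult a Q) = e a * ev e w Q" if "a \<in> A" "Q \<in> polys_over A" for a Q
 proof -
  have "smult a Q = [:a:] * Q" by simp
  then show ?thesis using that A ev_mult[OF e, of "[:a:]" Q] by (simp only: ev_const[OF e]) (auto intro!: polys_over_intros simp: ev_const[OF e])
 qed
 have ev0: "ev e w Q = 0" if "Q \<in> polys_over A" "\<forall>i. coeff Q i \<in> P" for Q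
  unfolding ev_altdef[OF e] using ker cA that by (intro sum.neutral) auto
 have forw: "ev e w Q = 0" if Q: "Q \<in> polys_over A" "poly Q x \<in> P" for Q
 proof -
  obtain k h r where hr: "h \<in> polys_over A" "r \<in> polys_over A" "smult (lead_coeff M ^ k) Q = M * h + r" "\<forall>i. coeff r i \<in> P"
   using minimal_relation_divides[OF P A M Q] by blast
  have lA: "lead_coeff M ^ k \<in> A" using cA[OF M'(1)] subring_power[OF A] by blast
  have "e (lead_coeff M ^ k) * ev e w Q = ev e w M * ev e w h + ev e w r"
   using evs[OF lA Q(1)] hr(3) ev_add[OF e subring_mult[OF PA M'(1) hr(1)] hr(2)] ev_mult[OF e M'(1) hr(1)] by simp
  then have "e (lead_coeff M ^ k) * ev e w Q = 0" using w ev0[OF hr(2,4)] by simp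
  moreover have "e (lead_coeff M ^ k) ~= 0" using ker[OF lA] prime_set_power[OF P M'(3)] by blast
  ultimately show ?thesis by simp
 qed
 have bwd: "poly Q x \<in> P" if Q: "Q \<in> polys_over A" "ev e w Q = 0" for Q
 proof (rule ccontr)
  assume nQ: "poly Q x \<notin> P"
  define B where "B = (\<lambda>Q. Q \<in> polys_over A \<and> ev e w Q = 0 \<and> poly Q x \<notin> P)"
  have "B Q" using Q nQ by (simp add: B_def)
  then obtain R where R: "B R" and Rmin: "\<And>Q. B Q ==> degree R \<le> degree Q"
   using ex_has_least_nat[of B Q degree] by blast
  have R': "R \<in> polys_over A" "ev e w R = 0" "poly R x \<notin> P" using R by (auto simp: B_def)
  have R0: "R ~= 0" using R'(3) prime_setD(1)[OF P] by auto
  have dR: "degree R < degree M"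
  proof (rule ccontr)
   assume nd: "\<not> degree R < degree M"
   obtain k h r where hr: "h \<in> polys_over A" "r \<in> polys_over A" "smult (lead_coeff M ^ k) R = M * h + r"
    "r = 0 \<or> degree r < degree M" using polys_over_pseudo_division[OF A M'(1) R'(1)] by blast
   have lA: "lead_coeff M ^ k \<in> A" using cA[OF M'(1)] subring_power[OF A] by blast
   have "e (lead_coeff M ^ k) * ev e w R = ev e w M * ev e w h + ev e w r"
    using evs[OF lA R'(1)] hr(3) ev_add[OF e subring_mult[OF PA M'(1) hr(1)] hr(2)] ev_mult[OF e M'(1) hr(1)] by simp
   then have er: "ev e w r = 0" using w R'(2) by simp
   have pr: "lead_coeff M ^ k * poly R x = poly M x * poly h x + poly r x"
    using arg_cong[OF hr(3), of "\<lambda>p. poly p x"] by simp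
   have "poly r x \<notin> P"
   proof
    assume "poly r x \<in> P"
    then have "lead_coeff M ^ k * poly R x \<in> P" unfolding pr by (rule prime_setD(2)[OF P prime_setD(4)[OF P M'(2)]])
    then show False using prime_setD(6)[OF P] prime_set_power[OF P M'(3)] R'(3) by blast
   qed
   then have "B r" using hr er by (simp add: B_def)
   moreover have "r ~= 0" using \<open>poly r x \<notin> P\<close> prime_setD(1)[OF P] by auto
   ultimately show False using Rmin[of r] hr(4) nd by auto
  qed
  have lR: "lead_coeff R \<notin> P"
  proof
   assume l: "lead_coeff R \<in> P"
   define S where "S = R - monom (lead_coeff R) (degree R)"
   have mA: "monom (lead_coeff R) (degree R) \<in> polys_over A" using cA[OF R'(1)] by (intro polys_over_monom A)
   have SA: "S \<in> polys_over A" unfolding S_def using mA R'(1) by (intro subring_diff[OF PA])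
   have m0: "ev e w (monom (lead_coeff R) (degree R)) = 0"
    by (rule ev0[OF mA]) (use l prime_setD(1)[OF P] in auto)
   have "R = S + monom (lead_coeff R) (degree R)" by (simp add: S_def)
   then have "ev e w S = 0" using ev_add[OF e SA mA] m0 R'(2) by simp
   moreover have Sx: "poly S x \<notin> P"
   proof
    assume "poly S x \<in> P"
    then have "poly S x + lead_coeff R * x ^ degree R \<in> P" by (rule prime_setD(2)[OF P _ prime_setD(4)[OF P l]])
    then show False using R'(3) by (simp add: S_def poly_monom)
   qed
   ultimately have BS: "B S" using SA by (simp add: B_def)
   have S0: "S ~= 0" using Sx prime_setD(1)[OF P] by auto
   have "coeff S n = 0" if "n \<ge> degree R" for n using that by (cases "n = degree R") (auto simp: S_def coeff_eq_0)
   then have "degree S < degree R" using S0 by (metis leading_coeff_0_iff not_less)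
   then show False using Rmin[OF BS] by simp
  qed
  have dR0: "degree R > 0"
  proof (rule ccontr)
   assume "\<not> degree R > 0"
   then have d0: "degree R = 0" by simp
   obtain a where a: "R = [:a:]" using degree_eq_zeroE[OF d0] by blast
   then show False using R' ker[of a] ev_const[OF e] cA[OF R'(1), of 0] by simp
  qed
  obtain k h r where hr: "h \<in> polys_over A" "r \<in> polys_over A" "smult (lead_coeff R ^ k) M = R * h + r"
   "r = 0 \<or> degree r < degree R" "degree h \<le> degree M - degree R" using polys_over_pseudo_division[OF A R'(1) M'(1)] by blast
  have lA: "lead_coeff R ^ k \<in> A" using cA[OF R'(1)] subring_power[OF A] by blast
  have "e (lead_coeff R ^ k) * ev e w M = ev e w R * ev e w h + ev e w r"
   using evs[OF lA M'(1)] hr(3) ev_add[OF e subring_mult[OF PA R'(1) hr(1)] hr(2)] ev_mult[OF e R'(1) hr(1)] by simp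
  then have er: "ev e w r = 0" using w R'(2) by simp
  have rx: "poly r x \<in> P"
  proof (rule ccontr)
   assume "poly r x \<notin> P"
   then have "B r" "r ~= 0" using er hr prime_setD(1)[OF P] by (auto simp: B_def)
   then show False using Rmin[of r] hr(4) by auto
  qed
  have "lead_coeff R ^ k * poly M x = poly R x * poly h x + poly r x"
   using arg_cong[OF hr(3), of "\<lambda>p. poly p x"] by simp
  then have "poly R x * poly h x = lead_coeff R ^ k * poly M x - poly r x" by simp
  then have "poly R x * poly h x \<in> P" using prime_setD(8)[OF P prime_setD(3)[OF P M'(2)] rx] by simp
  then have "poly h x \<in> P" using prime_setD(6)[OF P] R'(3) by blast
  then have hP: "\<forall>i. coeff h i \<in> P" using Mm[OF hr(1)] hr(5) dR dR0 by auto
  have "coeff (smult (lead_coeff R ^ k) M) (degree M) = coeff (R * h) (degree M)"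
   unfolding hr(3) using hr(4) dR by (auto simp: coeff_eq_0)
  moreover have "coeff (R * h) (degree M) \<in> P"
   unfolding coeff_mult using hP by (intro prime_set_sum[OF P] prime_setD(3)[OF P]) blast
  ultimately have "lead_coeff R ^ k * lead_coeff M \<in> P" by simp
  then show False using prime_setD(6)[OF P] prime_set_power[OF P lR] M'(3) by blast
 qed
 show ?thesis using forw bwd Q by blast
qed

text \<open>The polynomials in the first \<open>i\<close> variables.\<close>

primrec var_tower :: "(nat => 'n::finite) => nat => ('n, 'a::comm_ring_1) mpoly set" where
 "var_tower vs 0 = range mpoly_const"
| "var_tower vs (Suc i) = adjoin (var_tower vs i) (mpoly_var (vs i))"

lemma var_tower_subring: "is_subring (var_tower vs i)"
proof (induction i)
 case 0
 show ?case unfolding var_tower.simps by (rule is_subringI) (auto simp flip: mpoly_const_simps)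
qed (simp add: is_subring_adjoin)

lemma var_tower_mono: "i \<le> j ==> var_tower vs i \<subseteq> var_tower vs j"
proof (induction j rule: dec_induct)
 case (step k)
 show ?case unfolding var_tower.simps by (rule order_trans[OF step.IH adjoin_superset[OF var_tower_subring]])
qed simp

lemma var_tower_const: "mpoly_const c \<in> var_tower vs i"
 using var_tower_mono[of 0 i vs] by auto

lemma var_tower_UNIV:
 assumes vs: "bij_betw vs {0..<n} (UNIV :: 'n::finite set)"
 shows "var_tower vs n = (UNIV :: ('n, 'a::comm_ring_1) mpoly set)"
proof (rule mpoly_subring_UNIV[OF var_tower_subring])
 show "mpoly_const c \<in> var_tower vs n" for c :: 'a by (rule var_tower_const)
 show "(mpoly_var l :: ('n, 'a) mpoly) \<in> var_tower vs n" for l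
 proof -
  have "l \<in> vs ` {0..<n}" using vs by (simp add: bij_betw_def)
  then obtain i where i: "i < n" "vs i = l" by auto
  show ?thesis using adjoin_mem[OF var_tower_subring[of vs i], of "mpoly_var (vs i) :: ('n, 'a) mpoly"] var_tower_mono[of "Suc i" n vs] i by auto
 qed
qed

text \<open>The variables are treated one after the other: a generic one is sent to a fresh transcendental, any other one
  to a root of its transported minimal relation.\<close>

theorem generic_point:
 fixes P :: "('n::finite, real) mpoly set"
 assumes P: "prime_set P"
 shows "\<exists>e :: ('n, real) mpoly => host. phom UNIV e \<and> (\<forall>p. e p = 0 \<longleftrightarrow> p \<in> P) \<and> (\<forall>c. e (mpoly_const c) = gconst c)"
proof -
 obtain vs :: "nat => 'n" and n where vs: "bij_betw vs {0..<n} UNIV"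
  using ex_bij_betw_nat_finite[OF finite[of "UNIV :: 'n set"]] by blast
 define xv where "xv = (\<lambda>i. mpoly_var (vs i) :: ('n, real) mpoly)"
 define A where "A = (var_tower vs :: nat => ('n, real) mpoly set)"
 have A0: "A 0 = range mpoly_const" and AS: "A (Suc i) = adjoin (A i) (xv i)" for i by (simp_all add: A_def xv_def)
 have A0r: "is_subring (A 0)" unfolding A_def by (rule var_tower_subring)
 have "\<exists>e. phom (A i) e \<and> (\<forall>a\<in>A i. e a = 0 \<longleftrightarrow> a \<in> P) \<and> (\<forall>c. e (mpoly_const c) = gconst c) \<and> e ` A i \<subseteq> gclosed i" for i
 proof (induction i)
  case 0
  define e where "e = (\<lambda>p::('n, real) mpoly. gconst (Poly_Mapping.lookup p 0))"
  have ec: "e (mpoly_const c) = gconst c" for c by (simp add: e_def mpoly_const_def)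
  have cP: "mpoly_const c \<in> P \<longleftrightarrow> c = 0" for c
  proof
   assume "mpoly_const c \<in> P"
   then have "mpoly_const (inverse c) * mpoly_const c \<in> P" by (rule prime_setD(3)[OF P])
   then show "c = 0" using prime_setD(5)[OF P] by (cases "c = 0") (auto simp flip: mpoly_const_simps)
  qed (use prime_setD(1)[OF P] in \<open>auto simp: mpoly_const_simps\<close>)
  have "gconst c = 0 \<longleftrightarrow> c = 0" for c
   unfolding gconst_def by (metis emb_eq_0_iff lookup_single_eq lookup_zero single_zero)
  then have "\<forall>a\<in>A 0. e a = 0 \<longleftrightarrow> a \<in> P" by (auto simp: A0 ec cP)
  moreover have "phom (A 0) e" unfolding phom_def
   using A0r phom_gconst by (auto simp: A0 ec phom_def simp flip: mpoly_const_simps)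
  moreover have "e ` A 0 \<subseteq> gclosed 0" using gclosed_field[of 0] by (auto simp: A0 ec)
  ultimately show ?case using ec by blast
 next
  case (Suc i)
  then obtain e where e: "phom (A i) e" and ker: "\<And>a. a \<in> A i ==> e a = 0 \<longleftrightarrow> a \<in> P"
   and ec: "\<And>c. e (mpoly_const c) = gconst c" and eE: "e ` A i \<subseteq> gclosed i" by blast
  note Ai = phom_subring[OF e]
  have cA: "mpoly_const c \<in> A i" for c unfolding A_def by (rule var_tower_const)
  have "\<exists>w. w \<in> gclosed (Suc i) \<and> (\<forall>Q\<in>polys_over (A i). ev e w Q = 0 \<longleftrightarrow> poly Q (xv i) \<in> P)"
  proof (cases "generic_over P (A i) (xv i)")
   case True
   let ?w = "emb (gvar i)"
   have "ev e ?w Q = 0 \<longleftrightarrow> poly Q (xv i) \<in> P" if Q: "Q \<in> polys_over (A i)" for Q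
   proof
    assume h: "ev e ?w Q = 0"
    have "map_poly e Q \<in> polys_over (gclosed i)"
     using Q eE by (auto simp: polys_over_def coeff_map_poly phom_zero[OF e])
    then have "map_poly e Q = 0"
     using h gclosed_field[of i] gvar_fresh[of i] unfolding ev_def rel_closed_def by blast
    then have "e (coeff Q j) = 0" for j by (metis coeff_0 coeff_map_poly phom_zero[OF e])
    then have "coeff Q j \<in> P" for j using ker Q by (auto simp: polys_over_def)
    then show "poly Q (xv i) \<in> P" by (rule poly_coeffs_prime[OF P])
   next
    assume "poly Q (xv i) \<in> P"
    then have "coeff Q j \<in> P" for j using True Q by (auto simp: generic_over_def)
    then have "e (coeff Q j) = 0" for j using ker Q by (auto simp: polys_over_def)
    then show "ev e ?w Q = 0" by (simp add: ev_altdef[OF e])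
   qed
   then show ?thesis using gvar_gclosed[of i "Suc i"] by blast
  next
   case False
   then obtain M where M: "minimal_relation P (A i) (xv i) M"
    using generic_or_minimal_relation[OF P Ai] by blast
   have M': "M \<in> polys_over (A i)" "lead_coeff M \<notin> P" using M by (auto simp: minimal_relation_def)
   have "coeff (map_poly e M) (degree M) ~= 0"
    using M' ker by (auto simp: coeff_map_poly phom_zero[OF e] polys_over_def)
   then have d: "degree (map_poly e M) \<ge> degree M" "map_poly e M ~= 0" by (auto intro: le_degree)
   then obtain w where w: "poly (map_poly e M) w = 0"
    using alg_closed_imp_poly_has_root[of "map_poly e M"] minimal_relation_degree[OF P M] by auto
   have "map_poly e M \<in> polys_over (gclosed i)"
    using M'(1) eE by (auto simp: polys_over_def coeff_map_poly phom_zero[OF e])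
   then have "w \<in> gclosed i" using w d gclosed_field[of i] unfolding rel_closed_def by blast
   then have "w \<in> gclosed (Suc i)" using gclosed_mono[of i "Suc i"] by auto
   moreover have "ev e w M = 0" using w by (simp add: ev_def)
   ultimately show ?thesis using generic_step_algebraic[OF P e ker M] by blast
  qed
  then obtain w where w: "w \<in> gclosed (Suc i)" "\<And>Q. Q \<in> polys_over (A i) ==> ev e w Q = 0 \<longleftrightarrow> poly Q (xv i) \<in> P" by blast
  have cond: "ev e w Q = 0" if "Q \<in> polys_over (A i)" "poly Q (xv i) = 0" for Q
   using w(2)[OF that(1)] that(2) prime_setD(1)[OF P] by simp
  obtain e' where e': "phom (A (Suc i)) e'" "\<And>Q. Q \<in> polys_over (A i) ==> e' (poly Q (xv i)) = ev e w Q"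
   using phom_adjoin[OF e cond] unfolding AS by blast
  have "\<forall>a\<in>A (Suc i). e' a = 0 \<longleftrightarrow> a \<in> P" using e' w(2) by (auto simp: AS adjoin_def)
  moreover have "e' (mpoly_const c) = gconst c" for c
   using e'(2)[of "[:mpoly_const c:]"] cA Ai ec by (auto simp: ev_const[OF e] intro!: polys_over_intros)
  moreover have "e' ` A (Suc i) \<subseteq> gclosed (Suc i)"
  proof
   fix v assume "v \<in> e' ` A (Suc i)"
   then obtain Q where Q: "Q \<in> polys_over (A i)" "v = ev e w Q" using e'(2) by (auto simp: AS adjoin_def)
   have "e (coeff Q j) \<in> gclosed (Suc i)" for j
    using Q eE gclosed_mono[of i "Suc i"] by (auto simp: polys_over_def)
   then show "v \<in> gclosed (Suc i)" unfolding Q(2) ev_altdef[OF e] using w(1) gclosed_field[of "Suc i"]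
    by (auto intro!: subfield_intros)
  qed
  ultimately show ?case using e' by blast
 qed
 then obtain e where e: "phom (A n) e" "\<forall>a\<in>A n. e a = 0 \<longleftrightarrow> a \<in> P" "\<forall>c. e (mpoly_const c) = gconst c" by blast
 moreover have "A n = UNIV" unfolding A_def by (rule var_tower_UNIV[OF vs])
 ultimately show ?thesis by (intro exI[of _ e]) simp
qed

section \<open>Regular points of the zero locus of a real prime ideal\<close>

definition reval :: "complex ^ 'n::finite => ('n, real) mpoly => complex" where
 "reval z = meval complex_of_real (\<lambda>l. z $ l)"

lemma phom_of_real: "phom UNIV complex_of_real"
 unfolding phom_def by (simp add: is_subring_def)

lemma phom_reval: "phom UNIV (reval z)"
 unfolding reval_def by (rule phom_meval[OF phom_of_real])

lemmas reval_simps [simp] = phom_add[OF phom_reval UNIV_I UNIV_I] phom_mult[OF phom_reval UNIV_I UNIV_I]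
 phom_one[OF phom_reval] phom_zero[OF phom_reval] phom_uminus[OF phom_reval UNIV_I]
 phom_diff[OF phom_reval UNIV_I UNIV_I] phom_power[OF phom_reval UNIV_I]

lemma reval_const [simp]: "reval z (mpoly_const c) = complex_of_real c"
 unfolding reval_def by (rule meval_const[OF phom_of_real])

lemma reval_var [simp]: "reval z (mpoly_var l) = z $ l"
 unfolding reval_def by (rule meval_var[OF phom_of_real])

lemma reval_poly: "reval z (poly Q x) = poly (map_poly (reval z) Q) (reval z x)"
 by (induction Q) (simp_all add: map_poly_pCons)

definition has_cderiv :: "(complex ^ 'n::finite => complex) => (complex ^ 'n => complex ^ 'n => complex) => bool" where
 "has_cderiv f D \<longleftrightarrow> (\<forall>z. (f has_derivative D z) (at z)) \<and> (\<forall>z c v. D z (c *s v) = c * D z v) \<and>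
  (\<forall>v. continuous_on UNIV (\<lambda>z. D z v))"

lemma has_cderiv_continuous: "has_cderiv f D ==> continuous_on UNIV f"
 unfolding has_cderiv_def by (meson continuous_at_imp_continuous_on has_derivative_continuous)

lemma has_cderiv_const: "has_cderiv (\<lambda>z. c) (\<lambda>z v. 0)"
 unfolding has_cderiv_def by simp

lemma has_cderiv_component: "has_cderiv (\<lambda>z :: complex ^ 'n::finite. z $ l) (\<lambda>z v. v $ l)"
 unfolding has_cderiv_def by (auto intro!: bounded_linear_imp_has_derivative bounded_linear_vec_nth)

lemma has_cderiv_add: "has_cderiv f D ==> has_cderiv g D' ==> has_cderiv (\<lambda>z. f z + g z) (\<lambda>z v. D z v + D' z v)"
 unfolding has_cderiv_def by (auto intro!: has_derivative_add continuous_on_add simp: distrib_left)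

lemma has_cderiv_minus: "has_cderiv f D ==> has_cderiv (\<lambda>z. - f z) (\<lambda>z v. - D z v)"
 unfolding has_cderiv_def by (auto intro!: has_derivative_minus continuous_on_minus)

lemma has_cderiv_mult:
 assumes f: "has_cderiv f D" and g: "has_cderiv g D'"
 shows "has_cderiv (\<lambda>z. f z * g z) (\<lambda>z v. f z * D' z v + D z v * g z)"
proof -
 note has_cderiv_continuous[OF f] has_cderiv_continuous[OF g]
 moreover have "((\<lambda>z. f z * g z) has_derivative (\<lambda>v. f z * D' z v + D z v * g z)) (at z)" for z
  using f g by (intro has_derivative_mult) (auto simp: has_cderiv_def)
 ultimately show ?thesis using f g
  unfolding has_cderiv_def by (auto intro!: continuous_on_add continuous_on_mult simp: algebra_simps)
qed

lemma reval_has_cderiv: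
 fixes p :: "('n::finite, real) mpoly"
 shows "\<exists>D. has_cderiv (\<lambda>z. reval z p) D"
proof -
 have "{p :: ('n, real) mpoly. \<exists>D. has_cderiv (\<lambda>z. reval z p) D} = UNIV"
 proof (rule mpoly_subring_UNIV)
  show "is_subring {p :: ('n, real) mpoly. \<exists>D. has_cderiv (\<lambda>z. reval z p) D}"
   by (rule is_subringI) (auto intro: has_cderiv_const has_cderiv_add has_cderiv_minus has_cderiv_mult)
 qed (auto intro: has_cderiv_const has_cderiv_component)
 then show ?thesis by blast
qed

lemma continuous_on_reval: "continuous_on S (\<lambda>z. reval z p)"
proof -
 obtain D where "has_cderiv (\<lambda>z. reval z p) D" using reval_has_cderiv by blast
 from has_cderiv_continuous[OF this] show ?thesis by (rule continuous_on_subset) simp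
qed

text \<open>A polynomial in the tower only depends on the earlier variables.\<close>

lemma var_tower_depends:
 fixes z z' :: "complex ^ 'n::finite"
 assumes "a \<in> var_tower vs i" "\<And>j. j < i ==> z $ vs j = z' $ vs j"
 shows "reval z a = reval z' a"
 using assms
proof (induction i arbitrary: a)
 case (Suc i)
 then obtain Q where Q: "Q \<in> polys_over (var_tower vs i)" "a = poly Q (mpoly_var (vs i))" by (auto simp: adjoin_def)
 have "map_poly (reval z) Q = map_poly (reval z') Q"
  using Q(1) Suc by (intro poly_eqI) (auto simp: coeff_map_poly polys_over_def)
 then show ?case using Suc.prems(2)[of i] by (simp add: Q(2) reval_poly)
qed auto

lemma has_cderiv_direction:
 fixes f :: "complex ^ 'n::finite => complex"
 assumes f: "has_cderiv f D" and p: "\<And>t::real. f (z + t *\<^sub>R v) = poly p (a + of_real t * b)"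
 shows "D z v = poly (pderiv p) a * b"
proof -
 have "((\<lambda>t. f (z + t *\<^sub>R v)) has_derivative (\<lambda>t. D z (t *\<^sub>R v))) (at 0)"
  by (rule has_derivative_compose[of "\<lambda>t. z + t *\<^sub>R v" "\<lambda>t. t *\<^sub>R v" 0 UNIV f "D z"])
   (use f in \<open>auto simp: has_cderiv_def intro!: derivative_eq_intros\<close>)
 moreover have "D z (t *\<^sub>R v) = t *\<^sub>R D z v" for t
  using f linear_cmul[OF has_derivative_linear[of f "D z" "at z"]] by (auto simp: has_cderiv_def)
 ultimately have "((\<lambda>t. f (z + t *\<^sub>R v)) has_vector_derivative D z v) (at 0)"
  by (simp add: has_vector_derivative_def)
 moreover have "((\<lambda>t. f (z + t *\<^sub>R v)) has_vector_derivative (b * poly (pderiv p) a)) (at 0)"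
 proof -
  have "(poly p has_field_derivative poly (pderiv p) (a + of_real 0 * b)) (at (a + of_real 0 * b))"
   by (rule poly_DERIV)
  moreover have "((\<lambda>t. a + of_real t * b) has_vector_derivative b) (at 0)"
   by (auto intro!: derivative_eq_intros simp: has_vector_derivative_def scaleR_conv_of_real)
  ultimately have "((poly p \<circ> (\<lambda>t. a + of_real t * b)) has_vector_derivative (b * poly (pderiv p) (a + of_real 0 * b))) (at 0)"
   by (rule field_vector_diff_chain_at[rotated])
  then show ?thesis by (simp add: p o_def)
 qed
 ultimately show ?thesis using vector_derivative_unique_at by (simp add: mult.commute) blast
qed

text \<open>The coefficients form a ring of polynomials in several variables, which is not an instance of the integral
  domains that \<open>pderiv\<close> presupposes.\<close>

definition formal_deriv :: "'a::comm_ring_1 poly => 'a poly" where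
 "formal_deriv p = (\<Sum>k<degree p. monom (of_nat (Suc k) * coeff p (Suc k)) k)"

lemma coeff_formal_deriv: "coeff (formal_deriv p) k = of_nat (Suc k) * coeff p (Suc k)"
proof -
 have "coeff (formal_deriv p) k = (\<Sum>j<degree p. if j = k then of_nat (Suc j) * coeff p (Suc j) else 0)"
  unfolding formal_deriv_def coeff_sum by (intro sum.cong) auto
 also have "\<dots> = of_nat (Suc k) * coeff p (Suc k)" by (simp add: coeff_eq_0)
 finally show ?thesis .
qed

text \<open>\<open>G\<close> consists of the minimal relations of the successive nongeneric variables, and \<open>h\<close> is the product of
  their leading coefficients and derivatives. Where the relations vanish and \<open>h\<close> does not, pseudodivision shows
  that all of \<open>I\<close> vanishes. Replacing each nongeneric coordinate by its relation gives a map with triangular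
  Jacobian and nonzero diagonal; it is a local coordinate system in which the zero locus is a coordinate subspace.\<close>

theorem generic_regular_points:
 fixes I :: "('n::finite, real) mpoly set"
 assumes P: "prime_set I"
 defines "Z \<equiv> {z. \<forall>p\<in>I. reval z p = 0}"
 obtains G h where "finite G" "G \<subseteq> I" "h \<notin> I"
  "\<And>z. (\<And>g. g \<in> G ==> reval z g = 0) ==> reval z h ~= 0 ==> regular_point Z z"
proof -
 obtain vs :: "nat => 'n" and n where vs: "bij_betw vs {0..<n} UNIV"
  using ex_bij_betw_nat_finite[OF finite[of "UNIV :: 'n set"]] by blast
 define A where "A = (var_tower vs :: nat => ('n, real) mpoly set)"
 define xv where "xv = (\<lambda>i. mpoly_var (vs i) :: ('n, real) mpoly)"
 have AS: "A (Suc i) = adjoin (A i) (xv i)" for i by (simp add: A_def xv_def)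
 have Ar: "is_subring (A i)" for i unfolding A_def by (rule var_tower_subring)
 define alg where "alg = {i. i < n \<and> \<not> generic_over I (A i) (xv i)}"
 obtain M where M: "\<And>i. i \<in> alg ==> minimal_relation I (A i) (xv i) (M i)"
 proof -
  have "\<forall>i\<in>alg. \<exists>M. minimal_relation I (A i) (xv i) M"
   using generic_or_minimal_relation[OF P Ar] by (auto simp: alg_def)
  from bchoice[OF this] show ?thesis using that by blast
 qed
 have M': "M i \<in> polys_over (A i)" "poly (M i) (xv i) \<in> I" "lead_coeff (M i) \<notin> I" if "i \<in> alg" for i
  using M[OF that] by (auto simp: minimal_relation_def)
 have fin: "finite alg" by (simp add: alg_def)
 define G where "G = (\<lambda>i. poly (M i) (xv i)) ` alg"
 define h where "h = (\<Prod>i\<in>alg. lead_coeff (M i) * poly (formal_deriv (M i)) (xv i))"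
 have dI: "poly (formal_deriv (M i)) (xv i) \<notin> I" if i: "i \<in> alg" for i
 proof
  assume d: "poly (formal_deriv (M i)) (xv i) \<in> I"
  have deg: "degree (M i) > 0" by (rule minimal_relation_degree[OF P M[OF i]])
  have "formal_deriv (M i) \<in> polys_over (A i)"
   using M'(1)[OF i] Ar by (auto simp: polys_over_def coeff_formal_deriv simp del: of_nat_Suc intro!: subring_mult subring_of_nat)
  moreover have "degree (formal_deriv (M i)) < degree (M i)"
  proof -
   have "degree (formal_deriv (M i)) \<le> degree (M i) - 1" by (rule degree_le) (auto simp: coeff_formal_deriv coeff_eq_0)
   then show ?thesis using deg by simp
  qed
  ultimately have "coeff (formal_deriv (M i)) (degree (M i) - 1) \<in> I"
   using M[OF i] d unfolding minimal_relation_def by blast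
  then have "of_nat (degree (M i)) * lead_coeff (M i) \<in> I" using deg by (simp add: coeff_formal_deriv del: of_nat_Suc)
  then have "mpoly_const (1 / real (degree (M i))) * (of_nat (degree (M i)) * lead_coeff (M i)) \<in> I" by (rule prime_setD(3)[OF P])
  moreover have "(of_nat k :: ('n, real) mpoly) = mpoly_const (real k)" for k
   by (induction k) (simp_all add: mpoly_const_simps)
  ultimately show False using M'(3)[OF i] deg by (simp add: mult.assoc[symmetric] mpoly_const_simps(2)[symmetric] mpoly_const_simps(3))
 qed
 have hI: "h \<notin> I"
 proof -
  have "(\<Prod>i\<in>K. lead_coeff (M i) * poly (formal_deriv (M i)) (xv i)) \<notin> I" if "finite K" "K \<subseteq> alg" for K
   using that
  proof (induction K rule: finite_induct)
   case (insert k K)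
   have k: "lead_coeff (M k) * poly (formal_deriv (M k)) (xv k) \<notin> I"
    using prime_setD(6)[OF P _ M'(3)[of k]] dI[of k] insert.prems by blast
   have "(\<Prod>i\<in>K. lead_coeff (M i) * poly (formal_deriv (M i)) (xv i)) \<notin> I" using insert by blast
   then show ?case using prime_setD(6)[OF P _ k] unfolding prod.insert[OF insert.hyps] by blast
  qed (simp add: prime_setD[OF P])
  then show ?thesis using fin by (simp add: h_def)
 qed
 \<comment> \<open>points where the relations vanish and no leading coefficient does\<close>
 have inZ: "z \<in> Z" if z: "\<And>i. i \<in> alg ==> reval z (poly (M i) (xv i)) = 0" "\<And>i. i \<in> alg ==> reval z (lead_coeff (M i)) ~= 0" for z
 proof -
  have "i \<le> n ==> a \<in> A i ==> a \<in> I ==> reval z a = 0" for i a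
  proof (induction i arbitrary: a)
   case 0
   then obtain c where c: "a = mpoly_const c" by (auto simp: A_def)
   have "mpoly_const (inverse c) * a \<in> I" using 0 by (intro prime_setD(3)[OF P])
   then have "c = 0" using prime_setD(5)[OF P] c by (cases "c = 0") (auto simp: mpoly_const_simps simp flip: mpoly_const_simps(2))
   then show ?case by (simp add: c)
  next
   case (Suc i)
   then obtain Q where Q: "Q \<in> polys_over (A i)" "a = poly Q (xv i)" by (auto simp: AS adjoin_def)
   have ze: "reval z (poly r (xv i)) = 0" if "r \<in> polys_over (A i)" "\<And>k. coeff r k \<in> I" for r
   proof -
    have "map_poly (reval z) r = 0"
     using that Suc.IH Suc.prems(1) by (intro poly_eqI) (simp add: coeff_map_poly polys_over_def)
    then show ?thesis by (simp add: reval_poly)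
   qed
   show ?case
   proof (cases "i \<in> alg")
    case False
    then have "generic_over I (A i) (xv i)" using Suc.prems(1) by (auto simp: alg_def)
    then show ?thesis using ze Q Suc.prems(3) by (auto simp: generic_over_def)
   next
    case True
    have QI: "poly Q (xv i) \<in> I" using Q Suc.prems(3) by simp
    obtain k h r where hr: "h \<in> polys_over (A i)" "r \<in> polys_over (A i)"
     "smult (lead_coeff (M i) ^ k) Q = M i * h + r" "\<forall>j. coeff r j \<in> I"
     using minimal_relation_divides[OF P Ar M[OF True] Q(1) QI] by blast
    have "lead_coeff (M i) ^ k * poly Q (xv i) = poly (M i) (xv i) * poly h (xv i) + poly r (xv i)"
     using arg_cong[OF hr(3), of "\<lambda>p. poly p (xv i)"] by simp
    then have "reval z (lead_coeff (M i) ^ k * poly Q (xv i)) = 0" using z(1)[OF True] ze[OF hr(2)] hr(4) by simp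
    then show ?thesis using z(2)[OF True] Q(2) by simp
   qed
  qed
  then show ?thesis using var_tower_UNIV[OF vs] unfolding Z_def A_def by blast
 qed
 have vsi: "\<exists>i<n. vs i = l" for l
 proof -
  have "l \<in> vs ` {0..<n}" using vs by (simp add: bij_betw_def)
  then show ?thesis by auto
 qed
 have vsinj: "i = j" if "vs i = vs j" "i < n" "j < n" for i j
  using vs that by (auto simp: bij_betw_def inj_on_def)
 define idx where "idx = (\<lambda>l. SOME i. i < n \<and> vs i = l)"
 have idx: "idx l < n" "vs (idx l) = l" for l
  using someI_ex[of "\<lambda>i. i < n \<and> vs i = l"] vsi[of l] unfolding idx_def by blast+
 have idx_vs: "i < n ==> idx (vs i) = i" for i using vsinj idx by blast
 define F where "F = (\<lambda>l (z :: complex ^ 'n). if idx l \<in> alg then reval z (poly (M (idx l)) (xv (idx l))) else z $ l)"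
 have "\<exists>D. has_cderiv (F l) D" for l
  using reval_has_cderiv[of "poly (M (idx l)) (xv (idx l))"] has_cderiv_component[of l]
  unfolding F_def by (cases "idx l \<in> alg") auto
 then obtain D where D: "\<And>l. has_cderiv (F l) (D l)" by metis
 define \<Phi> where "\<Phi> = (\<lambda>z. \<chi> l. F l z)"
 define DP where "DP = (\<lambda>z v. \<chi> l. D l z v)"
 have der: "(\<Phi> has_derivative DP z) (at z)" for z
 proof -
  have "((\<lambda>z. F l z \<bullet> b) has_derivative (\<lambda>v. D l z v \<bullet> b)) (at z)" for l b
   using D by (intro bounded_linear.has_derivative[OF bounded_linear_inner_left]) (auto simp: has_cderiv_def)
  then show ?thesis unfolding has_derivative_componentwise_within[of \<Phi>]
   by (auto simp: \<Phi>_def DP_def Basis_vec_def inner_axis)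
 qed
 have bl: "bounded_linear (DP z)" for z using der has_derivative_bounded_linear by blast
 have DPc: "DP z (c *s v) = c *s DP z v" for z c v
  using D by (simp add: DP_def vec_eq_iff has_cderiv_def)
 define f' where "f' = (\<lambda>z. Blinfun (DP z))"
 have f'[simp]: "blinfun_apply (f' z) = DP z" for z unfolding f'_def by (rule bounded_linear_Blinfun_apply[OF bl])
 have contf: "continuous_on U f'" for U
 proof (rule continuous_on_blinfun_componentwise)
  fix v :: "complex ^ 'n"
  have "continuous_on U (\<lambda>z. D l z v)" for l
   using D[of l] unfolding has_cderiv_def by (meson continuous_on_subset subset_UNIV)
  then show "continuous_on U (\<lambda>z. blinfun_apply (f' z) v)" by (simp add: DP_def continuous_on_vec_lambda)
 qed
 have injD: "v = 0" if h: "reval z h ~= 0" and v: "DP z v = 0" for z v :: "complex ^ 'n"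
 proof -
  have nz: "reval z (poly (formal_deriv (M i)) (xv i)) ~= 0" if "i \<in> alg" for i
  proof -
   have "(\<Prod>i\<in>alg. reval z (lead_coeff (M i) * poly (formal_deriv (M i)) (xv i))) ~= 0"
    using h unfolding h_def by (simp only: phom_prod[OF phom_reval UNIV_I] not_False_eq_True)
   then show ?thesis using that fin by simp
  qed
  have "i < n ==> v $ vs i = 0" for i
  proof (induction i rule: less_induct)
   case (less i)
   have Dv: "D (vs i) z v = 0" using v by (simp add: DP_def vec_eq_iff)
   show ?case
   proof (cases "i \<in> alg")
    case False
    then have "F (vs i) (z + t *\<^sub>R v) = poly [:0, 1:] (z $ vs i + of_real t * v $ vs i)" for t
     using less.prems by (simp add: F_def idx_vs scaleR_conv_of_real[where 'a = complex])
    from has_cderiv_direction[OF D this] Dv show ?thesis by (simp add: pderiv_pCons)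
   next
    case True
    have "F (vs i) (z + t *\<^sub>R v) = poly (map_poly (reval z) (M i)) (z $ vs i + of_real t * v $ vs i)" for t
    proof -
     have "map_poly (reval (z + t *\<^sub>R v)) (M i) = map_poly (reval z) (M i)"
     proof (rule poly_eqI)
      fix k
      have "coeff (M i) k \<in> A i" using M'(1)[OF True] by (simp add: polys_over_def)
      then have "reval (z + t *\<^sub>R v) (coeff (M i) k) = reval z (coeff (M i) k)"
       unfolding A_def using less by (intro var_tower_depends) auto
      then show "coeff (map_poly (reval (z + t *\<^sub>R v)) (M i)) k = coeff (map_poly (reval z) (M i)) k"
       by (simp add: coeff_map_poly)
     qed
     then show ?thesis using True less.prems by (simp add: F_def idx_vs reval_poly xv_def scaleR_conv_of_real[where 'a = complex])
    qed
    from has_cderiv_direction[OF D this] Dv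
    have "poly (pderiv (map_poly (reval z) (M i))) (z $ vs i) * v $ vs i = 0" by simp
    moreover have "pderiv (map_poly (reval z) (M i)) = map_poly (reval z) (formal_deriv (M i))"
    proof (rule poly_eqI)
     fix k
     have "reval z (of_nat m) = of_nat m" for m by (induction m) simp_all
     then show "coeff (pderiv (map_poly (reval z) (M i))) k = coeff (map_poly (reval z) (formal_deriv (M i))) k"
      by (simp add: coeff_pderiv coeff_formal_deriv coeff_map_poly)
    qed
    ultimately show ?thesis using nz[OF True] by (simp add: reval_poly xv_def)
   qed
  qed
  then show ?thesis using vsi by (metis vec_eq_iff zero_index)
 qed
 define S where "S = {l :: 'n. idx l \<in> alg}"
 have reg: "regular_point Z q" if q: "\<And>g. g \<in> G ==> reval q g = 0" "reval q h ~= 0" for q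
 proof -
  define U0 where "U0 = {z. reval z h ~= 0}"
  have "open U0" unfolding U0_def by (intro open_Collect_neq continuous_on_reval continuous_on_const)
  have lin: "linear (DP q)" using bl by (rule bounded_linear.linear)
  have "inj (DP q)" using injD[OF q(2)] by (simp add: linear_injective_0[OF lin])
  then obtain g where g: "linear g" "g \<circ> DP q = id" using linear_injective_left_inverse[OF lin] by blast
  have inv: "Blinfun g o\<^sub>L f' q = id_blinfun"
  proof (rule blinfun_eqI)
   fix v show "blinfun_apply (Blinfun g o\<^sub>L f' q) v = blinfun_apply id_blinfun v"
    using g(1) fun_cong[OF g(2), of v] by (simp add: bounded_linear_Blinfun_apply linear_conv_bounded_linear)
  qed
  have qU: "q \<in> U0" using q by (simp add: U0_def)
  have der': "(\<Phi> has_derivative blinfun_apply (f' x)) (at x)" if "x \<in> U0" for x using der by simp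
  obtain U V \<Psi> \<Psi>' where UV: "open U" "U \<subseteq> U0" "q \<in> U" "open V" "\<Phi> q \<in> V" "homeomorphism U V \<Phi> \<Psi>"
   "\<And>y. y \<in> V ==> (\<Psi> has_derivative (\<Psi>' y)) (at y)"
   "\<And>y. y \<in> V ==> \<Psi>' y = Hilbert_Choice.inv (blinfun_apply (f' (\<Psi> y)))" "\<And>y. y \<in> V ==> bij (blinfun_apply (f' (\<Psi> y)))"
  proof (rule inverse_function_theorem[OF \<open>open U0\<close> der' contf qU inv])
   fix U V g g'
   assume h: "open U" "U \<subseteq> U0" "q \<in> U" "open V" "\<Phi> q \<in> V" "homeomorphism U V \<Phi> g"
    "\<And>y. y \<in> V ==> (g has_derivative g' y) (at y)"
    "\<And>y. y \<in> V ==> g' y = Hilbert_Choice.inv (blinfun_apply (f' (g y)))"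
    "\<And>y. y \<in> V ==> bij (blinfun_apply (f' (g y)))"
   show thesis by (rule that[OF h])
  qed
  have lead: "reval z (lead_coeff (M i)) ~= 0" if "z \<in> U" "i \<in> alg" for z i
  proof -
   have "reval z h ~= 0" using UV(2) that by (auto simp: U0_def)
   then have "(\<Prod>i\<in>alg. reval z (lead_coeff (M i) * poly (formal_deriv (M i)) (xv i))) ~= 0"
    unfolding h_def by (simp only: phom_prod[OF phom_reval UNIV_I] not_False_eq_True)
   then show ?thesis using that fin by simp
  qed
  have ZU: "z \<in> Z \<longleftrightarrow> (\<forall>l\<in>S. \<Phi> z $ l = 0)" if z: "z \<in> U" for z
  proof
   assume "z \<in> Z"
   then show "\<forall>l\<in>S. \<Phi> z $ l = 0" using M'(2) by (auto simp: S_def \<Phi>_def F_def Z_def)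
  next
   assume h: "\<forall>l\<in>S. \<Phi> z $ l = 0"
   show "z \<in> Z"
   proof (rule inZ[OF _ lead[OF z]])
    fix i assume i: "i \<in> alg"
    then have "idx (vs i) = i" "vs i \<in> S" using idx_vs by (auto simp: alg_def S_def)
    then show "reval z (poly (M i) (xv i)) = 0" using h i by (auto simp: \<Phi>_def F_def)
   qed
  qed
  have "\<Phi> ` (Z \<inter> U) = {w\<in>V. \<forall>i\<in>S. w $ i = 0}"
  proof -
   have "\<Phi> ` U = V" using UV(6) by (auto simp: homeomorphism_def)
   then show ?thesis using ZU by auto
  qed
  moreover have "cholomorphic_on (\<lambda>z. \<Phi> z $ i) U" for i
   unfolding cholomorphic_on_def
  proof
   fix z assume "z \<in> U"
   show "\<exists>D. ((\<lambda>z. \<Phi> z $ i) has_derivative D) (at z) \<and> (\<forall>c v. D (c *s v) = c * D v)"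
    using D[of i] by (intro exI[of _ "D i z"]) (auto simp: \<Phi>_def has_cderiv_def)
  qed
  moreover have "cholomorphic_on (\<lambda>z. \<Psi> z $ i) V" for i
   unfolding cholomorphic_on_def
  proof
   fix w assume w: "w \<in> V"
   let ?L = "DP (\<Psi> w)"
   have b: "bij ?L" using UV(9)[OF w] by simp
   have e: "\<Psi>' w = Hilbert_Choice.inv ?L" using UV(8)[OF w] by simp
   have "\<Psi>' w (c *s v) = c *s \<Psi>' w v" for c v
   proof -
    have "?L (c *s \<Psi>' w v) = c *s v" unfolding DPc e using b by (simp add: bij_is_surj surj_f_inv_f)
    then show ?thesis unfolding e using b by (metis bij_inv_eq_iff)
   qed
   then show "\<exists>D. ((\<lambda>z. \<Psi> z $ i) has_derivative D) (at w) \<and> (\<forall>c v. D (c *s v) = c * D v)"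
    using bounded_linear.has_derivative[OF bounded_linear_vec_nth UV(7)[OF w], of i]
    by (intro exI[of _ "\<lambda>v. \<Psi>' w v $ i"]) auto
  qed
  moreover have "q \<in> Z" using q(1) lead[OF UV(3)] by (intro inZ) (auto simp: G_def)
  ultimately show ?thesis unfolding regular_point_def using UV(1,3,4,6) by blast
 qed
 show thesis
 proof (rule that[of G h])
  show "finite G" "G \<subseteq> I" using fin M'(2) by (auto simp: G_def)
 qed (use hI reg in auto)
qed

section \<open>Real and complexified ideals, cosets and values\<close>

lemma type_ring_simps [simp]:
 "carrier (ring_of_type_algebra :: 'r::comm_ring_1 ring) = UNIV"
 "x \<otimes>\<^bsub>(ring_of_type_algebra :: 'r ring)\<^esub> y = x * y" "x \<oplus>\<^bsub>(ring_of_type_algebra :: 'r ring)\<^esub> y = x + y"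
 "\<one>\<^bsub>(ring_of_type_algebra :: 'r ring)\<^esub> = 1" "\<zero>\<^bsub>(ring_of_type_algebra :: 'r ring)\<^esub> = 0"
 by (simp_all add: ring_of_type_algebra_def)

definition ideal_set :: "'r::comm_ring_1 set => bool" where
 "ideal_set I \<longleftrightarrow> 0 \<in> I \<and> (\<forall>x\<in>I. \<forall>y\<in>I. x + y \<in> I) \<and> (\<forall>r. \<forall>x\<in>I. r * x \<in> I)"

lemma ideal_setD:
 assumes "ideal_set I" shows "0 \<in> I" "x \<in> I ==> y \<in> I ==> x + y \<in> I" "x \<in> I ==> r * x \<in> I"
  "x \<in> I ==> - x \<in> I" "x \<in> I ==> y \<in> I ==> x - y \<in> I"
proof -
 show a: "0 \<in> I" "\<And>x y. x \<in> I ==> y \<in> I ==> x + y \<in> I" "\<And>r x. x \<in> I ==> r * x \<in> I"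
  using assms unfolding ideal_set_def by blast+
 have m: "- x \<in> I" if "x \<in> I" for x using a(3)[OF that, of "- 1"] by simp
 then show "x \<in> I ==> - x \<in> I" .
 show "x \<in> I ==> y \<in> I ==> x - y \<in> I" using a(2)[OF _ m, of x y] by simp
qed

lemma ideal_iff_ideal_set:
 fixes I :: "'r::comm_ring_1 set"
 shows "ideal I ring_of_type_algebra \<longleftrightarrow> ideal_set I"
proof
 assume "ideal I (ring_of_type_algebra :: 'r ring)"
 then interpret ideal I "ring_of_type_algebra :: 'r ring" .
 show "ideal_set I" unfolding ideal_set_def
  using additive_subgroup.a_closed[OF additive_subgroup_axioms] I_l_closed additive_subgroup.zero_closed[OF additive_subgroup_axioms] by auto
next
 assume I: "ideal_set I"
 interpret ring "ring_of_type_algebra :: 'r ring" by (rule ring_from_type_algebra)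
 have inv: "inv\<^bsub>add_monoid (ring_of_type_algebra :: 'r ring)\<^esub> x = - x" for x
 proof -
  have "\<ominus>\<^bsub>(ring_of_type_algebra :: 'r ring)\<^esub> x = - x" by (rule minus_equality) auto
  then show ?thesis by (simp add: a_inv_def)
 qed
 have "subgroup I (add_monoid (ring_of_type_algebra :: 'r ring))"
  by (rule subgroup.intro) (use ideal_setD[OF I] inv in auto)
 then show "ideal I (ring_of_type_algebra :: 'r ring)"
  by (rule idealI[OF ring_axioms]) (use ideal_setD[OF I] in \<open>auto simp: mult.commute[of _ "_ :: 'r"]\<close>)
qed

lemma mem_coset: "y \<in> I +>\<^bsub>(ring_of_type_algebra :: 'r::comm_ring_1 ring)\<^esub> x \<longleftrightarrow> y - x \<in> I"
 unfolding a_r_coset_def' by (auto simp: algebra_simps) (metis add_diff_cancel diff_add_cancel)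

lemma coset_eq_iff:
 assumes "ideal_set I"
 shows "I +>\<^bsub>(ring_of_type_algebra :: 'r::comm_ring_1 ring)\<^esub> x = I +>\<^bsub>ring_of_type_algebra\<^esub> y \<longleftrightarrow> x - y \<in> I" (is "?A = ?B \<longleftrightarrow> _")
proof
 assume "?A = ?B"
 moreover have "x \<in> ?A" using ideal_setD(1)[OF assms] by (simp add: mem_coset)
 ultimately show "x - y \<in> I" by (simp add: mem_coset)
next
 assume d: "x - y \<in> I"
 have "z - x \<in> I \<longleftrightarrow> z - y \<in> I" for z
  using ideal_setD(2)[OF assms, of "z - x" "x - y"] ideal_setD(5)[OF assms, of "z - y" "x - y"] d by auto
 then show "?A = ?B" by (auto simp: mem_coset)
qed

lemma coset_zero: "ideal_set I ==> I +>\<^bsub>(ring_of_type_algebra :: 'r::comm_ring_1 ring)\<^esub> 0 = I"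
 by (auto simp: mem_coset)

lemma quotient_ops:
 assumes "ideal_set I"
 defines "R \<equiv> (ring_of_type_algebra :: 'r::comm_ring_1 ring)"
 shows "carrier (R Quot I) = range (\<lambda>x. I +>\<^bsub>R\<^esub> x)"
  "\<zero>\<^bsub>R Quot I\<^esub> = I" "\<one>\<^bsub>R Quot I\<^esub> = I +>\<^bsub>R\<^esub> 1"
  "(I +>\<^bsub>R\<^esub> x) \<otimes>\<^bsub>R Quot I\<^esub> (I +>\<^bsub>R\<^esub> y) = I +>\<^bsub>R\<^esub> (x * y)"
  "(I +>\<^bsub>R\<^esub> x) \<oplus>\<^bsub>R Quot I\<^esub> (I +>\<^bsub>R\<^esub> y) = I +>\<^bsub>R\<^esub> (x + y)"
proof -
 interpret ideal I R unfolding R_def using assms(1) by (simp add: ideal_iff_ideal_set)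
 show "carrier (R Quot I) = range (\<lambda>x. I +>\<^bsub>R\<^esub> x)"
  by (auto simp: FactRing_def A_RCOSETS_def' R_def)
 show "\<zero>\<^bsub>R Quot I\<^esub> = I" "\<one>\<^bsub>R Quot I\<^esub> = I +>\<^bsub>R\<^esub> 1" by (simp_all add: FactRing_def R_def)
 show "(I +>\<^bsub>R\<^esub> x) \<otimes>\<^bsub>R Quot I\<^esub> (I +>\<^bsub>R\<^esub> y) = I +>\<^bsub>R\<^esub> (x * y)"
  using rcoset_mult_add[of x y] by (simp add: FactRing_def R_def)
 show "(I +>\<^bsub>R\<^esub> x) \<oplus>\<^bsub>R Quot I\<^esub> (I +>\<^bsub>R\<^esub> y) = I +>\<^bsub>R\<^esub> (x + y)"
  using a_rcos_sum[of x y] by (simp add: FactRing_def R_def)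
qed

lemma quotient_finprod:
 fixes m :: nat
 assumes I: "ideal_set I"
 defines "R \<equiv> (ring_of_type_algebra :: 'r::comm_ring_1 ring)"
 shows "finprod (R Quot I) (\<lambda>j. I +>\<^bsub>R\<^esub> q j) {0..m} = I +>\<^bsub>R\<^esub> (\<Prod>j\<le>m. q j)"
proof -
 interpret id: ideal I R unfolding R_def using I by (simp add: ideal_iff_ideal_set)
 interpret Q: cring "R Quot I" using id.quotient_is_cring cring_from_type_algebra unfolding R_def by blast
 have c: "I +>\<^bsub>R\<^esub> x \<in> carrier (R Quot I)" for x unfolding R_def quotient_ops[OF I] by blast
 have "finprod (R Quot I) (\<lambda>j. I +>\<^bsub>R\<^esub> q j) {..m} = I +>\<^bsub>R\<^esub> (\<Prod>j\<le>m. q j)"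
 proof (induction m)
  case 0
  show ?case using c[of "q 0"] by simp
 next
  case (Suc m)
  have "finprod (R Quot I) (\<lambda>j. I +>\<^bsub>R\<^esub> q j) {..Suc m} =
    (I +>\<^bsub>R\<^esub> q (Suc m)) \<otimes>\<^bsub>R Quot I\<^esub> finprod (R Quot I) (\<lambda>j. I +>\<^bsub>R\<^esub> q j) {..m}"
   by (rule Q.finprod_Suc) (use c in auto)
  then show ?case unfolding Suc using quotient_ops(4)[OF I] by (simp add: R_def mult.commute)
 qed
 then show ?thesis by (simp add: atLeast0AtMost)
qed

lemma mpoly_eval_meval: "mpoly_eval q z = meval (\<lambda>c. c) (\<lambda>l. z $ l) q" for z :: "'a::comm_ring_1 ^ 'n::finite"
 unfolding mpoly_eval_def meval_def by (simp add: mon_eval_superset[OF finite subset_UNIV])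

lemma phom_mpoly_eval: "phom UNIV (\<lambda>q. mpoly_eval q z)" for z :: "'a::comm_ring_1 ^ 'n::finite"
 unfolding mpoly_eval_meval by (rule phom_meval) (simp add: phom_def is_subring_def)

lemma complexify_meval: "complexify p = meval (\<lambda>c. mpoly_const (complex_of_real c)) mpoly_var (p :: ('n::finite, real) mpoly)"
proof -
 have lk: "Poly_Mapping.lookup (complexify p) \<alpha> = complex_of_real (Poly_Mapping.lookup p \<alpha>)" for \<alpha>
  unfolding complexify_def by (simp add: Poly_Mapping.map.rep_eq when_def)
 have k: "Poly_Mapping.keys (complexify p) = Poly_Mapping.keys p" by (auto simp: in_keys_iff lk)
 have "complexify p = (\<Sum>\<alpha>\<in>Poly_Mapping.keys p. Poly_Mapping.single \<alpha> (complex_of_real (Poly_Mapping.lookup p \<alpha>)))"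
  by (subst sum_monomials) (simp add: k lk)
 then show ?thesis by (simp add: meval_def single_eq_mon_eval)
qed

lemma phom_const_of_real: "phom UNIV (\<lambda>c. mpoly_const (complex_of_real c) :: ('n::finite, complex) mpoly)"
 unfolding phom_def by (simp add: is_subring_def mpoly_const_simps)

lemma phom_complexify: "phom UNIV (complexify :: ('n::finite, real) mpoly => _)"
 using phom_meval[OF phom_const_of_real, of mpoly_var] unfolding complexify_meval[symmetric, abs_def] .

lemma complexify_const: "complexify (mpoly_const c) = mpoly_const (complex_of_real c)"
 unfolding complexify_meval by (rule meval_const[OF phom_const_of_real])

lemma complexify_var: "complexify (mpoly_var l) = mpoly_var l"
 unfolding complexify_meval by (rule meval_var[OF phom_const_of_real])

lemmas complexify_simps = phom_add[OF phom_complexify UNIV_I UNIV_I] phom_mult[OF phom_complexify UNIV_I UNIV_I]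
 phom_one[OF phom_complexify] phom_zero[OF phom_complexify] phom_diff[OF phom_complexify UNIV_I UNIV_I]
 phom_uminus[OF phom_complexify UNIV_I] complexify_const complexify_var

lemma mpoly_eval_complexify: "mpoly_eval (complexify p) z = reval z p"
proof (rule phom_mpoly_unique[OF _ phom_reval])
 have idc: "phom UNIV (\<lambda>c::complex. c)" by (simp add: phom_def is_subring_def)
 show "phom UNIV (\<lambda>p. mpoly_eval (complexify p) z)"
  unfolding phom_def by (simp add: is_subring_def complexify_simps phom_add[OF phom_mpoly_eval UNIV_I UNIV_I]
   phom_mult[OF phom_mpoly_eval UNIV_I UNIV_I] phom_one[OF phom_mpoly_eval])
 show "mpoly_eval (complexify (mpoly_const c)) z = reval z (mpoly_const c)" for c
  by (simp add: complexify_simps mpoly_eval_meval meval_const[OF idc])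
 show "mpoly_eval (complexify (mpoly_var l)) z = reval z (mpoly_var l)" for l
  by (simp add: complexify_simps mpoly_eval_meval meval_var[OF idc])
qed

context
 fixes I :: "('n::finite, real) mpoly set"
 assumes I: "ideal_set I"
begin

lemma complexified_ideal_set: "ideal_set (complexified_ideal I)"
proof -
 interpret ring "mpoly_ring :: ('n, complex) mpoly ring" by (rule ring_from_type_algebra)
 show ?thesis unfolding ideal_iff_ideal_set[symmetric] complexified_ideal_def by (rule genideal_ideal) simp
qed

lemma complexified_ideal_minimal:
 assumes J: "ideal_set J" "\<And>p. p \<in> I ==> complexify p \<in> J" shows "complexified_ideal I \<subseteq> J"
proof -
 interpret ring "mpoly_ring :: ('n, complex) mpoly ring" by (rule ring_from_type_algebra)
 show ?thesis unfolding complexified_ideal_def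
  by (rule genideal_minimal) (use J in \<open>auto simp: ideal_iff_ideal_set\<close>)
qed

text \<open>The sums \<open>p + \<i> q\<close> with \<open>p\<close> and \<open>q\<close> in \<open>I\<close> already form an ideal of complex polynomials, and real
  and imaginary parts of coefficients are unique.\<close>

lemma complexify_mem:
 "complexify p \<in> complexified_ideal I \<longleftrightarrow> p \<in> I"
proof
 assume p: "complexify p \<in> complexified_ideal I"
 define im where "im = (mpoly_const \<i> :: ('n, complex) mpoly)"
 have im2: "im * (im * q) = - q" for q :: "('n, complex) mpoly"
  by (simp add: im_def mult.assoc[symmetric] mpoly_const_simps(2)[symmetric] mpoly_const_simps)
 define J where "J = {complexify p + im * complexify q | p q. p \<in> I \<and> q \<in> I}"
 have JI: "complexify p + im * complexify q \<in> J" if "p \<in> I" "q \<in> I" for p q using that by (auto simp: J_def)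
 have J0: "0 \<in> J" using JI[OF ideal_setD(1)[OF I] ideal_setD(1)[OF I]] by (simp add: complexify_simps)
 have Jadd: "x + y \<in> J" if xy: "x \<in> J" "y \<in> J" for x y
 proof -
  obtain p q p' q' where e: "p \<in> I" "q \<in> I" "p' \<in> I" "q' \<in> I" "x = complexify p + im * complexify q" "y = complexify p' + im * complexify q'"
   using xy unfolding J_def by blast
  have "x + y = complexify (p + p') + im * complexify (q + q')" by (simp add: e complexify_simps algebra_simps)
  then show ?thesis using JI[of "p + p'" "q + q'"] e ideal_setD(2)[OF I] by simp
 qed
 have Jreal: "complexify r * x \<in> J" if xJ: "x \<in> J" for r x
 proof -
  obtain p q where e: "p \<in> I" "q \<in> I" "x = complexify p + im * complexify q" using xJ unfolding J_def by blast
  have "complexify r * x = complexify (r * p) + im * complexify (r * q)" by (simp add: e complexify_simps algebra_simps)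
  then show ?thesis using JI[of "r * p" "r * q"] e ideal_setD(3)[OF I] by simp
 qed
 have Jim: "im * x \<in> J" if xJ: "x \<in> J" for x
 proof -
  obtain p q where e: "p \<in> I" "q \<in> I" "x = complexify p + im * complexify q" using xJ unfolding J_def by blast
  have "im * x = complexify (- q) + im * complexify p" by (simp add: e im2 complexify_simps distrib_left)
  then show ?thesis using JI[of "- q" p] e ideal_setD(4)[OF I] by simp
 qed
 have "{s. \<forall>x\<in>J. s * x \<in> J} = UNIV"
 proof (rule mpoly_subring_UNIV)
  have m: "- x \<in> J" if "x \<in> J" for x using Jreal[OF that, of "- 1"] by (simp add: complexify_simps)
  show "is_subring {s. \<forall>x\<in>J. s * x \<in> J}"
   by (rule is_subringI) (auto simp: distrib_right mult.assoc intro: Jadd m)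
  show "mpoly_const c \<in> {s. \<forall>x\<in>J. s * x \<in> J}" for c
  proof (intro CollectI ballI)
   fix x assume x: "x \<in> J"
   have "mpoly_const c = complexify (mpoly_const (Re c)) + im * complexify (mpoly_const (Im c))"
    unfolding im_def complexify_const mpoly_const_simps(1,2)[symmetric] by (simp add: complex_eq[symmetric] mult.commute)
   then have "mpoly_const c * x = complexify (mpoly_const (Re c)) * x + im * (complexify (mpoly_const (Im c)) * x)"
    by (simp add: algebra_simps)
   then show "mpoly_const c * x \<in> J" using Jadd[OF Jreal[OF x] Jim[OF Jreal[OF x]]] by simp
  qed
  show "mpoly_var l \<in> {s. \<forall>x\<in>J. s * x \<in> J}" for l using Jreal[of _ "mpoly_var l"] by (auto simp: complexify_simps)
 qed
 then have "ideal_set J" unfolding ideal_set_def using J0 Jadd by blast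
 moreover have "complexify p \<in> J" if "p \<in> I" for p using JI[OF that ideal_setD(1)[OF I]] by (simp add: complexify_simps)
 ultimately have "complexify p \<in> J" using p complexified_ideal_minimal[of J] by blast
 then obtain p1 q1 where e: "p1 \<in> I" "complexify p = complexify p1 + im * complexify q1" by (auto simp: J_def)
 have "Poly_Mapping.lookup (complexify r) \<alpha> = complex_of_real (Poly_Mapping.lookup r \<alpha>)" for r :: "('n, real) mpoly" and \<alpha>
  unfolding complexify_def by (simp add: Poly_Mapping.map.rep_eq when_def)
 moreover have "Poly_Mapping.lookup (im * r) \<alpha> = \<i> * Poly_Mapping.lookup r \<alpha>" for r :: "('n, complex) mpoly" and \<alpha>
 proof -
  have "im * r = (\<Sum>\<beta>\<in>Poly_Mapping.keys r. Poly_Mapping.single \<beta> (\<i> * Poly_Mapping.lookup r \<beta>))"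
   by (subst (1) sum_monomials[of r]) (simp add: im_def mpoly_const_def sum_distrib_left mult_single)
  then have "Poly_Mapping.lookup (im * r) \<alpha> = (\<Sum>\<beta>\<in>Poly_Mapping.keys r. if \<beta> = \<alpha> then \<i> * Poly_Mapping.lookup r \<beta> else 0)"
   by (simp add: lookup_sum lookup_single when_def)
  also have "\<dots> = \<i> * Poly_Mapping.lookup r \<alpha>" by (simp add: in_keys_iff)
  finally show ?thesis .
 qed
 ultimately have "complex_of_real (Poly_Mapping.lookup p \<alpha>) = complex_of_real (Poly_Mapping.lookup p1 \<alpha>) + \<i> * complex_of_real (Poly_Mapping.lookup q1 \<alpha>)" for \<alpha>
  using arg_cong[OF e(2), of "\<lambda>r. Poly_Mapping.lookup r \<alpha>"] by (simp add: lookup_add)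
 then have "Poly_Mapping.lookup p \<alpha> = Poly_Mapping.lookup p1 \<alpha>" for \<alpha> by (metis Re_complex_of_real plus_complex.sel(1) Re_i_times Im_complex_of_real add.right_neutral minus_zero)
 then have "p = p1" by (rule poly_mapping_eqI)
 then show "p \<in> I" using e by simp
next
 assume p: "p \<in> I"
 interpret ring "mpoly_ring :: ('n, complex) mpoly ring" by (rule ring_from_type_algebra)
 show "complexify p \<in> complexified_ideal I"
  unfolding complexified_ideal_def using p genideal_self[of "complexify ` I"] by auto
qed

lemma zero_locus_real: "zero_locus (complexified_ideal I) = {z. \<forall>p\<in>I. reval z p = 0}"
proof -
 have "ideal_set {q. mpoly_eval q z = 0}" for z :: "complex ^ 'n"
  unfolding ideal_set_def by (auto simp: phom_add[OF phom_mpoly_eval] phom_mult[OF phom_mpoly_eval] phom_zero[OF phom_mpoly_eval])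
 then have "complexified_ideal I \<subseteq> {q. mpoly_eval q z = 0}" if "\<forall>p\<in>I. reval z p = 0" for z
  using that by (intro complexified_ideal_minimal) (auto simp: mpoly_eval_complexify)
 moreover have "reval z p = 0" if "z \<in> zero_locus (complexified_ideal I)" "p \<in> I" for z p
  using that complexify_mem[of p] by (auto simp: zero_locus_def simp flip: mpoly_eval_complexify)
 ultimately show ?thesis by (auto simp: zero_locus_def)
qed

lemma quotient_complexify_coset:
 "quotient_complexify I (I +>\<^bsub>mpoly_ring\<^esub> p) = complexified_ideal I +>\<^bsub>mpoly_ring\<^esub> complexify p"
proof -
 have "(\<lambda>f. complexified_ideal I +>\<^bsub>mpoly_ring\<^esub> complexify f) ` (I +>\<^bsub>mpoly_ring\<^esub> p) = {complexified_ideal I +>\<^bsub>mpoly_ring\<^esub> complexify p}"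
 proof -
  have "complexified_ideal I +>\<^bsub>mpoly_ring\<^esub> complexify f = complexified_ideal I +>\<^bsub>mpoly_ring\<^esub> complexify p"
   if "f \<in> I +>\<^bsub>mpoly_ring\<^esub> p" for f
   using that complexify_mem[of "f - p"] by (simp add: coset_eq_iff[OF complexified_ideal_set] mem_coset complexify_simps)
  moreover have "p \<in> I +>\<^bsub>mpoly_ring\<^esub> p" using ideal_setD(1)[OF I] by (simp add: mem_coset)
  ultimately show ?thesis by blast
 qed
 then show ?thesis unfolding quotient_complexify_def by simp
qed

lemma residue_eval_coset:
 assumes z: "z \<in> zero_locus (complexified_ideal I)"
 shows "residue_eval (complexified_ideal I +>\<^bsub>mpoly_ring\<^esub> q) z = mpoly_eval q z"
 unfolding residue_eval_def
proof (rule the_equality)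
 show a: "\<forall>p\<in>complexified_ideal I +>\<^bsub>mpoly_ring\<^esub> q. mpoly_eval p z = mpoly_eval q z"
 proof
  fix p assume "p \<in> complexified_ideal I +>\<^bsub>mpoly_ring\<^esub> q"
  then have "mpoly_eval (p - q) z = 0" using z by (simp add: mem_coset zero_locus_def)
  then show "mpoly_eval p z = mpoly_eval q z" by (simp add: phom_diff[OF phom_mpoly_eval])
 qed
 have "q \<in> complexified_ideal I +>\<^bsub>mpoly_ring\<^esub> q" using ideal_setD(1)[OF complexified_ideal_set] by (simp add: mem_coset)
 then show "v = mpoly_eval q z" if "\<forall>p\<in>complexified_ideal I +>\<^bsub>mpoly_ring\<^esub> q. mpoly_eval p z = v" for v
  using that by auto
qed

lemma real_prime:
 assumes "primeideal (complexified_ideal I) mpoly_ring" shows "prime_set I"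
proof -
 interpret primeideal "complexified_ideal I" "mpoly_ring :: ('n, complex) mpoly ring" by (rule assms)
 have "1 \<notin> I"
 proof
  assume "1 \<in> I"
  then have "1 \<in> complexified_ideal I" using complexify_mem[of 1] by (simp add: complexify_simps)
  then have "r \<in> complexified_ideal I" for r using ideal_setD(3)[OF complexified_ideal_set, of 1 r] by simp
  then show False using I_notcarr by auto
 qed
 moreover have "x \<in> I \<or> y \<in> I" if "x * y \<in> I" for x y
  using that I_prime[of "complexify x" "complexify y"] complexify_mem[of "x * y"] complexify_mem[of x] complexify_mem[of y]
  by (simp add: complexify_simps)
 ultimately show ?thesis using I unfolding prime_set_def ideal_set_def by blast
qed

end

section \<open>From valuations to points\<close>

lemma gconst_eq_iff: "gconst c = gconst d \<longleftrightarrow> c = d"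
 unfolding gconst_def emb_eq_iff by (metis lookup_single_eq)

lemma gconst_simps: "gconst 0 = 0" "gconst 1 = 1" "gconst (c + d) = gconst c + gconst d" "gconst (c * d) = gconst c * gconst d"
 "gconst (- c) = - gconst c" "gconst (inverse c) = inverse (gconst c)"
 using phom_gconst phom_inverse[OF phom_gconst UNIV_I UNIV_I]
 by (simp_all add: phom_zero phom_one phom_add phom_mult phom_uminus)

lemma subfield_gconst: "is_subfield (range gconst)"
 unfolding is_subfield_def
proof
 show "is_subring (range gconst)" by (rule is_subringI) (auto simp flip: gconst_simps)
qed (auto simp flip: gconst_simps)

lemma of_nat_hconst: "of_nat n = hconst (real n)"
 by (induction n) (simp_all add: phom_zero[OF phom_hconst] phom_add[OF phom_hconst] phom_one[OF phom_hconst])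

lemma hconst_unit: "c ~= 0 ==> hconst c ~= 0"
 using phom_mult[OF phom_hconst, of c "inverse c"] phom_one[OF phom_hconst] by auto

lemma phom_reval_seq: "phom UNIV (\<lambda>p. abs_hcomplex (\<lambda>n. reval (zz n) p))"
 unfolding phom_def by (auto simp: is_subring_def abs_hcomplex_simps[symmetric])

text \<open>The transport theorem sends the generic point to a point with coordinates in the ultrapower, that is, to a
  sequence of complex points. Relations in \<open>I\<close> are preserved, elements outside \<open>I\<close> stay nonzero, and quotients
  in the maximal ideal become infinitesimal. All finitely many conditions hold together at some index.\<close>

theorem points_from_valuation_ring:
 fixes I :: "('n::finite, real) mpoly set" and e :: "('n, real) mpoly => host"
 assumes e: "phom UNIV e" and ker: "\<And>p. e p = 0 \<longleftrightarrow> p \<in> I" and ec: "\<And>c. e (mpoly_const c) = gconst c"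
  and V: "is_vring V" and cV: "range gconst \<subseteq> V" and x: "\<And>l. e (mpoly_var l) \<in> maximal_ideal V"
  and h: "h \<notin> I" and G: "finite G" "G \<subseteq> I"
  and T: "finite T" "\<And>s t. (s, t) \<in> T ==> t \<notin> I \<and> e s / e t \<in> maximal_ideal V" and \<epsilon>: "\<epsilon> > 0"
 obtains z :: "complex ^ 'n" where "\<And>l. cmod (z $ l) < \<epsilon>" "\<And>g. g \<in> G ==> reval z g = 0" "reval z h ~= 0"
  "\<And>s t. (s, t) \<in> T ==> cmod (reval z s) \<le> \<epsilon> * cmod (reval z t)"
proof -
 define \<iota> where "\<iota> = (\<lambda>x. hconst (SOME c. gconst c = x))"
 have \<iota>: "\<iota> (gconst c) = hconst c" for c unfolding \<iota>_def by (simp add: gconst_eq_iff)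
 have nu: "of_nat n \<in> units_of_vring hfinite" if "n > 0" for n
 proof -
  have "inverse (hconst (real n)) = hconst (inverse (real n))" using phom_inverse[OF phom_hconst UNIV_I UNIV_I] by simp
  then show ?thesis unfolding of_nat_hconst units_of_vring_def using hconst_unit[of "real n"] hconst_finite that by auto
 qed
 interpret vt: valued_target V hfinite "range gconst" \<iota> False "{}"
  by unfold_locales (use V is_vring_hfinite nu ex_infinitesimal in auto)
 have lh: "local_hom (range gconst) \<iota>"
  unfolding local_hom_def
 proof
  show "phom (range gconst) \<iota>" unfolding phom_def
   using subfield_subring[OF subfield_gconst] \<iota> phom_one[OF phom_hconst] \<iota>[of 1]
   by (auto simp: phom_add[OF phom_hconst] phom_mult[OF phom_hconst] gconst_simps simp flip: gconst_simps(3,4))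
 qed (auto simp flip: gconst_simps)
 have ap0: "vt.approx (range gconst)"
  unfolding vt.approx_def
 proof (intro allI impI)
  fix S assume S: "finite S" "S \<subseteq> range gconst"
  have "vt.agree S \<iota>" unfolding vt.agree_def
  proof (intro ballI impI)
   fix s assume s: "s \<in> S" "s ~= 0"
   then obtain c where c: "s = gconst c" using S by blast
   then have "c ~= 0" using s gconst_simps by auto
   then show "\<iota> s ~= 0 \<and> (s \<in> V) = (\<iota> s \<in> hfinite)"
    using c \<iota> hconst_unit cV hconst_finite by auto
  qed
  moreover have "vt.target_hom (range gconst) \<iota> {}" unfolding vt.target_hom_def using lh by simp
  ultimately show "\<exists>D hm E. vt.target_hom D hm E \<and> D \<subseteq> range gconst \<and> S \<subseteq> D \<and> vt.agree S hm" using S by blast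
 qed
 have ap: "vt.approx UNIV" by (rule vt.approx_UNIV[OF subfield_gconst ap0])
 define S where "S = range (\<lambda>l. e (mpoly_var l)) \<union> {e h} \<union> (\<lambda>(s, t). e s / e t) ` T"
 have "finite S" using T by (auto simp: S_def)
 then obtain D hm E where D: "vt.target_hom D hm E" "S \<subseteq> D" "vt.agree_units S hm"
  using vt.approxE[OF _ ap, of S] by (auto simp: is_subfield_def is_subring_def)
 note ph = vt.target_hom_phom[OF D(1)]
 note Dr = phom_subring[OF ph]
 have De: "e p \<in> D" for p
 proof -
  have "{p. e p \<in> D} = UNIV"
  proof (rule mpoly_subring_UNIV)
   show "is_subring {p. e p \<in> D}"
    using Dr by (intro is_subringI) (auto simp: phom_one[OF e] phom_add[OF e] phom_mult[OF e] phom_uminus[OF e] intro: subring_intros)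
  qed (use D(1,2) in \<open>auto simp: ec S_def vt.target_hom_def\<close>)
  then show ?thesis by blast
 qed
 obtain Zl where Zl: "\<And>l. hm (e (mpoly_var l)) = abs_hcomplex (Zl l)"
 proof -
  have "\<forall>l. \<exists>w. hm (e (mpoly_var l)) = abs_hcomplex w" using abs_hcomplex_surj by blast
  from choice[OF this] show ?thesis using that by blast
 qed
 define zz where "zz = (\<lambda>n. (\<chi> l. Zl l n) :: complex ^ 'n)"
 have val: "hm (e p) = abs_hcomplex (\<lambda>n. reval (zz n) p)" for p
 proof (rule phom_mpoly_unique[OF _ phom_reval_seq])
  show "phom UNIV (\<lambda>p. hm (e p))" unfolding phom_def
   using De by (auto simp: is_subring_def phom_one[OF e] phom_one[OF ph] phom_add[OF e] phom_add[OF ph] phom_mult[OF e] phom_mult[OF ph])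
  show "hm (e (mpoly_const c)) = abs_hcomplex (\<lambda>n. reval (zz n) (mpoly_const c))" for c
   using D(1) by (simp add: ec vt.target_hom_def \<iota> hconst_def)
  show "hm (e (mpoly_var l)) = abs_hcomplex (\<lambda>n. reval (zz n) (mpoly_var l))" for l
   by (simp add: Zl zz_def)
 qed
 have "uev (\<lambda>n. cmod (zz n $ l) < \<epsilon>)" for l
 proof -
  have "hm (e (mpoly_var l)) \<in> maximal_ideal hfinite" using vt.agree_unitsD(3)[OF D(3), of "e (mpoly_var l)"] x by (auto simp: S_def)
  then show ?thesis unfolding Zl using infinitesimal[OF _ \<epsilon>] by (simp add: zz_def)
 qed
 then have u1: "uev (\<lambda>n. \<forall>l\<in>UNIV. cmod (zz n $ l) < \<epsilon>)" by (intro uev_finite_conj) auto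
 have "uev (\<lambda>n. reval (zz n) g = 0)" if "g \<in> G" for g
 proof -
  have "e g = 0" using ker that G(2) by blast
  then have "hm (e g) = 0" using phom_zero[OF ph] by simp
  then show ?thesis unfolding val using abs_hcomplex_eq_iff[of _ "\<lambda>n. 0"] by (simp add: abs_hcomplex_simps)
 qed
 then have u2: "uev (\<lambda>n. \<forall>g\<in>G. reval (zz n) g = 0)" by (intro uev_finite_conj G)
 have "hm (e h) ~= 0" using vt.agree_unitsD(1)[OF D(3), of "e h"] ker h by (auto simp: S_def)
 then have u3: "uev (\<lambda>n. reval (zz n) h ~= 0)"
  unfolding val using abs_hcomplex_eq_iff[of _ "\<lambda>n. 0"] by (simp add: abs_hcomplex_simps uev_not)
 have "uev (\<lambda>n. cmod (reval (zz n) s) \<le> \<epsilon> * cmod (reval (zz n) t))" if st: "(s, t) \<in> T" for s t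
 proof -
  define r where "r = e s / e t"
  have r: "r \<in> maximal_ideal V" "r \<in> S" "e s = r * e t"
   using T(2)[OF st] st ker by (force simp: r_def S_def)+
  obtain w where w: "hm r = abs_hcomplex w" using abs_hcomplex_surj by blast
  have "hm r \<in> maximal_ideal hfinite" using vt.agree_unitsD(3)[OF D(3) r(2)] r(1) by blast
  then have "uev (\<lambda>n. cmod (w n) < \<epsilon>)" unfolding w using infinitesimal[OF _ \<epsilon>] by blast
  moreover have "hm (e s) = hm r * hm (e t)" unfolding r(3) using phom_mult[OF ph _ De] D(2) r(2) by blast
  then have "uev (\<lambda>n. reval (zz n) s = w n * reval (zz n) t)"
   unfolding val w abs_hcomplex_simps(2)[symmetric] abs_hcomplex_eq_iff .
  ultimately have "uev (\<lambda>n. cmod (w n) < \<epsilon> \<and> reval (zz n) s = w n * reval (zz n) t)" by (simp add: uev_conj)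
  then show ?thesis by (rule uev_mono) (auto simp: norm_mult intro!: mult_right_mono)
 qed
 then have u4: "uev (\<lambda>n. \<forall>st\<in>T. cmod (reval (zz n) (fst st)) \<le> \<epsilon> * cmod (reval (zz n) (snd st)))"
  by (intro uev_finite_conj T) auto
 have "uev (\<lambda>n. (\<forall>l\<in>UNIV. cmod (zz n $ l) < \<epsilon>) \<and> (\<forall>g\<in>G. reval (zz n) g = 0) \<and> reval (zz n) h ~= 0 \<and>
   (\<forall>st\<in>T. cmod (reval (zz n) (fst st)) \<le> \<epsilon> * cmod (reval (zz n) (snd st))))"
  using u1 u2 u3 u4 by (simp only: uev_conj)
 then obtain n where "(\<forall>l\<in>UNIV. cmod (zz n $ l) < \<epsilon>) \<and> (\<forall>g\<in>G. reval (zz n) g = 0) \<and> reval (zz n) h ~= 0 \<and>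
   (\<forall>st\<in>T. cmod (reval (zz n) (fst st)) \<le> \<epsilon> * cmod (reval (zz n) (snd st)))"
  using uev_witness by blast
 then show thesis using that[of "zz n"] by fastforce
qed

lemma ex_nat_ratio:
 fixes x y :: real assumes "0 \<le> x" "x < y"
 obtains P Q :: nat where "P > 0" "x < real Q / real P" "real Q / real P < y"
proof -
 obtain r where r: "r \<in> \<rat>" "x < r" "r < y" using Rats_dense_in_real[OF assms(2)] by blast
 obtain Q P :: nat where "P ~= 0" "\<bar>r\<bar> = real Q / real P" using Rats_abs_nat_div_natE[OF r(1)] by metis
 then show thesis using that[of P Q] r assms by auto
qed

lemma power_le_powerD:
 fixes x t :: real
 assumes "x \<ge> 0" "t > 0" "P > 0" "x ^ P \<le> t ^ Q" shows "x \<le> t powr (real Q / real P)"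
proof (cases "x = 0")
 case False
 then have x: "x > 0" using assms by simp
 have "(x ^ P) powr (1 / real P) \<le> (t ^ Q) powr (1 / real P)" using assms by (intro powr_mono2) auto
 moreover have "(x ^ P) powr (1 / real P) = x" using x assms(3) by (simp add: powr_powr flip: powr_realpow)
 moreover have "(t ^ Q) powr (1 / real P) = t powr (real Q / real P)" using assms by (simp add: powr_powr flip: powr_realpow)
 ultimately show ?thesis by simp
qed simp

text \<open>Let \<open>t = \<bar>p\<^sub>1\<bar>\<close>. The values of powers of \<open>p\<^sub>j\<close> and \<open>p\<^sub>1\<close> yield points where
  \<open>\<bar>p\<^sub>j\<bar>\<close> is at most \<open>t\<close> to an exponent just below \<open>a\<^sub>j / a\<^sub>1\<close>, and the values of \<open>p\<^sub>1\<close>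
 and \<open>F\<close> yield \<open>\<bar>F\<bar>\<close> at least \<open>t\<close> to an exponent just above \<open>A / a\<^sub>1\<close>. As \<open>t\<close> is small, the second
 beats \<open>C\<close> times the power \<open>c / a\<^sub>1\<close> minus a little of \<open>t\<close>.\<close>

theorem valuation_violates_bound:
 fixes I :: "('n::finite, real) mpoly set" and v :: "('n, real) mpoly => real" and p :: "nat => ('n, real) mpoly"
 assumes P: "prime_set I" and vI: "\<And>x y. x - y \<in> I ==> v x = v y"
  and v_mult: "\<And>x y. x \<notin> I ==> y \<notin> I ==> v (x * y) = v x + v y"
  and v_add: "\<And>x y. x \<notin> I ==> y \<notin> I ==> x + y \<notin> I ==> v (x + y) \<ge> min (v x) (v y)"
  and v_const: "\<And>c. c ~= 0 ==> v (mpoly_const c) = 0"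
  and v_var: "\<And>l. mpoly_var l \<notin> I ==> v (mpoly_var l) > 0"
  and p: "\<And>j. j \<le> m ==> p j \<notin> I" "\<And>j. j \<le> m ==> v (p j) = a j"
  and m: "m \<ge> 1" and a0: "a 0 = 0" and a: "\<And>j. 1 \<le> j ==> j \<le> m ==> a j > 0"
  and h: "h \<notin> I" and G: "finite G" "G \<subseteq> I" and c: "c > (\<Sum>j=1..m. a j)" and \<epsilon>: "\<epsilon> > 0"
 obtains z :: "complex ^ 'n" where "\<And>l. cmod (z $ l) < \<epsilon>" "\<And>g. g \<in> G ==> reval z g = 0" "reval z h ~= 0"
  "cmod (reval z (\<Prod>j\<le>m. p j)) > C * (\<Sum>j=1..m. cmod (reval z (p j)) powr (1 / a j)) powr c"
proof -
 define A where "A = (\<Sum>j=1..m. a j)"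
 have Apos: "A > 0" unfolding A_def using a m by (intro sum_pos) auto
 have a1: "a 1 > 0" using a m by simp
 obtain e :: "('n, real) mpoly => host" where e: "phom UNIV e" "\<And>p. e p = 0 \<longleftrightarrow> p \<in> I" "\<And>c. e (mpoly_const c) = gconst c"
  using generic_point[OF P] by blast
 obtain V where V: "is_vring V" "\<And>a b. e a ~= 0 ==> e b ~= 0 ==> e a / e b \<in> V \<longleftrightarrow> v a \<ge> v b"
 proof (rule valuation_extends[OF e(1), of v])
  show "v a = v b" if "e a = e b" for a b
   using that vI[of a b] e(2)[of "a - b"] phom_diff[OF e(1), of a b] by simp
 qed (use v_mult v_add e(2) in auto)
 have one: "e 1 = 1" "1 \<notin> I" "v 1 = 0"
  using phom_one[OF e(1)] prime_setD(5)[OF P] v_const[of 1] by (simp_all add: mpoly_const_simps)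
 have max: "e s / e t \<in> maximal_ideal V" if "s \<notin> I" "t \<notin> I" "v s > v t" for s t
  using V(2)[of s t] V(2)[of t s] that e(2) unfolding maximal_ideal_def by auto
 have cV: "range gconst \<subseteq> V"
 proof
  fix x assume "x \<in> range gconst"
  then obtain c where c: "x = gconst c" by blast
  show "x \<in> V"
  proof (cases "c = 0")
   case True then show ?thesis using c gconst_simps(1) subring_zero[OF vring_subring[OF V(1)]] by simp
  next
   case False
   then have "e (mpoly_const c) ~= 0" using e(3)[of c] gconst_eq_iff[of c 0] gconst_simps(1) by auto
   then show ?thesis using V(2)[of "mpoly_const c" 1] one v_const[OF False] c e(3) by simp
  qed
 qed
 have xm: "e (mpoly_var l) \<in> maximal_ideal V" for l
 proof (cases "mpoly_var l \<in> I")
  case True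
  then have "e (mpoly_var l) = 0" using e(2) by blast
  then show ?thesis using subring_zero[OF vring_subring[OF V(1)]] by (simp add: maximal_ideal_def)
 next
  case False
  then show ?thesis using max[OF False one(2)] v_var one by simp
 qed
 have vpow: "v (x ^ k) = real k * v x" if "x \<notin> I" for x k
 proof (induction k)
  case (Suc k)
  then show ?case using v_mult[OF that prime_set_power[OF P that, of k]] by (simp add: algebra_simps)
 qed (simp add: one)
 define F where "F = (\<Prod>j\<le>m. p j)"
 have F: "F \<notin> I" "v F = A"
 proof -
  have "(\<Prod>j\<le>k. p j) \<notin> I \<and> v (\<Prod>j\<le>k. p j) = (\<Sum>j=1..k. a j)" if "k \<le> m" for k
   using that
  proof (induction k)
   case 0
   then show ?case using p a0 by simp
  next
   case (Suc k)
   then have "(\<Prod>j\<le>k. p j) \<notin> I" "v (\<Prod>j\<le>k. p j) = (\<Sum>j=1..k. a j)" by simp_all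
   then show ?case using p[OF Suc.prems] prime_setD(6)[OF P, of "prod p {..k}" "p (Suc k)"] v_mult[of "prod p {..k}" "p (Suc k)"] by (auto simp: sum.cl_ivl_Suc)
  qed
  then show "F \<notin> I" "v F = A" by (auto simp: F_def A_def)
 qed
 \<comment> \<open>the gap \<open>c - A\<close> is cut in three: one part is lost to each of the two rational approximations, one absorbs \<open>C\<close>\<close>
 define \<delta> where "\<delta> = (c - A) / (3 * c)"
 have cA: "c > A" "c > 0" using c Apos by (simp_all add: A_def)
 have \<delta>: "\<delta> > 0" "\<delta> < 1" "(1 - \<delta>) * c = A + 2 * (c - A) / 3"
  unfolding \<delta>_def using cA Apos by (simp_all add: field_simps)
 have "\<exists>PQ. fst PQ > 0 \<and> (1 - \<delta>) * a j / a 1 < real (snd PQ) / real (fst PQ) \<and> real (snd PQ) / real (fst PQ) < a j / a 1" if "j \<in> {1..m}" for j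
 proof -
  have "0 \<le> (1 - \<delta>) * a j / a 1" "(1 - \<delta>) * a j / a 1 < a j / a 1"
   using a[of j] that \<delta> a1 by (auto simp: divide_simps)
  then obtain P Q :: nat where "P > 0" "(1 - \<delta>) * a j / a 1 < real Q / real P" "real Q / real P < a j / a 1" by (rule ex_nat_ratio)
  then show ?thesis by (intro exI[of _ "(P, Q)"]) simp
 qed
 then obtain PQ where PQ: "\<And>j. j \<in> {1..m} ==> fst (PQ j) > 0 \<and> (1 - \<delta>) * a j / a 1 < real (snd (PQ j)) / real (fst (PQ j)) \<and> real (snd (PQ j)) / real (fst (PQ j)) < a j / a 1"
  by metis
 have "0 \<le> A / a 1" "A / a 1 < (A + (c - A) / 3) / a 1" using Apos a1 cA by (simp_all add: divide_strict_right_mono)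
 then obtain N M :: nat where NM: "N > 0" "A / a 1 < real M / real N" "real M / real N < (A + (c - A) / 3) / a 1" by (rule ex_nat_ratio)
 define T where "T = (\<lambda>j. (p j ^ fst (PQ j), p 1 ^ snd (PQ j))) ` {1..m} \<union> {(p 1 ^ M, F ^ N), (p 1, 1)}"
 have p1: "p 1 \<notin> I" "v (p 1) = a 1" using p m by auto
 have Tm: "t \<notin> I \<and> e s / e t \<in> maximal_ideal V" if st: "(s, t) \<in> T" for s t
 proof -
  have "s \<notin> I \<and> t \<notin> I \<and> v s > v t"
  proof -
   consider j where "j \<in> {1..m}" "s = p j ^ fst (PQ j)" "t = p 1 ^ snd (PQ j)" | "s = p 1 ^ M" "t = F ^ N" | "s = p 1" "t = 1"
    using st unfolding T_def by blast
   then show ?thesis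
   proof cases
    case 1
    then have pj: "p j \<notin> I" "v (p j) = a j" using p by auto
    have "real (snd (PQ j)) * a 1 < real (fst (PQ j)) * a j"
     using PQ[OF 1(1)] a1 by (simp add: divide_simps mult.commute split: if_splits)
    then show ?thesis using 1 pj p1 by (auto simp: vpow dest: prime_set_power[OF P])
   next
    case 2
    have "real N * A < real M * a 1" using NM a1 by (simp add: divide_simps mult.commute split: if_splits)
    then show ?thesis using 2 F p1 by (auto simp: vpow dest: prime_set_power[OF P])
   next
    case 3
    then show ?thesis using p1 one a1 by simp
   qed
  qed
  then show ?thesis using max by blast
 qed
 have finT: "finite T" by (simp add: T_def)
 define K where "K = \<bar>C\<bar> * real m powr c"
 define \<kappa> where "\<kappa> = (c - A) / (3 * a 1)"
 have K: "K \<ge> 0" and \<kappa>: "\<kappa> > 0" using cA a1 by (simp_all add: K_def \<kappa>_def)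
 define \<epsilon>' where "\<epsilon>' = min (min \<epsilon> 1) ((1 / (2 * (K + 1))) powr (1 / \<kappa>))"
 have \<epsilon>': "\<epsilon>' > 0" "\<epsilon>' \<le> \<epsilon>" "\<epsilon>' \<le> 1" using \<epsilon> K by (auto simp: \<epsilon>'_def)
 have hp: "h * p 1 \<notin> I" using prime_setD(6)[OF P, of h "p 1"] h p1 by blast
 obtain z :: "complex ^ 'n" where z: "\<And>l. cmod (z $ l) < \<epsilon>'" "\<And>g. g \<in> G ==> reval z g = 0" "reval z (h * p 1) ~= 0"
  "\<And>s t. (s, t) \<in> T ==> cmod (reval z s) \<le> \<epsilon>' * cmod (reval z t)"
  using points_from_valuation_ring[OF e V(1) cV xm hp G finT Tm \<epsilon>'(1)] by blast
 define t where "t = cmod (reval z (p 1))"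
 have t0: "t > 0" using z(3) by (simp add: t_def)
 have te: "t \<le> \<epsilon>'" using z(4)[of "p 1" 1] by (simp add: T_def t_def)
 have t1: "t \<le> 1" using te \<epsilon>' by simp
 have mono: "t powr y \<le> t powr x" if "x \<le> y" for x y using powr_mono'[OF that] t0 t1 by simp
 have noeps: "cmod (reval z s) \<le> cmod (reval z t')" if "(s, t') \<in> T" for s t'
  using z(4)[OF that] mult_right_mono[OF \<epsilon>'(3), of "cmod (reval z t')"] by simp
 have summand: "cmod (reval z (p j)) powr (1 / a j) \<le> t powr ((1 - \<delta>) / a 1)" if j: "j \<in> {1..m}" for j
 proof -
  define P' Q' where PQ': "P' = fst (PQ j)" "Q' = snd (PQ j)"
  have "cmod (reval z (p j ^ P')) \<le> cmod (reval z (p 1 ^ Q'))" using j by (intro noeps) (auto simp: T_def PQ')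
  then have "cmod (reval z (p j)) ^ P' \<le> t ^ Q'" by (simp add: norm_power t_def)
  then have "cmod (reval z (p j)) \<le> t powr (real Q' / real P')" using t0 PQ[OF j] by (intro power_le_powerD) (auto simp: PQ')
  then have "cmod (reval z (p j)) powr (1 / a j) \<le> (t powr (real Q' / real P')) powr (1 / a j)"
   using a[of j] j by (intro powr_mono2) auto
  also have "\<dots> = t powr (real Q' / real P' / a j)" by (simp add: powr_powr)
  also have "\<dots> \<le> t powr ((1 - \<delta>) / a 1)"
  proof (rule mono)
   have "(1 - \<delta>) * a j / a 1 / a j \<le> real Q' / real P' / a j"
    using PQ[OF j] a[of j] j by (intro divide_right_mono) (auto simp: PQ')
   then show "(1 - \<delta>) / a 1 \<le> real Q' / real P' / a j" using a[of j] j by simp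
  qed
  finally show ?thesis .
 qed
 have "(\<Sum>j=1..m. cmod (reval z (p j)) powr (1 / a j)) \<le> (\<Sum>j=1..m. t powr ((1 - \<delta>) / a 1))"
  using summand by (intro sum_mono) auto
 then have E: "(\<Sum>j=1..m. cmod (reval z (p j)) powr (1 / a j)) \<le> real m * t powr ((1 - \<delta>) / a 1)" by simp
 have "(\<Sum>j=1..m. cmod (reval z (p j)) powr (1 / a j)) powr c \<le> (real m * t powr ((1 - \<delta>) / a 1)) powr c"
  using E cA by (intro powr_mono2) (auto intro: sum_nonneg)
 also have "\<dots> = real m powr c * t powr ((1 - \<delta>) * c / a 1)" by (simp add: powr_mult powr_powr)
 finally have "C * (\<Sum>j=1..m. cmod (reval z (p j)) powr (1 / a j)) powr c \<le> \<bar>C\<bar> * (real m powr c * t powr ((1 - \<delta>) * c / a 1))"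
  by (intro mult_mono) auto
 also have "\<dots> = K * t powr ((1 - \<delta>) * c / a 1)" by (simp add: K_def)
 also have "(1 - \<delta>) * c / a 1 = (A + (c - A) / 3) / a 1 + \<kappa>" unfolding \<delta>(3) \<kappa>_def using a1 by (simp add: field_simps)
 also have "K * t powr ((A + (c - A) / 3) / a 1 + \<kappa>) = (K * t powr \<kappa>) * t powr ((A + (c - A) / 3) / a 1)" by (simp add: powr_add)
 also have "\<dots> < 1 * t powr ((A + (c - A) / 3) / a 1)"
 proof (rule mult_strict_right_mono)
  have "t powr \<kappa> \<le> ((1 / (2 * (K + 1))) powr (1 / \<kappa>)) powr \<kappa>"
   using te t0 \<kappa> by (intro powr_mono2) (auto simp: \<epsilon>'_def)
  also have "\<dots> = 1 / (2 * (K + 1))" using \<kappa> K by (simp add: powr_powr)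
  finally have "K * t powr \<kappa> \<le> K * (1 / (2 * (K + 1)))" using K by (intro mult_left_mono)
  also have "\<dots> < 1" using K by (simp add: field_simps)
  finally show "K * t powr \<kappa> < 1" .
 qed (use t0 in simp)
 also have "\<dots> \<le> t powr (real M / real N)" using mono NM(3) by simp
 also have "\<dots> \<le> cmod (reval z F)"
 proof -
  have "cmod (reval z (p 1 ^ M)) \<le> cmod (reval z (F ^ N))" by (intro noeps) (simp add: T_def)
  then have "t ^ M \<le> cmod (reval z F) ^ N" by (simp add: norm_power t_def)
  then have "(t ^ M) powr (1 / real N) \<le> (cmod (reval z F) ^ N) powr (1 / real N)" using t0 by (intro powr_mono2) auto
  moreover have "(t ^ M) powr (1 / real N) = t powr (real M / real N)" using t0 by (simp add: powr_powr flip: powr_realpow)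
  moreover have "(cmod (reval z F) ^ N) powr (1 / real N) = cmod (reval z F)"
  proof (cases "reval z F = 0")
   case False
   then show ?thesis using NM(1) by (simp add: powr_powr flip: powr_realpow)
  qed (use NM(1) in simp)
  ultimately show ?thesis by simp
 qed
 finally have "cmod (reval z F) > C * (\<Sum>j=1..m. cmod (reval z (p j)) powr (1 / a j)) powr c" .
 moreover have "cmod (z $ l) < \<epsilon>" for l using z(1)[of l] \<epsilon>'(2) by simp
 moreover have "reval z h ~= 0" using z(3) by auto
 ultimately show thesis using that[of z] z(2) unfolding F_def by blast
qed

section \<open>From growth to valuations\<close>

context
 fixes V' :: "'a::field set" and N :: "'a => real"
 assumes N_mult: "\<And>x y. x ~= 0 ==> y ~= 0 ==> N (x * y) = N x + N y"
begin

lemma val_one: "N 1 = 0" using N_mult[of 1 1] by simp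

lemma val_inverse: "x ~= 0 ==> N (inverse x) = - N x" using N_mult[of x "inverse x"] val_one by simp

lemma val_divide: "x ~= 0 ==> y ~= 0 ==> N (x / y) = N x - N y"
 using N_mult[of x "inverse y"] val_inverse[of y] by (simp add: divide_inverse)

lemma val_power: "x ~= 0 ==> N (x ^ k) = real k * N x"
 by (induction k) (simp_all add: val_one N_mult algebra_simps)

lemma val_power_int: "x ~= 0 ==> N (x powi k) = real_of_int k * N x"
 by (auto simp: power_int_def val_power val_inverse)

lemma val_prod: "finite K ==> (\<And>j. j \<in> K ==> x j ~= 0) ==> N (prod x K) = (\<Sum>j\<in>K. N (x j))"
 by (induction K rule: finite_induct) (simp_all add: val_one N_mult)

end

lemma unit_add_maximal:
 assumes V: "is_vring V" and u: "u \<in> units_of_vring V" and x: "x \<in> maximal_ideal V"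
 shows "u + x \<in> units_of_vring V"
proof -
 have "u + x \<in> V" using u x units_sub maximal_sub by (intro subring_add[OF vring_subring[OF V]])
 moreover have "u + x \<notin> maximal_ideal V"
  using maximal_diff[OF V _ x, of "u + x"] units_not_maximal[OF u] by auto
 ultimately show ?thesis using vring_cases by blast
qed

lemma reval_bounded: "\<exists>C\<ge>0. \<forall>z. norm z \<le> 1 --> cmod (reval z q) \<le> C"
proof -
 have "bounded ((\<lambda>z. reval z q) ` cball 0 1)"
  by (intro compact_imp_bounded compact_continuous_image continuous_on_reval compact_cball)
 then obtain C where "\<forall>x\<in>(\<lambda>z. reval z q) ` cball 0 1. cmod x \<le> C" unfolding bounded_iff by blast
 then have "cmod (reval z q) \<le> max C 0" if "norm z \<le> 1" for z using that by (auto simp: le_max_iff_disj)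
 then show ?thesis by (intro exI[of _ "max C 0"]) simp
qed

text \<open>The analytic hypothesis: no exponent beyond the sum of the \<open>a j\<close> bounds the product of the \<open>p j\<close> near the
  origin. The homomorphism \<open>e\<close> is a generic point.\<close>

locale growth =
 fixes I :: "('n::finite, real) mpoly set" and p :: "nat => ('n, real) mpoly" and a :: "nat => real" and m :: nat
  and e :: "('n, real) mpoly => host"
 assumes P: "prime_set I" and m: "m \<ge> 1" and a0: "a 0 = 0" and a: "\<And>j. 1 \<le> j ==> j \<le> m ==> a j > 0"
  and growth: "\<And>c C \<epsilon>. c > (\<Sum>j=1..m. a j) ==> \<epsilon> > 0 ==> \<exists>z. (\<forall>q\<in>I. reval z q = 0) \<and> norm z < \<epsilon> \<and>
   cmod (reval z (\<Prod>j\<le>m. p j)) > C * (\<Sum>j=1..m. cmod (reval z (p j)) powr (1 / a j)) powr c"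
  and e: "phom UNIV e" and ker: "\<And>q. e q = 0 \<longleftrightarrow> q \<in> I" and ec: "\<And>c. e (mpoly_const c) = gconst c"
begin

definition "A = (\<Sum>j=1..m. a j)"
definition "E z = (\<Sum>j=1..m. cmod (reval z (p j)) powr (1 / a j))"
definition "F = (\<Prod>j\<le>m. p j)"
text \<open>Points with \<open>E z = 0\<close> are excluded because \<open>0 powr 0 = 0\<close>; the product of the \<open>p j\<close> vanishes there anyway.\<close>

definition "W = {z. (\<forall>q\<in>I. reval z q = 0) \<and> norm z < 1 \<and> E z > 0}"
definition "bd q d \<longleftrightarrow> (\<exists>C\<ge>0. \<forall>z\<in>W. cmod (reval z q) \<le> C * E z powr d)"

lemmas esimps = phom_add[OF e UNIV_I UNIV_I] phom_mult[OF e UNIV_I UNIV_I] phom_one[OF e] phom_zero[OF e]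
 phom_uminus[OF e UNIV_I] phom_diff[OF e UNIV_I UNIV_I] phom_power[OF e UNIV_I]

lemma A_alt: "A = (\<Sum>j\<le>m. a j)"
proof -
 have "{..m} = insert 0 {1..m}" by auto
 then show ?thesis using a0 by (simp add: A_def)
qed

lemma E_nonneg: "E z \<ge> 0" by (simp add: E_def sum_nonneg)

lemma E_bounded: "\<exists>B\<ge>1. \<forall>z\<in>W. E z \<le> B"
proof -
 obtain C where C: "\<And>j. C j \<ge> 0 \<and> (\<forall>z. norm z \<le> 1 --> cmod (reval z (p j)) \<le> C j)"
 proof -
  have "\<forall>j. \<exists>C. C \<ge> 0 \<and> (\<forall>z. norm z \<le> 1 --> cmod (reval z (p j)) \<le> C)" using reval_bounded by blast
  from choice[OF this] show ?thesis using that by blast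
 qed
 have "E z \<le> (\<Sum>j=1..m. C j powr (1 / a j))" if "z \<in> W" for z
  unfolding E_def
 proof (rule sum_mono)
  fix j assume j: "j \<in> {1..m}"
  have "norm z \<le> 1" using that by (simp add: W_def)
  then show "cmod (reval z (p j)) powr (1 / a j) \<le> C j powr (1 / a j)" using C a[of j] j by (intro powr_mono2) auto
 qed
 then show ?thesis by (intro exI[of _ "max 1 (\<Sum>j=1..m. C j powr (1 / a j))"]) fastforce
qed

lemma bd_any: "bd q 0"
proof -
 obtain C where "C \<ge> 0" "\<forall>z. norm z \<le> 1 --> cmod (reval z q) \<le> C" using reval_bounded[of q] by blast
 then show ?thesis unfolding bd_def by (intro exI[of _ C]) (auto simp: W_def)
qed

lemma bd_zero: "bd 0 d"
 unfolding bd_def by (intro exI[of _ 0]) simp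

lemma bd_add:
 assumes "bd q d" "bd r d" shows "bd (q + r) d"
proof -
 obtain C C' where C: "C \<ge> 0" "C' \<ge> 0" "\<forall>z\<in>W. cmod (reval z q) \<le> C * E z powr d" "\<forall>z\<in>W. cmod (reval z r) \<le> C' * E z powr d"
  using assms unfolding bd_def by blast
 have "cmod (reval z (q + r)) \<le> (C + C') * E z powr d" if "z \<in> W" for z
  using C that norm_triangle_ineq[of "reval z q" "reval z r"] by (fastforce simp: distrib_right)
 then show ?thesis unfolding bd_def using C by (intro exI[of _ "C + C'"]) auto
qed

lemma bd_mult:
 assumes "bd q d" "bd r d'" shows "bd (q * r) (d + d')"
proof -
 obtain C C' where C: "C \<ge> 0" "C' \<ge> 0" "\<forall>z\<in>W. cmod (reval z q) \<le> C * E z powr d" "\<forall>z\<in>W. cmod (reval z r) \<le> C' * E z powr d'"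
  using assms unfolding bd_def by blast
 have "cmod (reval z (q * r)) \<le> (C * C') * E z powr (d + d')" if "z \<in> W" for z
 proof -
  have "cmod (reval z q) * cmod (reval z r) \<le> (C * E z powr d) * (C' * E z powr d')"
   using C that by (intro mult_mono) auto
  then show ?thesis by (simp add: norm_mult powr_add mult_ac)
 qed
 then show ?thesis unfolding bd_def using C by (intro exI[of _ "C * C'"]) auto
qed

lemma bd_power: "bd q d ==> bd (q ^ k) (real k * d)"
proof (induction k)
 case (Suc k)
 then show ?case using bd_mult[of q d "q ^ k" "real k * d"] by (simp add: algebra_simps)
qed (simp add: bd_any)

lemma bd_weaken:
 assumes "bd q d" "d' \<le> d" shows "bd q d'"
proof -
 obtain C where C: "C \<ge> 0" "\<forall>z\<in>W. cmod (reval z q) \<le> C * E z powr d" using assms unfolding bd_def by blast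
 obtain B where B: "B \<ge> 1" "\<forall>z\<in>W. E z \<le> B" using E_bounded by blast
 have "cmod (reval z q) \<le> (C * B powr (d - d')) * E z powr d'" if "z \<in> W" for z
 proof -
  have "E z powr (d - d') \<le> B powr (d - d')" using B that assms E_nonneg by (intro powr_mono2) auto
  then have "E z powr (d - d') * E z powr d' \<le> B powr (d - d') * E z powr d'" by (intro mult_right_mono) auto
  then have "E z powr d \<le> B powr (d - d') * E z powr d'" by (simp add: powr_add[symmetric])
  then have "C * E z powr d \<le> C * (B powr (d - d') * E z powr d')" using C by (intro mult_left_mono)
  then show ?thesis using C that by fastforce
 qed
 then show ?thesis unfolding bd_def using C by (intro exI[of _ "C * B powr (d - d')"]) auto
qed

lemma bd_p: "j \<le> m ==> bd (p j) (a j)"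
proof (cases "j = 0")
 case True
 then show ?thesis using bd_any a0 by simp
next
 case False
 assume j: "j \<le> m"
 then have aj: "a j > 0" "j \<in> {1..m}" using a False by auto
 have "cmod (reval z (p j)) \<le> 1 * E z powr a j" for z
 proof -
  have "cmod (reval z (p j)) powr (1 / a j) \<le> E z"
   unfolding E_def using aj(2) by (intro member_le_sum) auto
  then have "(cmod (reval z (p j)) powr (1 / a j)) powr a j \<le> E z powr a j" using aj by (intro powr_mono2) auto
  then show ?thesis using aj by (simp add: powr_powr)
 qed
 then show ?thesis unfolding bd_def by (intro exI[of _ 1]) auto
qed

lemma bd_monomial: "k \<le> m ==> bd (\<Prod>j\<le>k. p j ^ n j) (\<Sum>j\<le>k. real (n j) * a j)"
proof (induction k)
 case 0
 then show ?case using bd_power[OF bd_p, of 0 "n 0"] by simp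
next
 case (Suc k)
 then show ?case using bd_mult[OF Suc.IH bd_power[OF bd_p, of "Suc k" "n (Suc k)"]] by simp
qed

lemma bd_F: "bd F A"
 using bd_monomial[of m "\<lambda>_. 1"] by (simp add: F_def A_alt)

lemma p_notin: assumes "j \<le> m" shows "p j \<notin> I"
proof
 assume "p j \<in> I"
 then have "F \<in> I" unfolding F_def using assms prime_setD(4)[OF P] by (subst prod.remove[of _ j]) auto
 then show False using growth[of "A + 1" 1 0] by (auto simp: F_def A_def)
qed

lemma e_p_nz: "j \<le> m ==> e (p j) ~= 0"
 using ker p_notin by blast

lemma eF: "e F = (\<Prod>j\<le>m. e (p j))" "e F ~= 0"
proof -
 show "e F = (\<Prod>j\<le>m. e (p j))" unfolding F_def by (rule phom_prod[OF e UNIV_I])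
 then show "e F ~= 0" using e_p_nz by simp
qed

text \<open>The elements of order at least \<open>\<delta>\<close>, measured after multiplication by a power of \<open>F\<close>, which has order \<open>A\<close>.\<close>

definition "Ad \<delta> = {x. \<exists>M q. e q = x * e F ^ M \<and> bd q (real M * A + \<delta>)}"

lemma Ad_lift:
 assumes "e q = x * e F ^ M" "bd q (real M * A + \<delta>)"
 shows "e (q * F ^ k) = x * e F ^ (M + k)" "bd (q * F ^ k) (real (M + k) * A + \<delta>)"
 using assms bd_mult[OF assms(2) bd_power[OF bd_F, of k]] by (simp_all add: esimps power_add algebra_simps)

lemma Ad_add:
 assumes "x \<in> Ad \<delta>" "y \<in> Ad \<delta>" shows "x + y \<in> Ad \<delta>"
proof -
 obtain M q M' q' where q: "e q = x * e F ^ M" "bd q (real M * A + \<delta>)" "e q' = y * e F ^ M'" "bd q' (real M' * A + \<delta>)"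
  using assms unfolding Ad_def by blast
 note l = Ad_lift[OF q(1,2), of M'] Ad_lift[OF q(3,4), of M]
 have "e (q * F ^ M' + q' * F ^ M) = (x + y) * e F ^ (M + M')" using l by (simp add: esimps algebra_simps)
 moreover have "bd (q * F ^ M' + q' * F ^ M) (real (M + M') * A + \<delta>)" using l by (intro bd_add) (simp_all add: add.commute)
 ultimately show ?thesis unfolding Ad_def by blast
qed

lemma Ad_mult:
 assumes "x \<in> Ad \<delta>" "y \<in> Ad \<delta>'" shows "x * y \<in> Ad (\<delta> + \<delta>')"
proof -
 obtain M q M' q' where q: "e q = x * e F ^ M" "bd q (real M * A + \<delta>)" "e q' = y * e F ^ M'" "bd q' (real M' * A + \<delta>')"
  using assms unfolding Ad_def by blast
 have "e (q * q') = (x * y) * e F ^ (M + M')" using q by (simp add: esimps power_add mult_ac)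
 moreover have "bd (q * q') (real (M + M') * A + (\<delta> + \<delta>'))" using bd_mult[OF q(2,4)] by (simp add: algebra_simps)
 ultimately show ?thesis unfolding Ad_def by blast
qed

lemma Ad_mono: "x \<in> Ad \<delta> ==> \<delta>' \<le> \<delta> ==> x \<in> Ad \<delta>'"
 unfolding Ad_def using bd_weaken by fastforce

lemma Ad_e: "e q \<in> Ad 0"
 unfolding Ad_def using bd_any[of q] by (intro CollectI exI[of _ 0] exI[of _ q]) simp

lemma Ad_uminus: "x \<in> Ad \<delta> ==> - x \<in> Ad \<delta>"
 using Ad_mult[OF Ad_e[of "- 1"], of x \<delta>] by (simp add: esimps)

text \<open>Otherwise a power \<open>F ^ M\<close> would agree on the zero locus with a polynomial bounded by \<open>E\<close> to the power
  \<open>M A + \<delta>\<close>, so that \<open>F\<close> would be bounded by \<open>E\<close> to the power \<open>A + \<delta> / M\<close>.\<close>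

lemma one_notin_Ad:
 assumes "\<delta> > 0" shows "1 \<notin> Ad \<delta>"
proof
 assume "1 \<in> Ad \<delta>"
 then obtain M0 q0 where "e q0 = 1 * e F ^ M0" "bd q0 (real M0 * A + \<delta>)" unfolding Ad_def by blast
 note l = Ad_lift[OF this, of 1]
 define M q where "M = M0 + 1" and "q = q0 * F ^ 1"
 have M: "M > 0" "e q = e F ^ M" "bd q (real M * A + \<delta>)" using l by (simp_all add: M_def q_def)
 then obtain C where C: "C \<ge> 0" "\<forall>z\<in>W. cmod (reval z q) \<le> C * E z powr (real M * A + \<delta>)" unfolding bd_def by blast
 have "q - F ^ M \<in> I" using M(2) ker[of "q - F ^ M"] by (simp add: esimps)
 define c where "c = A + \<delta> / real M"
 define C' where "C' = (C + 1) powr (1 / real M)"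
 have c: "c > (\<Sum>j=1..m. a j)" "c * real M = real M * A + \<delta>"
  unfolding A_def[symmetric] c_def using assms M(1) by (simp_all add: distrib_right)
 obtain z where z: "\<forall>q\<in>I. reval z q = 0" "norm z < 1" "cmod (reval z F) > C' * E z powr c"
  using growth[OF c(1), of 1 C'] unfolding F_def E_def by auto
 have C'0: "C' \<ge> 0" by (simp add: C'_def)
 then have Fz: "reval z F ~= 0" using z(3) by (smt (verit) mult_nonneg_nonneg norm_zero powr_ge_zero)
 have E0: "E z > 0"
 proof -
  have "reval z F = (\<Prod>j\<le>m. reval z (p j))" unfolding F_def by (rule phom_prod[OF phom_reval UNIV_I])
  then have "reval z (p 1) ~= 0" using Fz m by auto
  then have "0 < cmod (reval z (p 1)) powr (1 / a 1)" by simp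
  also have "\<dots> \<le> E z" unfolding E_def using m by (intro member_le_sum) auto
  finally show ?thesis .
 qed
 then have zW: "z \<in> W" using z by (simp add: W_def)
 have "reval z (q - F ^ M) = 0" using z(1) \<open>q - F ^ M \<in> I\<close> by blast
 then have "cmod (reval z F) ^ M = cmod (reval z q)" by (simp add: norm_power)
 also have "\<dots> \<le> C * E z powr (real M * A + \<delta>)" using C zW by blast
 also have "\<dots> \<le> (C + 1) * E z powr (real M * A + \<delta>)" by (intro mult_right_mono) auto
 also have "\<dots> = (C' * E z powr c) ^ M"
 proof -
  have "C' ^ M = C + 1" using C(1) M(1) by (simp add: C'_def powr_powr flip: powr_realpow)
  moreover have "(E z powr c) ^ M = E z powr (real M * A + \<delta>)" using E0 by (simp add: powr_powr c(2) flip: powr_realpow)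
  ultimately show ?thesis by (simp add: power_mult_distrib)
 qed
 also have "\<dots> < cmod (reval z F) ^ M" using z(3) C'0 M(1) by (intro power_strict_mono) auto
 finally show False by simp
qed

definition "J = (\<Union>\<delta>\<in>{0<..}. Ad \<delta>)"

lemma proper_pair_growth: "proper_pair (Ad 0) J"
 unfolding proper_pair_def
proof (intro conjI ballI)
 show "is_subring (Ad 0)"
 proof (rule is_subringI)
  show "1 \<in> Ad 0" using Ad_e[of 1] by (simp add: esimps)
 qed (use Ad_add Ad_uminus Ad_mult[of _ 0 _ 0] in auto)
 show "J \<subseteq> Ad 0" using Ad_mono by (fastforce simp: J_def)
 have "0 \<in> Ad 1" unfolding Ad_def using bd_zero esimps(4) by (intro CollectI exI[of _ 0] exI[of _ 0]) simp
 then show "0 \<in> J" by (force simp: J_def)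
 show "x + y \<in> J" if xy: "x \<in> J" "y \<in> J" for x y
 proof -
  obtain \<delta> \<delta>' where "\<delta> > 0" "\<delta>' > 0" "x \<in> Ad \<delta>" "y \<in> Ad \<delta>'" using xy unfolding J_def by blast
  then have "x + y \<in> Ad (min \<delta> \<delta>')" "min \<delta> \<delta>' > 0"
   using Ad_add[OF Ad_mono[of x \<delta> "min \<delta> \<delta>'"] Ad_mono[of y \<delta>' "min \<delta> \<delta>'"]] by auto
  then show ?thesis by (auto simp: J_def)
 qed
 show "b * x \<in> J" if "b \<in> Ad 0" "x \<in> J" for b x
  using that Ad_mult[of b 0 x] by (auto simp: J_def)
 show "1 \<notin> J" using one_notin_Ad by (auto simp: J_def)
qed

definition mon :: "(nat => int) => host" where "mon k = (\<Prod>j\<le>m. e (p j) powi k j)"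
definition wt :: "(nat => int) => real" where "wt k = (\<Sum>j\<le>m. real_of_int (k j) * a j)"

lemma mon_nz: "mon k ~= 0" using e_p_nz by (simp add: mon_def)

lemma mon_diff: "mon (\<lambda>j. k j - l j) = mon k / mon l"
 unfolding mon_def prod_dividef[symmetric] using e_p_nz by (intro prod.cong) (auto simp: power_int_diff)

lemma wt_diff: "wt (\<lambda>j. k j - l j) = wt k - wt l"
 by (simp add: wt_def algebra_simps sum_subtractf)

lemma mon_uminus: "mon (\<lambda>j. - k j) = inverse (mon k)" and wt_uminus: "wt (\<lambda>j. - k j) = - wt k"
 using mon_diff[of "\<lambda>_. 0" k] wt_diff[of "\<lambda>_. 0" k] by (simp_all add: mon_def wt_def divide_inverse)

text \<open>Multiplication by a high power of \<open>F\<close>, the product of all \<open>p j\<close>, makes the exponents nonnegative.\<close>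

lemma mon_Ad: "mon k \<in> Ad (wt k)"
proof -
 define M where "M = nat (\<Sum>j\<le>m. \<bar>k j\<bar>)"
 have Mk: "0 \<le> int M + k j" if "j \<le> m" for j
 proof -
  have "\<bar>k j\<bar> \<le> (\<Sum>j\<le>m. \<bar>k j\<bar>)" using that by (intro member_le_sum) auto
  then show ?thesis by (simp add: M_def)
 qed
 define n where "n = (\<lambda>j. nat (int M + k j))"
 have "e (\<Prod>j\<le>m. p j ^ n j) = (\<Prod>j\<le>m. e (p j) powi k j * e (p j) ^ M)"
  unfolding phom_prod[OF e UNIV_I]
 proof (rule prod.cong[OF refl])
  fix j assume j: "j \<in> {..m}"
  then have "int (n j) = k j + int M" using Mk by (simp add: n_def)
  then have "e (p j) ^ n j = e (p j) powi (k j + int M)" by (metis power_int_of_nat)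
  then show "e (p j ^ n j) = e (p j) powi k j * e (p j) ^ M" using e_p_nz[of j] j by (simp add: esimps power_int_add)
 qed
 also have "\<dots> = mon k * e F ^ M" by (simp add: mon_def eF prod.distrib prod_power_distrib)
 finally have "e (\<Prod>j\<le>m. p j ^ n j) = mon k * e F ^ M" .
 moreover have "(\<Sum>j\<le>m. real (n j) * a j) = real M * A + wt k"
 proof -
  have "(\<Sum>j\<le>m. real (n j) * a j) = (\<Sum>j\<le>m. real M * a j + real_of_int (k j) * a j)"
   using Mk by (intro sum.cong) (auto simp: n_def algebra_simps)
  then show ?thesis by (simp add: A_alt wt_def sum.distrib sum_distrib_left)
 qed
 ultimately show ?thesis using bd_monomial[of m n] unfolding Ad_def by auto
qed

definition indep :: "nat set => bool" where
 "indep S \<longleftrightarrow> (\<forall>k. (\<forall>j. j \<notin> S --> k j = 0) --> wt k = 0 --> (\<forall>j. k j = 0))"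

lemma indepD: "indep S ==> (\<And>j. j \<notin> S ==> k j = 0) ==> wt k = 0 ==> k j = 0"
 unfolding indep_def by blast

lemma wt_single: "j \<le> m ==> wt (\<lambda>i. if i = j then c else 0) = real_of_int c * a j"
proof -
 assume j: "j \<le> m"
 have "wt (\<lambda>i. if i = j then c else 0) = (\<Sum>i\<le>m. if i = j then real_of_int c * a j else 0)"
  unfolding wt_def by (intro sum.cong) auto
 then show ?thesis using j by simp
qed

text \<open>A maximal family of integrally independent \<open>a j\<close>; every other one has a multiple in its span.\<close>

lemma ex_basis:
 obtains S s where "S \<subseteq> {1..m}" "indep S" "s \<in> S"
  "\<And>j. j \<le> m ==> \<exists>n k. n > 0 \<and> (\<forall>i. i \<notin> S --> k i = 0) \<and> real n * a j = wt k"
proof -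
 let ?X = "{S. S \<subseteq> {1..m} \<and> indep S}"
 have one: "{1} \<in> ?X"
 proof -
  have one0: "k 1 = 0" if "\<forall>j. j \<notin> {1} --> k j = 0" "wt k = 0" for k :: "nat => int"
  proof -
   have "k = (\<lambda>i. if i = 1 then k 1 else 0)" using that by auto
   then have "wt k = real_of_int (k 1) * a 1" using wt_single[of 1 "k 1"] m by simp
   then show ?thesis using that a[of 1] m by simp
  qed
  have "indep {1}" unfolding indep_def
  proof (intro allI impI)
   fix k :: "nat => int" and j
   assume k: "\<forall>j. j \<notin> {1} --> k j = 0" "wt k = 0"
   then show "k j = 0" using one0[OF k] by (cases "j = 1") auto
  qed
  then show ?thesis using m by auto
 qed
 have fin: "finite ?X" by (rule finite_subset[of _ "Pow {1..m}"]) auto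
 then obtain S where S: "S \<in> ?X" and max: "\<And>T. T \<in> ?X ==> S \<subseteq> T ==> S = T"
 proof -
  have "\<exists>S\<in>?X. \<forall>T\<in>?X. S \<subseteq> T --> S = T" by (rule finite_has_maximal[OF fin]) (use one in blast)
  then show ?thesis using that by (elim bexE) blast
 qed
 have "S ~= {}" using max[OF one] by auto
 then obtain s where s: "s \<in> S" by blast
 have "\<exists>n k. n > 0 \<and> (\<forall>i. i \<notin> S --> k i = 0) \<and> real n * a j = wt k" if j: "j \<le> m" for j
 proof (cases "j = 0 \<or> j \<in> S")
  case True
  then show ?thesis
  proof
   assume "j = 0"
   then show ?thesis using a0 by (intro exI[of _ 1] exI[of _ "\<lambda>_. 0"]) (simp add: wt_def)
  next
   assume "j \<in> S"
   then show ?thesis using wt_single[OF j, of 1] by (intro exI[of _ 1] exI[of _ "\<lambda>i. if i = j then 1 else 0"]) auto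
  qed
 next
  case False
  then have "insert j S \<notin> ?X" using max[of "insert j S"] by blast
  then have "\<not> indep (insert j S)" using S False j by auto
  then obtain k where k: "\<forall>i. i \<notin> insert j S --> k i = 0" "wt k = 0" "\<exists>i. k i ~= 0" unfolding indep_def by blast
  have kj: "k j ~= 0"
  proof
   assume "k j = 0"
   then have "\<forall>i. i \<notin> S --> k i = 0" using k(1) by auto
   then show False using S k unfolding indep_def by blast
  qed
  define k' where "k' = (\<lambda>i. k i - (if i = j then k j else 0))"
  have k': "\<forall>i. i \<notin> S --> k' i = 0" "wt k' = - (real_of_int (k j) * a j)"
   using k wt_single[OF j, of "k j"] unfolding k'_def by (auto simp: wt_diff)
  show ?thesis
  proof (cases "k j > 0")
   case True
   then show ?thesis using k' wt_uminus[of k']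
    by (intro exI[of _ "nat (k j)"] exI[of _ "\<lambda>i. - k' i"]) auto
  next
   case False
   then show ?thesis using k' kj by (intro exI[of _ "nat (- k j)"] exI[of _ k']) auto
  qed
 qed
 then show thesis using that[of S s] S s by blast
qed

text \<open>Let \<open>V\<close> be a valuation ring given by Chevalley's theorem for \<open>J\<close>. Among the monomials of a
  polynomial in the \<open>p j\<close> with \<open>j\<close> in the basis \<open>S\<close>, a single one has the least weight, and \<open>V\<close> sees the
  polynomial as a unit times this monomial. Hence these \<open>p j\<close> are algebraically independent, and sending
  them to variables of weight \<open>a j\<close> respects the valuation rings. After transport, the remaining \<open>p j\<close> have the
  right values because a power of each is a \<open>V\<close>-unit times a monomial in the basis.\<close>

theorem ex_real_valuation:
 "\<exists>v :: ('n, real) mpoly => real. (\<forall>x y. x - y \<in> I --> v x = v y) \<and>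
  (\<forall>x y. x \<notin> I --> y \<notin> I --> v (x * y) = v x + v y) \<and>
  (\<forall>x y. x \<notin> I --> y \<notin> I --> x + y \<notin> I --> v (x + y) \<ge> min (v x) (v y)) \<and>
  (\<forall>c. c ~= 0 --> v (mpoly_const c) = 0) \<and> (\<forall>x. x \<notin> I --> v x \<ge> 0) \<and> (\<forall>j\<le>m. p j \<notin> I \<and> v (p j) = a j)"
proof -
 obtain V where V: "is_vring V" "Ad 0 \<subseteq> V" "\<And>x. x \<in> J ==> x ~= 0 ==> inverse x \<notin> V"
  using chevalley[OF proper_pair_growth] by blast
 note Vr = vring_subring[OF V(1)]
 have eV: "e q \<in> V" for q using Ad_e V by blast
 have mon_max: "mon k \<in> maximal_ideal V" if "wt k > 0" for k
 proof -
  have "mon k \<in> J" using mon_Ad that by (auto simp: J_def)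
  moreover have "mon k \<in> Ad 0" using Ad_mono[OF mon_Ad] that by simp
  ultimately show ?thesis using V mon_nz by (auto simp: maximal_ideal_def)
 qed
 have mon_V: "mon k \<in> V \<longleftrightarrow> wt k \<ge> 0" for k
 proof
  assume k: "mon k \<in> V"
  show "wt k \<ge> 0"
  proof (rule ccontr)
   assume "\<not> wt k \<ge> 0"
   then have "mon (\<lambda>j. - k j) \<in> maximal_ideal V" by (intro mon_max) (simp add: wt_uminus)
   then show False using k mon_nz[of k] by (simp add: mon_uminus maximal_ideal_def)
  qed
 next
  assume "wt k \<ge> 0"
  then show "mon k \<in> V" using Ad_mono[OF mon_Ad, of 0 k] V by blast
 qed
 have mon_unit: "mon k \<in> units_of_vring V" if "wt k = 0" for k
  using mon_V[of k] mon_V[of "\<lambda>j. - k j"] that mon_nz by (simp add: units_of_vring_def mon_uminus wt_uminus)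
 have gunit: "gconst c \<in> units_of_vring V" if "c ~= 0" for c
  using eV[of "mpoly_const c"] eV[of "mpoly_const (inverse c)"] that gconst_eq_iff[of c 0]
  by (simp add: ec units_of_vring_def gconst_simps)
 have gV: "gconst c \<in> V" for c using eV[of "mpoly_const c"] by (simp add: ec)
 obtain S s where S: "S \<subseteq> {1..m}" "indep S" "s \<in> S"
  and rel: "\<And>j. j \<le> m ==> \<exists>n k. n > 0 \<and> (\<forall>i. i \<notin> S --> k i = 0) \<and> real n * a j = wt k"
  using ex_basis by blast
 \<comment> \<open>the variables outside \<open>S\<close> get weight zero; those beyond \<open>m\<close> are the fresh units of the target\<close>
 define \<gamma> where "\<gamma> = (\<lambda>j. if j \<in> S then a j else 0)"
 define y where "y = (\<lambda>j. e (p j))"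
 define Y where "Y = meval gconst y"
 have Yh: "phom UNIV Y" unfolding Y_def by (rule phom_meval[OF phom_gconst])
 note Ys = phom_add[OF Yh UNIV_I UNIV_I] phom_mult[OF Yh UNIV_I UNIV_I] phom_one[OF Yh] phom_zero[OF Yh]
  phom_uminus[OF Yh UNIV_I] phom_diff[OF Yh UNIV_I UNIV_I]
 have Yc: "Y (Poly_Mapping.single 0 c) = gconst c" for c unfolding Y_def by (simp add: meval_single[OF phom_gconst])
 have Yv: "Y (gvar j) = y j" for j
  unfolding Y_def gvar_def by (simp add: meval_single[OF phom_gconst] mon_eval_single gconst_simps)
 define ke where "ke = (\<lambda>(\<alpha> :: nat \<Rightarrow>\<^sub>0 nat) j. int (Poly_Mapping.lookup \<alpha> j))"
 have ke: "mon_eval y \<alpha> = mon (ke \<alpha>)" "mweight \<gamma> \<alpha> = wt (ke \<alpha>)" if "Poly_Mapping.keys \<alpha> \<subseteq> S" for \<alpha>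
 proof -
  have K: "Poly_Mapping.keys \<alpha> \<subseteq> {..m}" using that S(1) by auto
  show "mon_eval y \<alpha> = mon (ke \<alpha>)"
   using mon_eval_superset[OF _ K, of y] by (simp add: mon_def ke_def y_def)
  have \<gamma>eq: "real (Poly_Mapping.lookup \<alpha> j) * \<gamma> j = real (Poly_Mapping.lookup \<alpha> j) * a j" for j
   using that by (cases "j \<in> S") (auto simp: \<gamma>_def in_keys_iff subset_iff)
  show "mweight \<gamma> \<alpha> = wt (ke \<alpha>)"
   unfolding mweight_superset[OF finite_atMost K] \<gamma>eq by (simp add: wt_def ke_def)
 qed
 have outside: "Poly_Mapping.lookup \<alpha> j = 0" if "Poly_Mapping.keys \<alpha> \<subseteq> S" "j \<notin> S" for \<alpha> :: "nat \<Rightarrow>\<^sub>0 nat" and j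
 proof -
  have "j \<notin> Poly_Mapping.keys \<alpha>" using that by blast
  then show ?thesis by (simp add: in_keys_iff)
 qed
 have lead: "\<exists>\<alpha>. Poly_Mapping.keys \<alpha> \<subseteq> S \<and> mweight \<gamma> \<alpha> = mval \<gamma> q \<and> Y q / mon (ke \<alpha>) \<in> units_of_vring V"
  if q: "q \<in> polys_in S" "q ~= 0" for q
 proof -
  obtain \<alpha> where \<alpha>: "\<alpha> \<in> Poly_Mapping.keys q" "mweight \<gamma> \<alpha> = mval \<gamma> q" using mval_attained[OF q(2)] by blast
  have ks: "Poly_Mapping.keys \<beta> \<subseteq> S" if "\<beta> \<in> Poly_Mapping.keys q" for \<beta> using q(1) that unfolding polys_in_def by blast
  have big: "mon (ke \<beta>) / mon (ke \<alpha>) \<in> maximal_ideal V" if \<beta>: "\<beta> \<in> Poly_Mapping.keys q - {\<alpha>}" for \<beta>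
  proof -
   let ?d = "\<lambda>j. ke \<beta> j - ke \<alpha> j"
   have b: "Poly_Mapping.keys \<beta> \<subseteq> S" "Poly_Mapping.keys \<alpha> \<subseteq> S" using ks \<beta> \<alpha> by auto
   have "mweight \<gamma> \<beta> \<ge> mweight \<gamma> \<alpha>" using mval_le[of \<beta> q \<gamma>] \<beta> \<alpha> by simp
   then have ge: "wt ?d \<ge> 0" using ke(2)[OF b(1)] ke(2)[OF b(2)] by (simp add: wt_diff)
   have "wt ?d ~= 0"
   proof
    assume "wt ?d = 0"
    moreover have "?d j = 0" if "j \<notin> S" for j
     using outside[OF b(1) that] outside[OF b(2) that] by (simp add: ke_def)
    ultimately have "?d j = 0" for j by (rule indepD[OF S(2), rotated])
    then have "\<beta> = \<alpha>" by (intro poly_mapping_eqI) (simp add: ke_def)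
    then show False using \<beta> by simp
   qed
   then show ?thesis using mon_max[of ?d] ge by (simp add: mon_diff)
  qed
  have "Y q = (\<Sum>\<beta>\<in>Poly_Mapping.keys q. gconst (Poly_Mapping.lookup q \<beta>) * mon (ke \<beta>))"
   unfolding Y_def meval_def using ke(1) ks by (intro sum.cong) auto
  then have "Y q / mon (ke \<alpha>) = (\<Sum>\<beta>\<in>Poly_Mapping.keys q. gconst (Poly_Mapping.lookup q \<beta>) * (mon (ke \<beta>) / mon (ke \<alpha>)))"
   by (simp add: sum_divide_distrib)
  also have "\<dots> = gconst (Poly_Mapping.lookup q \<alpha>) +
    (\<Sum>\<beta>\<in>Poly_Mapping.keys q - {\<alpha>}. gconst (Poly_Mapping.lookup q \<beta>) * (mon (ke \<beta>) / mon (ke \<alpha>)))"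
   using \<alpha>(1) mon_nz by (subst sum.remove[of _ \<alpha>]) auto
  finally have eq: "Y q / mon (ke \<alpha>) = \<dots>" .
  have "(\<Sum>\<beta>\<in>Poly_Mapping.keys q - {\<alpha>}. gconst (Poly_Mapping.lookup q \<beta>) * (mon (ke \<beta>) / mon (ke \<alpha>))) \<in> maximal_ideal V"
   using big gV by (intro maximal_sum[OF V(1)]) (metis maximal_mult[OF V(1)] mult.commute)
  then have "Y q / mon (ke \<alpha>) \<in> units_of_vring V" unfolding eq
   using \<alpha>(1) by (intro unit_add_maximal[OF V(1)] gunit) (auto simp: in_keys_iff)
  then show ?thesis using \<alpha> ks by blast
 qed
 have Ynz: "Y q ~= 0" if "q \<in> polys_in S" "q ~= 0" for q using lead[OF that] units_nonzero by fastforce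
 note PS = polys_in_subring[of S]
 have Yinj: "Y q = Y r \<longleftrightarrow> q = r" if "q \<in> polys_in S" "r \<in> polys_in S" for q r
  using Ynz[OF subring_diff[OF PS that]] by (auto simp: Ys)
 define hm0 where "hm0 = (\<lambda>x. emb (SOME q. q \<in> polys_in S \<and> Y q = x))"
 have hm0: "hm0 (Y q) = emb q" if "q \<in> polys_in S" for q
 proof -
  have "(SOME r. r \<in> polys_in S \<and> Y r = Y q) = q" using Yinj that by (intro some_equality) auto
  then show ?thesis by (simp add: hm0_def)
 qed
 have h0: "phom (Y ` polys_in S) hm0"
 proof -
  have "is_subring (Y ` polys_in S)"
  proof (rule is_subringI)
   show "1 \<in> Y ` polys_in S" using subring_one[OF PS] Ys(3) by (metis image_eqI)
  qed (use PS in \<open>auto simp flip: Ys intro!: imageI intro: subring_intros\<close>)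
  moreover have "hm0 1 = 1" using hm0[OF subring_one[OF PS]] by (simp add: Ys emb_simps)
  moreover have "hm0 (Y q + Y r) = hm0 (Y q) + hm0 (Y r) \<and> hm0 (Y q * Y r) = hm0 (Y q) * hm0 (Y r)"
   if "q \<in> polys_in S" "r \<in> polys_in S" for q r
   using that hm0[OF subring_add[OF PS that]] hm0[OF subring_mult[OF PS that]] by (simp add: hm0 Ys emb_simps)
  ultimately show ?thesis unfolding phom_def by blast
 qed
 obtain W0 hm1 where W0: "local_hom W0 hm1" "W0 = {b / c | b c. b \<in> Y ` polys_in S \<and> c \<in> Y ` polys_in S \<and> hm0 c ~= 0}"
  and hm1_raw: "\<And>b c. b \<in> Y ` polys_in S ==> c \<in> Y ` polys_in S ==> hm0 c ~= 0 ==> hm1 (b / c) = hm0 b / hm0 c"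
  using phom_localize[OF h0] by blast
 have W0_rep: "\<exists>q r. q \<in> polys_in S \<and> r \<in> polys_in S \<and> r ~= 0 \<and> x = Y q / Y r" if x: "x \<in> W0" for x
 proof -
  obtain q r where qr: "q \<in> polys_in S" "r \<in> polys_in S" "hm0 (Y r) ~= 0" "x = Y q / Y r" using x unfolding W0(2) by blast
  moreover have "r ~= 0" using qr(3) hm0[OF qr(2)] by (simp add: emb_simps)
  ultimately show ?thesis by blast
 qed
 have hm1: "hm1 (Y q / Y r) = emb q / emb r" "Y q / Y r \<in> W0" if "q \<in> polys_in S" "r \<in> polys_in S" "r ~= 0" for q r
 proof -
  have nz: "Y q \<in> Y ` polys_in S" "Y r \<in> Y ` polys_in S" "hm0 (Y r) ~= 0" using that hm0[OF that(2)] by auto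
  then show "hm1 (Y q / Y r) = emb q / emb r" using hm1_raw[OF nz] hm0 that by simp
  show "Y q / Y r \<in> W0" unfolding W0(2) using nz by blast
 qed
 have h1: "phom W0 hm1" using W0(1) by (simp add: local_hom_def)
 have hm1nz: "hm1 x ~= 0" if x: "x \<in> W0" "x ~= 0" for x
 proof -
  obtain q r where qr: "q \<in> polys_in S" "r \<in> polys_in S" "r ~= 0" "x = Y q / Y r" using W0_rep[OF x(1)] by blast
  then have "q ~= 0" using x Ys(4) by auto
  then show ?thesis using qr hm1 by simp
 qed
 have W0f: "is_subfield W0"
  unfolding is_subfield_def
 proof
  show "\<forall>x\<in>W0. inverse x \<in> W0"
  proof
   fix x assume x: "x \<in> W0"
   show "inverse x \<in> W0" using W0(1) hm1nz[OF x] x by (cases "x = 0") (auto simp: local_hom_def)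
  qed
 qed (rule phom_subring[OF h1])
 have S1: "1 \<in> polys_in S" by (rule subring_one[OF PS])
 have cS: "Poly_Mapping.single 0 c \<in> polys_in S" for c by (auto simp: polys_in_def split: if_splits)
 have vS: "gvar j \<in> polys_in S" if "j \<in> S" for j using that by (auto simp: gvar_def polys_in_def split: if_splits)
 have hm1c: "gconst c \<in> W0" "hm1 (gconst c) = gconst c" for c
  using hm1[OF cS[of c] S1] by (simp_all add: Yc Ys emb_simps gconst_def)
 have hm1v: "e (p j) \<in> W0" "hm1 (e (p j)) = emb (gvar j)" if "j \<in> S" for j
  using hm1[OF vS[OF that] S1] by (simp_all add: Yv Ys emb_simps y_def)
 obtain V' and N :: "host => real" where V': "is_vring V'"
  and Nm: "\<And>x y. x ~= 0 ==> y ~= 0 ==> N (x * y) = N x + N y"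
  and Na: "\<And>x y. x ~= 0 ==> y ~= 0 ==> x + y ~= 0 ==> N (x + y) \<ge> min (N x) (N y)"
  and NV: "\<And>x. x ~= 0 ==> x \<in> V' \<longleftrightarrow> N x \<ge> 0" and Ne: "\<And>q. q ~= 0 ==> N (emb q) = mval \<gamma> q"
  using monomial_real_valuation[of \<gamma>] by blast
 have Ninv: "N (inverse x) = - N x" if "x ~= 0" for x by (rule val_inverse[OF Nm that])
 have Ndiv: "N (x / y) = N x - N y" if "x ~= 0" "y ~= 0" for x y by (rule val_divide[OF Nm that])
 have Npow: "N (x ^ i) = real i * N x" if "x ~= 0" for x i by (rule val_power[OF Nm that])
 have Npowi: "N (x powi i) = real_of_int i * N x" if "x ~= 0" for x i by (rule val_power_int[OF Nm that])
 have Nprod: "N (prod x K) = (\<Sum>j\<in>K. N (x j))" if "finite K" "\<And>j. j \<in> K ==> x j ~= 0" for x :: "nat => host" and K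
  by (rule val_prod[OF Nm that])
 have V'u: "x \<in> units_of_vring V' \<longleftrightarrow> N x = 0" if "x ~= 0" for x
  using that NV[of x] NV[of "inverse x"] Ninv[of x] by (auto simp: units_of_vring_def)
 have Nc: "N (gconst c) = 0" if "c ~= 0" for c
  unfolding gconst_def using that by (subst Ne) (auto simp: mval_single, metis lookup_single_eq lookup_zero)
 have of_nat_g: "of_nat n = gconst (real n)" for n by (induction n) (simp_all add: gconst_simps)
 define base where "base = {e (p j) | j. j \<in> S} \<union> range gconst"
 interpret vt: valued_target V V' base hm1 True "gclosed ` {Suc m..}"
 proof
  show "is_vring V" "is_vring V'" by (rule V V')+
  show "of_nat n \<in> units_of_vring V'" if "n > 0" for n
   unfolding of_nat_g using that gconst_eq_iff[of "real n" 0] by (subst V'u) (auto simp: gconst_simps Nc)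
  have "N (emb (gvar s)) = a s" using Ne[OF gvar_nz, of s] S(3) by (simp add: mval_gvar \<gamma>_def)
  moreover have "a s > 0" using S a by auto
  ultimately have "emb (gvar s) \<in> maximal_ideal V'"
   using NV[of "emb (gvar s)"] NV[of "inverse (emb (gvar s))"] Ninv[of "emb (gvar s)"] gvar_nz[of s] by (auto simp: maximal_ideal_def)
  moreover have "emb (gvar s) \<in> gclosed i" if "Suc m \<le> i" for i using S that by (intro gvar_gclosed) auto
  ultimately show "\<exists>p. p ~= 0 \<and> p \<in> maximal_ideal V' \<and> (True --> (\<forall>E\<in>gclosed ` {Suc m..}. p \<in> E))"
   using gvar_nz[of s] by (intro exI[of _ "emb (gvar s)"]) auto
  show "is_subfield E \<and> rel_closed E" if "E \<in> gclosed ` {Suc m..}" for E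
   using that gclosed_field by blast
  show "\<exists>E'\<in>gclosed ` {Suc m..}. \<exists>t\<in>E'. E \<subseteq> E' \<and> t \<in> V' \<and> t \<notin> E" if E: "E \<in> gclosed ` {Suc m..}" for E
  proof -
   obtain i where i: "i \<ge> Suc m" "E = gclosed i" using E by auto
   have "i \<notin> S" using i S by auto
   then have "N (emb (gvar i)) = 0" using Ne[OF gvar_nz, of i] by (simp add: mval_gvar \<gamma>_def)
   then have "emb (gvar i) \<in> V'" using NV gvar_nz by simp
   then show ?thesis using i gvar_gclosed[of i "Suc i"] gclosed_mono[of i "Suc i"] gvar_fresh[of i]
    by (intro bexI[of _ "gclosed (Suc i)"] bexI[of _ "emb (gvar i)"]) auto
  qed
 qed
 have hE: "vt.target_hom W0 hm1 (gclosed (Suc m))"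
  unfolding vt.target_hom_def
 proof (intro conjI impI)
  show "local_hom W0 hm1" by (rule W0)
  show "base \<subseteq> W0" using hm1c hm1v by (auto simp: base_def)
  show "inj_on hm1 W0" by (rule phom_injI[OF h1]) (use hm1nz in blast)
  show "hm1 ` W0 \<subseteq> gclosed (Suc m)"
  proof
   fix w assume "w \<in> hm1 ` W0"
   then obtain x where x: "x \<in> W0" "w = hm1 x" by blast
   obtain q r where qr: "q \<in> polys_in S" "r \<in> polys_in S" "r ~= 0" "x = Y q / Y r" using W0_rep[OF x(1)] by blast
   have "polys_in S \<subseteq> polys_in {..<Suc m}" using S(1) unfolding polys_in_def by fastforce
   then have "w \<in> gfield {..<Suc m}" unfolding x(2) qr(4) hm1(1)[OF qr(1-3)] gfield_def using qr by blast
   then show "w \<in> gclosed (Suc m)" unfolding gclosed_def using acl_superset by blast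
  qed
 qed auto
 have ag: "s \<in> V \<longleftrightarrow> hm1 s \<in> V'" if s: "s \<in> W0" "s ~= 0" for s
 proof -
  obtain q r where qr: "q \<in> polys_in S" "r \<in> polys_in S" "r ~= 0" "s = Y q / Y r" using W0_rep[OF s(1)] by blast
  then have q0: "q ~= 0" using s Ys(4) by auto
  obtain \<alpha> where \<alpha>: "Poly_Mapping.keys \<alpha> \<subseteq> S" "mweight \<gamma> \<alpha> = mval \<gamma> q" "Y q / mon (ke \<alpha>) \<in> units_of_vring V"
   using lead[OF qr(1) q0] by blast
  obtain \<beta> where \<beta>: "Poly_Mapping.keys \<beta> \<subseteq> S" "mweight \<gamma> \<beta> = mval \<gamma> r" "Y r / mon (ke \<beta>) \<in> units_of_vring V"
   using lead[OF qr(2,3)] by blast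
  have "s = mon (\<lambda>j. ke \<alpha> j - ke \<beta> j) * ((Y q / mon (ke \<alpha>)) / (Y r / mon (ke \<beta>)))"
   unfolding qr(4) mon_diff using mon_nz by (simp add: field_simps)
  then have "s \<in> V \<longleftrightarrow> wt (\<lambda>j. ke \<alpha> j - ke \<beta> j) \<ge> 0"
   using mult_unit_in_vring_iff[OF V(1) units_divide[OF V(1) \<alpha>(3) \<beta>(3)]] mon_V by metis
  also have "\<dots> \<longleftrightarrow> mval \<gamma> q - mval \<gamma> r \<ge> 0" using \<alpha> \<beta> ke(2) by (simp add: wt_diff)
  also have "\<dots> \<longleftrightarrow> hm1 s \<in> V'" unfolding qr(4) hm1(1)[OF qr(1-3)] using NV[of "emb q / emb r"] q0 qr(3) by (simp add: Ndiv Ne)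
  finally show ?thesis .
 qed
 have "vt.approx W0"
  unfolding vt.approx_def
 proof (intro allI impI)
  fix T assume T: "finite T" "T \<subseteq> W0"
  have "vt.agree T hm1" unfolding vt.agree_def using ag hm1nz T by blast
  then show "\<exists>D hm E. vt.target_hom D hm E \<and> D \<subseteq> W0 \<and> T \<subseteq> D \<and> vt.agree T hm" using hE T by blast
 qed
 then have ap: "vt.approx UNIV" by (rule vt.approx_UNIV[OF W0f])
 obtain n k where nk: "\<And>j. j \<le> m ==> n j > 0 \<and> (\<forall>i. i \<notin> S --> k j i = 0) \<and> real (n j) * a j = wt (k j)"
  using rel by metis
 define u where "u = (\<lambda>j. e (p j) ^ n j / mon (k j))"
 have uu: "u j \<in> units_of_vring V" if j: "j \<le> m" for j
 proof -
  let ?l = "\<lambda>i. (if i = j then int (n j) else 0) - k j i"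
  have "mon (\<lambda>i. if i = j then int (n j) else 0) = (\<Prod>i\<le>m. if i = j then e (p j) ^ n j else 1)"
   unfolding mon_def by (intro prod.cong) auto
  then have "mon ?l = u j" using j unfolding mon_diff u_def by simp
  moreover have "wt ?l = 0" using nk[OF j] wt_single[OF j, of "int (n j)"] by (simp add: wt_diff)
  ultimately show ?thesis using mon_unit by metis
 qed
 define T where "T = range (\<lambda>l. e (mpoly_var l)) \<union> u ` {..m}"
 have "finite T" by (simp add: T_def)
 then obtain D hm E where D: "vt.target_hom D hm E" "T \<subseteq> D" "vt.agree_units T hm"
  using vt.approxE[OF _ ap, of T] by (auto simp: is_subfield_def is_subring_def)
 note ph = vt.target_hom_phom[OF D(1)]
 note Dr = phom_subring[OF ph]
 have base: "base \<subseteq> D" "\<And>b. b \<in> base ==> hm b = hm1 b" using D(1) by (auto simp: vt.target_hom_def)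
 have gc: "gconst c \<in> D" "hm (gconst c) = gconst c" for c using base hm1c by (auto simp: base_def)
 have De: "e q \<in> D" for q
 proof -
  have "{q. e q \<in> D} = UNIV"
  proof (rule mpoly_subring_UNIV)
   show "is_subring {q. e q \<in> D}" using Dr by (intro is_subringI) (auto simp: esimps intro: subring_intros)
  qed (use D(2) gc in \<open>auto simp: ec T_def\<close>)
  then show ?thesis by blast
 qed
 have inj: "hm x ~= 0" if "x \<in> D" "x ~= 0" for x
  using vt.target_hom_J[OF D(1)] that phom_zero[OF ph] subring_zero[OF Dr] unfolding inj_on_def by metis
 have powi: "x powi i \<in> D \<and> hm (x powi i) = hm x powi i" if x: "x \<in> D" "x ~= 0" for x i
  using vt.target_hom_inverse[OF D(1) x(1) inj[OF x]] x
  by (auto simp: power_int_def phom_power[OF ph] intro: subring_power[OF Dr])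
 have Nbase: "N (hm (e (p j))) = a j" if "j \<in> S" for j
 proof -
  have "hm (e (p j)) = emb (gvar j)" using base(2)[of "e (p j)"] that hm1v[OF that] by (auto simp: base_def)
  then show ?thesis using Ne[OF gvar_nz, of j] that by (simp add: mval_gvar \<gamma>_def)
 qed
 have Nmon: "mon l \<in> D \<and> N (hm (mon l)) = wt l" if l: "\<forall>i. i \<notin> S --> l i = 0" for l
 proof -
  have f: "e (p i) powi l i \<in> D \<and> hm (e (p i) powi l i) ~= 0 \<and> N (hm (e (p i) powi l i)) = real_of_int (l i) * a i" if i: "i \<le> m" for i
  proof -
   have nz: "hm (e (p i)) ~= 0" by (rule inj[OF De e_p_nz[OF i]])
   have pw: "e (p i) powi l i \<in> D" "hm (e (p i) powi l i) = hm (e (p i)) powi l i" using powi[OF De e_p_nz[OF i]] by auto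
   have "real_of_int (l i) * N (hm (e (p i))) = real_of_int (l i) * a i" using l Nbase by (cases "i \<in> S") auto
   then show ?thesis using pw nz Npowi[OF nz, of "l i"] by simp
  qed
  have "mon l \<in> D" unfolding mon_def using f by (intro subring_prod[OF Dr]) auto
  moreover have "hm (mon l) = (\<Prod>i\<le>m. hm (e (p i) powi l i))" unfolding mon_def using f by (intro phom_prod[OF ph]) auto
  moreover have "N (\<Prod>i\<le>m. hm (e (p i) powi l i)) = (\<Sum>i\<le>m. N (hm (e (p i) powi l i)))" using f by (intro Nprod) auto
  moreover have "(\<Sum>i\<le>m. N (hm (e (p i) powi l i))) = wt l" unfolding wt_def using f by (intro sum.cong) auto
  ultimately show ?thesis by simp
 qed
 have Np: "N (hm (e (p j))) = a j" if j: "j \<le> m" for j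
 proof -
  have uT: "u j \<in> T" "u j \<in> D" using D(2) j by (auto simp: T_def)
  have unz: "hm (u j) ~= 0" using inj[OF uT(2)] units_nonzero[OF uu[OF j]] by blast
  have "hm (u j) \<in> units_of_vring V'" using vt.agree_unitsD(4)[OF D(3) uT(1)] uu[OF j] by blast
  then have Nu: "N (hm (u j)) = 0" using V'u[OF unz] by blast
  have mD: "mon (k j) \<in> D" "N (hm (mon (k j))) = wt (k j)" using Nmon nk[OF j] by auto
  have "e (p j) ^ n j = u j * mon (k j)" using mon_nz by (simp add: u_def)
  then have "hm (e (p j)) ^ n j = hm (u j) * hm (mon (k j))"
   using phom_power[OF ph De] phom_mult[OF ph uT(2) mD(1)] by metis
  then have "N (hm (e (p j)) ^ n j) = N (hm (u j)) + N (hm (mon (k j)))" using Nm[OF unz inj[OF mD(1) mon_nz]] by simp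
  then have "real (n j) * N (hm (e (p j))) = real (n j) * a j"
   using Nu mD(2) nk[OF j] Npow[OF inj[OF De e_p_nz[OF j]], of "n j"] by simp
  moreover have "real (n j) ~= 0" using nk[OF j] by simp
  ultimately show ?thesis using mult_left_cancel by blast
 qed
 have nz: "hm (e q) ~= 0" if "q \<notin> I" for q using inj[OF De] ker that by blast
 have eV': "hm (e q) \<in> V'" for q
 proof -
  have "{q. hm (e q) \<in> V'} = UNIV"
  proof (rule mpoly_subring_UNIV)
   show "is_subring {q. hm (e q) \<in> V'}"
    using vring_subring[OF V'] De
    by (intro is_subringI) (auto simp: esimps phom_add[OF ph] phom_mult[OF ph] phom_one[OF ph] phom_uminus[OF ph] intro: subring_intros)
   show "mpoly_const c \<in> {q. hm (e q) \<in> V'}" for c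
    using NV[of "gconst c"] Nc[of c] gconst_eq_iff[of c 0] subring_zero[OF vring_subring[OF V']]
    by (cases "c = 0") (auto simp: ec gc gconst_simps phom_zero[OF ph])
   show "mpoly_var l \<in> {q. hm (e q) \<in> V'}" for l
    using vt.agree_unitsD(2)[OF D(3), of "e (mpoly_var l)"] eV by (auto simp: T_def)
  qed
  then show ?thesis by blast
 qed
 show ?thesis
 proof (intro exI[of _ "\<lambda>q. N (hm (e q))"] conjI allI impI)
  show "N (hm (e x)) = N (hm (e y))" if "x - y \<in> I" for x y
   using ker[of "x - y"] that by (simp add: esimps)
  show "N (hm (e (x * y))) = N (hm (e x)) + N (hm (e y))" if "x \<notin> I" "y \<notin> I" for x y
   using Nm nz that De by (simp add: esimps phom_mult[OF ph])
  show "min (N (hm (e x))) (N (hm (e y))) \<le> N (hm (e (x + y)))" if "x \<notin> I" "y \<notin> I" "x + y \<notin> I" for x y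
   using Na[OF nz[OF that(1)] nz[OF that(2)]] nz[OF that(3)] De by (simp add: esimps phom_add[OF ph])
  show "N (hm (e (mpoly_const c))) = 0" if "c ~= 0" for c using Nc[OF that] by (simp add: ec gc)
  show "0 \<le> N (hm (e x))" if "x \<notin> I" for x using NV[OF nz[OF that]] eV' by blast
 qed (use p_notin Np in auto)
qed

end

section \<open>Relative types\<close>

lemma elog_le_iff:
 assumes "x \<ge> 0" "t \<ge> 0" "c > 0"
 shows "elog x \<le> ereal c * elog t + ereal C \<longleftrightarrow> x \<le> exp C * t powr c"
proof (cases "t = 0 \<or> x = 0")
 case True
 then show ?thesis using assms by (auto simp: elog_def)
next
 case False
 then have "x > 0" "t > 0" using assms by auto
 then have "elog x \<le> ereal c * elog t + ereal C \<longleftrightarrow> ln x \<le> c * ln t + C" by (simp add: elog_def)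
 also have "\<dots> \<longleftrightarrow> exp (ln x) \<le> exp (c * ln t + C)" by simp
 also have "\<dots> \<longleftrightarrow> x \<le> exp C * t powr c"
  using \<open>x > 0\<close> \<open>t > 0\<close> by (simp add: exp_add powr_def mult.commute)
 finally show ?thesis .
qed

context
 fixes Z :: "(complex ^ 'n::finite) set" and f g :: "complex ^ 'n => real" and A :: real
 assumes f: "\<And>z. f z \<ge> 0" and g: "\<And>z. g z \<ge> 0" and Z0: "0 \<in> Z" and A: "A > 0"
begin

lemma relative_type_eqD:
 assumes "relative_type Z 0 (\<lambda>z. elog (f z)) (\<lambda>z. elog (g z)) = ennreal A" "c > A" "\<epsilon> > 0"
 shows "\<exists>z\<in>Z. norm z < \<epsilon> \<and> f z > C * g z powr c"
proof (rule ccontr)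
 assume h: "\<not> ?thesis"
 define C' where "C' = ln (max C 1)"
 have C': "exp C' = max C 1" by (simp add: C'_def)
 have "ennreal c \<le> relative_type Z 0 (\<lambda>z. elog (f z)) (\<lambda>z. elog (g z))"
  unfolding relative_type_def
 proof (rule Sup_upper, rule imageI, rule CollectI, intro conjI exI)
  show "0 \<le> c" using assms A by simp
  show "openin (top_of_set Z) (Z \<inter> ball 0 \<epsilon>)" "0 \<in> Z \<inter> ball 0 \<epsilon>" using Z0 assms by auto
  show "\<forall>z\<in>Z \<inter> ball 0 \<epsilon> - sing_locus Z. elog (f z) \<le> ereal c * elog (g z) + ereal C'"
  proof
   fix z assume "z \<in> Z \<inter> ball 0 \<epsilon> - sing_locus Z"
   then have "f z \<le> C * g z powr c" using h by (auto simp: not_less)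
   also have "\<dots> \<le> exp C' * g z powr c" unfolding C' by (intro mult_right_mono) auto
   finally show "elog (f z) \<le> ereal c * elog (g z) + ereal C'"
    using elog_le_iff[OF f g, of c z z C'] assms A by simp
  qed
 qed
 then show False using assms A by (simp add: ennreal_le_iff)
qed

lemma relative_type_eqI:
 assumes le: "\<exists>C. \<forall>z\<in>Z. norm z < 1 --> f z \<le> C * g z powr A"
  and ge: "\<And>c C \<epsilon>. c > A ==> \<epsilon> > 0 ==> \<exists>z. norm z < \<epsilon> \<and> regular_point Z z \<and> f z > C * g z powr c"
 shows "relative_type Z 0 (\<lambda>z. elog (f z)) (\<lambda>z. elog (g z)) = ennreal A"
proof (rule antisym)
 obtain C where C: "\<forall>z\<in>Z. norm z < 1 --> f z \<le> C * g z powr A" using le by blast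
 define C' where "C' = ln (max C 1)"
 have C': "exp C' = max C 1" by (simp add: C'_def)
 show "ennreal A \<le> relative_type Z 0 (\<lambda>z. elog (f z)) (\<lambda>z. elog (g z))"
  unfolding relative_type_def
 proof (rule Sup_upper, rule imageI, rule CollectI, intro conjI exI)
  show "0 \<le> A" using A by simp
  show "openin (top_of_set Z) (Z \<inter> ball 0 1)" "0 \<in> Z \<inter> ball 0 1" using Z0 by auto
  show "\<forall>z\<in>Z \<inter> ball 0 1 - sing_locus Z. elog (f z) \<le> ereal A * elog (g z) + ereal C'"
  proof
   fix z assume "z \<in> Z \<inter> ball 0 1 - sing_locus Z"
   then have "f z \<le> C * g z powr A" using C by auto
   also have "\<dots> \<le> exp C' * g z powr A" unfolding C' by (intro mult_right_mono) auto
   finally show "elog (f z) \<le> ereal A * elog (g z) + ereal C'"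
    using elog_le_iff[OF f g A, of z z C'] by simp
  qed
 qed
 show "relative_type Z 0 (\<lambda>z. elog (f z)) (\<lambda>z. elog (g z)) \<le> ennreal A"
  unfolding relative_type_def
 proof (rule Sup_least, elim imageE CollectE conjE exE)
  fix x c U C assume c: "x = ennreal c" "0 \<le> c" "openin (top_of_set Z) U" "0 \<in> U"
   and b: "\<forall>z\<in>U - sing_locus Z. elog (f z) \<le> ereal c * elog (g z) + ereal C"
  show "x \<le> ennreal A"
  proof (rule ccontr)
   assume "\<not> x \<le> ennreal A"
   then have cA: "c > A" using c(1) by (meson ennreal_leI not_le)
   obtain T where T: "open T" "U = Z \<inter> T" using c(3) by (auto simp: openin_open)
   then obtain \<epsilon> where \<epsilon>: "\<epsilon> > 0" "ball 0 \<epsilon> \<subseteq> T" using c(4) open_contains_ball[of T] by blast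
   obtain z where z: "norm z < \<epsilon>" "regular_point Z z" "f z > exp C * g z powr c" using ge[OF cA \<epsilon>(1)] by blast
   have "z \<in> Z" using z(2) by (simp add: regular_point_def)
   then have "z \<in> U - sing_locus Z" using T \<epsilon>(2) z by (auto simp: sing_locus_def)
   then have "f z \<le> exp C * g z powr c" using b elog_le_iff[OF f g, of c z z C] cA A by auto
   then show False using z(3) by simp
  qed
 qed
qed

end

lemma norm_vec_less:
 fixes z :: "complex ^ 'n::finite"
 assumes "\<epsilon> > 0" "\<And>l. cmod (z $ l) < \<epsilon> / (2 * real CARD('n))" shows "norm z < \<epsilon>"
proof -
 have "norm z \<le> (\<Sum>l\<in>UNIV. cmod (z $ l))" unfolding norm_vec_def by (rule L2_set_le_sum) simp
 also have "\<dots> \<le> (\<Sum>l\<in>(UNIV::'n set). \<epsilon> / (2 * real CARD('n)))" using assms(2) by (intro sum_mono) (simp add: less_imp_le)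
 also have "\<dots> = \<epsilon> / 2" by simp
 finally show ?thesis using assms by simp
qed

lemma product_upper_bound:
 fixes p :: "nat => ('n::finite, real) mpoly"
 assumes m: "m \<ge> 1" and a: "\<And>j. 1 \<le> j ==> j \<le> m ==> a j > 0"
 shows "\<exists>C. \<forall>z. norm z < 1 --> cmod (reval z (\<Prod>j\<le>m. p j)) \<le> C * (\<Sum>j=1..m. cmod (reval z (p j)) powr (1 / a j)) powr (\<Sum>j=1..m. a j)"
proof -
 obtain C where C: "C \<ge> 0" "\<forall>z. norm z \<le> 1 --> cmod (reval z (p 0)) \<le> C" using reval_bounded[of "p 0"] by blast
 have "cmod (reval z (\<Prod>j\<le>m. p j)) \<le> C * (\<Sum>j=1..m. cmod (reval z (p j)) powr (1 / a j)) powr (\<Sum>j=1..m. a j)" if z: "norm z < 1" for z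
 proof -
  define E where "E = (\<Sum>j=1..m. cmod (reval z (p j)) powr (1 / a j))"
  have E0: "E \<ge> 0" unfolding E_def by (simp add: sum_nonneg)
  have b: "cmod (reval z (p j)) \<le> E powr a j" if j: "j \<in> {1..m}" for j
  proof -
   have aj: "a j > 0" using a j by auto
   have "cmod (reval z (p j)) powr (1 / a j) \<le> E" unfolding E_def using j by (intro member_le_sum) auto
   then have "(cmod (reval z (p j)) powr (1 / a j)) powr a j \<le> E powr a j" using aj by (intro powr_mono2) auto
   then show ?thesis using aj by (simp add: powr_powr)
  qed
  have "{..m} = insert 0 {1..m}" by auto
  then have "cmod (reval z (\<Prod>j\<le>m. p j)) = cmod (reval z (p 0)) * (\<Prod>j=1..m. cmod (reval z (p j)))"
   by (simp add: phom_prod[OF phom_reval UNIV_I] norm_mult prod_norm)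
  also have "\<dots> \<le> C * (\<Prod>j=1..m. E powr a j)"
   using C z b by (intro mult_mono prod_mono prod_nonneg) auto
  also have "(\<Prod>j=1..m. E powr a j) = E powr (\<Sum>j=1..m. a j)"
  proof (cases "E = 0")
   case True
   then show ?thesis using m by simp
  next
   case False
   then have "(\<Sum>j=1..m. a j * ln E) = (\<Sum>j=1..m. a j) * ln E" by (simp add: sum_distrib_right)
   then show ?thesis using False by (simp add: powr_def exp_sum[symmetric])
  qed
  finally show ?thesis by (simp add: E_def)
 qed
 then show ?thesis by blast
qed

theorem corollary1p17:
  fixes I :: "('n::finite, real) mpoly set"
    and Z :: "(complex ^ 'n) set"
    and m :: nat
    and f :: "nat \<Rightarrow> ('n, real) mpoly set"
    and a :: "nat \<Rightarrow> real"
    and F :: "('n, complex) mpoly set"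
    and \<phi> :: "complex ^ 'n \<Rightarrow> ereal"
  assumes "ideal I mpoly_ring"
    and "primeideal (complexified_ideal I) mpoly_ring"
    and Z_def: "Z = zero_locus (complexified_ideal I)"
    and "0 \<in> Z"
    and "irreducible_germ Z 0"
    and "m \<ge> 1"
    and "\<And>j. j \<le> m \<Longrightarrow> f j \<in> carrier (real_quotient I)"
    and "a 0 = 0"
    and "\<And>j. 1 \<le> j \<Longrightarrow> j \<le> m \<Longrightarrow> a j > 0"
    and F_def: "F = finprod (complex_quotient I) (\<lambda>j. quotient_complexify I (f j)) {0..m}"
    and \<phi>_def: "\<phi> = (\<lambda>z. elog (\<Sum>j=1..m.
                  cmod (residue_eval (quotient_complexify I (f j)) z) powr (1 / a j)))"
  shows "(relative_type Z 0 (\<lambda>z. elog (cmod (residue_eval F z))) \<phi> = ennreal (\<Sum>j=1..m. a j) \<longrightarrow>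
            (\<exists>\<nu>. is_valuation I \<nu> \<and> (\<forall>j\<le>m. \<nu> (f j) = ereal (a j)))) \<and>
         ((\<exists>\<nu>. is_valuation I \<nu> \<and> (\<forall>j\<le>m. \<nu> (f j) = ereal (a j)) \<and>
                (\<forall>l. \<nu> (I +>\<^bsub>mpoly_ring\<^esub> mpoly_var l) > 0)) \<longrightarrow>
            relative_type Z 0 (\<lambda>z. elog (cmod (residue_eval F z))) \<phi> = ennreal (\<Sum>j=1..m. a j))"
proof -
 note m = assms(6) and a0 = assms(8) and a = assms(9)
 have I: "ideal_set I" using assms(1) by (simp add: ideal_iff_ideal_set)
 have P: "prime_set I" by (rule real_prime[OF I assms(2)])
 have Zr: "Z = {z. \<forall>q\<in>I. reval z q = 0}" unfolding Z_def by (rule zero_locus_real[OF I])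
 define A where "A = (\<Sum>j=1..m. a j)"
 have Apos: "A > 0" unfolding A_def using a m by (intro sum_pos) auto
 define K where "K = (\<lambda>q. I +>\<^bsub>mpoly_ring\<^esub> (q :: ('n, real) mpoly))"
 have car: "carrier (real_quotient I) = range K" by (simp add: K_def quotient_ops(1)[OF I])
 have K_eq: "K q = K r \<longleftrightarrow> q - r \<in> I" for q r unfolding K_def by (rule coset_eq_iff[OF I])
 have K0: "K q = I \<longleftrightarrow> q \<in> I" for q using K_eq[of q 0] coset_zero[OF I] by (simp add: K_def)
 have "\<exists>q. f j = K q" if "j \<le> m" for j using assms(7)[OF that] car by auto
 then obtain p where p: "\<And>j. j \<le> m ==> f j = K (p j)" by metis
 have rf: "residue_eval (quotient_complexify I (f j)) z = reval z (p j)" if "j \<le> m" "z \<in> Z" for j z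
  unfolding p[OF that(1)] K_def quotient_complexify_coset[OF I]
  using residue_eval_coset[OF I, of z] that(2) by (simp add: Z_def mpoly_eval_complexify)
 have rF: "residue_eval F z = reval z (\<Prod>j\<le>m. p j)" if "z \<in> Z" for z
 proof -
  have "F = finprod (complex_quotient I) (\<lambda>j. complexified_ideal I +>\<^bsub>mpoly_ring\<^esub> complexify (p j)) {0..m}"
   unfolding F_def
  proof (rule comm_monoid.finprod_cong')
   interpret id: ideal "complexified_ideal I" "mpoly_ring :: ('n, complex) mpoly ring"
    using complexified_ideal_set[OF I] by (simp add: ideal_iff_ideal_set)
   interpret Q: cring "complex_quotient I" using id.quotient_is_cring cring_from_type_algebra by blast
   show "comm_monoid (complex_quotient I)" by (rule Q.comm_monoid_axioms)
   show "(\<lambda>j. complexified_ideal I +>\<^bsub>mpoly_ring\<^esub> complexify (p j)) \<in> {0..m} \<rightarrow> carrier (complex_quotient I)"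
    by (auto simp: quotient_ops(1)[OF complexified_ideal_set[OF I]])
  qed (use p quotient_complexify_coset[OF I] in \<open>auto simp: K_def\<close>)
  also have "\<dots> = complexified_ideal I +>\<^bsub>mpoly_ring\<^esub> (\<Prod>j\<le>m. complexify (p j))"
   by (rule quotient_finprod[OF complexified_ideal_set[OF I]])
  also have "(\<Prod>j\<le>m. complexify (p j)) = complexify (\<Prod>j\<le>m. p j)" by (rule phom_prod[OF phom_complexify UNIV_I, symmetric])
  finally have "F = complexified_ideal I +>\<^bsub>mpoly_ring\<^esub> complexify (\<Prod>j\<le>m. p j)" .
  then show ?thesis using residue_eval_coset[OF I, of z] that by (simp add: Z_def mpoly_eval_complexify)
 qed
 define ff where "ff = (\<lambda>z. cmod (residue_eval F z))"
 define gg where "gg = (\<lambda>z. \<Sum>j=1..m. cmod (residue_eval (quotient_complexify I (f j)) z) powr (1 / a j))"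
 have gg: "gg z = (\<Sum>j=1..m. cmod (reval z (p j)) powr (1 / a j))" if "z \<in> Z" for z
  unfolding gg_def using rf that by (intro sum.cong) auto
 have ff: "ff z = cmod (reval z (\<Prod>j\<le>m. p j))" if "z \<in> Z" for z using rF[OF that] by (simp add: ff_def)
 have pos: "ff z \<ge> 0" "gg z \<ge> 0" for z by (simp_all add: ff_def gg_def sum_nonneg)
 have Rops: "\<zero>\<^bsub>real_quotient I\<^esub> = I" "K q \<otimes>\<^bsub>real_quotient I\<^esub> K r = K (q * r)" "K q \<oplus>\<^bsub>real_quotient I\<^esub> K r = K (q + r)" for q r
  unfolding K_def by (rule quotient_ops[OF I])+
 have R': "carrier (real_quotient I) - {I} = K ` (- I)"
  unfolding car using K0 by blast
 have one: "1 \<notin> I" by (rule prime_setD(5)[OF P])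
 have dir1: "\<exists>\<nu>. is_valuation I \<nu> \<and> (\<forall>j\<le>m. \<nu> (f j) = ereal (a j))"
  if h: "relative_type Z 0 (\<lambda>z. elog (ff z)) (\<lambda>z. elog (gg z)) = ennreal A"
 proof -
  obtain e :: "('n, real) mpoly => host" where e: "phom UNIV e" "\<And>q. e q = 0 \<longleftrightarrow> q \<in> I" "\<And>c. e (mpoly_const c) = gconst c"
   using generic_point[OF P] by blast
  interpret growth I p a m e
  proof
   fix c C \<epsilon> :: real assume c: "c > (\<Sum>j=1..m. a j)" and \<epsilon>: "\<epsilon> > 0"
   obtain z where "z \<in> Z" "norm z < \<epsilon>" "ff z > C * gg z powr c"
    using relative_type_eqD[OF pos(1) pos(2) assms(4) Apos h _ \<epsilon>, of c C] c by (auto simp: A_def)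
   then show "\<exists>z. (\<forall>q\<in>I. reval z q = 0) \<and> norm z < \<epsilon> \<and>
     cmod (reval z (\<Prod>j\<le>m. p j)) > C * (\<Sum>j=1..m. cmod (reval z (p j)) powr (1 / a j)) powr c"
    using ff[of z] gg[of z] Zr by auto
  qed (use P m a0 a e in auto)
  obtain v :: "('n, real) mpoly => real" where v: "\<And>x y. x - y \<in> I ==> v x = v y"
   "\<And>x y. x \<notin> I ==> y \<notin> I ==> v (x * y) = v x + v y"
   "\<And>x y. x \<notin> I ==> y \<notin> I ==> x + y \<notin> I ==> v (x + y) \<ge> min (v x) (v y)"
   "\<And>c. c ~= 0 ==> v (mpoly_const c) = 0" "\<And>x. x \<notin> I ==> v x \<ge> 0" "\<And>j. j \<le> m ==> p j \<notin> I \<and> v (p j) = a j"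
   using ex_real_valuation by blast
  define \<nu> where "\<nu> = (\<lambda>L. if L = I then \<infinity> else ereal (v (SOME q. L = K q)))"
  have \<nu>: "\<nu> (K q) = ereal (v q)" if "q \<notin> I" for q
  proof -
   have "K q = K (SOME r. K q = K r)" by (rule someI[of "\<lambda>r. K q = K r"]) simp
   then have "v q = v (SOME r. K q = K r)" using v(1) K_eq by blast
   then show ?thesis using that K0 by (simp add: \<nu>_def)
  qed
  have prod: "x * y \<notin> I" if "x \<notin> I" "y \<notin> I" for x y using prime_setD(6)[OF P] that by blast
  have const: "\<nu> (I +>\<^bsub>mpoly_ring\<^esub> mpoly_const c) = 0" if c: "c ~= 0" for c
  proof -
   have "mpoly_const c \<notin> I"
   proof
    assume "mpoly_const c \<in> I"
    then have "mpoly_const (inverse c) * mpoly_const c \<in> I" by (rule prime_setD(3)[OF P])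
    then show False using c one by (simp add: mpoly_const_simps flip: mpoly_const_simps(2))
   qed
   then show ?thesis using \<nu>[of "mpoly_const c"] v(4)[OF c] by (simp add: K_def)
  qed
  have "is_valuation I \<nu>"
   unfolding is_valuation_def Let_def Rops(1) R'
  proof (intro conjI)
   show "\<nu> I = \<infinity>" by (simp add: \<nu>_def)
   show "\<forall>f\<in>K ` (- I). \<exists>r\<ge>0. \<nu> f = ereal r" using \<nu> v(5) by auto
   have ne: "v (p 1) ~= v 1" using v(4)[of 1] v(6)[of 1] a[of 1] m by (simp add: mpoly_const_simps)
   then have "\<nu> (K (p 1)) ~= \<nu> (K 1)" using \<nu>[of "p 1"] \<nu>[OF one] v(6)[of 1] m by simp
   then show "\<exists>f\<in>K ` (- I). \<exists>g\<in>K ` (- I). \<nu> f ~= \<nu> g" using v(6)[of 1] m one by blast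
   show "\<forall>f\<in>K ` (- I). \<forall>g\<in>K ` (- I). \<nu> (f \<otimes>\<^bsub>real_quotient I\<^esub> g) = \<nu> f + \<nu> g"
    using \<nu> v(2) prod by (auto simp: Rops)
   show "\<forall>f\<in>K ` (- I). \<forall>g\<in>K ` (- I). f \<oplus>\<^bsub>real_quotient I\<^esub> g ~= I --> min (\<nu> f) (\<nu> g) \<le> \<nu> (f \<oplus>\<^bsub>real_quotient I\<^esub> g)"
   proof (intro ballI impI)
    fix L L' assume L: "L \<in> K ` (- I)" "L' \<in> K ` (- I)" "L \<oplus>\<^bsub>real_quotient I\<^esub> L' ~= I"
    then obtain x y where xy: "x \<notin> I" "y \<notin> I" "L = K x" "L' = K y" by blast
    then have "x + y \<notin> I" using L(3) by (simp add: Rops K0)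
    then show "min (\<nu> L) (\<nu> L') \<le> \<nu> (L \<oplus>\<^bsub>real_quotient I\<^esub> L')"
     using \<nu> v(3)[OF xy(1,2)] xy by (simp add: Rops min_def split: if_splits)
   qed
   show "\<forall>c. c ~= 0 --> \<nu> (I +>\<^bsub>mpoly_ring\<^esub> mpoly_const c) = 0" using const by blast
  qed
  moreover have "\<nu> (f j) = ereal (a j)" if "j \<le> m" for j using \<nu> v(6)[OF that] p[OF that] by simp
  ultimately show ?thesis by blast
 qed
 have dir2: "relative_type Z 0 (\<lambda>z. elog (ff z)) (\<lambda>z. elog (gg z)) = ennreal A"
  if val: "is_valuation I \<nu>" and fj: "\<And>j. j \<le> m ==> \<nu> (f j) = ereal (a j)" and xl: "\<And>l. \<nu> (I +>\<^bsub>mpoly_ring\<^esub> mpoly_var l) > 0" for \<nu>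
 proof -
  define v where "v = (\<lambda>q. real_of_ereal (\<nu> (K q)))"
  note V = val[unfolded is_valuation_def Let_def Rops(1) R']
  have fin: "\<nu> (K q) = ereal (v q)" if "q \<notin> I" for q
  proof -
   have "\<exists>r\<ge>0. \<nu> (K q) = ereal r" using V that by blast
   then show ?thesis by (auto simp: v_def)
  qed
  have pI: "p j \<notin> I \<and> v (p j) = a j" if "j \<le> m" for j
  proof
   show "p j \<notin> I"
   proof
    assume "p j \<in> I"
    then have "K (p j) = I" using K0 by simp
    then have "\<nu> (f j) = \<infinity>" using V p[OF that] by simp
    then show False using fj[OF that] by simp
   qed
   then show "v (p j) = a j" using fj[OF that] p[OF that] by (simp add: v_def)
  qed
  obtain G h where Gh: "finite G" "G \<subseteq> I" "h \<notin> I"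
   "\<And>z. (\<And>g. g \<in> G ==> reval z g = 0) ==> reval z h ~= 0 ==> regular_point Z z"
   using generic_regular_points[OF P] unfolding Zr by blast
  show ?thesis
  proof (rule relative_type_eqI[OF pos(1) pos(2) assms(4) Apos])
   obtain C where "\<forall>z. norm z < 1 --> cmod (reval z (\<Prod>j\<le>m. p j)) \<le> C * (\<Sum>j=1..m. cmod (reval z (p j)) powr (1 / a j)) powr A"
    using product_upper_bound[where m = m and a = a and p = p] m a unfolding A_def by blast
   then show "\<exists>C. \<forall>z\<in>Z. norm z < 1 --> ff z \<le> C * gg z powr A" using ff gg by (intro exI[of _ C]) auto
  next
   fix c C \<epsilon> :: real assume c: "c > A" and \<epsilon>: "\<epsilon> > 0"
   have \<epsilon>': "\<epsilon> / (2 * real CARD('n)) > 0" using \<epsilon> by simp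
   obtain z :: "complex ^ 'n" where z: "\<And>l. cmod (z $ l) < \<epsilon> / (2 * real CARD('n))" "\<And>g. g \<in> G ==> reval z g = 0" "reval z h ~= 0"
    "cmod (reval z (\<Prod>j\<le>m. p j)) > C * (\<Sum>j=1..m. cmod (reval z (p j)) powr (1 / a j)) powr c"
   proof (rule valuation_violates_bound[OF P, where v = v and p = p and m = m and a = a and h = h and G = G and c = c
     and C = C and \<epsilon> = "\<epsilon> / (2 * real CARD('n))"])
    show "v x = v y" if "x - y \<in> I" for x y using K_eq[of x y] that by (simp add: v_def)
    show "v (x * y) = v x + v y" if "x \<notin> I" "y \<notin> I" for x y
    proof -
     have "x * y \<notin> I" using prime_setD(6)[OF P] that by blast
     moreover have "\<nu> (K x \<otimes>\<^bsub>real_quotient I\<^esub> K y) = \<nu> (K x) + \<nu> (K y)" using V that by blast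
     ultimately show ?thesis using fin that by (simp add: Rops)
    qed
    show "min (v x) (v y) \<le> v (x + y)" if "x \<notin> I" "y \<notin> I" "x + y \<notin> I" for x y
    proof -
     have "K x \<oplus>\<^bsub>real_quotient I\<^esub> K y ~= I" using that by (simp add: Rops K0)
     then have "min (\<nu> (K x)) (\<nu> (K y)) \<le> \<nu> (K x \<oplus>\<^bsub>real_quotient I\<^esub> K y)" using V that by blast
     then show ?thesis using fin[OF that(1)] fin[OF that(2)] fin[OF that(3)] by (simp add: Rops min_def split: if_splits)
    qed
    show "v (mpoly_const c) = 0" if "c ~= 0" for c using V that by (simp add: v_def K_def)
    show "0 < v (mpoly_var l)" if "mpoly_var l \<notin> I" for l using xl[of l] fin[OF that] by (simp add: K_def)
   qed (use pI m a0 a Gh c \<epsilon>' in \<open>auto simp: A_def\<close>)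
   have reg: "regular_point Z z" by (rule Gh(4)) (use z in auto)
   moreover have "z \<in> Z" using reg by (simp add: regular_point_def)
   ultimately show "\<exists>z. norm z < \<epsilon> \<and> regular_point Z z \<and> ff z > C * gg z powr c"
    using norm_vec_less[OF \<epsilon> z(1)] z(4) ff gg by auto
  qed
 qed
 show ?thesis using dir1 dir2 unfolding \<phi>_def ff_def gg_def A_def by blast
qed

end
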